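(* Let $k$ be a field, $G$ a finite group scheme over $k$, and $X$ a $G$-variety with function field $K = k(X)$. Equip $\mathrm{Spec}(K)$ with the unique $G$-action such that the canonical morphism $\mathrm{Spec}(K) \to X$ is equivariant, and let $L = K^G$ be the subfield of invariants. Let $Z = \mathrm{Spec}(K \otimes_L K) = \mathrm{Spec}(K) \times_{\mathrm{Spec}(L)} \mathrm{Spec}(K)$, viewed as a $K$-scheme via the first projection and equipped with the action of the $K$-group scheme $G_K$ coming from the $G$-action on the second factor $\mathrm{Spec}(K)$. Let $z \in Z(K)$ be the diagonal point, corresponding to the multiplication map $K \otimes_L K \to K$, and let $H = \mathrm{Stab}_{G_K}(z)$ be its stabilizer. Then there is a $G_K$-equivariant isomorphism of $K$-schemes $Z \simeq G_K/H$.
   Context: A variety over $k$ is a separated, geometrically integral $k$-scheme of finite type. A $G$-variety is a variety equipped with an action of $G$. For a field extension $K/k$, $G_K = G \times_{\mathrm{Spec}(k)} \mathrm{Spec}(K)$. The $G$-action on $\mathrm{Spec}(K)$ mentioned in the claim exists and is unique; it makes $K$ a $G$-algebra over $k$, and $K^G$ denotes its subfield of $G$-invariants (the elements $f$ whose co-action is $1 \otimes f \in \mathcal{O}(G) \otimes_k K$). The subgroup scheme $H$ is the generic stabilizer, i.e. the generic fiber of the projection $\mathrm{Stab}_G \to X$, where $\mathrm{Stab}_G \subset G \times X$ is the preimage of the diagonal under $G \times X \to X \times X$, $(g,x) \mapsto (g \cdot x, x)$. *)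

theory Defs
  imports
    "HOL-Algebra.QuotRing"
    "HOL-Algebra.Module"
    "HOL-Algebra.Algebraic_Closure"
    "HOL-Analysis.Abstract_Topology"
begin

text \<open>
  Algebras over a commutative ring \<open>R\<close> are the records of \<open>HOL-Algebra.Module\<close>
  satisfying the library locale \<^locale>\<open>algebra\<close>.
  Schemes over a field \<open>k\<close> are locally ringed spaces whose structure sheaf is a sheaf of
  \<open>k\<close>-algebras (which is the same datum as a morphism to \<open>Spec k\<close>) and which are locally
  isomorphic to spectra.  A finite group scheme over a field is affine, so it is given as
  \<open>Spec A\<close> for a finite-dimensional commutative Hopf algebra \<open>A\<close>.
\<close>

(* frees the identifier X *)
no_notation var (\<open>X\<index>\<close>)

section \<open>Algebras and tensor products\<close>

definition alg_hom ::
  "('c, 'x) ring_scheme \<Rightarrow> ('c, 'a, 'y) module_scheme \<Rightarrow> ('c, 'b, 'z) module_scheme \<Rightarrow> ('a \<Rightarrow> 'b) set"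
  where "alg_hom R M N =
    {f \<in> ring_hom M N. \<forall>r \<in> carrier R. \<forall>m \<in> carrier M. f (r \<odot>\<^bsub>M\<^esub> m) = r \<odot>\<^bsub>N\<^esub> f m}"

text \<open>A ring \<open>S\<close> as an algebra along a ring homomorphism \<open>h\<close> into it.\<close>

definition alg_via :: "('c \<Rightarrow> 'a) \<Rightarrow> ('a, 'y) ring_scheme \<Rightarrow> ('c, 'a) module"
  where "alg_via h S =
    \<lparr>carrier = carrier S, monoid.mult = monoid.mult S, one = one S, zero = zero S, add = add S,
     smult = (\<lambda>r s. h r \<otimes>\<^bsub>S\<^esub> s)\<rparr>"

abbreviation self_alg :: "('a, 'y) ring_scheme \<Rightarrow> ('a, 'a) module"
  where "self_alg S \<equiv> alg_via (\<lambda>x. x) S"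

definition quot_alg :: "('c, 'a, 'y) module_scheme \<Rightarrow> 'a set \<Rightarrow> ('c, 'a set) module"
  where "quot_alg M J =
    \<lparr>carrier = a_rcosets\<^bsub>M\<^esub> J, monoid.mult = rcoset_mult M J, one = J +>\<^bsub>M\<^esub> \<one>\<^bsub>M\<^esub>, zero = J,
     add = set_add M, smult = (\<lambda>r C. \<Union>x\<in>C. J +>\<^bsub>M\<^esub> (r \<odot>\<^bsub>M\<^esub> x))\<rparr>"

definition finite_algebra :: "('c, 'x) ring_scheme \<Rightarrow> ('c, 'a, 'y) module_scheme \<Rightarrow> bool"
  where "finite_algebra R M \<longleftrightarrow> algebra R M \<and>
    (\<exists>E. finite E \<and> E \<subseteq> carrier M \<and>
      (\<forall>m \<in> carrier M. \<exists>c \<in> E \<rightarrow> carrier R. m = (\<Oplus>\<^bsub>M\<^esub>e\<in>E. c e \<odot>\<^bsub>M\<^esub> e)))"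

definition fin_gen_algebra :: "('c, 'x) ring_scheme \<Rightarrow> ('c, 'a, 'y) module_scheme \<Rightarrow> bool"
  where "fin_gen_algebra R M \<longleftrightarrow> algebra R M \<and>
    (\<exists>E. finite E \<and> E \<subseteq> carrier M \<and>
      (\<forall>T. subring T M \<and> (\<forall>r \<in> carrier R. \<forall>t \<in> T. r \<odot>\<^bsub>M\<^esub> t \<in> T) \<and> E \<subseteq> T \<longrightarrow> T = carrier M))"

text \<open>
  The tensor product \<open>M \<otimes>\<^sub>R N\<close> of \<open>R\<close>-algebras is the monoid algebra over \<open>R\<close> of the
  multiplicative monoid \<open>M \<times> N\<close>, i.e. the free \<open>R\<close>-module on \<open>M \<times> N\<close>
  (finitely supported functions), modulo the ideal of bilinearity relations.
\<close>

definition single :: "('c, 'x) ring_scheme \<Rightarrow> 'i \<Rightarrow> 'i \<Rightarrow> 'c"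
  where "single R p = (\<lambda>q. if q = p then \<one>\<^bsub>R\<^esub> else \<zero>\<^bsub>R\<^esub>)"

definition pair_alg ::
  "('c, 'x) ring_scheme \<Rightarrow> ('c, 'a, 'y) module_scheme \<Rightarrow> ('c, 'b, 'z) module_scheme
    \<Rightarrow> ('c, 'a \<times> 'b \<Rightarrow> 'c) module"
  where "pair_alg R M N =
    \<lparr>carrier = {f. (\<forall>p. f p \<in> carrier R) \<and> finite {p. f p \<noteq> \<zero>\<^bsub>R\<^esub>} \<and>
                   {p. f p \<noteq> \<zero>\<^bsub>R\<^esub>} \<subseteq> carrier M \<times> carrier N},
     monoid.mult = (\<lambda>f g p. \<Oplus>\<^bsub>R\<^esub>qr \<in> {(q, r). f q \<noteq> \<zero>\<^bsub>R\<^esub> \<and> g r \<noteq> \<zero>\<^bsub>R\<^esub> \<and>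
         (fst q \<otimes>\<^bsub>M\<^esub> fst r, snd q \<otimes>\<^bsub>N\<^esub> snd r) = p}. f (fst qr) \<otimes>\<^bsub>R\<^esub> g (snd qr)),
     one = single R (\<one>\<^bsub>M\<^esub>, \<one>\<^bsub>N\<^esub>),
     zero = (\<lambda>p. \<zero>\<^bsub>R\<^esub>),
     add = (\<lambda>f g p. f p \<oplus>\<^bsub>R\<^esub> g p),
     smult = (\<lambda>r f p. r \<otimes>\<^bsub>R\<^esub> f p)\<rparr>"

definition tensor_ideal ::
  "('c, 'x) ring_scheme \<Rightarrow> ('c, 'a, 'y) module_scheme \<Rightarrow> ('c, 'b, 'z) module_scheme
    \<Rightarrow> ('a \<times> 'b \<Rightarrow> 'c) set"
  where "tensor_ideal R M N = (let P = pair_alg R M N; d = single R in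
    Idl\<^bsub>P\<^esub>
     ({d (m \<oplus>\<^bsub>M\<^esub> m', n) \<ominus>\<^bsub>P\<^esub> (d (m, n) \<oplus>\<^bsub>P\<^esub> d (m', n)) | m m' n.
         m \<in> carrier M \<and> m' \<in> carrier M \<and> n \<in> carrier N}
    \<union> {d (m, n \<oplus>\<^bsub>N\<^esub> n') \<ominus>\<^bsub>P\<^esub> (d (m, n) \<oplus>\<^bsub>P\<^esub> d (m, n')) | m n n'.
         m \<in> carrier M \<and> n \<in> carrier N \<and> n' \<in> carrier N}
    \<union> {d (r \<odot>\<^bsub>M\<^esub> m, n) \<ominus>\<^bsub>P\<^esub> r \<odot>\<^bsub>P\<^esub> d (m, n) | r m n.
         r \<in> carrier R \<and> m \<in> carrier M \<and> n \<in> carrier N}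
    \<union> {d (m, r \<odot>\<^bsub>N\<^esub> n) \<ominus>\<^bsub>P\<^esub> r \<odot>\<^bsub>P\<^esub> d (m, n) | r m n.
         r \<in> carrier R \<and> m \<in> carrier M \<and> n \<in> carrier N}))"

definition tensor ::
  "('c, 'x) ring_scheme \<Rightarrow> ('c, 'a, 'y) module_scheme \<Rightarrow> ('c, 'b, 'z) module_scheme
    \<Rightarrow> ('c, ('a \<times> 'b \<Rightarrow> 'c) set) module"
  where "tensor R M N = quot_alg (pair_alg R M N) (tensor_ideal R M N)"

definition tens ::
  "('c, 'x) ring_scheme \<Rightarrow> ('c, 'a, 'y) module_scheme \<Rightarrow> ('c, 'b, 'z) module_scheme
    \<Rightarrow> 'a \<Rightarrow> 'b \<Rightarrow> ('a \<times> 'b \<Rightarrow> 'c) set"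
  where "tens R M N m n = tensor_ideal R M N +>\<^bsub>pair_alg R M N\<^esub> single R (m, n)"

abbreviation "t_inl R M N m \<equiv> tens R M N m \<one>\<^bsub>N\<^esub>"
abbreviation "t_inr R M N n \<equiv> tens R M N \<one>\<^bsub>M\<^esub> n"

text \<open>
  \<open>tensor_lift R M N P f g\<close> is the homomorphism \<open>m \<otimes> n \<mapsto> f m * g n\<close> from
  \<open>M \<otimes>\<^sub>R N\<close> to \<open>P\<close>, for ring homomorphisms \<open>f\<close>, \<open>g\<close> that agree on \<open>R\<close>.
\<close>

definition tensor_lift ::
  "('c, 'x) ring_scheme \<Rightarrow> ('c, 'a, 'y) module_scheme \<Rightarrow> ('c, 'b, 'z) module_scheme
    \<Rightarrow> ('d, 'w) ring_scheme \<Rightarrow> ('a \<Rightarrow> 'd) \<Rightarrow> ('b \<Rightarrow> 'd) \<Rightarrow> ('a \<times> 'b \<Rightarrow> 'c) set \<Rightarrow> 'd"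
  where "tensor_lift R M N P f g C = (let u = (SOME u. u \<in> C) in
    \<Oplus>\<^bsub>P\<^esub>p \<in> {p. u p \<noteq> \<zero>\<^bsub>R\<^esub>}. f (u p \<odot>\<^bsub>M\<^esub> fst p) \<otimes>\<^bsub>P\<^esub> g (snd p))"

text \<open>\<open>f \<otimes> g\<close> from \<open>M \<otimes>\<^sub>R N\<close> to \<open>M' \<otimes>\<^sub>R N'\<close>\<close>

definition tensor_map ::
  "('c, 'x) ring_scheme \<Rightarrow> ('c, 'a, 'y) module_scheme \<Rightarrow> ('c, 'b, 'z) module_scheme
    \<Rightarrow> ('c, 'a', 'v) module_scheme \<Rightarrow> ('c, 'b', 'w) module_scheme
    \<Rightarrow> ('a \<Rightarrow> 'a') \<Rightarrow> ('b \<Rightarrow> 'b') \<Rightarrow> ('a \<times> 'b \<Rightarrow> 'c) set \<Rightarrow> ('a' \<times> 'b' \<Rightarrow> 'c) set"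
  where "tensor_map R M N M' N' f g =
    tensor_lift R M N (tensor R M' N') (\<lambda>m. t_inl R M' N' (f m)) (\<lambda>n. t_inr R M' N' (g n))"

text \<open>The associativity isomorphism from \<open>(M \<otimes> N) \<otimes> P\<close> to \<open>M \<otimes> (N \<otimes> P)\<close>\<close>

definition tensor_assoc ::
  "('c, 'x) ring_scheme \<Rightarrow> ('c, 'a, 'y) module_scheme \<Rightarrow> ('c, 'b, 'z) module_scheme
    \<Rightarrow> ('c, 'd, 'w) module_scheme
    \<Rightarrow> (('a \<times> 'b \<Rightarrow> 'c) set \<times> 'd \<Rightarrow> 'c) set \<Rightarrow> ('a \<times> ('b \<times> 'd \<Rightarrow> 'c) set \<Rightarrow> 'c) set"
  where "tensor_assoc R M N P = (let NP = tensor R N P; T = tensor R M NP in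
    tensor_lift R (tensor R M N) P T
      (tensor_lift R M N T (t_inl R M NP) (\<lambda>n. t_inr R M NP (t_inl R N P n)))
      (\<lambda>p. t_inr R M NP (t_inr R N P p)))"

section \<open>Affine group schemes and their actions on affine schemes\<close>

record ('c, 'a) hopf = "('c, 'a) module" +
  comult :: "'a \<Rightarrow> ('a \<times> 'a \<Rightarrow> 'c) set"
  counit :: "'a \<Rightarrow> 'c"
  antipode :: "'a \<Rightarrow> 'a"

definition hopf_algebra :: "('c, 'x) ring_scheme \<Rightarrow> ('c, 'a) hopf \<Rightarrow> bool"
  where "hopf_algebra k A \<longleftrightarrow> algebra k A
    \<and> comult A \<in> alg_hom k A (tensor k A A)
    \<and> counit A \<in> alg_hom k A (self_alg k)
    \<and> antipode A \<in> alg_hom k A A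
    \<and> (\<forall>a \<in> carrier A.
        tensor_assoc k A A A (tensor_map k A A (tensor k A A) A (comult A) (\<lambda>x. x) (comult A a))
          = tensor_map k A A A (tensor k A A) (\<lambda>x. x) (comult A) (comult A a)
      \<and> tensor_lift k A A A (\<lambda>x. counit A x \<odot>\<^bsub>A\<^esub> \<one>\<^bsub>A\<^esub>) (\<lambda>x. x) (comult A a) = a
      \<and> tensor_lift k A A A (\<lambda>x. x) (\<lambda>x. counit A x \<odot>\<^bsub>A\<^esub> \<one>\<^bsub>A\<^esub>) (comult A a) = a
      \<and> tensor_lift k A A A (antipode A) (\<lambda>x. x) (comult A a) = counit A a \<odot>\<^bsub>A\<^esub> \<one>\<^bsub>A\<^esub>
      \<and> tensor_lift k A A A (\<lambda>x. x) (antipode A) (comult A a) = counit A a \<odot>\<^bsub>A\<^esub> \<one>\<^bsub>A\<^esub>)"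

definition finite_group_scheme :: "('c, 'x) ring_scheme \<Rightarrow> ('c, 'a) hopf \<Rightarrow> bool"
  where "finite_group_scheme k A \<longleftrightarrow> hopf_algebra k A \<and> finite_algebra k A"

text \<open>
  A left action \<open>Spec A \<times> Spec M \<rightarrow> Spec M\<close>, given by its comorphism
  \<open>M \<rightarrow> A \<otimes>\<^sub>k M\<close>; equivalently, the structure of a \<open>G\<close>-algebra on \<open>M\<close>.
\<close>

definition coaction ::
  "('c, 'x) ring_scheme \<Rightarrow> ('c, 'a) hopf \<Rightarrow> ('c, 'm, 'y) module_scheme
    \<Rightarrow> ('m \<Rightarrow> ('a \<times> 'm \<Rightarrow> 'c) set) \<Rightarrow> bool"
  where "coaction k A M \<rho> \<longleftrightarrow> \<rho> \<in> alg_hom k M (tensor k A M) \<and>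
    (\<forall>m \<in> carrier M.
        tensor_assoc k A A M (tensor_map k A M (tensor k A A) M (comult A) (\<lambda>x. x) (\<rho> m))
          = tensor_map k A M A (tensor k A M) (\<lambda>x. x) \<rho> (\<rho> m)
      \<and> tensor_lift k A M M (\<lambda>a. counit A a \<odot>\<^bsub>M\<^esub> \<one>\<^bsub>M\<^esub>) (\<lambda>x. x) (\<rho> m) = m)"

definition invariants ::
  "('c, 'x) ring_scheme \<Rightarrow> ('c, 'a) hopf \<Rightarrow> ('c, 'm, 'y) module_scheme
    \<Rightarrow> ('m \<Rightarrow> ('a \<times> 'm \<Rightarrow> 'c) set) \<Rightarrow> 'm set"
  where "invariants k A M \<rho> = {m \<in> carrier M. \<rho> m = t_inr k A M m}"

text \<open>The coordinate ring \<open>A \<otimes>\<^sub>k K\<close> of \<open>G\<^sub>K\<close>, a Hopf algebra over \<open>K\<close>\<close>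

definition base_change ::
  "('c, 'x) ring_scheme \<Rightarrow> ('c, 'a) hopf \<Rightarrow> ('c, 'm) module \<Rightarrow> ('m, ('a \<times> 'm \<Rightarrow> 'c) set) hopf"
  where "base_change k A K = (let
      T = alg_via (t_inr k A K) (tensor k A K);
      T2 = tensor K T T;
      j = t_inl k A K
    in module.extend T
      \<lparr>comult = tensor_lift k A K T2
         (\<lambda>a. tensor_lift k A A T2 (\<lambda>b. t_inl K T T (j b)) (\<lambda>b. t_inr K T T (j b)) (comult A a))
         (\<lambda>c. c \<odot>\<^bsub>T2\<^esub> \<one>\<^bsub>T2\<^esub>),
       counit = tensor_lift k A K K (\<lambda>a. counit A a \<odot>\<^bsub>K\<^esub> \<one>\<^bsub>K\<^esub>) (\<lambda>c. c),
       antipode = tensor_lift k A K T (\<lambda>a. j (antipode A a)) (t_inr k A K)\<rparr>)"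

text \<open>
  The stabilizer of a rational point \<open>z\<close> (a homomorphism \<open>M \<rightarrow> F\<close>) is the closed subgroup
  scheme of \<open>Spec A\<close> where the orbit map \<open>g \<mapsto> g z\<close> equals the constant map \<open>z\<close>.
  It is given by its ideal in \<open>A\<close>.
\<close>

definition orbit_comorphism ::
  "('c, 'x) ring_scheme \<Rightarrow> ('c, 'a) hopf \<Rightarrow> ('c, 'm, 'y) module_scheme
    \<Rightarrow> ('m \<Rightarrow> ('a \<times> 'm \<Rightarrow> 'c) set) \<Rightarrow> ('m \<Rightarrow> 'c) \<Rightarrow> 'm \<Rightarrow> 'a"
  where "orbit_comorphism F A M \<rho> z m =
    tensor_lift F A M A (\<lambda>x. x) (\<lambda>x. z x \<odot>\<^bsub>A\<^esub> \<one>\<^bsub>A\<^esub>) (\<rho> m)"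

definition stabilizer_ideal ::
  "('c, 'x) ring_scheme \<Rightarrow> ('c, 'a) hopf \<Rightarrow> ('c, 'm, 'y) module_scheme
    \<Rightarrow> ('m \<Rightarrow> ('a \<times> 'm \<Rightarrow> 'c) set) \<Rightarrow> ('m \<Rightarrow> 'c) \<Rightarrow> 'a set"
  where "stabilizer_ideal F A M \<rho> z =
    Idl\<^bsub>A\<^esub> {orbit_comorphism F A M \<rho> z m \<ominus>\<^bsub>A\<^esub> (z m \<odot>\<^bsub>A\<^esub> \<one>\<^bsub>A\<^esub>) | m. m \<in> carrier M}"

text \<open>
  For the closed subgroup scheme \<open>H\<close> of a finite group scheme \<open>G = Spec A\<close> with ideal \<open>J\<close>,
  the quotient \<open>G/H\<close> is the spectrum of the functions on \<open>G\<close> invariant under right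
  translation by \<open>H\<close>, that is \<open>f (g h) = f g\<close>
  (Mumford, Abelian Varieties, section 12; Jantzen, Representations of Algebraic Groups, I.5).
  Its left \<open>G\<close>-action is the one for which \<open>G \<rightarrow> G/H\<close> is equivariant.
\<close>

definition coset_alg ::
  "('c, 'x) ring_scheme \<Rightarrow> ('c, 'a) hopf \<Rightarrow> 'a set \<Rightarrow> ('c, 'a) module"
  where "coset_alg F A J =
    (module.truncate A)\<lparr>carrier := {a \<in> carrier A.
       tensor_map F A A A (quot_alg A J) (\<lambda>x. x) (\<lambda>x. J +>\<^bsub>A\<^esub> x) (comult A a)
         = t_inl F A (quot_alg A J) a}\<rparr>"

definition coset_coaction ::
  "('c, 'x) ring_scheme \<Rightarrow> ('c, 'a) hopf \<Rightarrow> 'a set \<Rightarrow> 'a \<Rightarrow> ('a \<times> 'a \<Rightarrow> 'c) set"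
  where "coset_coaction F A J a = (let D = coset_alg F A J in
    THE t. t \<in> carrier (tensor F A D) \<and>
           tensor_map F A D A A (\<lambda>x. x) (\<lambda>x. x) t = comult A a)"

section \<open>Ringed spaces over a field\<close>

record ('p, 'r, 'c) rspace =
  tp :: "'p topology"
  sec :: "'p set \<Rightarrow> ('c, 'r) module"
  res :: "'p set \<Rightarrow> 'p set \<Rightarrow> 'r \<Rightarrow> 'r"

abbreviation points :: "('p, 'r, 'c) rspace \<Rightarrow> 'p set"
  where "points X \<equiv> topspace (tp X)"

abbreviation opens :: "('p, 'r, 'c) rspace \<Rightarrow> 'p set set"
  where "opens X \<equiv> {U. openin (tp X) U}"

definition alg_sheaf :: "('c, 'x) ring_scheme \<Rightarrow> ('p, 'r, 'c) rspace \<Rightarrow> bool"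
  where "alg_sheaf k X \<longleftrightarrow>
    (\<forall>U \<in> opens X. algebra k (sec X U) \<and> (\<forall>s \<in> carrier (sec X U). res X U U s = s)) \<and>
    (\<forall>U \<in> opens X. \<forall>V \<in> opens X. V \<subseteq> U \<longrightarrow> res X U V \<in> alg_hom k (sec X U) (sec X V)) \<and>
    (\<forall>U \<in> opens X. \<forall>V \<in> opens X. \<forall>W \<in> opens X. W \<subseteq> V \<and> V \<subseteq> U \<longrightarrow>
       (\<forall>s \<in> carrier (sec X U). res X V W (res X U V s) = res X U W s)) \<and>
    (\<forall>\<U> \<sigma>. \<U> \<subseteq> opens X \<and> (\<forall>V \<in> \<U>. \<sigma> V \<in> carrier (sec X V)) \<and>
       (\<forall>V \<in> \<U>. \<forall>W \<in> \<U>. res X V (V \<inter> W) (\<sigma> V) = res X W (V \<inter> W) (\<sigma> W)) \<longrightarrow>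
       (\<exists>!s. s \<in> carrier (sec X (\<Union>\<U>)) \<and> (\<forall>V \<in> \<U>. res X (\<Union>\<U>) V s = \<sigma> V)))"

definition germ :: "('p, 'r, 'c) rspace \<Rightarrow> 'p \<Rightarrow> 'p set \<Rightarrow> 'r \<Rightarrow> ('p set \<times> 'r) set"
  where "germ X x U s =
    {(V, t). V \<in> opens X \<and> x \<in> V \<and> t \<in> carrier (sec X V) \<and>
       (\<exists>W \<in> opens X. x \<in> W \<and> W \<subseteq> U \<inter> V \<and> res X U W s = res X V W t)}"

definition stalk :: "('p, 'r, 'c) rspace \<Rightarrow> 'p \<Rightarrow> ('c, ('p set \<times> 'r) set) module"
  where "stalk X x =
    \<lparr>carrier = {germ X x U s | U s. U \<in> opens X \<and> x \<in> U \<and> s \<in> carrier (sec X U)},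
     monoid.mult = (\<lambda>\<alpha> \<beta>. \<Union>(U, s)\<in>\<alpha>. \<Union>(V, t)\<in>\<beta>. germ X x (U \<inter> V)
        (res X U (U \<inter> V) s \<otimes>\<^bsub>sec X (U \<inter> V)\<^esub> res X V (U \<inter> V) t)),
     one = germ X x (points X) \<one>\<^bsub>sec X (points X)\<^esub>,
     zero = germ X x (points X) \<zero>\<^bsub>sec X (points X)\<^esub>,
     add = (\<lambda>\<alpha> \<beta>. \<Union>(U, s)\<in>\<alpha>. \<Union>(V, t)\<in>\<beta>. germ X x (U \<inter> V)
        (res X U (U \<inter> V) s \<oplus>\<^bsub>sec X (U \<inter> V)\<^esub> res X V (U \<inter> V) t)),
     smult = (\<lambda>c \<alpha>. \<Union>(U, s)\<in>\<alpha>. germ X x U (c \<odot>\<^bsub>sec X U\<^esub> s))\<rparr>"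

definition local_ring :: "('a, 'x) ring_scheme \<Rightarrow> bool"
  where "local_ring R \<longleftrightarrow> cring R \<and> (\<exists>!m. maximalideal m R)"

definition lr_space :: "('c, 'x) ring_scheme \<Rightarrow> ('p, 'r, 'c) rspace \<Rightarrow> bool"
  where "lr_space k X \<longleftrightarrow> alg_sheaf k X \<and> (\<forall>x \<in> points X. local_ring (stalk X x))"

definition open_sub :: "('p, 'r, 'c) rspace \<Rightarrow> 'p set \<Rightarrow> ('p, 'r, 'c) rspace"
  where "open_sub X U = X\<lparr>tp := subtopology (tp X) U\<rparr>"

subsection \<open>Morphisms\<close>

text \<open>\<open>pull f V\<close> is the map from sections over \<open>V\<close> to sections over the preimage of \<open>V\<close>.\<close>

record ('p, 'r, 'q, 's) morph =
  pt :: "'p \<Rightarrow> 'q"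
  pull :: "'q set \<Rightarrow> 's \<Rightarrow> 'r"

definition pre :: "('p, 'r, 'c) rspace \<Rightarrow> ('p, 'r, 'q, 's) morph \<Rightarrow> 'q set \<Rightarrow> 'p set"
  where "pre X f V = {x \<in> points X. pt f x \<in> V}"

definition mor ::
  "('c, 'x) ring_scheme \<Rightarrow> ('p, 'r, 'c) rspace \<Rightarrow> ('q, 's, 'c) rspace
    \<Rightarrow> ('p, 'r, 'q, 's) morph \<Rightarrow> bool"
  where "mor k X Y f \<longleftrightarrow> continuous_map (tp X) (tp Y) (pt f) \<and>
    (\<forall>V \<in> opens Y. pull f V \<in> alg_hom k (sec Y V) (sec X (pre X f V))) \<and>
    (\<forall>V \<in> opens Y. \<forall>W \<in> opens Y. W \<subseteq> V \<longrightarrow> (\<forall>t \<in> carrier (sec Y V).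
       pull f W (res Y V W t) = res X (pre X f V) (pre X f W) (pull f V t))) \<and>
    (\<forall>x \<in> points X. \<forall>V \<in> opens Y. \<forall>t \<in> carrier (sec Y V).
       pt f x \<in> V \<and> germ X x (pre X f V) (pull f V t) \<in> Units (stalk X x) \<longrightarrow>
       germ Y (pt f x) V t \<in> Units (stalk Y (pt f x)))"

text \<open>Equality of morphisms, ignoring values outside the points and the sections\<close>

definition mor_eq ::
  "('p, 'r, 'c) rspace \<Rightarrow> ('q, 's, 'c) rspace \<Rightarrow> ('p, 'r, 'q, 's) morph
    \<Rightarrow> ('p, 'r, 'q, 's) morph \<Rightarrow> bool"
  where "mor_eq X Y f g \<longleftrightarrow> (\<forall>x \<in> points X. pt f x = pt g x) \<and>
    (\<forall>V \<in> opens Y. \<forall>t \<in> carrier (sec Y V). pull f V t = pull g V t)"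

definition idm :: "('p, 'r, 'p, 'r) morph"
  where "idm = \<lparr>pt = (\<lambda>x. x), pull = (\<lambda>V t. t)\<rparr>"

text \<open>\<open>mcomp Y g f\<close> is the composite of \<open>f\<close> from \<open>X\<close> to \<open>Y\<close> with \<open>g\<close> from \<open>Y\<close> to \<open>Z\<close>.\<close>

definition mcomp ::
  "('q, 's, 'c) rspace \<Rightarrow> ('q, 's, 't, 'u) morph \<Rightarrow> ('p, 'r, 'q, 's) morph \<Rightarrow> ('p, 'r, 't, 'u) morph"
  where "mcomp Y g f =
    \<lparr>pt = (\<lambda>x. pt g (pt f x)), pull = (\<lambda>V t. pull f (pre Y g V) (pull g V t))\<rparr>"

definition miso ::
  "('c, 'x) ring_scheme \<Rightarrow> ('p, 'r, 'c) rspace \<Rightarrow> ('q, 's, 'c) rspace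
    \<Rightarrow> ('p, 'r, 'q, 's) morph \<Rightarrow> bool"
  where "miso k X Y f \<longleftrightarrow> mor k X Y f \<and>
    (\<exists>g. mor k Y X g \<and> mor_eq X X (mcomp Y g f) idm \<and> mor_eq Y Y (mcomp X f g) idm)"

definition closed_immersion ::
  "('c, 'x) ring_scheme \<Rightarrow> ('p, 'r, 'c) rspace \<Rightarrow> ('q, 's, 'c) rspace
    \<Rightarrow> ('p, 'r, 'q, 's) morph \<Rightarrow> bool"
  where "closed_immersion k X Y f \<longleftrightarrow> mor k X Y f \<and>
    embedding_map (tp X) (tp Y) (pt f) \<and> closedin (tp Y) (pt f ` points X) \<and>
    (\<forall>x \<in> points X. \<forall>\<alpha> \<in> carrier (stalk X x). \<exists>W \<in> opens Y. \<exists>t \<in> carrier (sec Y W).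
       pt f x \<in> W \<and> germ X x (pre X f W) (pull f W t) = \<alpha>)"

section \<open>Spectra and fibre products\<close>

text \<open>Localization of an algebra at a prime ideal \<open>P\<close>\<close>

definition fraction :: "('c, 'a, 'y) module_scheme \<Rightarrow> 'a set \<Rightarrow> 'a \<Rightarrow> 'a \<Rightarrow> ('a \<times> 'a) set"
  where "fraction R P a s = {(b, t). b \<in> carrier R \<and> t \<in> carrier R - P \<and>
     (\<exists>u \<in> carrier R - P. u \<otimes>\<^bsub>R\<^esub> (a \<otimes>\<^bsub>R\<^esub> t) = u \<otimes>\<^bsub>R\<^esub> (b \<otimes>\<^bsub>R\<^esub> s))}"

definition localize :: "('c, 'a, 'y) module_scheme \<Rightarrow> 'a set \<Rightarrow> ('c, ('a \<times> 'a) set) module"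
  where "localize R P =
    \<lparr>carrier = {fraction R P a s | a s. a \<in> carrier R \<and> s \<in> carrier R - P},
     monoid.mult = (\<lambda>\<alpha> \<beta>. \<Union>(a, s)\<in>\<alpha>. \<Union>(b, t)\<in>\<beta>. fraction R P (a \<otimes>\<^bsub>R\<^esub> b) (s \<otimes>\<^bsub>R\<^esub> t)),
     one = fraction R P \<one>\<^bsub>R\<^esub> \<one>\<^bsub>R\<^esub>,
     zero = fraction R P \<zero>\<^bsub>R\<^esub> \<one>\<^bsub>R\<^esub>,
     add = (\<lambda>\<alpha> \<beta>. \<Union>(a, s)\<in>\<alpha>. \<Union>(b, t)\<in>\<beta>.
        fraction R P ((a \<otimes>\<^bsub>R\<^esub> t) \<oplus>\<^bsub>R\<^esub> (b \<otimes>\<^bsub>R\<^esub> s)) (s \<otimes>\<^bsub>R\<^esub> t)),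
     smult = (\<lambda>c \<alpha>. \<Union>(a, s)\<in>\<alpha>. fraction R P (c \<odot>\<^bsub>R\<^esub> a) s)\<rparr>"

text \<open>
  The ringed space with prescribed local rings \<open>L z\<close> whose topology is generated by the
  sets \<open>D\<close>, and whose sections are the functions that locally agree with some \<open>\<sigma>\<close>, for
  \<open>(D, \<sigma>) \<in> B\<close>.
\<close>

definition germ_space ::
  "('p \<Rightarrow> ('c, 't) module) \<Rightarrow> ('p set \<times> ('p \<Rightarrow> 't)) set \<Rightarrow> ('p, 'p \<Rightarrow> 't, 'c) rspace"
  where "germ_space L B =
    \<lparr>tp = topology_generated_by (fst ` B),
     sec = (\<lambda>U.
       \<lparr>carrier = {s \<in> extensional U.
          \<forall>z \<in> U. \<exists>(D, \<sigma>) \<in> B. z \<in> D \<and> D \<subseteq> U \<and> (\<forall>w \<in> D. s w = \<sigma> w)},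
        monoid.mult = (\<lambda>s t. \<lambda>z\<in>U. s z \<otimes>\<^bsub>L z\<^esub> t z),
        one = (\<lambda>z\<in>U. \<one>\<^bsub>L z\<^esub>),
        zero = (\<lambda>z\<in>U. \<zero>\<^bsub>L z\<^esub>),
        add = (\<lambda>s t. \<lambda>z\<in>U. s z \<oplus>\<^bsub>L z\<^esub> t z),
        smult = (\<lambda>c s. \<lambda>z\<in>U. c \<odot>\<^bsub>L z\<^esub> s z)\<rparr>),
     res = (\<lambda>U V s. restrict s V)\<rparr>"

definition Spec :: "('c, 'a, 'y) module_scheme \<Rightarrow> ('a set, 'a set \<Rightarrow> ('a \<times> 'a) set, 'c) rspace"
  where "Spec R = germ_space (localize R)
    {({P. primeideal P R \<and> f \<notin> P}, \<lambda>P. fraction R P a f) | a f. a \<in> carrier R \<and> f \<in> carrier R}"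

text \<open>The morphism from \<open>Spec S\<close> to \<open>Spec R\<close> induced by \<open>h\<close> from \<open>R\<close> to \<open>S\<close>\<close>

definition Spec_map ::
  "('c, 'a, 'y) module_scheme \<Rightarrow> ('c, 'b, 'z) module_scheme \<Rightarrow> ('a \<Rightarrow> 'b)
    \<Rightarrow> ('b set, 'b set \<Rightarrow> ('b \<times> 'b) set, 'a set, 'a set \<Rightarrow> ('a \<times> 'a) set) morph"
  where "Spec_map R S h = (let c = (\<lambda>Q. {a \<in> carrier R. h a \<in> Q}) in
    \<lparr>pt = c,
     pull = (\<lambda>U s. \<lambda>Q \<in> {Q. primeideal Q S \<and> c Q \<in> U}.
        \<Union>(a, b) \<in> s (c Q). fraction S Q (h a) (h b))\<rparr>)"

text \<open>
  The fibre product over \<open>Spec k\<close> in the category of locally ringed spaces (for schemes it is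
  the fibre product of schemes), in its explicit form (Gillam, Localization of ringed spaces):
  a point is \<open>(x, y, P)\<close> where \<open>P\<close> is a prime ideal of the tensor product of the
  local rings at \<open>x\<close> and \<open>y\<close> lying over both maximal ideals; the local ring there is the
  localization at \<open>P\<close>; and sections are locally fractions of elements of
  \<open>\<O>(V) \<otimes>\<^sub>k \<O>(W)\<close>.
\<close>

definition stalk_tensor where
  "stalk_tensor k X Y x y = tensor k (stalk X x) (stalk Y y)"

definition fprod_points where
  "fprod_points k X Y = {(x, y, P). x \<in> points X \<and> y \<in> points Y \<and>
     primeideal P (stalk_tensor k X Y x y) \<and>
     {\<alpha> \<in> carrier (stalk X x). t_inl k (stalk X x) (stalk Y y) \<alpha> \<in> P}
       = carrier (stalk X x) - Units (stalk X x) \<and>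
     {\<beta> \<in> carrier (stalk Y y). t_inr k (stalk X x) (stalk Y y) \<beta> \<in> P}
       = carrier (stalk Y y) - Units (stalk Y y)}"

definition fprod_germ where
  "fprod_germ k X Y V W x y =
     tensor_map k (sec X V) (sec Y W) (stalk X x) (stalk Y y) (germ X x V) (germ Y y W)"

definition fprod where
  "fprod k X Y = germ_space (\<lambda>(x, y, P). localize (stalk_tensor k X Y x y) P)
     {({(x, y, P) \<in> fprod_points k X Y. x \<in> V \<and> y \<in> W \<and> fprod_germ k X Y V W x y f \<notin> P},
       \<lambda>(x, y, P). fraction (stalk_tensor k X Y x y) P
          (fprod_germ k X Y V W x y g) (fprod_germ k X Y V W x y f)) | V W f g.
       V \<in> opens X \<and> W \<in> opens Y \<and>
       f \<in> carrier (tensor k (sec X V) (sec Y W)) \<and> g \<in> carrier (tensor k (sec X V) (sec Y W))}"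

definition pr1 where
  "pr1 k X Y =
    \<lparr>pt = fst,
     pull = (\<lambda>V s. \<lambda>(x, y, P) \<in> {z \<in> fprod_points k X Y. fst z \<in> V}.
       fraction (stalk_tensor k X Y x y) P (t_inl k (stalk X x) (stalk Y y) (germ X x V s))
         \<one>\<^bsub>stalk_tensor k X Y x y\<^esub>)\<rparr>"

definition pr2 where
  "pr2 k X Y =
    \<lparr>pt = (\<lambda>z. fst (snd z)),
     pull = (\<lambda>W t. \<lambda>(x, y, P) \<in> {z \<in> fprod_points k X Y. fst (snd z) \<in> W}.
       fraction (stalk_tensor k X Y x y) P (t_inr k (stalk X x) (stalk Y y) (germ Y y W t))
         \<one>\<^bsub>stalk_tensor k X Y x y\<^esub>)\<rparr>"

text \<open>\<open>h\<close> is the morphism \<open>(f, g)\<close> from \<open>T\<close> to \<open>X \<times> Y\<close>.\<close>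

definition is_pair where
  "is_pair k T X Y f g h \<longleftrightarrow> mor k T (fprod k X Y) h \<and>
     mor_eq T X (mcomp (fprod k X Y) (pr1 k X Y) h) f \<and>
     mor_eq T Y (mcomp (fprod k X Y) (pr2 k X Y) h) g"

section \<open>Varieties\<close>

definition affine_open :: "('c, 'x) ring_scheme \<Rightarrow> ('p, 'r, 'c) rspace \<Rightarrow> 'p set \<Rightarrow> bool"
  where "affine_open k X U \<longleftrightarrow> U \<in> opens X \<and> (\<exists>f. miso k (open_sub X U) (Spec (sec X U)) f)"

definition scheme :: "('c, 'x) ring_scheme \<Rightarrow> ('p, 'r, 'c) rspace \<Rightarrow> bool"
  where "scheme k X \<longleftrightarrow> lr_space k X \<and> (\<forall>x \<in> points X. \<exists>U. x \<in> U \<and> affine_open k X U)"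

definition separated :: "('c, 'x) ring_scheme \<Rightarrow> ('p, 'r, 'c) rspace \<Rightarrow> bool"
  where "separated k X \<longleftrightarrow>
    (\<exists>d. is_pair k X X X idm idm d \<and> closed_immersion k X (fprod k X X) d)"

definition finite_type :: "('c, 'x) ring_scheme \<Rightarrow> ('p, 'r, 'c) rspace \<Rightarrow> bool"
  where "finite_type k X \<longleftrightarrow> compact_space (tp X) \<and>
    (\<forall>x \<in> points X. \<exists>U. x \<in> U \<and> affine_open k X U \<and> fin_gen_algebra k (sec X U))"

definition integral_scheme :: "('p, 'r, 'c) rspace \<Rightarrow> bool"
  where "integral_scheme X \<longleftrightarrow> points X \<noteq> {} \<and> (\<forall>U \<in> opens X. U \<noteq> {} \<longrightarrow> domain (sec X U))"

text \<open>
  Integrality of \<open>X \<times>\<^sub>k Spec F\<close> for all field extensions \<open>F\<close> of \<open>k\<close>.  Extensions are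
  taken with carrier in the type of the library's algebraic closure of \<open>k\<close>; these include an
  algebraic closure, for which the condition already implies it for all extensions.
  Integrality of \<open>X\<close> itself is the case \<open>F = k\<close> and is only repeated for convenience.
\<close>

definition geometrically_integral :: "('c, 'x) ring_scheme \<Rightarrow> ('p, 'r, 'c) rspace \<Rightarrow> bool"
  where "geometrically_integral k X \<longleftrightarrow> integral_scheme X \<and>
    (\<forall>(F :: (('c list \<times> nat) multiset \<Rightarrow> 'c) ring) h.
       field F \<and> h \<in> ring_hom k F \<longrightarrow> integral_scheme (fprod k X (Spec (alg_via h F))))"

definition variety :: "('c, 'x) ring_scheme \<Rightarrow> ('p, 'r, 'c) rspace \<Rightarrow> bool"
  where "variety k X \<longleftrightarrow>
    scheme k X \<and> separated k X \<and> finite_type k X \<and> geometrically_integral k X"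

definition generic_point :: "('p, 'r, 'c) rspace \<Rightarrow> 'p \<Rightarrow> bool"
  where "generic_point X \<xi> \<longleftrightarrow> \<xi> \<in> points X \<and> tp X closure_of {\<xi>} = points X"

text \<open>The canonical morphism from \<open>Spec\<close> of the function field, the stalk at \<open>\<xi>\<close>, to \<open>X\<close>\<close>

definition generic_mor where
  "generic_mor X \<xi> = (let K = stalk X \<xi> in
    \<lparr>pt = (\<lambda>_. \<xi>),
     pull = (\<lambda>V t. \<lambda>P \<in> {P. primeideal P K \<and> \<xi> \<in> V}. fraction K P (germ X \<xi> V t) \<one>\<^bsub>K\<^esub>)\<rparr>)"

section \<open>Group actions on schemes\<close>

text \<open>
  \<open>h\<close> is the product of the \<open>T\<close>-valued points \<open>g1\<close>, \<open>g2\<close> of \<open>Spec A\<close>: the composite of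
  \<open>(g1, g2)\<close>, as a morphism to \<open>Spec (A \<otimes> A)\<close>, with the multiplication.
\<close>

definition is_group_mult where
  "is_group_mult k A T g1 g2 h \<longleftrightarrow> (let A2 = tensor k A A in
     \<exists>u. mor k T (Spec A2) u \<and>
       mor_eq T (Spec A) (mcomp (Spec A2) (Spec_map A A2 (t_inl k A A)) u) g1 \<and>
       mor_eq T (Spec A) (mcomp (Spec A2) (Spec_map A A2 (t_inr k A A)) u) g2 \<and>
       mor_eq T (Spec A) (mcomp (Spec A2) (Spec_map A A2 (comult A)) u) h)"

text \<open>
  \<open>a\<close> is a left action \<open>G \<times> X \<rightarrow> X\<close> of \<open>G = Spec A\<close>.  Associativity is the identity
  \<open>a (g g', x) = a (g, a (g', x))\<close> for the universal point \<open>(g, (g', x))\<close> of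
  \<open>G \<times> (G \<times> X)\<close>.
\<close>

definition group_action where
  "group_action k A X a \<longleftrightarrow> (let
      G = Spec A; P = fprod k G X; Q = fprod k G P;
      g = pr1 k G P; g' = mcomp P (pr1 k G X) (pr2 k G P); x = mcomp P (pr2 k G X) (pr2 k G P)
    in mor k P X a \<and>
      (\<exists>gg u v. mor k Q G gg \<and> is_group_mult k A Q g g' gg \<and>
         is_pair k Q G X gg x u \<and> is_pair k Q G X g (mcomp P a (pr2 k G P)) v \<and>
         mor_eq Q X (mcomp P a u) (mcomp P a v)) \<and>
      (\<exists>s u. mor k X (Spec (self_alg k)) s \<and>
         is_pair k X G X (mcomp (Spec (self_alg k)) (Spec_map A (self_alg k) (counit A)) s) idm u \<and>
         mor_eq X X (mcomp P a u) idm))"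

text \<open>
  Equivariance of the canonical morphism \<open>Spec K \<rightarrow> X\<close>, for the action on \<open>Spec K\<close> with
  comorphism \<open>\<rho>\<close>: the two composites \<open>G \<times> Spec K = Spec (A \<otimes> K) \<rightarrow> X\<close> agree.
\<close>

definition generic_mor_equivariant where
  "generic_mor_equivariant k A X a \<xi> \<rho> \<longleftrightarrow> (let
      K = stalk X \<xi>; AK = tensor k A K; \<eta> = generic_mor X \<xi>
    in \<exists>u. is_pair k (Spec AK) (Spec A) X
          (Spec_map A AK (t_inl k A K)) (mcomp (Spec K) \<eta> (Spec_map K AK (t_inr k A K))) u \<and>
        mor_eq (Spec AK) X (mcomp (fprod k (Spec A) X) a u) (mcomp (Spec K) \<eta> (Spec_map K AK \<rho>)))"

text \<open>
  \<open>\<phi>\<close> from \<open>Spec M\<close> to \<open>Spec N\<close> is an isomorphism of \<open>F\<close>-schemes that is equivariant for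
  the actions of \<open>Spec A\<close> with comorphisms \<open>\<rho>\<close> and \<open>\<tau>\<close>; here \<open>\<psi>\<close> is \<open>id \<times> \<phi>\<close>, from
  \<open>Spec (A \<otimes> M)\<close> to \<open>Spec (A \<otimes> N)\<close>.
\<close>

definition equivariant_iso where
  "equivariant_iso F A M \<rho> N \<tau> \<phi> \<longleftrightarrow> (let AM = tensor F A M; AN = tensor F A N in
     miso F (Spec M) (Spec N) \<phi> \<and>
     (\<exists>\<psi>. mor F (Spec AM) (Spec AN) \<psi> \<and>
        mor_eq (Spec AM) (Spec A) (mcomp (Spec AN) (Spec_map A AN (t_inl F A N)) \<psi>)
          (Spec_map A AM (t_inl F A M)) \<and>
        mor_eq (Spec AM) (Spec N) (mcomp (Spec AN) (Spec_map N AN (t_inr F A N)) \<psi>)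
          (mcomp (Spec M) \<phi> (Spec_map M AM (t_inr F A M))) \<and>
        mor_eq (Spec AM) (Spec N) (mcomp (Spec M) \<phi> (Spec_map M AM \<rho>))
          (mcomp (Spec AN) (Spec_map N AN \<tau>) \<psi>)))"

section \<open>The scheme \<open>Spec (K \<otimes>\<^sub>L K)\<close>\<close>

text \<open>\<open>K \<otimes>\<^sub>L K\<close> for a subfield \<open>L\<close> of \<open>K\<close>, as a \<open>K\<close>-algebra through the first factor\<close>

definition self_tensor :: "('m, 'y) ring_scheme \<Rightarrow> 'm set \<Rightarrow> ('m, ('m \<times> 'm \<Rightarrow> 'm) set) module"
  where "self_tensor K L = (let L' = K\<lparr>carrier := L\<rparr>; K' = self_alg K in
    alg_via (t_inl L' K' K') (tensor L' K' K'))"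

definition diag_point :: "('m, 'y) ring_scheme \<Rightarrow> 'm set \<Rightarrow> ('m \<times> 'm \<Rightarrow> 'm) set \<Rightarrow> 'm"
  where "diag_point K L =
    tensor_lift (K\<lparr>carrier := L\<rparr>) (self_alg K) (self_alg K) K (\<lambda>x. x) (\<lambda>x. x)"

text \<open>
  The action of \<open>G\<^sub>K\<close> on \<open>Spec (K \<otimes>\<^sub>L K)\<close> through the second factor: the comorphism is
  \<open>K\<close>-linear and sends \<open>1 \<otimes> y\<close> to the sum of the \<open>(a \<otimes> 1) \<otimes> (1 \<otimes> c)\<close>, where
  \<open>\<rho> y\<close> is the sum of the \<open>a \<otimes> c\<close>.
\<close>

definition self_tensor_coaction ::
  "('c, 'x) ring_scheme \<Rightarrow> ('c, 'a) hopf \<Rightarrow> ('c, 'm) module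
    \<Rightarrow> ('m \<Rightarrow> ('a \<times> 'm \<Rightarrow> 'c) set) \<Rightarrow> 'm set \<Rightarrow> ('m \<times> 'm \<Rightarrow> 'm) set
    \<Rightarrow> (('a \<times> 'm \<Rightarrow> 'c) set \<times> ('m \<times> 'm \<Rightarrow> 'm) set \<Rightarrow> 'm) set"
  where "self_tensor_coaction k A K \<rho> L = (let
      L' = K\<lparr>carrier := L\<rparr>; K' = self_alg K;
      GK = base_change k A K; Z = self_tensor K L; T = tensor K GK Z
    in tensor_lift L' K' K' T
        (\<lambda>x. x \<odot>\<^bsub>T\<^esub> \<one>\<^bsub>T\<^esub>)
        (\<lambda>y. tensor_lift k A K T
               (\<lambda>a. t_inl K GK Z (t_inl k A K a))
               (\<lambda>c. t_inr K GK Z (t_inr L' K' K' c)) (\<rho> y)))"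

end

theory Submission
  imports Defs
begin

text \<open>
  Only the fact that \<open>K\<close> is a field with a coaction \<open>\<rho>\<close> of \<open>A = O(G)\<close> matters.  The orbit map of the
  diagonal point has the comorphism \<open>\<Psi> : K \<otimes>\<^sub>L K \<rightarrow> A \<otimes>\<^sub>k K\<close>, \<open>x \<otimes> y \<mapsto> (1 \<otimes> x) \<rho>(y)\<close>, and it must be
  shown that \<open>\<Psi>\<close> is injective with image the algebra of \<open>H\<close>-invariant functions.

  The \<open>K\<close>-span of \<open>\<rho>(K)\<close> has a basis \<open>\<rho>(y\<^sub>i)\<close>, and since \<open>\<rho>\<close> is a coaction, the coefficients of each
  \<open>\<rho>(s)\<close> in it are invariant.  Hence the \<open>y\<^sub>i\<close> form a basis of \<open>K\<close> over \<open>L\<close>, and \<open>\<Psi>\<close> is injective.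
  As \<open>K\<close> is a finite field extension of \<open>L\<close>, \<open>K \<otimes>\<^sub>L K\<close> is a Frobenius algebra over \<open>K\<close>, hence a direct
  summand of \<open>A \<otimes>\<^sub>k K\<close> as a module over itself.  Two points of \<open>G\<^sub>K\<close> with the same image in the orbit differ by a
  point of \<open>H\<close>, so an \<open>H\<close>-invariant \<open>f\<close> satisfies \<open>f \<otimes> 1 = 1 \<otimes> f\<close> in
  \<open>(A \<otimes>\<^sub>k K) \<otimes> (A \<otimes>\<^sub>k K)\<close> over \<open>K \<otimes>\<^sub>L K\<close>, and the direct summand property puts \<open>f\<close> into the image.
\<close>

section \<open>Additive maps and finite sums\<close>

text \<open>Homomorphisms are treated as points: for points \<open>g\<close> of the group and
  \<open>x\<close> of the space with values in a ring \<open>Q\<close>, \<open>act\<close> is the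
  comorphism of g . x, and homomorphisms out of a tensor product are compared on the two factors
  only. Coassociativity then enters only as \<open>act_act\<close> and the antipode laws as
  \<open>hopf_inverse\<close>, so products such as (g1 g2^-1) g2 are handled as in an abstract
  group. The obstacle is that G and H may be non-reduced and K inseparable over L: automorphisms
  cannot be counted, and the ordinary field trace may vanish. Its place is taken by the coordinate
  form \<Lambda>_0 o \<rho>, which is 1 at a basis vector; a nonzero linear form on a field is
  nondegenerate. From f \<otimes> 1 = 1 \<otimes> f one usually concludes by faithfully flat
  descent; a linear retraction \<pi> gives the conclusion directly, by c \<otimes> d |-> \<pi>(c) d.
  On the geometric side every morphism that has to be constructed is \<open>Spec_map\<close> of an
  algebra map. Local arguments are needed only for the functoriality of Spec and for showing that
  the stalk at the generic point is a field.\<close>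

lemma cring_cong:
  assumes "cring R" "carrier S = carrier R" "monoid.mult S = monoid.mult R" "one S = one R"
    "zero S = zero R" "add S = add R"
  shows "cring S"
  using assms(1)
  unfolding cring_def ring_def ring_axioms_def abelian_group_def abelian_monoid_def
    abelian_group_axioms_def comm_monoid_def comm_monoid_axioms_def comm_group_def group_def
    group_axioms_def monoid_def Units_def partial_object.simps monoid.simps assms(2-6)
  .

text \<open>The axioms, here and in \<open>cring_cong\<close>, mention only the listed fields, so
  records that differ in Hopf data or in scalars share their structure. This is how
  \<open>alg_via\<close>, \<open>quot_alg\<close>, \<open>base_change\<close> and
  \<open>coset_alg\<close> inherit their axioms.\<close>

lemma algebra_cong:
  assumes "algebra R M" "carrier N = carrier M" "monoid.mult N = monoid.mult M" "one N = one M"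
    "zero N = zero M" "add N = add M" "smult N = smult M"
  shows "algebra R N"
proof -
  have "cring N" using cring_cong[OF algebra.M_cring[OF assms(1)] assms(2-6)] .
  moreover from this have "abelian_group N" by (simp add: cring_def ring_def)
  ultimately show ?thesis
    using assms unfolding algebra_def module_def module_axioms_def algebra_axioms_def
    by simp
qed

text \<open>Scalars are left out on purpose: later maps are linear over \<open>k\<close>,
  \<open>K\<close>, \<open>L\<close> or \<open>K \<otimes> K\<close> in turn, while commuting with
  finite sums and agreement on pure tensors need additivity only.\<close>

definition additive_map :: "('a, 'x) ring_scheme \<Rightarrow> ('b, 'y) ring_scheme \<Rightarrow> ('a \<Rightarrow> 'b) \<Rightarrow> bool"
  where "additive_map P Q h \<longleftrightarrow> h \<in> carrier P \<rightarrow> carrier Q \<and>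
    (\<forall>x \<in> carrier P. \<forall>y \<in> carrier P. h (x \<oplus>\<^bsub>P\<^esub> y) = h x \<oplus>\<^bsub>Q\<^esub> h y)"

lemma additive_mapI:
  assumes "\<And>x. x \<in> carrier P \<Longrightarrow> h x \<in> carrier Q"
    "\<And>x y. x \<in> carrier P \<Longrightarrow> y \<in> carrier P \<Longrightarrow> h (x \<oplus>\<^bsub>P\<^esub> y) = h x \<oplus>\<^bsub>Q\<^esub> h y"
  shows "additive_map P Q h"
  using assms unfolding additive_map_def by auto

lemma additive_mapD:
  assumes "additive_map P Q h"
  shows "x \<in> carrier P \<Longrightarrow> h x \<in> carrier Q"
    "x \<in> carrier P \<Longrightarrow> y \<in> carrier P \<Longrightarrow> h (x \<oplus>\<^bsub>P\<^esub> y) = h x \<oplus>\<^bsub>Q\<^esub> h y"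
  using assms unfolding additive_map_def by auto

lemma additive_map_zero:
  assumes "abelian_group P" "abelian_group Q" "additive_map P Q h"
  shows "h \<zero>\<^bsub>P\<^esub> = \<zero>\<^bsub>Q\<^esub>"
proof -
  interpret P: abelian_group P by fact
  interpret Q: abelian_group Q by fact
  have "h \<zero>\<^bsub>P\<^esub> \<oplus>\<^bsub>Q\<^esub> h \<zero>\<^bsub>P\<^esub> = h \<zero>\<^bsub>P\<^esub>"
    using additive_mapD(2)[OF assms(3), of "\<zero>\<^bsub>P\<^esub>" "\<zero>\<^bsub>P\<^esub>"] by simp
  moreover have "h \<zero>\<^bsub>P\<^esub> \<in> carrier Q" using additive_mapD(1)[OF assms(3)] by simp
  ultimately show ?thesis using Q.add.r_cancel_one' by (metis Q.add.l_cancel_one)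
qed

lemma additive_map_minus:
  assumes "abelian_group P" "abelian_group Q" "additive_map P Q h"
    "x \<in> carrier P" "y \<in> carrier P"
  shows "h (x \<ominus>\<^bsub>P\<^esub> y) = h x \<ominus>\<^bsub>Q\<^esub> h y"
proof -
  interpret P: abelian_group P by fact
  interpret Q: abelian_group Q by fact
  note [simp] = additive_mapD(1)[OF assms(3)]
  have "h (x \<ominus>\<^bsub>P\<^esub> y) \<oplus>\<^bsub>Q\<^esub> h y = h ((x \<ominus>\<^bsub>P\<^esub> y) \<oplus>\<^bsub>P\<^esub> y)"
    using assms additive_mapD(2)[OF assms(3)] by simp
  also have "(x \<ominus>\<^bsub>P\<^esub> y) \<oplus>\<^bsub>P\<^esub> y = x"
    using assms by (simp add: P.minus_eq P.a_assoc P.l_neg)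
  finally have "h (x \<ominus>\<^bsub>P\<^esub> y) \<oplus>\<^bsub>Q\<^esub> h y = h x" .
  then have "h x \<ominus>\<^bsub>Q\<^esub> h y = (h (x \<ominus>\<^bsub>P\<^esub> y) \<oplus>\<^bsub>Q\<^esub> h y) \<ominus>\<^bsub>Q\<^esub> h y" by simp
  also have "\<dots> = h (x \<ominus>\<^bsub>P\<^esub> y)"
    using assms by (simp add: Q.minus_eq Q.a_assoc Q.r_neg)
  finally show ?thesis by simp
qed

lemma additive_map_finsum:
  assumes "abelian_group P" "abelian_group Q" "additive_map P Q h" "f \<in> A \<rightarrow> carrier P"
  shows "h (\<Oplus>\<^bsub>P\<^esub>i\<in>A. f i) = (\<Oplus>\<^bsub>Q\<^esub>i\<in>A. h (f i))"
proof -
  interpret P: abelian_group P by fact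
  interpret Q: abelian_group Q by fact
  have z: "h \<zero>\<^bsub>P\<^esub> = \<zero>\<^bsub>Q\<^esub>" by (rule additive_map_zero[OF assms(1-3)])
  note hD = additive_mapD[OF assms(3)]
  show ?thesis
  proof (cases "finite A")
    case True
    then show ?thesis using assms(4)
    proof (induction A rule: finite_induct)
      case empty
      then show ?case using z by simp
    next
      case (insert a A)
      have 1: "f a \<in> carrier P" "f \<in> A \<rightarrow> carrier P" using insert.prems by auto
      have 2: "(\<lambda>i. h (f i)) \<in> A \<rightarrow> carrier Q" using 1(2) by (auto intro: hD(1))
      have 3: "(\<Oplus>\<^bsub>P\<^esub>i\<in>A. f i) \<in> carrier P" by (rule P.finsum_closed[OF 1(2)])
      show ?case
        using insert.hyps insert.IH 1 2 3 hD by (simp add: P.finsum_insert Q.finsum_insert)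
    qed
  next
    case False
    then show ?thesis using z by (simp add: P.finsum_infinite Q.finsum_infinite)
  qed
qed

lemma ring_hom_additive: "h \<in> ring_hom P Q \<Longrightarrow> additive_map P Q h"
  by (rule additive_mapI) (auto dest: ring_hom_closed ring_hom_add)

lemma ring_hom_zero':
  "abelian_group P \<Longrightarrow> abelian_group Q \<Longrightarrow> h \<in> ring_hom P Q \<Longrightarrow> h \<zero>\<^bsub>P\<^esub> = \<zero>\<^bsub>Q\<^esub>"
  by (rule additive_map_zero[OF _ _ ring_hom_additive])

lemma cring_ab: "cring R \<Longrightarrow> abelian_group R"
  by (simp add: cring_def ring_def)

lemma ring_hom_minus:
  "cring P \<Longrightarrow> cring Q \<Longrightarrow> h \<in> ring_hom P Q \<Longrightarrow> x \<in> carrier P \<Longrightarrow> y \<in> carrier P \<Longrightarrow>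
    h (x \<ominus>\<^bsub>P\<^esub> y) = h x \<ominus>\<^bsub>Q\<^esub> h y"
  by (rule additive_map_minus[OF cring_ab cring_ab ring_hom_additive])

lemma additive_map_comp:
  "additive_map P Q h \<Longrightarrow> additive_map Q S g \<Longrightarrow> additive_map P S (\<lambda>x. g (h x))"
  unfolding additive_map_def by (auto simp: Pi_iff)

lemma additive_map_id: "additive_map P P (\<lambda>x. x)"
  unfolding additive_map_def by auto

lemma ring_hom_comp:
  "h \<in> ring_hom P Q \<Longrightarrow> g \<in> ring_hom Q S \<Longrightarrow> (\<lambda>x. g (h x)) \<in> ring_hom P S"
  unfolding ring_hom_def by (auto simp: Pi_iff)

lemma ring_hom_id: "(\<lambda>x. x) \<in> ring_hom P P"
  unfolding ring_hom_def by auto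

lemma ring_hom_cong:
  assumes "h \<in> ring_hom P Q" "\<And>x. x \<in> carrier P \<Longrightarrow> g x = h x" "ring P"
  shows "g \<in> ring_hom P Q"
proof -
  interpret P: ring P by fact
  show ?thesis using assms unfolding ring_hom_def by (auto simp: Pi_iff)
qed

lemma (in abelian_monoid) finsum_mono_neutral:
  assumes "finite B" "A \<subseteq> B" "\<And>i. i \<in> B - A \<Longrightarrow> h i = \<zero>" "\<And>x. x \<in> B \<Longrightarrow> h x \<in> carrier G"
  shows "(\<Oplus>i\<in>A. h i) = (\<Oplus>i\<in>B. h i)"
  by (rule add.finprod_mono_neutral_cong_left) (use assms in auto)

lemma (in abelian_monoid) finsum_single:
  assumes "finite A" "a \<in> A" "\<And>i. i \<in> A \<Longrightarrow> i \<noteq> a \<Longrightarrow> h i = \<zero>" "h a \<in> carrier G"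
  shows "(\<Oplus>i\<in>A. h i) = h a"
proof -
  have "(\<Oplus>i\<in>{a}. h i) = (\<Oplus>i\<in>A. h i)"
    by (rule finsum_mono_neutral) (use assms in force)+
  then show ?thesis using assms by (simp add: finsum_insert)
qed

lemma (in abelian_monoid) finsum_swap:
  assumes "finite A" "finite B" "\<And>i j. i \<in> A \<Longrightarrow> j \<in> B \<Longrightarrow> h i j \<in> carrier G"
  shows "(\<Oplus>i\<in>A. \<Oplus>j\<in>B. h i j) = (\<Oplus>j\<in>B. \<Oplus>i\<in>A. h i j)"
  using assms(1,3)
proof (induction A rule: finite_induct)
  case empty
  then show ?case by simp
next
  case (insert a A)
  have 1: "(\<lambda>j. h a j) \<in> B \<rightarrow> carrier G" using insert.prems by auto
  have 2: "(\<lambda>j. \<Oplus>i\<in>A. h i j) \<in> B \<rightarrow> carrier G" using insert.prems by (auto intro!: finsum_closed)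
  have 3: "(\<lambda>i. \<Oplus>j\<in>B. h i j) \<in> A \<rightarrow> carrier G" using insert.prems by (auto intro!: finsum_closed)
  have "(\<Oplus>j\<in>B. \<Oplus>i\<in>insert a A. h i j) = (\<Oplus>j\<in>B. h a j \<oplus> (\<Oplus>i\<in>A. h i j))"
    by (rule finsum_cong') (use insert 1 2 in \<open>auto simp: finsum_insert Pi_iff\<close>)
  also have "\<dots> = (\<Oplus>j\<in>B. h a j) \<oplus> (\<Oplus>j\<in>B. \<Oplus>i\<in>A. h i j)"
    by (rule finsum_addf[OF 1 2])
  also have "\<dots> = (\<Oplus>i\<in>insert a A. \<Oplus>j\<in>B. h i j)"
    using insert 1 3 by (simp add: finsum_insert finsum_closed)
  finally show ?case by simp
qed

section \<open>The monoid algebra on pairs that underlies the tensor product\<close>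

definition mono_at :: "('c, 'x) ring_scheme \<Rightarrow> 'c \<Rightarrow> 'i \<Rightarrow> 'i \<Rightarrow> 'c"
  where "mono_at R c p = (\<lambda>q. if q = p then c else \<zero>\<^bsub>R\<^esub>)"

lemma single_mono_at: "single R p = mono_at R \<one>\<^bsub>R\<^esub> p"
  by (simp add: single_def mono_at_def)

locale algebra_pair = M: algebra R M + N: algebra R N
  for R :: "('c, 'x) ring_scheme" and M :: "('c, 'a, 'y) module_scheme"
    and N :: "('c, 'b, 'z) module_scheme"
begin

abbreviation "P \<equiv> pair_alg R M N"
abbreviation "MN \<equiv> carrier M \<times> carrier N"
abbreviation "pmul p q \<equiv> (fst p \<otimes>\<^bsub>M\<^esub> fst q, snd p \<otimes>\<^bsub>N\<^esub> snd q)"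

lemma P_carrier: "carrier P = {f. (\<forall>p. f p \<in> carrier R) \<and> finite {p. f p \<noteq> \<zero>\<^bsub>R\<^esub>} \<and>
    {p. f p \<noteq> \<zero>\<^bsub>R\<^esub>} \<subseteq> MN}"
  and P_add: "f \<oplus>\<^bsub>P\<^esub> g = (\<lambda>p. f p \<oplus>\<^bsub>R\<^esub> g p)"
  and P_zero: "\<zero>\<^bsub>P\<^esub> = (\<lambda>p. \<zero>\<^bsub>R\<^esub>)"
  and P_one: "\<one>\<^bsub>P\<^esub> = mono_at R \<one>\<^bsub>R\<^esub> (\<one>\<^bsub>M\<^esub>, \<one>\<^bsub>N\<^esub>)"
  and P_smult: "c \<odot>\<^bsub>P\<^esub> f = (\<lambda>p. c \<otimes>\<^bsub>R\<^esub> f p)"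
  by (simp_all add: pair_alg_def single_mono_at)

lemma P_val: "f \<in> carrier P \<Longrightarrow> f p \<in> carrier R"
  unfolding P_carrier by blast

lemma P_carrierI:
  assumes "\<And>p. f p \<in> carrier R" "finite S" "S \<subseteq> MN" "\<And>p. p \<notin> S \<Longrightarrow> f p = \<zero>\<^bsub>R\<^esub>"
  shows "f \<in> carrier P"
proof -
  have "{p. f p \<noteq> \<zero>\<^bsub>R\<^esub>} \<subseteq> S" using assms(4) by auto
  then show ?thesis using assms finite_subset by (fastforce simp: P_carrier)
qed

lemma P_supp:
  assumes "f \<in> carrier P"
  obtains S where "finite S" "S \<subseteq> MN" "\<And>p. p \<notin> S \<Longrightarrow> f p = \<zero>\<^bsub>R\<^esub>"
  using assms unfolding P_carrier by blast

lemma mono_at_closed: "c \<in> carrier R \<Longrightarrow> p \<in> MN \<Longrightarrow> mono_at R c p \<in> carrier P"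
  by (rule P_carrierI[of _ "{p}"]) (auto simp: mono_at_def)

lemma P_add_closed:
  assumes "f \<in> carrier P" "g \<in> carrier P"
  shows "f \<oplus>\<^bsub>P\<^esub> g \<in> carrier P"
proof -
  obtain S T where "finite S" "S \<subseteq> MN" "\<And>p. p \<notin> S \<Longrightarrow> f p = \<zero>\<^bsub>R\<^esub>"
    "finite T" "T \<subseteq> MN" "\<And>p. p \<notin> T \<Longrightarrow> g p = \<zero>\<^bsub>R\<^esub>"
    using P_supp assms by metis
  then show ?thesis
    by (intro P_carrierI[of _ "S \<union> T"]) (use P_val assms in \<open>auto simp: P_add\<close>)
qed

lemma P_smult_closed:
  assumes "c \<in> carrier R" "f \<in> carrier P"
  shows "c \<odot>\<^bsub>P\<^esub> f \<in> carrier P"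
proof -
  obtain S where "finite S" "S \<subseteq> MN" "\<And>p. p \<notin> S \<Longrightarrow> f p = \<zero>\<^bsub>R\<^esub>"
    using P_supp assms by metis
  then show ?thesis
    by (intro P_carrierI[of _ "S"]) (use P_val assms in \<open>auto simp: P_smult\<close>)
qed

lemma P_zero_closed: "\<zero>\<^bsub>P\<^esub> \<in> carrier P"
  by (rule P_carrierI[of _ "{}"]) (auto simp: P_zero)

lemma P_abelian_group: "abelian_group P"
proof (rule abelian_groupI)
  fix f assume f: "f \<in> carrier P"
  have "(\<lambda>p. \<ominus>\<^bsub>R\<^esub> f p) \<in> carrier P"
  proof -
    obtain S where "finite S" "S \<subseteq> MN" "\<And>p. p \<notin> S \<Longrightarrow> f p = \<zero>\<^bsub>R\<^esub>"
      using P_supp f by metis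
    then show ?thesis
      by (intro P_carrierI[of _ "S"]) (use P_val f in auto)
  qed
  moreover have "(\<lambda>p. \<ominus>\<^bsub>R\<^esub> f p) \<oplus>\<^bsub>P\<^esub> f = \<zero>\<^bsub>P\<^esub>"
    using P_val[OF f] by (auto simp: P_add P_zero M.R.l_neg)
  ultimately show "\<exists>y\<in>carrier P. y \<oplus>\<^bsub>P\<^esub> f = \<zero>\<^bsub>P\<^esub>" by blast
next
  fix f g h assume fgh: "f \<in> carrier P" "g \<in> carrier P" "h \<in> carrier P"
  show "f \<oplus>\<^bsub>P\<^esub> g \<oplus>\<^bsub>P\<^esub> h = f \<oplus>\<^bsub>P\<^esub> (g \<oplus>\<^bsub>P\<^esub> h)"
    unfolding P_add using fgh[THEN P_val] by (intro ext) (rule M.R.a_assoc)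
  show "f \<oplus>\<^bsub>P\<^esub> g = g \<oplus>\<^bsub>P\<^esub> f"
    unfolding P_add using fgh[THEN P_val] by (intro ext) (rule M.R.a_comm)
  show "\<zero>\<^bsub>P\<^esub> \<oplus>\<^bsub>P\<^esub> f = f"
    unfolding P_add P_zero using fgh[THEN P_val] by (intro ext) (rule M.R.l_zero)
qed (use P_add_closed P_zero_closed in auto)

text \<open>Deleting one point of the support splits off a monomial. Identities that are additive in
  each argument therefore need to be checked on monomials only.\<close>

lemma P_induct [consumes 1, case_names zero add]:
  assumes "f \<in> carrier P" "Q \<zero>\<^bsub>P\<^esub>"
    "\<And>c p g. c \<in> carrier R \<Longrightarrow> p \<in> MN \<Longrightarrow> g \<in> carrier P \<Longrightarrow> Q g \<Longrightarrow> Q (mono_at R c p \<oplus>\<^bsub>P\<^esub> g)"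
  shows "Q f"
proof -
  obtain S where S: "finite S" "S \<subseteq> MN" "\<And>p. p \<notin> S \<Longrightarrow> f p = \<zero>\<^bsub>R\<^esub>"
    using P_supp assms(1) by metis
  from S(1,2,3) assms(1) show ?thesis
  proof (induction S arbitrary: f rule: finite_induct)
    case empty
    then have "f = \<zero>\<^bsub>P\<^esub>" by (auto simp: P_zero)
    then show ?case using assms(2) by simp
  next
    case (insert p S)
    let ?g = "f(p := \<zero>\<^bsub>R\<^esub>)"
    have g: "?g \<in> carrier P"
      by (rule P_carrierI[of _ S]) (use insert P_val in auto)
    have "f q = \<zero>\<^bsub>R\<^esub> \<or> q = p" if "q \<notin> S" for q
      using insert.prems(2)[of q] that by blast
    then have "Q ?g"
      using insert.prems by (intro insert.IH g) auto
    moreover have "f = mono_at R (f p) p \<oplus>\<^bsub>P\<^esub> ?g"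
      unfolding P_add mono_at_def using P_val[OF insert.prems(3)] by (intro ext) simp
    moreover have "p \<in> MN" using insert.prems by blast
    ultimately show ?case
      using assms(3)[OF P_val[OF insert.prems(3)] _ g] by metis
  qed
qed

text \<open>The defining sum runs over the exact supports, which change when elements are added.
  Fixed larger finite sets \<open>S\<close> and \<open>T\<close>, with zero terms filled in, make
  products of different elements comparable term by term.\<close>

lemma P_mult_eq:
  assumes f: "f \<in> carrier P" and g: "g \<in> carrier P"
    and S: "finite S" "\<And>p. p \<notin> S \<Longrightarrow> f p = \<zero>\<^bsub>R\<^esub>"
    and T: "finite T" "\<And>p. p \<notin> T \<Longrightarrow> g p = \<zero>\<^bsub>R\<^esub>"
  shows "(f \<otimes>\<^bsub>P\<^esub> g) p =
    (\<Oplus>\<^bsub>R\<^esub>x\<in>S \<times> T. if pmul (fst x) (snd x) = p then f (fst x) \<otimes>\<^bsub>R\<^esub> g (snd x) else \<zero>\<^bsub>R\<^esub>)"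
proof -
  let ?I = "{(q, r). f q \<noteq> \<zero>\<^bsub>R\<^esub> \<and> g r \<noteq> \<zero>\<^bsub>R\<^esub> \<and> pmul q r = p}"
  have I: "?I \<subseteq> S \<times> T" using S(2) T(2) by auto
  have "(f \<otimes>\<^bsub>P\<^esub> g) p = (\<Oplus>\<^bsub>R\<^esub>x\<in>?I. f (fst x) \<otimes>\<^bsub>R\<^esub> g (snd x))"
    by (simp add: pair_alg_def)
  also have "\<dots> = (\<Oplus>\<^bsub>R\<^esub>x\<in>S \<times> T. if pmul (fst x) (snd x) = p then f (fst x) \<otimes>\<^bsub>R\<^esub> g (snd x) else \<zero>\<^bsub>R\<^esub>)"
    by (rule M.R.add.finprod_mono_neutral_cong_left)
      (use I S T P_val[OF f] P_val[OF g] in auto)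
  finally show ?thesis .
qed

lemma P_mult_closed:
  assumes f: "f \<in> carrier P" and g: "g \<in> carrier P"
  shows "f \<otimes>\<^bsub>P\<^esub> g \<in> carrier P"
proof -
  obtain S T where S: "finite S" "S \<subseteq> MN" "\<And>p. p \<notin> S \<Longrightarrow> f p = \<zero>\<^bsub>R\<^esub>"
    and T: "finite T" "T \<subseteq> MN" "\<And>p. p \<notin> T \<Longrightarrow> g p = \<zero>\<^bsub>R\<^esub>"
    using P_supp assms by metis
  show ?thesis
  proof (rule P_carrierI[of _ "(\<lambda>x. pmul (fst x) (snd x)) ` (S \<times> T)"])
    fix p
    have eq: "(f \<otimes>\<^bsub>P\<^esub> g) p =
      (\<Oplus>\<^bsub>R\<^esub>x\<in>S \<times> T. if pmul (fst x) (snd x) = p then f (fst x) \<otimes>\<^bsub>R\<^esub> g (snd x) else \<zero>\<^bsub>R\<^esub>)"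
      by (rule P_mult_eq[OF f g S(1,3) T(1,3)])
    show "(f \<otimes>\<^bsub>P\<^esub> g) p \<in> carrier R"
      unfolding eq by (rule M.R.finsum_closed) (use P_val[OF f] P_val[OF g] in auto)
    assume "p \<notin> (\<lambda>x. pmul (fst x) (snd x)) ` (S \<times> T)"
    then have "\<And>x. x \<in> S \<times> T \<Longrightarrow> (if pmul (fst x) (snd x) = p then f (fst x) \<otimes>\<^bsub>R\<^esub> g (snd x) else \<zero>\<^bsub>R\<^esub>) = \<zero>\<^bsub>R\<^esub>"
      by force
    then show "(f \<otimes>\<^bsub>P\<^esub> g) p = \<zero>\<^bsub>R\<^esub>"
      unfolding eq by (rule M.R.add.finprod_one_eqI)
  next
    show "(\<lambda>x. pmul (fst x) (snd x)) ` (S \<times> T) \<subseteq> MN" using S(2) T(2) by fastforce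
  qed (use S T in auto)
qed

lemma P_distrib_l:
  assumes f: "f \<in> carrier P" and f': "f' \<in> carrier P" and g: "g \<in> carrier P"
  shows "(f \<oplus>\<^bsub>P\<^esub> f') \<otimes>\<^bsub>P\<^esub> g = (f \<otimes>\<^bsub>P\<^esub> g) \<oplus>\<^bsub>P\<^esub> (f' \<otimes>\<^bsub>P\<^esub> g)"
proof
  fix p
  obtain S S' T where S: "finite S" "\<And>p. p \<notin> S \<Longrightarrow> f p = \<zero>\<^bsub>R\<^esub>"
    and S': "finite S'" "\<And>p. p \<notin> S' \<Longrightarrow> f' p = \<zero>\<^bsub>R\<^esub>"
    and T: "finite T" "\<And>p. p \<notin> T \<Longrightarrow> g p = \<zero>\<^bsub>R\<^esub>"
    using P_supp assms by metis
  note val [simp] = P_val[OF f] P_val[OF f'] P_val[OF g]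
  let ?S = "S \<union> S'"
  have eq: "(h \<otimes>\<^bsub>P\<^esub> g) p = (\<Oplus>\<^bsub>R\<^esub>x\<in>?S \<times> T. if pmul (fst x) (snd x) = p then h (fst x) \<otimes>\<^bsub>R\<^esub> g (snd x) else \<zero>\<^bsub>R\<^esub>)"
    if "h = f \<or> h = f' \<or> h = f \<oplus>\<^bsub>P\<^esub> f'" for h
    by (rule P_mult_eq) (use that S S' T f f' g P_add_closed in \<open>auto simp: P_add\<close>)
  have "((f \<oplus>\<^bsub>P\<^esub> f') \<otimes>\<^bsub>P\<^esub> g) p =
    (\<Oplus>\<^bsub>R\<^esub>x\<in>?S \<times> T. (if pmul (fst x) (snd x) = p then f (fst x) \<otimes>\<^bsub>R\<^esub> g (snd x) else \<zero>\<^bsub>R\<^esub>) \<oplus>\<^bsub>R\<^esub>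
      (if pmul (fst x) (snd x) = p then f' (fst x) \<otimes>\<^bsub>R\<^esub> g (snd x) else \<zero>\<^bsub>R\<^esub>))"
    by (subst eq, simp, rule M.R.finsum_cong') (auto simp: P_add M.R.l_distr)
  also have "\<dots> = (f \<otimes>\<^bsub>P\<^esub> g) p \<oplus>\<^bsub>R\<^esub> (f' \<otimes>\<^bsub>P\<^esub> g) p"
    by (subst M.R.finsum_addf) (auto simp: eq)
  finally show "((f \<oplus>\<^bsub>P\<^esub> f') \<otimes>\<^bsub>P\<^esub> g) p = ((f \<otimes>\<^bsub>P\<^esub> g) \<oplus>\<^bsub>P\<^esub> (f' \<otimes>\<^bsub>P\<^esub> g)) p"
    by (simp add: P_add)
qed

lemma P_comm:
  assumes f: "f \<in> carrier P" and g: "g \<in> carrier P"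
  shows "f \<otimes>\<^bsub>P\<^esub> g = g \<otimes>\<^bsub>P\<^esub> f"
proof
  fix p
  obtain S T where S: "finite S" "S \<subseteq> MN" "\<And>p. p \<notin> S \<Longrightarrow> f p = \<zero>\<^bsub>R\<^esub>"
    and T: "finite T" "T \<subseteq> MN" "\<And>p. p \<notin> T \<Longrightarrow> g p = \<zero>\<^bsub>R\<^esub>"
    using P_supp assms by metis
  note val [simp] = P_val[OF f] P_val[OF g]
  have "prod.swap ` (T \<times> S) = S \<times> T" by auto
  then have "(f \<otimes>\<^bsub>P\<^esub> g) p = (\<Oplus>\<^bsub>R\<^esub>x\<in>prod.swap ` (T \<times> S). if pmul (fst x) (snd x) = p then f (fst x) \<otimes>\<^bsub>R\<^esub> g (snd x) else \<zero>\<^bsub>R\<^esub>)"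
    using P_mult_eq[OF f g S(1,3) T(1,3)] by simp
  also have "\<dots> = (\<Oplus>\<^bsub>R\<^esub>x\<in>T \<times> S. if pmul (snd x) (fst x) = p then f (snd x) \<otimes>\<^bsub>R\<^esub> g (fst x) else \<zero>\<^bsub>R\<^esub>)"
    by (subst M.R.finsum_reindex) (auto simp: Pi_iff intro!: M.R.finsum_cong')
  also have "\<dots> = (\<Oplus>\<^bsub>R\<^esub>x\<in>T \<times> S. if pmul (fst x) (snd x) = p then g (fst x) \<otimes>\<^bsub>R\<^esub> f (snd x) else \<zero>\<^bsub>R\<^esub>)"
    by (rule M.R.finsum_cong') (use S(2) T(2) in \<open>auto simp: M.R.m_comm M.m_comm N.m_comm subset_iff\<close>)
  also have "\<dots> = (g \<otimes>\<^bsub>P\<^esub> f) p"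
    by (rule P_mult_eq[OF g f T(1,3) S(1,3), symmetric])
  finally show "(f \<otimes>\<^bsub>P\<^esub> g) p = (g \<otimes>\<^bsub>P\<^esub> f) p" .
qed

lemma P_distrib_r:
  assumes "f \<in> carrier P" "f' \<in> carrier P" "g \<in> carrier P"
  shows "g \<otimes>\<^bsub>P\<^esub> (f \<oplus>\<^bsub>P\<^esub> f') = (g \<otimes>\<^bsub>P\<^esub> f) \<oplus>\<^bsub>P\<^esub> (g \<otimes>\<^bsub>P\<^esub> f')"
  using assms P_distrib_l P_comm P_add_closed by metis

lemma P_mult_mono_at:
  assumes "c \<in> carrier R" "d \<in> carrier R" "p \<in> MN" "q \<in> MN"
  shows "mono_at R c p \<otimes>\<^bsub>P\<^esub> mono_at R d q = mono_at R (c \<otimes>\<^bsub>R\<^esub> d) (pmul p q)"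
proof
  fix x
  show "(mono_at R c p \<otimes>\<^bsub>P\<^esub> mono_at R d q) x = mono_at R (c \<otimes>\<^bsub>R\<^esub> d) (pmul p q) x"
    by (subst P_mult_eq[of _ _ "{p}" "{q}"])
      (use assms mono_at_closed in \<open>auto simp: mono_at_def M.R.finsum_insert\<close>)
qed

lemma P_zero_mult:
  assumes "g \<in> carrier P"
  shows "\<zero>\<^bsub>P\<^esub> \<otimes>\<^bsub>P\<^esub> g = \<zero>\<^bsub>P\<^esub>"
proof -
  interpret P: abelian_group P by (rule P_abelian_group)
  have "additive_map P P (\<lambda>f. f \<otimes>\<^bsub>P\<^esub> g)"
    by (rule additive_mapI) (use assms P_mult_closed P_distrib_l in auto)
  then show ?thesis using additive_map_zero[OF P_abelian_group P_abelian_group] by blast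
qed

text \<open>Three nested inductions reduce the claim to monomials, where it is associativity in
  \<open>R\<close>, \<open>M\<close> and \<open>N\<close>.\<close>

lemma P_assoc:
  assumes f: "f \<in> carrier P" and g: "g \<in> carrier P" and h: "h \<in> carrier P"
  shows "(f \<otimes>\<^bsub>P\<^esub> g) \<otimes>\<^bsub>P\<^esub> h = f \<otimes>\<^bsub>P\<^esub> (g \<otimes>\<^bsub>P\<^esub> h)"
proof -
  note [simp] = P_mult_closed mono_at_closed P_add_closed P_distrib_l P_distrib_r P_zero_closed
    P_zero_mult
  have r0 [simp]: "g \<otimes>\<^bsub>P\<^esub> \<zero>\<^bsub>P\<^esub> = \<zero>\<^bsub>P\<^esub>" if "g \<in> carrier P" for g
    using that P_comm P_zero_mult by simp
  have 1: "(mono_at R c p \<otimes>\<^bsub>P\<^esub> mono_at R d q) \<otimes>\<^bsub>P\<^esub> mono_at R e r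
      = mono_at R c p \<otimes>\<^bsub>P\<^esub> (mono_at R d q \<otimes>\<^bsub>P\<^esub> mono_at R e r)"
    if "c \<in> carrier R" "d \<in> carrier R" "e \<in> carrier R" "p \<in> MN" "q \<in> MN" "r \<in> MN" for c d e p q r
    using that by (simp add: P_mult_mono_at M.R.m_assoc M.m_assoc N.m_assoc mem_Times_iff)
  have 2: "(mono_at R c p \<otimes>\<^bsub>P\<^esub> mono_at R d q) \<otimes>\<^bsub>P\<^esub> h = mono_at R c p \<otimes>\<^bsub>P\<^esub> (mono_at R d q \<otimes>\<^bsub>P\<^esub> h)"
    if "c \<in> carrier R" "d \<in> carrier R" "p \<in> MN" "q \<in> MN" for c d p q
    using h by (induction h rule: P_induct) (use that 1 in simp_all)
  have 3: "(mono_at R c p \<otimes>\<^bsub>P\<^esub> g) \<otimes>\<^bsub>P\<^esub> h = mono_at R c p \<otimes>\<^bsub>P\<^esub> (g \<otimes>\<^bsub>P\<^esub> h)"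
    if "c \<in> carrier R" "p \<in> MN" for c p
    using g by (induction g rule: P_induct) (use that 2 h in simp_all)
  show ?thesis
    using f by (induction f rule: P_induct) (use 3 g h in simp_all)
qed

lemma P_one_mult:
  assumes f: "f \<in> carrier P"
  shows "\<one>\<^bsub>P\<^esub> \<otimes>\<^bsub>P\<^esub> f = f"
proof -
  note [simp] = P_mult_closed mono_at_closed P_add_closed P_distrib_l P_distrib_r P_zero_closed
    P_zero_mult
  have r0 [simp]: "g \<otimes>\<^bsub>P\<^esub> \<zero>\<^bsub>P\<^esub> = \<zero>\<^bsub>P\<^esub>" if "g \<in> carrier P" for g
    using that P_comm P_zero_mult by simp
  show ?thesis
    using f by (induction f rule: P_induct) (simp_all add: P_one P_mult_mono_at mem_Times_iff)
qed

text \<open>Scalars act as multiplication by a constant monomial, so that compatibility of scalars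
  with products becomes associativity.\<close>

lemma P_smult_mult:
  assumes c: "c \<in> carrier R" and f: "f \<in> carrier P"
  shows "c \<odot>\<^bsub>P\<^esub> f = mono_at R c (\<one>\<^bsub>M\<^esub>, \<one>\<^bsub>N\<^esub>) \<otimes>\<^bsub>P\<^esub> f"
proof -
  have add: "c \<odot>\<^bsub>P\<^esub> (f \<oplus>\<^bsub>P\<^esub> g) = c \<odot>\<^bsub>P\<^esub> f \<oplus>\<^bsub>P\<^esub> c \<odot>\<^bsub>P\<^esub> g"
    if "f \<in> carrier P" "g \<in> carrier P" for f g
    using that c P_val by (auto simp: P_add P_smult M.R.r_distr)
  note [simp] = P_mult_closed mono_at_closed P_add_closed P_distrib_l P_distrib_r P_zero_closed
    P_zero_mult
  have r0 [simp]: "g \<otimes>\<^bsub>P\<^esub> \<zero>\<^bsub>P\<^esub> = \<zero>\<^bsub>P\<^esub>" if "g \<in> carrier P" for g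
    using that P_comm P_zero_mult by simp
  have m: "c \<odot>\<^bsub>P\<^esub> mono_at R d p = mono_at R (c \<otimes>\<^bsub>R\<^esub> d) p" if "d \<in> carrier R" for d p
    using c by (auto simp: P_smult mono_at_def)
  have z: "c \<odot>\<^bsub>P\<^esub> \<zero>\<^bsub>P\<^esub> = \<zero>\<^bsub>P\<^esub>" using c by (auto simp: P_smult P_zero)
  show ?thesis
    using f by (induction f rule: P_induct) (use c in \<open>simp_all add: z m add P_mult_mono_at mem_Times_iff\<close>)
qed

lemma P_cring: "cring P"
proof (rule cringI)
  show "abelian_group P" by (rule P_abelian_group)
  show "comm_monoid P"
  proof (rule comm_monoidI)
    show "\<one>\<^bsub>P\<^esub> \<in> carrier P" unfolding P_one by (rule mono_at_closed) auto
  qed (fact P_mult_closed P_assoc P_one_mult P_comm)+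
  show "(x \<oplus>\<^bsub>P\<^esub> y) \<otimes>\<^bsub>P\<^esub> z = x \<otimes>\<^bsub>P\<^esub> z \<oplus>\<^bsub>P\<^esub> y \<otimes>\<^bsub>P\<^esub> z"
    if "x \<in> carrier P" "y \<in> carrier P" "z \<in> carrier P" for x y z
    using that by (rule P_distrib_l)
qed

lemma P_algebra: "algebra R P"
proof (rule algebraI)
  show "cring R" by (rule M.R_cring)
  show "cring P" by (rule P_cring)
next
  fix a x y assume "a \<in> carrier R" "x \<in> carrier P" "y \<in> carrier P"
  then show "(a \<odot>\<^bsub>P\<^esub> x) \<otimes>\<^bsub>P\<^esub> y = a \<odot>\<^bsub>P\<^esub> (x \<otimes>\<^bsub>P\<^esub> y)"
    by (simp add: P_smult_mult P_mult_closed P_assoc mono_at_closed)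
next
  show "(a \<oplus>\<^bsub>R\<^esub> b) \<odot>\<^bsub>P\<^esub> x = a \<odot>\<^bsub>P\<^esub> x \<oplus>\<^bsub>P\<^esub> b \<odot>\<^bsub>P\<^esub> x"
    if "a \<in> carrier R" "b \<in> carrier R" "x \<in> carrier P" for a b x
    unfolding P_smult P_add using that P_val by (intro ext M.R.l_distr)
  show "a \<odot>\<^bsub>P\<^esub> (x \<oplus>\<^bsub>P\<^esub> y) = a \<odot>\<^bsub>P\<^esub> x \<oplus>\<^bsub>P\<^esub> a \<odot>\<^bsub>P\<^esub> y"
    if "a \<in> carrier R" "x \<in> carrier P" "y \<in> carrier P" for a x y
    unfolding P_smult P_add using that P_val by (intro ext M.R.r_distr)
  show "(a \<otimes>\<^bsub>R\<^esub> b) \<odot>\<^bsub>P\<^esub> x = a \<odot>\<^bsub>P\<^esub> (b \<odot>\<^bsub>P\<^esub> x)"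
    if "a \<in> carrier R" "b \<in> carrier R" "x \<in> carrier P" for a b x
    unfolding P_smult using that P_val by (intro ext M.R.m_assoc)
  show "\<one>\<^bsub>R\<^esub> \<odot>\<^bsub>P\<^esub> x = x" if "x \<in> carrier P" for x
    unfolding P_smult using that P_val by (intro ext M.R.l_one)
qed (rule P_smult_closed)

end

text \<open>A \<open>Q\<close>-valued point of Spec M lying over the point \<open>s\<close> of Spec
  R. The target is a bare ring with an explicit structure map, because one and the same
  \<open>Q\<close> is used over several base rings.\<close>

definition hom_over ::
  "('c, 'x) ring_scheme \<Rightarrow> ('c \<Rightarrow> 'd) \<Rightarrow> ('c, 'a, 'y) module_scheme \<Rightarrow> ('d, 'w) ring_scheme
    \<Rightarrow> ('a \<Rightarrow> 'd) set"
  where "hom_over R s M Q = {f \<in> ring_hom M Q. \<forall>r \<in> carrier R. f (r \<odot>\<^bsub>M\<^esub> \<one>\<^bsub>M\<^esub>) = s r}"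

lemma hom_overI:
  "f \<in> ring_hom M Q \<Longrightarrow> (\<And>r. r \<in> carrier R \<Longrightarrow> f (r \<odot>\<^bsub>M\<^esub> \<one>\<^bsub>M\<^esub>) = s r) \<Longrightarrow> f \<in> hom_over R s M Q"
  by (simp add: hom_over_def)

lemma hom_overD:
  assumes "f \<in> hom_over R s M Q"
  shows "f \<in> ring_hom M Q" "r \<in> carrier R \<Longrightarrow> f (r \<odot>\<^bsub>M\<^esub> \<one>\<^bsub>M\<^esub>) = s r"
  using assms by (auto simp: hom_over_def)

lemma alg_one_smult:
  assumes "algebra R M" "r \<in> carrier R" "m \<in> carrier M"
  shows "r \<odot>\<^bsub>M\<^esub> m = (r \<odot>\<^bsub>M\<^esub> \<one>\<^bsub>M\<^esub>) \<otimes>\<^bsub>M\<^esub> m"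
proof -
  interpret algebra R M by fact
  show ?thesis using assms by (simp add: smult_assoc2)
qed

lemma (in algebra) smult_mult_r:
  assumes "a \<in> carrier R" "x \<in> carrier M" "y \<in> carrier M"
  shows "x \<otimes>\<^bsub>M\<^esub> (a \<odot>\<^bsub>M\<^esub> y) = a \<odot>\<^bsub>M\<^esub> (x \<otimes>\<^bsub>M\<^esub> y)"
  using assms m_comm smult_assoc2 smult_closed by metis

lemma (in algebra) smult_left_commute:
  assumes "a \<in> carrier R" "b \<in> carrier R" "x \<in> carrier M"
  shows "a \<odot>\<^bsub>M\<^esub> (b \<odot>\<^bsub>M\<^esub> x) = b \<odot>\<^bsub>M\<^esub> (a \<odot>\<^bsub>M\<^esub> x)"
  using assms R.m_comm smult_assoc1 by metis

lemma alg_one_smult_hom: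
  assumes "algebra R M"
  shows "(\<lambda>r. r \<odot>\<^bsub>M\<^esub> \<one>\<^bsub>M\<^esub>) \<in> ring_hom R M"
proof -
  interpret algebra R M by fact
  show ?thesis
    by (rule ring_hom_memI) (auto simp: smult_l_distr smult_assoc2 smult_assoc1)
qed

lemma alg_homD:
  assumes "f \<in> alg_hom R M N"
  shows "f \<in> ring_hom M N"
    "r \<in> carrier R \<Longrightarrow> m \<in> carrier M \<Longrightarrow> f (r \<odot>\<^bsub>M\<^esub> m) = r \<odot>\<^bsub>N\<^esub> f m"
  using assms by (auto simp: alg_hom_def)

lemma hom_over_smult:
  assumes "algebra R M" "f \<in> hom_over R s M Q" "r \<in> carrier R" "m \<in> carrier M"
  shows "f (r \<odot>\<^bsub>M\<^esub> m) = s r \<otimes>\<^bsub>Q\<^esub> f m"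
proof -
  interpret algebra R M by fact
  have "f (r \<odot>\<^bsub>M\<^esub> m) = f ((r \<odot>\<^bsub>M\<^esub> \<one>\<^bsub>M\<^esub>) \<otimes>\<^bsub>M\<^esub> m)" using alg_one_smult assms by metis
  also have "\<dots> = f (r \<odot>\<^bsub>M\<^esub> \<one>\<^bsub>M\<^esub>) \<otimes>\<^bsub>Q\<^esub> f m"
    using ring_hom_mult[OF hom_overD(1)[OF assms(2)]] assms(3,4) by simp
  finally show ?thesis using hom_overD(2)[OF assms(2,3)] by simp
qed

lemma hom_over_comp:
  assumes "f \<in> hom_over R s M Q" "h \<in> ring_hom Q Q'" "algebra R M"
  shows "(\<lambda>x. h (f x)) \<in> hom_over R (\<lambda>r. h (s r)) M Q'"
  using assms by (auto simp: hom_over_def intro: ring_hom_comp)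

lemma alg_hom_hom_over:
  assumes "algebra R M" "f \<in> alg_hom R M N"
  shows "f \<in> hom_over R (\<lambda>r. r \<odot>\<^bsub>N\<^esub> \<one>\<^bsub>N\<^esub>) M N"
proof -
  interpret algebra R M by fact
  show ?thesis using assms(2) by (auto simp: hom_over_def alg_hom_def ring_hom_one)
qed

lemma hom_over_alg_hom:
  assumes "algebra R M" "algebra R N" "f \<in> hom_over R (\<lambda>r. r \<odot>\<^bsub>N\<^esub> \<one>\<^bsub>N\<^esub>) M N"
  shows "f \<in> alg_hom R M N"
proof -
  have "f (r \<odot>\<^bsub>M\<^esub> m) = r \<odot>\<^bsub>N\<^esub> f m" if "r \<in> carrier R" "m \<in> carrier M" for r m
    using hom_over_smult[OF assms(1,3) that] alg_one_smult[OF assms(2) that(1), of "f m"]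
      ring_hom_closed[OF hom_overD(1)[OF assms(3)] that(2)] by simp
  then show ?thesis using hom_overD(1)[OF assms(3)] by (simp add: alg_hom_def)
qed

lemma alg_via_simps [simp]:
  "carrier (alg_via h S) = carrier S" "monoid.mult (alg_via h S) = monoid.mult S"
  "one (alg_via h S) = one S" "zero (alg_via h S) = zero S" "add (alg_via h S) = add S"
  "r \<odot>\<^bsub>alg_via h S\<^esub> s = h r \<otimes>\<^bsub>S\<^esub> s"
  by (simp_all add: alg_via_def)

lemma alg_via_algebra:
  assumes "cring R" "cring S" "h \<in> ring_hom R S"
  shows "algebra R (alg_via h S)"
proof -
  interpret S: cring S by fact
  note [simp] = ring_hom_closed[OF assms(3)] ring_hom_add[OF assms(3)] ring_hom_mult[OF assms(3)]
    ring_hom_one[OF assms(3)]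
  show ?thesis
  proof (rule algebraI)
    show "cring R" by fact
    show "cring (alg_via h S)" by (rule cring_cong[OF assms(2)]) simp_all
  qed (simp_all add: S.l_distr S.r_distr S.m_assoc)
qed

lemma ring_hom_alg_via [simp]:
  "ring_hom (alg_via h S) Q = ring_hom S Q" "ring_hom Q' (alg_via h S) = ring_hom Q' S"
  by (simp_all add: ring_hom_def)

section \<open>Quotient algebras\<close>

lemma quot_alg_simps:
  "carrier (quot_alg M J) = a_rcosets\<^bsub>M\<^esub> J" "monoid.mult (quot_alg M J) = rcoset_mult M J"
  "one (quot_alg M J) = J +>\<^bsub>M\<^esub> \<one>\<^bsub>M\<^esub>" "zero (quot_alg M J) = J" "add (quot_alg M J) = set_add M"
  "r \<odot>\<^bsub>quot_alg M J\<^esub> C = (\<Union>x\<in>C. J +>\<^bsub>M\<^esub> (r \<odot>\<^bsub>M\<^esub> x))"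
  by (simp_all add: quot_alg_def)

locale algebra_ideal = algebra R M + ideal J M
  for R :: "('c, 'x) ring_scheme" and M :: "('c, 'a, 'y) module_scheme" and J
begin

abbreviation "Q \<equiv> quot_alg M J"

lemma Q_cring: "cring Q"
  by (rule cring_cong[OF quotient_is_cring[OF M_cring]]) (simp_all add: quot_alg_simps FactRing_def)

lemma class_hom: "(\<lambda>x. J +>\<^bsub>M\<^esub> x) \<in> ring_hom M Q"
  using rcos_ring_hom by (simp add: ring_hom_def quot_alg_simps FactRing_def)

lemma Q_carrier: "carrier Q = (\<lambda>x. J +>\<^bsub>M\<^esub> x) ` carrier M"
  by (auto simp: quot_alg_simps A_RCOSETS_def')

lemma class_eq_iff:
  "x \<in> carrier M \<Longrightarrow> y \<in> carrier M \<Longrightarrow> J +>\<^bsub>M\<^esub> x = J +>\<^bsub>M\<^esub> y \<longleftrightarrow> x \<ominus>\<^bsub>M\<^esub> y \<in> J"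
  using quotient_eq_iff_same_a_r_cos[OF ideal_axioms] by blast

lemma class_self: "x \<in> carrier M \<Longrightarrow> x \<in> J +>\<^bsub>M\<^esub> x"
  by (rule a_rcos_self)

lemma class_memD:
  assumes "x \<in> carrier M" "y \<in> J +>\<^bsub>M\<^esub> x"
  shows "y \<in> carrier M" "J +>\<^bsub>M\<^esub> y = J +>\<^bsub>M\<^esub> x"
proof -
  show "y \<in> carrier M" using assms a_r_coset_subset_G a_subset by blast
  show "J +>\<^bsub>M\<^esub> y = J +>\<^bsub>M\<^esub> x"
    using M.a_repr_independence[OF assms(2,1)] is_additive_subgroup additive_subgroup.a_subgroup by metis
qed

text \<open>The scalar multiplication is a union over all representatives. Its members coincide
  because \<open>r\<close> acts on classes as multiplication by the class of r . 1.\<close>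

lemma class_smult:
  assumes "r \<in> carrier R" "x \<in> carrier M"
  shows "r \<odot>\<^bsub>Q\<^esub> (J +>\<^bsub>M\<^esub> x) = J +>\<^bsub>M\<^esub> (r \<odot>\<^bsub>M\<^esub> x)"
proof -
  have "J +>\<^bsub>M\<^esub> (r \<odot>\<^bsub>M\<^esub> y) = J +>\<^bsub>M\<^esub> (r \<odot>\<^bsub>M\<^esub> x)" if y: "y \<in> J +>\<^bsub>M\<^esub> x" for y
  proof -
    note y' = class_memD[OF assms(2) y]
    have *: "J +>\<^bsub>M\<^esub> (r \<odot>\<^bsub>M\<^esub> z) = (J +>\<^bsub>M\<^esub> (r \<odot>\<^bsub>M\<^esub> \<one>\<^bsub>M\<^esub>)) \<otimes>\<^bsub>Q\<^esub> (J +>\<^bsub>M\<^esub> z)" if "z \<in> carrier M" for z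
      using alg_one_smult[OF algebra_axioms assms(1) that] ring_hom_mult[OF class_hom] that assms(1)
      by simp
    show ?thesis unfolding *[OF y'(1)] *[OF assms(2)] y'(2) ..
  qed
  then have "(\<Union>y\<in>J +>\<^bsub>M\<^esub> x. J +>\<^bsub>M\<^esub> (r \<odot>\<^bsub>M\<^esub> y)) = (\<Union>y\<in>J +>\<^bsub>M\<^esub> x. J +>\<^bsub>M\<^esub> (r \<odot>\<^bsub>M\<^esub> x))"
    by (rule SUP_cong[OF refl])
  then show ?thesis unfolding quot_alg_simps using class_self[OF assms(2)] by blast
qed

lemma Q_algebra: "algebra R Q"
proof -
  note c [simp] = class_hom[THEN ring_hom_closed] class_smult
    class_hom[THEN ring_hom_add, symmetric] class_hom[THEN ring_hom_mult, symmetric]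
  show ?thesis
  proof (rule algebraI)
    show "cring R" by (rule R_cring)
    show "cring Q" by (rule Q_cring)
  qed (auto simp: Q_carrier smult_l_distr smult_r_distr smult_assoc1 smult_assoc2)
qed

lemma class_alg_hom: "(\<lambda>x. J +>\<^bsub>M\<^esub> x) \<in> alg_hom R M Q"
  using class_hom class_smult by (simp add: alg_hom_def)

lemma quot_lift:
  assumes "h \<in> ring_hom M S" "cring S" "\<And>x. x \<in> J \<Longrightarrow> h x = \<zero>\<^bsub>S\<^esub>"
  obtains g where "g \<in> ring_hom Q S" "\<And>x. x \<in> carrier M \<Longrightarrow> g (J +>\<^bsub>M\<^esub> x) = h x"
proof -
  interpret S: cring S by fact
  define g where "g C = h (SOME x. x \<in> C)" for C
  have g: "g (J +>\<^bsub>M\<^esub> x) = h x" if x: "x \<in> carrier M" for x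
  proof -
    define y where "y = (SOME y. y \<in> J +>\<^bsub>M\<^esub> x)"
    have "y \<in> J +>\<^bsub>M\<^esub> x" unfolding y_def by (rule someI[of _ x]) (rule class_self[OF x])
    note y = class_memD[OF x this]
    then have "y \<ominus>\<^bsub>M\<^esub> x \<in> J" using class_eq_iff x by blast
    then have "h y \<ominus>\<^bsub>S\<^esub> h x = \<zero>\<^bsub>S\<^esub>"
      using assms(3) ring_hom_minus[OF M_cring assms(2,1) y(1) x] by simp
    then have "h y = h x" using ring_hom_closed[OF assms(1)] y x by simp
    then show ?thesis by (simp add: g_def y_def)
  qed
  have "g \<in> ring_hom Q S"
  proof (rule ring_hom_memI)
    show "g \<one>\<^bsub>Q\<^esub> = \<one>\<^bsub>S\<^esub>" using g[of "\<one>\<^bsub>M\<^esub>"] ring_hom_one[OF assms(1)] by (simp add: quot_alg_simps)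
  qed (auto simp: Q_carrier g ring_hom_closed[OF assms(1)] ring_hom_add[OF assms(1)] ring_hom_mult[OF assms(1)]
      class_hom[THEN ring_hom_add, symmetric] class_hom[THEN ring_hom_mult, symmetric])
  with g that show ?thesis by blast
qed

end

section \<open>Tensor products\<close>

text \<open>The additive extension of \<beta> from monomials. The coefficient is an argument of
  \<beta>, not a factor outside it, since \<open>Q\<close> carries no action of
  \<open>R\<close>.\<close>

definition lsum where
  "lsum R Q \<beta> f = (\<Oplus>\<^bsub>Q\<^esub>p \<in> {p. f p \<noteq> \<zero>\<^bsub>R\<^esub>}. \<beta> (f p) p)"

definition balanced where
  "balanced R M N Q f g \<longleftrightarrow> additive_map M Q f \<and> additive_map N Q g \<and>
    (\<forall>r \<in> carrier R. \<forall>m \<in> carrier M. \<forall>n \<in> carrier N.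
      f (r \<odot>\<^bsub>M\<^esub> m) \<otimes>\<^bsub>Q\<^esub> g n = f m \<otimes>\<^bsub>Q\<^esub> g (r \<odot>\<^bsub>N\<^esub> n))"

context algebra_pair
begin

lemma lsum_mono_at:
  assumes "abelian_group Q" "\<And>c p. c \<in> carrier R \<Longrightarrow> p \<in> MN \<Longrightarrow> \<beta> c p \<in> carrier Q"
    "\<And>c d p. c \<in> carrier R \<Longrightarrow> d \<in> carrier R \<Longrightarrow> p \<in> MN \<Longrightarrow> \<beta> (c \<oplus>\<^bsub>R\<^esub> d) p = \<beta> c p \<oplus>\<^bsub>Q\<^esub> \<beta> d p"
    "c \<in> carrier R" "p \<in> MN"
  shows "lsum R Q \<beta> (mono_at R c p) = \<beta> c p"
proof -
  interpret Q: abelian_group Q by fact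
  have "\<beta> \<zero>\<^bsub>R\<^esub> p = \<zero>\<^bsub>Q\<^esub>"
    by (rule additive_map_zero[of R]) (use assms in \<open>auto intro: additive_mapI M.R.abelian_group_axioms\<close>)
  moreover have "{q. mono_at R c p q \<noteq> \<zero>\<^bsub>R\<^esub>} = (if c = \<zero>\<^bsub>R\<^esub> then {} else {p})"
    by (auto simp: mono_at_def)
  ultimately show ?thesis
    using assms(2,4,5) by (auto simp: lsum_def Q.finsum_insert mono_at_def)
qed

lemma lsum_additive:
  assumes Q: "abelian_group Q" and cl: "\<And>c p. c \<in> carrier R \<Longrightarrow> p \<in> MN \<Longrightarrow> \<beta> c p \<in> carrier Q"
    and add: "\<And>c d p. c \<in> carrier R \<Longrightarrow> d \<in> carrier R \<Longrightarrow> p \<in> MN \<Longrightarrow> \<beta> (c \<oplus>\<^bsub>R\<^esub> d) p = \<beta> c p \<oplus>\<^bsub>Q\<^esub> \<beta> d p"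
  shows "additive_map P Q (lsum R Q \<beta>)"
proof -
  interpret Q: abelian_group Q by fact
  have z: "\<beta> \<zero>\<^bsub>R\<^esub> p = \<zero>\<^bsub>Q\<^esub>" if "p \<in> MN" for p
    by (rule additive_map_zero[of R]) (use assms that in \<open>auto intro: additive_mapI M.R.abelian_group_axioms\<close>)
  have sup: "lsum R Q \<beta> f = (\<Oplus>\<^bsub>Q\<^esub>p\<in>S. \<beta> (f p) p)"
    if "finite S" "S \<subseteq> MN" "\<And>p. p \<notin> S \<Longrightarrow> f p = \<zero>\<^bsub>R\<^esub>" "f \<in> carrier P" for f S
    unfolding lsum_def
  proof (rule Q.finsum_mono_neutral)
    show "finite S" by fact
    show "{p. f p \<noteq> \<zero>\<^bsub>R\<^esub>} \<subseteq> S" using that(3) by blast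
    show "\<beta> (f p) p = \<zero>\<^bsub>Q\<^esub>" if "p \<in> S - {p. f p \<noteq> \<zero>\<^bsub>R\<^esub>}" for p
      using that z \<open>S \<subseteq> MN\<close> by auto
    show "\<beta> (f p) p \<in> carrier Q" if "p \<in> S" for p
      using that \<open>S \<subseteq> MN\<close> P_val[OF \<open>f \<in> carrier P\<close>] by (intro cl) auto
  qed
  show ?thesis
  proof (rule additive_mapI)
    fix f assume f: "f \<in> carrier P"
    obtain S where S: "finite S" "S \<subseteq> MN" "\<And>p. p \<notin> S \<Longrightarrow> f p = \<zero>\<^bsub>R\<^esub>"
      using P_supp f by metis
    have cS: "\<beta> (f p) p \<in> carrier Q" if "p \<in> S" for p
      using that S(2) P_val[OF f] by (intro cl) auto
    show "lsum R Q \<beta> f \<in> carrier Q"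
      using cS by (subst sup[OF S f]) (auto intro!: Q.finsum_closed)
  next
    fix f g assume f: "f \<in> carrier P" and g: "g \<in> carrier P"
    obtain S T where S: "finite S" "S \<subseteq> MN" "\<And>p. p \<notin> S \<Longrightarrow> f p = \<zero>\<^bsub>R\<^esub>"
      and T: "finite T" "T \<subseteq> MN" "\<And>p. p \<notin> T \<Longrightarrow> g p = \<zero>\<^bsub>R\<^esub>"
      using P_supp f g by metis
    let ?S = "S \<union> T"
    have S': "finite ?S" "?S \<subseteq> MN" using S T by auto
    have c: "\<beta> (f p) p \<in> carrier Q" "\<beta> (g p) p \<in> carrier Q" if "p \<in> ?S" for p
      using that S'(2) P_val[OF f] P_val[OF g] by (auto intro!: cl)
    have "lsum R Q \<beta> (f \<oplus>\<^bsub>P\<^esub> g) = (\<Oplus>\<^bsub>Q\<^esub>p\<in>?S. \<beta> ((f \<oplus>\<^bsub>P\<^esub> g) p) p)"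
      by (rule sup[OF S']) (use S T P_add_closed[OF f g] in \<open>auto simp: P_add\<close>)
    also have "\<dots> = (\<Oplus>\<^bsub>Q\<^esub>p\<in>?S. \<beta> (f p) p \<oplus>\<^bsub>Q\<^esub> \<beta> (g p) p)"
      by (rule Q.finsum_cong') (use c S'(2) P_val[OF f] P_val[OF g] in \<open>auto simp: P_add add\<close>)
    also have "\<dots> = (\<Oplus>\<^bsub>Q\<^esub>p\<in>?S. \<beta> (f p) p) \<oplus>\<^bsub>Q\<^esub> (\<Oplus>\<^bsub>Q\<^esub>p\<in>?S. \<beta> (g p) p)"
      by (rule Q.finsum_addf) (use c in auto)
    also have "(\<Oplus>\<^bsub>Q\<^esub>p\<in>?S. \<beta> (f p) p) = lsum R Q \<beta> f"
      by (rule sup[OF S', symmetric]) (use S f in auto)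
    also have "(\<Oplus>\<^bsub>Q\<^esub>p\<in>?S. \<beta> (g p) p) = lsum R Q \<beta> g"
      by (rule sup[OF S', symmetric]) (use T g in auto)
    finally show "lsum R Q \<beta> (f \<oplus>\<^bsub>P\<^esub> g) = lsum R Q \<beta> f \<oplus>\<^bsub>Q\<^esub> lsum R Q \<beta> g" .
  qed
qed

section \<open>The tensor ideal, pure tensors and the universal property\<close>

definition relations :: "('a \<times> 'b \<Rightarrow> 'c) set" where
  "relations = (let d = single R in
     {d (m \<oplus>\<^bsub>M\<^esub> m', n) \<ominus>\<^bsub>P\<^esub> (d (m, n) \<oplus>\<^bsub>P\<^esub> d (m', n)) | m m' n.
         m \<in> carrier M \<and> m' \<in> carrier M \<and> n \<in> carrier N}
    \<union> {d (m, n \<oplus>\<^bsub>N\<^esub> n') \<ominus>\<^bsub>P\<^esub> (d (m, n) \<oplus>\<^bsub>P\<^esub> d (m, n')) | m n n'.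
         m \<in> carrier M \<and> n \<in> carrier N \<and> n' \<in> carrier N}
    \<union> {d (r \<odot>\<^bsub>M\<^esub> m, n) \<ominus>\<^bsub>P\<^esub> r \<odot>\<^bsub>P\<^esub> d (m, n) | r m n.
         r \<in> carrier R \<and> m \<in> carrier M \<and> n \<in> carrier N}
    \<union> {d (m, r \<odot>\<^bsub>N\<^esub> n) \<ominus>\<^bsub>P\<^esub> r \<odot>\<^bsub>P\<^esub> d (m, n) | r m n.
         r \<in> carrier R \<and> m \<in> carrier M \<and> n \<in> carrier N})"

abbreviation "I \<equiv> tensor_ideal R M N"
abbreviation "T \<equiv> tensor R M N"

lemma I_eq: "I = Idl\<^bsub>P\<^esub> relations"
  by (simp add: tensor_ideal_def relations_def Let_def)

lemma single_closed: "m \<in> carrier M \<Longrightarrow> n \<in> carrier N \<Longrightarrow> single R (m, n) \<in> carrier P"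
  by (simp add: single_mono_at mono_at_closed)

lemma relations_sub: "relations \<subseteq> carrier P"
proof -
  interpret P: algebra R P by (rule P_algebra)
  show ?thesis by (auto simp: relations_def Let_def intro!: P.minus_closed P.a_closed P.smult_closed single_closed)
qed

lemma I_ideal: "ideal I P"
  unfolding I_eq by (rule ring.genideal_ideal[OF cring.axioms(1)[OF P_cring] relations_sub])

lemma I_rel: "u \<in> relations \<Longrightarrow> u \<in> I"
  unfolding I_eq using ring.genideal_self[OF cring.axioms(1)[OF P_cring] relations_sub] by blast

sublocale AI: algebra_ideal R P I
  by (intro algebra_ideal.intro P_algebra I_ideal)

lemma T_eq: "T = AI.Q"
  by (simp add: tensor_def)

lemma T_algebra: "algebra R T"
  unfolding T_eq by (rule AI.Q_algebra)

lemma T_cring: "cring T"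
  unfolding T_eq by (rule AI.Q_cring)

lemma tens_eq: "tens R M N m n = I +>\<^bsub>P\<^esub> single R (m, n)"
  by (simp add: tens_def)

lemma tens_closed [simp]: "m \<in> carrier M \<Longrightarrow> n \<in> carrier N \<Longrightarrow> tens R M N m n \<in> carrier T"
  unfolding T_eq tens_eq using AI.class_hom[THEN ring_hom_closed] single_closed by blast

lemma tens_add_l:
  assumes "m \<in> carrier M" "m' \<in> carrier M" "n \<in> carrier N"
  shows "tens R M N (m \<oplus>\<^bsub>M\<^esub> m') n = tens R M N m n \<oplus>\<^bsub>T\<^esub> tens R M N m' n"
proof -
  have "single R (m \<oplus>\<^bsub>M\<^esub> m', n) \<ominus>\<^bsub>P\<^esub> (single R (m, n) \<oplus>\<^bsub>P\<^esub> single R (m', n)) \<in> I"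
    by (rule I_rel) (use assms in \<open>auto simp: relations_def Let_def\<close>)
  then show ?thesis
    unfolding T_eq tens_eq using assms
    by (simp add: AI.class_eq_iff single_closed P_add_closed AI.class_hom[THEN ring_hom_add, symmetric])
qed

lemma tens_add_r:
  assumes "m \<in> carrier M" "n \<in> carrier N" "n' \<in> carrier N"
  shows "tens R M N m (n \<oplus>\<^bsub>N\<^esub> n') = tens R M N m n \<oplus>\<^bsub>T\<^esub> tens R M N m n'"
proof -
  have "single R (m, n \<oplus>\<^bsub>N\<^esub> n') \<ominus>\<^bsub>P\<^esub> (single R (m, n) \<oplus>\<^bsub>P\<^esub> single R (m, n')) \<in> I"
    by (rule I_rel) (use assms in \<open>auto simp: relations_def Let_def\<close>)
  then show ?thesis
    unfolding T_eq tens_eq using assms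
    by (simp add: AI.class_eq_iff single_closed P_add_closed AI.class_hom[THEN ring_hom_add, symmetric])
qed

lemma tens_smult_l:
  assumes "r \<in> carrier R" "m \<in> carrier M" "n \<in> carrier N"
  shows "tens R M N (r \<odot>\<^bsub>M\<^esub> m) n = r \<odot>\<^bsub>T\<^esub> tens R M N m n"
proof -
  have "single R (r \<odot>\<^bsub>M\<^esub> m, n) \<ominus>\<^bsub>P\<^esub> (r \<odot>\<^bsub>P\<^esub> single R (m, n)) \<in> I"
    by (rule I_rel) (use assms in \<open>auto simp: relations_def Let_def\<close>)
  then show ?thesis
    unfolding T_eq tens_eq using assms
    by (simp add: AI.class_eq_iff single_closed P_smult_closed AI.class_smult)
qed

lemma tens_smult_r:
  assumes "r \<in> carrier R" "m \<in> carrier M" "n \<in> carrier N"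
  shows "tens R M N m (r \<odot>\<^bsub>N\<^esub> n) = r \<odot>\<^bsub>T\<^esub> tens R M N m n"
proof -
  have "single R (m, r \<odot>\<^bsub>N\<^esub> n) \<ominus>\<^bsub>P\<^esub> (r \<odot>\<^bsub>P\<^esub> single R (m, n)) \<in> I"
    by (rule I_rel) (use assms in \<open>auto simp: relations_def Let_def\<close>)
  then show ?thesis
    unfolding T_eq tens_eq using assms
    by (simp add: AI.class_eq_iff single_closed P_smult_closed AI.class_smult)
qed

lemma tens_mult:
  assumes "m \<in> carrier M" "n \<in> carrier N" "m' \<in> carrier M" "n' \<in> carrier N"
  shows "tens R M N m n \<otimes>\<^bsub>T\<^esub> tens R M N m' n' = tens R M N (m \<otimes>\<^bsub>M\<^esub> m') (n \<otimes>\<^bsub>N\<^esub> n')"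
  unfolding T_eq tens_eq using assms
  by (simp add: AI.class_hom[THEN ring_hom_mult, symmetric] single_closed)
    (simp add: single_mono_at P_mult_mono_at)

lemma T_one: "\<one>\<^bsub>T\<^esub> = tens R M N \<one>\<^bsub>M\<^esub> \<one>\<^bsub>N\<^esub>"
  unfolding T_eq tens_eq by (simp add: quot_alg_simps P_one single_mono_at)

lemma tens_zero_l: "n \<in> carrier N \<Longrightarrow> tens R M N \<zero>\<^bsub>M\<^esub> n = \<zero>\<^bsub>T\<^esub>"
  by (rule additive_map_zero[OF M.abelian_group_axioms cring_ab[OF T_cring]])
    (auto intro!: additive_mapI simp: tens_add_l)

text \<open>Zero and scalar multiples need no case of their own: zero is itself a pure tensor, and a
  coefficient can be absorbed into the left factor.\<close>

lemma T_induct [consumes 1, case_names tens add]: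
  assumes x: "x \<in> carrier T"
    and tens: "\<And>m n. m \<in> carrier M \<Longrightarrow> n \<in> carrier N \<Longrightarrow> Pr (tens R M N m n)"
    and add: "\<And>x y. x \<in> carrier T \<Longrightarrow> y \<in> carrier T \<Longrightarrow> Pr x \<Longrightarrow> Pr y \<Longrightarrow> Pr (x \<oplus>\<^bsub>T\<^esub> y)"
  shows "Pr x"
proof -
  obtain u where u: "u \<in> carrier P" "x = I +>\<^bsub>P\<^esub> u"
    using x unfolding T_eq AI.Q_carrier by blast
  have "Pr (I +>\<^bsub>P\<^esub> u)" using u(1)
  proof (induction u rule: P_induct)
    case zero
    have "I +>\<^bsub>P\<^esub> \<zero>\<^bsub>P\<^esub> = \<zero>\<^bsub>T\<^esub>"
      unfolding T_eq using ring_hom_zero'[OF _ _ AI.class_hom] P_abelian_group cring_ab[OF AI.Q_cring] by blast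
    then show ?case using tens[of "\<zero>\<^bsub>M\<^esub>" "\<zero>\<^bsub>N\<^esub>"] tens_zero_l by simp
  next
    case (add c p g)
    obtain m n where p: "p = (m, n)" "m \<in> carrier M" "n \<in> carrier N" using add by auto
    have "mono_at R c p = c \<odot>\<^bsub>P\<^esub> single R (m, n)"
      using add(1) by (auto simp: single_mono_at P_smult mono_at_def p)
    then have "I +>\<^bsub>P\<^esub> mono_at R c p = tens R M N (c \<odot>\<^bsub>M\<^esub> m) n"
      using p add(1) by (simp add: tens_smult_l) (simp add: tens_eq T_eq AI.class_smult single_closed)
    moreover have "I +>\<^bsub>P\<^esub> (mono_at R c p \<oplus>\<^bsub>P\<^esub> g) = (I +>\<^bsub>P\<^esub> mono_at R c p) \<oplus>\<^bsub>T\<^esub> (I +>\<^bsub>P\<^esub> g)"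
      unfolding T_eq using AI.class_hom[THEN ring_hom_add] mono_at_closed add by blast
    moreover have "I +>\<^bsub>P\<^esub> g \<in> carrier T" unfolding T_eq using AI.class_hom[THEN ring_hom_closed] add by blast
    ultimately show ?case using assms(3) tens p add by simp
  qed
  then show ?thesis using u by simp
qed

lemma additive_ext:
  assumes "additive_map T Q h" "additive_map T Q h'" "x \<in> carrier T"
    "\<And>m n. m \<in> carrier M \<Longrightarrow> n \<in> carrier N \<Longrightarrow> h (tens R M N m n) = h' (tens R M N m n)"
  shows "h x = h' x"
  using assms(3) by (induction x rule: T_induct)
    (simp_all add: assms(4) additive_mapD[OF assms(1)] additive_mapD[OF assms(2)])

lemma inl_hom: "t_inl R M N \<in> ring_hom M T"
  by (rule ring_hom_memI) (simp_all add: tens_add_l tens_mult T_one)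

lemma inr_hom: "t_inr R M N \<in> ring_hom N T"
  by (rule ring_hom_memI) (simp_all add: tens_add_r tens_mult T_one)

lemma tens_inl_inr: "m \<in> carrier M \<Longrightarrow> n \<in> carrier N \<Longrightarrow>
    tens R M N m n = t_inl R M N m \<otimes>\<^bsub>T\<^esub> t_inr R M N n"
  by (simp add: tens_mult)

lemma inl_hom_over: "t_inl R M N \<in> hom_over R (\<lambda>r. r \<odot>\<^bsub>T\<^esub> \<one>\<^bsub>T\<^esub>) M T"
  by (rule hom_overI[OF inl_hom]) (simp add: T_one tens_smult_l)

lemma inr_hom_over: "t_inr R M N \<in> hom_over R (\<lambda>r. r \<odot>\<^bsub>T\<^esub> \<one>\<^bsub>T\<^esub>) N T"
  by (rule hom_overI[OF inr_hom]) (simp add: T_one tens_smult_r)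

lemma hom_ext:
  assumes "h \<in> ring_hom T Q" "h' \<in> ring_hom T Q" "x \<in> carrier T"
    "\<And>m. m \<in> carrier M \<Longrightarrow> h (t_inl R M N m) = h' (t_inl R M N m)"
    "\<And>n. n \<in> carrier N \<Longrightarrow> h (t_inr R M N n) = h' (t_inr R M N n)"
  shows "h x = h' x"
proof (rule additive_ext[OF ring_hom_additive[OF assms(1)] ring_hom_additive[OF assms(2)] assms(3)])
  fix m n assume mn: "m \<in> carrier M" "n \<in> carrier N"
  then show "h (tens R M N m n) = h' (tens R M N m n)"
    using assms(4)[OF mn(1)] assms(5)[OF mn(2)]
    by (simp add: tens_inl_inr[OF mn] ring_hom_mult[OF assms(1)] ring_hom_mult[OF assms(2)] del: tens_mult)
qed

context
  fixes Q :: "('d, 'w) ring_scheme" and f g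
  assumes Q: "cring Q" and bal: "balanced R M N Q f g"
begin

private abbreviation "\<beta> \<equiv> \<lambda>c p. f (c \<odot>\<^bsub>M\<^esub> fst p) \<otimes>\<^bsub>Q\<^esub> g (snd p)"

private lemma f: "additive_map M Q f" and g: "additive_map N Q g"
  and fg: "r \<in> carrier R \<Longrightarrow> m \<in> carrier M \<Longrightarrow> n \<in> carrier N \<Longrightarrow>
    f (r \<odot>\<^bsub>M\<^esub> m) \<otimes>\<^bsub>Q\<^esub> g n = f m \<otimes>\<^bsub>Q\<^esub> g (r \<odot>\<^bsub>N\<^esub> n)"
  using bal by (auto simp: balanced_def)

private lemma \<beta>_closed: "c \<in> carrier R \<Longrightarrow> p \<in> MN \<Longrightarrow> \<beta> c p \<in> carrier Q"
proof -
  interpret Q: cring Q by (rule Q)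
  show "c \<in> carrier R \<Longrightarrow> p \<in> MN \<Longrightarrow> \<beta> c p \<in> carrier Q"
    using additive_mapD(1)[OF f] additive_mapD(1)[OF g] by auto
qed

private lemma \<beta>_add: "c \<in> carrier R \<Longrightarrow> d \<in> carrier R \<Longrightarrow> p \<in> MN \<Longrightarrow> \<beta> (c \<oplus>\<^bsub>R\<^esub> d) p = \<beta> c p \<oplus>\<^bsub>Q\<^esub> \<beta> d p"
proof -
  interpret Q: cring Q by (rule Q)
  show "c \<in> carrier R \<Longrightarrow> d \<in> carrier R \<Longrightarrow> p \<in> MN \<Longrightarrow> \<beta> (c \<oplus>\<^bsub>R\<^esub> d) p = \<beta> c p \<oplus>\<^bsub>Q\<^esub> \<beta> d p"
    using additive_mapD[OF f] additive_mapD[OF g] by (auto simp: M.smult_l_distr Q.l_distr)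
qed

private lemma L_additive: "additive_map P Q (lsum R Q \<beta>)"
  by (rule lsum_additive) (use cring_ab[OF Q] \<beta>_closed \<beta>_add in auto)

private lemma L_mono_at: "c \<in> carrier R \<Longrightarrow> p \<in> MN \<Longrightarrow> lsum R Q \<beta> (mono_at R c p) = \<beta> c p"
  by (rule lsum_mono_at) (use cring_ab[OF Q] \<beta>_closed \<beta>_add in auto)

text \<open>As \<open>f\<close> and \<open>g\<close> are only additive, the lift need not be
  multiplicative, so all multiples of a relation must be checked and not just the relation. It
  suffices to multiply by a monomial at (m0, n0), which turns each bilinearity relation into one of
  the same kind for the products with m0 and n0.\<close>

private lemma L_relations:
  assumes u: "u \<in> relations" and w: "w \<in> carrier P"
  shows "lsum R Q \<beta> (w \<otimes>\<^bsub>P\<^esub> u) = \<zero>\<^bsub>Q\<^esub>"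
  using w
proof (induction w rule: P_induct)
  interpret Q: cring Q by (rule Q)
  have uP: "u \<in> carrier P" using u relations_sub by blast
  note LD = additive_mapD[OF L_additive] and fD = additive_mapD[OF f] and gD = additive_mapD[OF g]
  note L0 = additive_map_zero[OF P_abelian_group Q.abelian_group_axioms L_additive]
  {
    case zero
    show ?case using L0 uP by simp
  next
    case (add c p w)
    obtain m0 n0 where p: "p = (m0, n0)" "m0 \<in> carrier M" "n0 \<in> carrier N" using add by auto
    define h where "h v = lsum R Q \<beta> (mono_at R c p \<otimes>\<^bsub>P\<^esub> v)" for v
    have mc: "mono_at R c p \<in> carrier P" using add mono_at_closed by blast
    have ha: "additive_map P Q h"
      unfolding h_def by (rule additive_mapI) (use mc LD in \<open>simp_all add: AI.r_distr\<close>)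
    have hm: "h (mono_at R d (m, n)) = f ((c \<otimes>\<^bsub>R\<^esub> d) \<odot>\<^bsub>M\<^esub> (m0 \<otimes>\<^bsub>M\<^esub> m)) \<otimes>\<^bsub>Q\<^esub> g (n0 \<otimes>\<^bsub>N\<^esub> n)"
      if "d \<in> carrier R" "m \<in> carrier M" "n \<in> carrier N" for d m n
      unfolding h_def using that p add(1) by (simp add: P_mult_mono_at L_mono_at)
    have hs: "h (single R (m, n)) = f (c \<odot>\<^bsub>M\<^esub> (m0 \<otimes>\<^bsub>M\<^esub> m)) \<otimes>\<^bsub>Q\<^esub> g (n0 \<otimes>\<^bsub>N\<^esub> n)"
      if "m \<in> carrier M" "n \<in> carrier N" for m n
      using hm[of "\<one>\<^bsub>R\<^esub>" m n] that add(1) by (simp add: single_mono_at)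
    have hr: "h (r \<odot>\<^bsub>P\<^esub> single R (m, n)) = f (r \<odot>\<^bsub>M\<^esub> (c \<odot>\<^bsub>M\<^esub> (m0 \<otimes>\<^bsub>M\<^esub> m))) \<otimes>\<^bsub>Q\<^esub> g (n0 \<otimes>\<^bsub>N\<^esub> n)"
      if "r \<in> carrier R" "m \<in> carrier M" "n \<in> carrier N" for r m n
    proof -
      have "r \<odot>\<^bsub>P\<^esub> single R (m, n) = mono_at R r (m, n)"
        using that by (auto simp: single_mono_at P_smult mono_at_def)
      moreover have "(c \<otimes>\<^bsub>R\<^esub> r) \<odot>\<^bsub>M\<^esub> (m0 \<otimes>\<^bsub>M\<^esub> m) = r \<odot>\<^bsub>M\<^esub> (c \<odot>\<^bsub>M\<^esub> (m0 \<otimes>\<^bsub>M\<^esub> m))"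
        using that p add(1) by (simp add: M.smult_assoc1[symmetric] M.R.m_comm)
      ultimately show ?thesis using hm that by simp
    qed
    have hd: "h (x \<ominus>\<^bsub>P\<^esub> y) = \<zero>\<^bsub>Q\<^esub>" if "h x = h y" "x \<in> carrier P" "y \<in> carrier P" for x y
      using additive_map_minus[OF P_abelian_group Q.abelian_group_axioms ha that(2,3)] that
        additive_mapD(1)[OF ha] by simp
    note cl = single_closed p add(1) fD(1) gD(1)
    have "h u = \<zero>\<^bsub>Q\<^esub>"
      using u unfolding relations_def Let_def
    proof (elim UnE CollectE exE conjE)
      fix m m' n assume *: "u = single R (m \<oplus>\<^bsub>M\<^esub> m', n) \<ominus>\<^bsub>P\<^esub> (single R (m, n) \<oplus>\<^bsub>P\<^esub> single R (m', n))"
        "m \<in> carrier M" "m' \<in> carrier M" "n \<in> carrier N"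
      show ?thesis unfolding *(1)
        by (rule hd) (use cl *(2-) in \<open>simp_all add: hs additive_mapD(2)[OF ha] M.r_distr M.smult_r_distr fD(2) Q.l_distr\<close>)
    next
      fix m n n' assume *: "u = single R (m, n \<oplus>\<^bsub>N\<^esub> n') \<ominus>\<^bsub>P\<^esub> (single R (m, n) \<oplus>\<^bsub>P\<^esub> single R (m, n'))"
        "m \<in> carrier M" "n \<in> carrier N" "n' \<in> carrier N"
      show ?thesis unfolding *(1)
        by (rule hd) (use cl *(2-) in \<open>simp_all add: hs additive_mapD(2)[OF ha] N.r_distr gD(2) Q.r_distr\<close>)
    next
      fix r m n assume *: "u = single R (r \<odot>\<^bsub>M\<^esub> m, n) \<ominus>\<^bsub>P\<^esub> r \<odot>\<^bsub>P\<^esub> single R (m, n)"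
        "r \<in> carrier R" "m \<in> carrier M" "n \<in> carrier N"
      have "c \<odot>\<^bsub>M\<^esub> (m0 \<otimes>\<^bsub>M\<^esub> (r \<odot>\<^bsub>M\<^esub> m)) = r \<odot>\<^bsub>M\<^esub> (c \<odot>\<^bsub>M\<^esub> (m0 \<otimes>\<^bsub>M\<^esub> m))"
        using *(2-) p add(1) by (simp add: M.smult_mult_r M.smult_left_commute)
      then show ?thesis unfolding *(1)
        by (intro hd) (use cl *(2-) in \<open>simp_all add: hs hr\<close>)
    next
      fix r m n assume *: "u = single R (m, r \<odot>\<^bsub>N\<^esub> n) \<ominus>\<^bsub>P\<^esub> r \<odot>\<^bsub>P\<^esub> single R (m, n)"
        "r \<in> carrier R" "m \<in> carrier M" "n \<in> carrier N"
      have "n0 \<otimes>\<^bsub>N\<^esub> (r \<odot>\<^bsub>N\<^esub> n) = r \<odot>\<^bsub>N\<^esub> (n0 \<otimes>\<^bsub>N\<^esub> n)"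
        using *(2-) p by (simp add: N.smult_mult_r)
      then show ?thesis unfolding *(1)
        by (intro hd) (use cl *(2-) in \<open>simp_all add: hs hr fg\<close>)
    qed
    then show ?case
      unfolding h_def using add mc uP LD by (simp add: AI.l_distr)
  }
qed

text \<open>The kernel of an additive map need not be an ideal. The elements all of whose multiples
  lie in the kernel do form one; it contains the relations, hence all of \<open>I\<close>, and
  multiplying by one gives the claim.\<close>

private lemma L_I:
  assumes u: "u \<in> I"
  shows "lsum R Q \<beta> u = \<zero>\<^bsub>Q\<^esub>"
proof -
  interpret Q: cring Q by (rule Q)
  note LD = additive_mapD[OF L_additive]
  note L0 = additive_map_zero[OF P_abelian_group Q.abelian_group_axioms L_additive]
  let ?J = "{u \<in> carrier P. \<forall>w \<in> carrier P. lsum R Q \<beta> (w \<otimes>\<^bsub>P\<^esub> u) = \<zero>\<^bsub>Q\<^esub>}"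
  have "ideal ?J P"
  proof (rule idealI)
    show "ring P" by (rule AI.ring_axioms)
    show "subgroup ?J (add_monoid P)"
    proof (rule AI.add.subgroupI)
      fix a b assume "a \<in> ?J" "b \<in> ?J"
      then show "a \<oplus>\<^bsub>P\<^esub> b \<in> ?J" using LD by (simp add: AI.r_distr)
    next
      fix a assume a: "a \<in> ?J"
      have "w \<otimes>\<^bsub>P\<^esub> (\<ominus>\<^bsub>P\<^esub> a) = (\<ominus>\<^bsub>P\<^esub> w) \<otimes>\<^bsub>P\<^esub> a" if "w \<in> carrier P" for w
        using that a by (simp add: AI.l_minus AI.r_minus)
      then show "\<ominus>\<^bsub>P\<^esub> a \<in> ?J" using a by simp
    qed (use L0 in auto)
    fix a x assume a: "a \<in> ?J" and x: "x \<in> carrier P"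
    have "w \<otimes>\<^bsub>P\<^esub> (x \<otimes>\<^bsub>P\<^esub> a) = (w \<otimes>\<^bsub>P\<^esub> x) \<otimes>\<^bsub>P\<^esub> a" if "w \<in> carrier P" for w
      using that a x by (simp add: AI.m_assoc)
    then show 1: "x \<otimes>\<^bsub>P\<^esub> a \<in> ?J" using a x by simp
    then show "a \<otimes>\<^bsub>P\<^esub> x \<in> ?J" using a x AI.m_comm by simp
  qed
  moreover have "relations \<subseteq> ?J" using relations_sub L_relations by auto
  ultimately have "u \<in> ?J" using u AI.genideal_minimal unfolding I_eq by blast
  then have "u \<in> carrier P" "lsum R Q \<beta> (\<one>\<^bsub>P\<^esub> \<otimes>\<^bsub>P\<^esub> u) = \<zero>\<^bsub>Q\<^esub>" using AI.one_closed by blast+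
  then show ?thesis by simp
qed

text \<open>\<open>tensor_lift\<close> evaluates an arbitrarily chosen representative.
  Representatives differ by elements of \<open>I\<close>, on which the sum vanishes.\<close>

private lemma lift_class:
  assumes v: "v \<in> carrier P"
  shows "tensor_lift R M N Q f g (I +>\<^bsub>P\<^esub> v) = lsum R Q \<beta> v"
proof -
  interpret Q: cring Q by (rule Q)
  note LD = additive_mapD[OF L_additive]
  define u where "u = (SOME u. u \<in> I +>\<^bsub>P\<^esub> v)"
  have "u \<in> I +>\<^bsub>P\<^esub> v" unfolding u_def by (rule someI[of _ v]) (rule AI.class_self[OF v])
  note u = AI.class_memD[OF v this]
  then have "u \<ominus>\<^bsub>P\<^esub> v \<in> I" using AI.class_eq_iff v by blast
  then have "lsum R Q \<beta> u \<ominus>\<^bsub>Q\<^esub> lsum R Q \<beta> v = \<zero>\<^bsub>Q\<^esub>"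
    using L_I additive_map_minus[OF P_abelian_group cring_ab[OF Q] L_additive u(1) v] by simp
  then have "lsum R Q \<beta> u = lsum R Q \<beta> v" using LD(1) u v by simp
  then show ?thesis by (simp add: tensor_lift_def u_def lsum_def Let_def)
qed

lemma lift_additive: "additive_map T Q (tensor_lift R M N Q f g)"
proof (rule additive_mapI)
  note LD = additive_mapD[OF L_additive]
  fix x assume "x \<in> carrier T"
  then obtain u where u: "u \<in> carrier P" "x = I +>\<^bsub>P\<^esub> u" unfolding T_eq AI.Q_carrier by blast
  then show "tensor_lift R M N Q f g x \<in> carrier Q" using LD lift_class by simp
  fix y assume "y \<in> carrier T"
  then obtain v where v: "v \<in> carrier P" "y = I +>\<^bsub>P\<^esub> v" unfolding T_eq AI.Q_carrier by blast
  have "x \<oplus>\<^bsub>T\<^esub> y = I +>\<^bsub>P\<^esub> (u \<oplus>\<^bsub>P\<^esub> v)"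
    unfolding T_eq using u v AI.class_hom[THEN ring_hom_add] by simp
  then show "tensor_lift R M N Q f g (x \<oplus>\<^bsub>T\<^esub> y) =
      tensor_lift R M N Q f g x \<oplus>\<^bsub>Q\<^esub> tensor_lift R M N Q f g y"
    using u v LD lift_class P_add_closed by simp
qed

lemma lift_tens:
  assumes "m \<in> carrier M" "n \<in> carrier N"
  shows "tensor_lift R M N Q f g (tens R M N m n) = f m \<otimes>\<^bsub>Q\<^esub> g n"
  using assms by (simp add: tens_eq lift_class single_closed) (simp add: single_mono_at L_mono_at)

end

lemma balanced_hom:
  assumes "cring Q" "f \<in> hom_over R s M Q" "g \<in> hom_over R s N Q"
  shows "balanced R M N Q f g"
  unfolding balanced_def
proof (intro conjI ballI)
  interpret Q: cring Q by fact
  note f = hom_overD[OF assms(2)] and g = hom_overD[OF assms(3)]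
  show "additive_map M Q f" "additive_map N Q g" using f(1) g(1) by (auto intro: ring_hom_additive)
  fix r m n assume *: "r \<in> carrier R" "m \<in> carrier M" "n \<in> carrier N"
  have "s r \<in> carrier Q" using f(2)[OF *(1)] ring_hom_closed[OF f(1), of "r \<odot>\<^bsub>M\<^esub> \<one>\<^bsub>M\<^esub>"] * by simp
  then show "f (r \<odot>\<^bsub>M\<^esub> m) \<otimes>\<^bsub>Q\<^esub> g n = f m \<otimes>\<^bsub>Q\<^esub> g (r \<odot>\<^bsub>N\<^esub> n)"
    using * ring_hom_closed[OF f(1)] ring_hom_closed[OF g(1)]
    by (simp add: hom_over_smult[OF M.algebra_axioms assms(2)] hom_over_smult[OF N.algebra_axioms assms(3)] Q.m_ac)
qed

text \<open>Multiplicativity is tested on pure tensors, where it is commutativity of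
  \<open>Q\<close>, and extends by additivity in each argument.\<close>

lemma lift_hom_over:
  assumes Q: "cring Q" and f: "f \<in> hom_over R s M Q" and g: "g \<in> hom_over R s N Q"
  shows "tensor_lift R M N Q f g \<in> hom_over R s T Q"
    and "m \<in> carrier M \<Longrightarrow> tensor_lift R M N Q f g (t_inl R M N m) = f m"
    and "n \<in> carrier N \<Longrightarrow> tensor_lift R M N Q f g (t_inr R M N n) = g n"
proof -
  let ?L = "tensor_lift R M N Q f g"
  interpret Q: cring Q by fact
  interpret T: cring T by (rule T_cring)
  note bal = balanced_hom[OF Q f g]
  note LD = additive_mapD[OF lift_additive[OF Q bal]] and Lt = lift_tens[OF Q bal]
  note fh = hom_overD[OF f] and gh = hom_overD[OF g]
  note [simp] = ring_hom_one[OF fh(1)] ring_hom_one[OF gh(1)] ring_hom_closed[OF fh(1)]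
    ring_hom_closed[OF gh(1)] ring_hom_mult[OF fh(1)] ring_hom_mult[OF gh(1)]
  show "m \<in> carrier M \<Longrightarrow> ?L (t_inl R M N m) = f m" "n \<in> carrier N \<Longrightarrow> ?L (t_inr R M N n) = g n"
    by (simp_all add: Lt)
  have mult: "?L (x \<otimes>\<^bsub>T\<^esub> y) = ?L x \<otimes>\<^bsub>Q\<^esub> ?L y" if x: "x \<in> carrier T" and y: "y \<in> carrier T" for x y
    using x
  proof (induction x rule: T_induct)
    case (tens m n)
    show ?case using y
    proof (induction y rule: T_induct)
      case (tens m' n')
      then show ?case using \<open>m \<in> _\<close> \<open>n \<in> _\<close> by (simp add: tens_mult Lt Q.m_ac)
    next
      case (add x y)
      then show ?case using tens by (simp add: T.r_distr Q.r_distr LD)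
    qed
  next
    case (add x x')
    then show ?case using y by (simp add: T.l_distr Q.l_distr LD)
  qed
  have sQ: "s r \<in> carrier Q" if "r \<in> carrier R" for r
    using fh(2)[OF that] ring_hom_closed[OF fh(1), of "r \<odot>\<^bsub>M\<^esub> \<one>\<^bsub>M\<^esub>"] that by simp
  have "?L \<in> ring_hom T Q"
    by (rule ring_hom_memI) (simp_all add: LD mult T_one Lt)
  then show "?L \<in> hom_over R s T Q"
    by (rule hom_overI) (simp add: T_one tens_smult_l[symmetric] Lt fh sQ)
qed

end

text \<open>The tensor product looks only at these fields. It is used to exchange the bare algebra
  inside \<open>base_change\<close> for the full Hopf record.\<close>

lemma tensor_cong:
  assumes "carrier M' = carrier M" "monoid.mult M' = monoid.mult M" "one M' = one M" "add M' = add M" "smult M' = smult M"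
    "carrier N' = carrier N" "monoid.mult N' = monoid.mult N" "one N' = one N" "add N' = add N" "smult N' = smult N"
  shows "tensor_ideal R M' N' = tensor_ideal R M N" "tensor R M' N' = tensor R M N" "tens R M' N' = tens R M N"
proof -
  have P: "pair_alg R M' N' = pair_alg R M N" by (simp add: pair_alg_def assms)
  then show I: "tensor_ideal R M' N' = tensor_ideal R M N" by (simp add: tensor_ideal_def assms)
  show "tensor R M' N' = tensor R M N" by (simp add: tensor_def I P)
  show "tens R M' N' = tens R M N" by (intro ext) (simp add: tens_def I P)
qed

context algebra_pair
begin

text \<open>The main device for computing lifts: any homomorphism with the right values on both
  factors is the lift. Compatibility of \<open>f\<close> and \<open>g\<close> over \<open>R\<close>
  is inherited from \<open>h\<close> and need not be assumed.\<close>

lemma lift_unique: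
  assumes Q: "cring Q" and h: "h \<in> ring_hom T Q"
    and f: "\<And>m. m \<in> carrier M \<Longrightarrow> f m = h (t_inl R M N m)"
    and g: "\<And>n. n \<in> carrier N \<Longrightarrow> g n = h (t_inr R M N n)"
    and t: "t \<in> carrier T"
  shows "tensor_lift R M N Q f g t = h t"
proof -
  let ?s = "\<lambda>r. h (r \<odot>\<^bsub>T\<^esub> \<one>\<^bsub>T\<^esub>)"
  have fh: "f \<in> hom_over R ?s M Q"
    by (rule hom_overI[OF ring_hom_cong[OF ring_hom_comp[OF inl_hom h] f M.ring_axioms]])
      (simp_all add: f T_one tens_smult_l)
  have gh: "g \<in> hom_over R ?s N Q"
    by (rule hom_overI[OF ring_hom_cong[OF ring_hom_comp[OF inr_hom h] g N.ring_axioms]])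
      (simp_all add: g T_one tens_smult_r)
  note L = lift_hom_over[OF Q fh gh]
  show ?thesis
    by (rule hom_ext[OF hom_overD(1)[OF L(1)] h t]) (simp_all add: L(2,3) f g)
qed

lemma lift_natural:
  assumes Q: "cring Q" and Q': "cring Q'" and f: "f \<in> hom_over R s M Q" and g: "g \<in> hom_over R s N Q"
    and h: "h \<in> ring_hom Q Q'" and t: "t \<in> carrier T"
  shows "h (tensor_lift R M N Q f g t) = tensor_lift R M N Q' (\<lambda>m. h (f m)) (\<lambda>n. h (g n)) t"
proof -
  note L = lift_hom_over[OF Q f g]
  show ?thesis
    by (rule lift_unique[OF Q' ring_hom_comp[OF hom_overD(1)[OF L(1)] h] _ _ t, symmetric])
      (simp_all add: L(2,3))
qed

lemma lift_cong:
  assumes Q: "cring Q" and f: "f \<in> hom_over R s M Q" and g: "g \<in> hom_over R s N Q"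
    and "\<And>m. m \<in> carrier M \<Longrightarrow> f' m = f m" "\<And>n. n \<in> carrier N \<Longrightarrow> g' n = g n" "t \<in> carrier T"
  shows "tensor_lift R M N Q f' g' t = tensor_lift R M N Q f g t"
  by (rule lift_unique[OF Q hom_overD(1)[OF lift_hom_over(1)[OF Q f g]]])
    (simp_all add: lift_hom_over(2,3)[OF Q f g] assms(4-6))

lemma tensor_map_alg_hom:
  assumes M': "algebra R M'" and N': "algebra R N'" and f: "f \<in> alg_hom R M M'" and g: "g \<in> alg_hom R N N'"
  shows "tensor_map R M N M' N' f g \<in> alg_hom R T (tensor R M' N')"
    and "m \<in> carrier M \<Longrightarrow> tensor_map R M N M' N' f g (t_inl R M N m) = t_inl R M' N' (f m)"
    and "n \<in> carrier N \<Longrightarrow> tensor_map R M N M' N' f g (t_inr R M N n) = t_inr R M' N' (g n)"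
    and "m \<in> carrier M \<Longrightarrow> n \<in> carrier N \<Longrightarrow>
      tensor_map R M N M' N' f g (tens R M N m n) = tens R M' N' (f m) (g n)"
proof -
  interpret X: algebra_pair R M' N' by (intro algebra_pair.intro M' N')
  let ?s = "\<lambda>r. r \<odot>\<^bsub>tensor R M' N'\<^esub> \<one>\<^bsub>tensor R M' N'\<^esub>"
  have f1: "(\<lambda>m. t_inl R M' N' (f m)) \<in> hom_over R ?s M (tensor R M' N')"
    by (rule hom_overI[OF ring_hom_comp[OF alg_homD(1)[OF f] X.inl_hom]])
      (use hom_overD(2)[OF X.inl_hom_over] hom_overD(2)[OF alg_hom_hom_over[OF M.algebra_axioms f]] in simp)
  have g1: "(\<lambda>n. t_inr R M' N' (g n)) \<in> hom_over R ?s N (tensor R M' N')"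
    by (rule hom_overI[OF ring_hom_comp[OF alg_homD(1)[OF g] X.inr_hom]])
      (use hom_overD(2)[OF X.inr_hom_over] hom_overD(2)[OF alg_hom_hom_over[OF N.algebra_axioms g]] in simp)
  note L = lift_hom_over[OF X.T_cring f1 g1, folded tensor_map_def]
  show "tensor_map R M N M' N' f g \<in> alg_hom R T (tensor R M' N')"
    by (rule hom_over_alg_hom[OF T_algebra X.T_algebra L(1)])
  show "m \<in> carrier M \<Longrightarrow> tensor_map R M N M' N' f g (t_inl R M N m) = t_inl R M' N' (f m)"
    "n \<in> carrier N \<Longrightarrow> tensor_map R M N M' N' f g (t_inr R M N n) = t_inr R M' N' (g n)"
    using L by auto
  then show "m \<in> carrier M \<Longrightarrow> n \<in> carrier N \<Longrightarrow>
      tensor_map R M N M' N' f g (tens R M N m n) = tens R M' N' (f m) (g n)"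
    using ring_hom_closed[OF alg_homD(1)[OF f]] ring_hom_closed[OF alg_homD(1)[OF g]]
    by (simp add: tens_inl_inr[of m n] X.tens_inl_inr[of "f m" "g n"] ring_hom_mult[OF hom_overD(1)[OF L(1)]])
qed

end

section \<open>Points of group schemes\<close>

text \<open>The comorphism of the point g . x, for \<open>Q\<close>-valued points \<open>g\<close>
  of Spec A and \<open>x\<close> of Spec M. With \<open>M = A\<close> and \<rho> the
  comultiplication it is the product of two points of the group.\<close>

definition act where
  "act k A M \<rho> Q g x = (\<lambda>m. tensor_lift k A M Q g x (\<rho> m))"

lemma act_hom_over:
  assumes "algebra k A" "algebra k M" "\<rho> \<in> alg_hom k M (tensor k A M)" "cring Q"
    "g \<in> hom_over k s A Q" "x \<in> hom_over k s M Q"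
  shows "act k A M \<rho> Q g x \<in> hom_over k s M Q"
proof -
  interpret algebra_pair k A M by (intro algebra_pair.intro assms)
  note L = lift_hom_over[OF assms(4-6)]
  show ?thesis unfolding act_def
  proof (rule hom_overI)
    show "(\<lambda>m. tensor_lift k A M Q g x (\<rho> m)) \<in> ring_hom M Q"
      by (rule ring_hom_comp[OF alg_homD(1)[OF assms(3)] hom_overD(1)[OF L(1)]])
    fix r assume "r \<in> carrier k"
    then show "tensor_lift k A M Q g x (\<rho> (r \<odot>\<^bsub>M\<^esub> \<one>\<^bsub>M\<^esub>)) = s r"
      using hom_overD(2)[OF alg_hom_hom_over[OF assms(2,3)]] hom_overD(2)[OF L(1)] by simp
  qed
qed

lemma act_natural:
  assumes "algebra k A" "algebra k M" "\<rho> \<in> alg_hom k M (tensor k A M)" "cring Q" "cring Q'"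
    "g \<in> hom_over k s A Q" "x \<in> hom_over k s M Q" "h \<in> ring_hom Q Q'" "m \<in> carrier M"
  shows "h (act k A M \<rho> Q g x m) = act k A M \<rho> Q' (\<lambda>a. h (g a)) (\<lambda>m. h (x m)) m"
proof -
  interpret algebra_pair k A M by (intro algebra_pair.intro assms)
  show ?thesis unfolding act_def
    by (rule lift_natural[OF assms(4-8)]) (rule ring_hom_closed[OF alg_homD(1)[OF assms(3)] assms(9)])
qed

lemma act_cong:
  assumes "algebra k A" "algebra k M" "\<rho> \<in> alg_hom k M (tensor k A M)" "cring Q"
    "g \<in> hom_over k s A Q" "x \<in> hom_over k s M Q"
    "\<And>a. a \<in> carrier A \<Longrightarrow> g' a = g a" "\<And>m. m \<in> carrier M \<Longrightarrow> x' m = x m" "m \<in> carrier M"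
  shows "act k A M \<rho> Q g' x' m = act k A M \<rho> Q g x m"
proof -
  interpret algebra_pair k A M by (intro algebra_pair.intro assms)
  show ?thesis unfolding act_def
    by (rule lift_cong[OF assms(4-8)]) (simp_all add: ring_hom_closed[OF alg_homD(1)[OF assms(3)] assms(9)])
qed

lemma coactionD:
  assumes "coaction k A M \<rho>"
  shows "\<rho> \<in> alg_hom k M (tensor k A M)"
    "m \<in> carrier M \<Longrightarrow> tensor_assoc k A A M (tensor_map k A M (tensor k A A) M (comult A) (\<lambda>x. x) (\<rho> m))
          = tensor_map k A M A (tensor k A M) (\<lambda>x. x) \<rho> (\<rho> m)"
    "m \<in> carrier M \<Longrightarrow> tensor_lift k A M M (\<lambda>a. counit A a \<odot>\<^bsub>M\<^esub> \<one>\<^bsub>M\<^esub>) (\<lambda>x. x) (\<rho> m) = m"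
  using assms unfolding coaction_def by auto

lemma hopf_algebraD:
  assumes "hopf_algebra k A"
  shows "algebra k A" "comult A \<in> alg_hom k A (tensor k A A)" "counit A \<in> alg_hom k A (self_alg k)"
    "antipode A \<in> alg_hom k A A"
    "a \<in> carrier A \<Longrightarrow> tensor_lift k A A A (antipode A) (\<lambda>x. x) (comult A a) = counit A a \<odot>\<^bsub>A\<^esub> \<one>\<^bsub>A\<^esub>"
    "a \<in> carrier A \<Longrightarrow> tensor_lift k A A A (\<lambda>x. x) (antipode A) (comult A a) = counit A a \<odot>\<^bsub>A\<^esub> \<one>\<^bsub>A\<^esub>"
  using assms unfolding hopf_algebra_def by auto

text \<open>The group acts on itself by left translation, so its own associativity and inverse laws
  are instances of those for actions.\<close>

lemma hopf_coaction: "hopf_algebra k A \<Longrightarrow> coaction k A A (comult A)"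
  unfolding hopf_algebra_def coaction_def by auto

locale algebra_coaction =
  fixes k :: "('c, 'x) ring_scheme" and A :: "('c, 'a) hopf" and M :: "('c, 'm, 'y) module_scheme" and \<rho>
  assumes hopf: "hopf_algebra k A" and M_algebra: "algebra k M" and coact: "coaction k A M \<rho>"
begin

lemmas A_algebra = hopf_algebraD(1)[OF hopf]
lemmas comult_hom = hopf_algebraD(2)[OF hopf]
lemmas \<rho>_hom = coactionD(1)[OF coact]

sublocale AM: algebra_pair k A M
  by (intro algebra_pair.intro A_algebra M_algebra)

text \<open>The points g1, g2 and x define one homomorphism \<open>W\<close> on A \<otimes> (A
  \<otimes> M). Applied to the two sides of the coassociativity identity for
  \<open>\<rho> m\<close>, it gives the two sides of the claim.\<close>

lemma act_act:
  assumes Q: "cring Q" and g1: "g1 \<in> hom_over k s A Q" and g2: "g2 \<in> hom_over k s A Q"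
    and x: "x \<in> hom_over k s M Q" and m: "m \<in> carrier M"
  shows "act k A M \<rho> Q (act k A A (comult A) Q g1 g2) x m = act k A M \<rho> Q g1 (act k A M \<rho> Q g2 x) m"
proof -
  interpret AA: algebra_pair k A A by (intro algebra_pair.intro A_algebra)
  interpret AAM: algebra_pair k A "tensor k A M" by (intro algebra_pair.intro A_algebra AM.T_algebra)
  interpret AA_M: algebra_pair k "tensor k A A" M by (intro algebra_pair.intro M_algebra AA.T_algebra)
  let ?U = "tensor k A (tensor k A M)"
  let ?s = "\<lambda>r. r \<odot>\<^bsub>?U\<^esub> \<one>\<^bsub>?U\<^esub>"
  note \<rho>m = ring_hom_closed[OF alg_homD(1)[OF \<rho>_hom] m]
  note w2 = AM.lift_hom_over[OF Q g2 x]
  note W = AAM.lift_hom_over[OF Q g1 w2(1)]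
  define W where "W = tensor_lift k A (tensor k A M) Q g1 (tensor_lift k A M Q g2 x)"
  note W = W[folded W_def]
  note Wh = hom_overD(1)[OF W(1)]
  have idA: "(\<lambda>x. x) \<in> alg_hom k A A" and idM: "(\<lambda>x. x) \<in> alg_hom k M M"
    by (simp_all add: alg_hom_def ring_hom_id)
  note r = AM.tensor_map_alg_hom[OF A_algebra AM.T_algebra idA \<rho>_hom]
  have "W (tensor_map k A M A (tensor k A M) (\<lambda>x. x) \<rho> (\<rho> m)) = act k A M \<rho> Q g1 (act k A M \<rho> Q g2 x) m"
    unfolding act_def
    by (rule AM.lift_unique[OF Q ring_hom_comp[OF alg_homD(1)[OF r(1)] Wh] _ _ \<rho>m, symmetric])
      (simp_all add: r(2,3) W(2,3) ring_hom_closed[OF alg_homD(1)[OF \<rho>_hom]])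
  note l = AM.tensor_map_alg_hom[OF AA.T_algebra M_algebra comult_hom idM]
  have b1: "t_inl k A (tensor k A M) \<in> hom_over k ?s A ?U" by (rule AAM.inl_hom_over)
  have b2: "(\<lambda>n. t_inr k A (tensor k A M) (t_inl k A M n)) \<in> hom_over k ?s A ?U"
    by (rule hom_overI[OF ring_hom_comp[OF AM.inl_hom AAM.inr_hom]])
      (simp add: hom_overD(2)[OF AM.inl_hom_over] hom_overD(2)[OF AAM.inr_hom_over])
  have b3: "(\<lambda>n. t_inr k A (tensor k A M) (t_inr k A M n)) \<in> hom_over k ?s M ?U"
    by (rule hom_overI[OF ring_hom_comp[OF AM.inr_hom AAM.inr_hom]])
      (simp add: hom_overD(2)[OF AM.inr_hom_over] hom_overD(2)[OF AAM.inr_hom_over])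
  note b12 = AA.lift_hom_over[OF AAM.T_cring b1 b2]
  note b = AA_M.lift_hom_over[OF AAM.T_cring b12(1) b3]
  have as: "tensor_assoc k A A M = tensor_lift k (tensor k A A) M ?U
      (tensor_lift k A A ?U (t_inl k A (tensor k A M)) (\<lambda>n. t_inr k A (tensor k A M) (t_inl k A M n)))
      (\<lambda>p. t_inr k A (tensor k A M) (t_inr k A M p))"
    by (simp add: tensor_assoc_def Let_def)
  have c: "W (tensor_lift k A A ?U (t_inl k A (tensor k A M)) (\<lambda>n. t_inr k A (tensor k A M) (t_inl k A M n)) u)
      = tensor_lift k A A Q g1 g2 u" if "u \<in> carrier (tensor k A A)" for u
    by (rule AA.lift_unique[OF Q ring_hom_comp[OF hom_overD(1)[OF b12(1)] Wh] _ _ that, symmetric])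
      (simp_all add: b12 W(2,3) w2)
  have "W (tensor_assoc k A A M (tensor_map k A M (tensor k A A) M (comult A) (\<lambda>x. x) (\<rho> m)))
      = act k A M \<rho> Q (act k A A (comult A) Q g1 g2) x m"
    unfolding act_def as
    by (rule AM.lift_unique[OF Q ring_hom_comp[OF alg_homD(1)[OF l(1)]
          ring_hom_comp[OF hom_overD(1)[OF b(1)] Wh]] _ _ \<rho>m, symmetric])
      (simp_all add: l(2,3) b(2,3) c W(2,3) w2 ring_hom_closed[OF alg_homD(1)[OF comult_hom]])
  then show ?thesis
    using coactionD(2)[OF coact m] \<open>W (tensor_map k A M A (tensor k A M) (\<lambda>x. x) \<rho> (\<rho> m)) = _\<close> by simp
qed

text \<open>The counit identity of the coaction, transported along the point \<open>x\<close>;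
  \<open>s\<close> after the counit is the neutral element over \<open>s\<close>.\<close>

lemma act_unit:
  assumes Q: "cring Q" and x: "x \<in> hom_over k s M Q" and m: "m \<in> carrier M"
  shows "act k A M \<rho> Q (\<lambda>a. s (counit A a)) x m = x m"
proof -
  interpret k: cring k using algebra.R_cring[OF M_algebra] .
  note e = hopf_algebraD(3)[OF hopf]
  have "(\<lambda>a. counit A a \<odot>\<^bsub>M\<^esub> \<one>\<^bsub>M\<^esub>) \<in> ring_hom A M"
    using ring_hom_comp[OF _ alg_one_smult_hom[OF M_algebra]] alg_homD(1)[OF e] by simp
  then have e': "(\<lambda>a. counit A a \<odot>\<^bsub>M\<^esub> \<one>\<^bsub>M\<^esub>) \<in> hom_over k (\<lambda>r. r \<odot>\<^bsub>M\<^esub> \<one>\<^bsub>M\<^esub>) A M"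
    using hom_overD(2)[OF alg_hom_hom_over[OF A_algebra e]] by (intro hom_overI) simp_all
  have i: "(\<lambda>x. x) \<in> hom_over k (\<lambda>r. r \<odot>\<^bsub>M\<^esub> \<one>\<^bsub>M\<^esub>) M M"
    by (simp add: hom_over_def ring_hom_id)
  note \<rho>m = ring_hom_closed[OF alg_homD(1)[OF \<rho>_hom] m]
  have ec: "counit A a \<in> carrier k" if "a \<in> carrier A" for a
    using ring_hom_closed[OF alg_homD(1)[OF e] that] by simp
  have xe: "x (counit A a \<odot>\<^bsub>M\<^esub> \<one>\<^bsub>M\<^esub>) = s (counit A a)" if "a \<in> carrier A" for a
    using hom_overD(2)[OF x ec[OF that]] .
  have "x m = x (tensor_lift k A M M (\<lambda>a. counit A a \<odot>\<^bsub>M\<^esub> \<one>\<^bsub>M\<^esub>) (\<lambda>x. x) (\<rho> m))"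
    using coactionD(3)[OF coact m] by simp
  also have "\<dots> = tensor_lift k A M Q (\<lambda>a. x (counit A a \<odot>\<^bsub>M\<^esub> \<one>\<^bsub>M\<^esub>)) x (\<rho> m)"
    by (rule AM.lift_natural[OF AM.N.M_cring Q e' i hom_overD(1)[OF x] \<rho>m])
  also have "\<dots> = act k A M \<rho> Q (\<lambda>a. s (counit A a)) x m"
    unfolding act_def
    by (rule AM.lift_cong[OF Q, symmetric])
      (use hom_over_comp[OF e' hom_overD(1)[OF x] A_algebra] hom_over_comp[OF i hom_overD(1)[OF x] M_algebra] xe \<rho>m in auto)
  finally show ?thesis by simp
qed

end

text \<open>The inverse of the point \<open>g\<close>.\<close>

definition pinv where "pinv A g = (\<lambda>a. g (antipode A a))"

lemma pinv_hom_over: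
  assumes "hopf_algebra k A" "g \<in> hom_over k s A Q"
  shows "pinv A g \<in> hom_over k s A Q"
  unfolding pinv_def
  by (rule hom_overI[OF ring_hom_comp[OF alg_homD(1)[OF hopf_algebraD(4)[OF assms(1)]] hom_overD(1)[OF assms(2)]]])
    (simp add: hom_overD(2)[OF alg_hom_hom_over[OF hopf_algebraD(1,4)[OF assms(1)]]] hom_overD(2)[OF assms(2)])

lemma hopf_inverse:
  assumes A: "hopf_algebra k A" and Q: "cring Q" and g: "g \<in> hom_over k s A Q" and a: "a \<in> carrier A"
  shows "act k A A (comult A) Q (pinv A g) g a = s (counit A a)"
    "act k A A (comult A) Q g (pinv A g) a = s (counit A a)"
proof -
  note D = hopf_algebraD[OF A]
  interpret AA: algebra_pair k A A by (intro algebra_pair.intro D)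
  have S: "antipode A \<in> hom_over k (\<lambda>r. r \<odot>\<^bsub>A\<^esub> \<one>\<^bsub>A\<^esub>) A A"
    by (rule alg_hom_hom_over[OF D(1,4)])
  have i: "(\<lambda>x. x) \<in> hom_over k (\<lambda>r. r \<odot>\<^bsub>A\<^esub> \<one>\<^bsub>A\<^esub>) A A"
    by (simp add: hom_over_def ring_hom_id)
  have c: "comult A a \<in> carrier (tensor k A A)" by (rule ring_hom_closed[OF alg_homD(1)[OF D(2)] a])
  have e: "g (counit A a \<odot>\<^bsub>A\<^esub> \<one>\<^bsub>A\<^esub>) = s (counit A a)"
    using hom_overD(2)[OF g] ring_hom_closed[OF alg_homD(1)[OF D(3)] a] by simp
  show "act k A A (comult A) Q (pinv A g) g a = s (counit A a)"
    using AA.lift_natural[OF AA.M.M_cring Q S i hom_overD(1)[OF g] c] D(5)[OF a] e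
    by (simp add: act_def pinv_def)
  show "act k A A (comult A) Q g (pinv A g) a = s (counit A a)"
    using AA.lift_natural[OF AA.M.M_cring Q i S hom_overD(1)[OF g] c] D(6)[OF a] e
    by (simp add: act_def pinv_def)
qed

context algebra_coaction
begin

lemma act_inverse:
  assumes Q: "cring Q" and g: "g \<in> hom_over k s A Q" and x: "x \<in> hom_over k s M Q" and m: "m \<in> carrier M"
  shows "act k A M \<rho> Q (pinv A g) (act k A M \<rho> Q g x) m = x m"
    "act k A M \<rho> Q g (act k A M \<rho> Q (pinv A g) x) m = x m"
proof -
  note g' = pinv_hom_over[OF hopf g]
  note gg = act_hom_over[OF A_algebra A_algebra comult_hom Q g' g] act_hom_over[OF A_algebra A_algebra comult_hom Q g g']
  have "act k A M \<rho> Q (act k A A (comult A) Q (pinv A g) g) x m = act k A M \<rho> Q (\<lambda>a. s (counit A a)) x m"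
    by (rule act_cong[OF A_algebra M_algebra \<rho>_hom Q gg(1) x _ _ m, symmetric])
      (simp_all add: hopf_inverse[OF hopf Q g])
  then show "act k A M \<rho> Q (pinv A g) (act k A M \<rho> Q g x) m = x m"
    using act_act[OF Q g' g x m] act_unit[OF Q x m] by simp
  have "act k A M \<rho> Q (act k A A (comult A) Q g (pinv A g)) x m = act k A M \<rho> Q (\<lambda>a. s (counit A a)) x m"
    by (rule act_cong[OF A_algebra M_algebra \<rho>_hom Q gg(2) x _ _ m, symmetric])
      (simp_all add: hopf_inverse[OF hopf Q g])
  then show "act k A M \<rho> Q g (act k A M \<rho> Q (pinv A g) x) m = x m"
    using act_act[OF Q g g' x m] act_unit[OF Q x m] by simp
qed

end

section \<open>Dual bases\<close>

definition linear_map where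
  "linear_map R M N h \<longleftrightarrow> additive_map M N h \<and>
    (\<forall>r \<in> carrier R. \<forall>m \<in> carrier M. h (r \<odot>\<^bsub>M\<^esub> m) = r \<odot>\<^bsub>N\<^esub> h m)"

text \<open>A dual basis in the sense of finitely generated projective modules: only the reproducing
  identity is demanded, not biorthogonality. The vectors form an indexed family so that
  \<open>j (e i)\<close> can serve after base change with the same index set.\<close>

definition dual_basis where
  "dual_basis R M E e \<phi> \<longleftrightarrow> finite E \<and> e \<in> E \<rightarrow> carrier M \<and>
    (\<forall>i \<in> E. linear_map R M (self_alg R) (\<phi> i)) \<and>
    (\<forall>m \<in> carrier M. m = (\<Oplus>\<^bsub>M\<^esub>i\<in>E. \<phi> i m \<odot>\<^bsub>M\<^esub> e i))"

lemma dual_basisD: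
  assumes "dual_basis R M E e \<phi>"
  shows "finite E" "i \<in> E \<Longrightarrow> e i \<in> carrier M" "i \<in> E \<Longrightarrow> additive_map M R (\<phi> i)"
    "i \<in> E \<Longrightarrow> m \<in> carrier M \<Longrightarrow> \<phi> i m \<in> carrier R"
    "i \<in> E \<Longrightarrow> r \<in> carrier R \<Longrightarrow> m \<in> carrier M \<Longrightarrow> \<phi> i (r \<odot>\<^bsub>M\<^esub> m) = r \<otimes>\<^bsub>R\<^esub> \<phi> i m"
    "m \<in> carrier M \<Longrightarrow> (\<Oplus>\<^bsub>M\<^esub>i\<in>E. \<phi> i m \<odot>\<^bsub>M\<^esub> e i) = m"
  using assms by (auto simp: dual_basis_def linear_map_def additive_map_def)

text \<open>A spanning set of least cardinality is independent, since a nontrivial relation would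
  allow one vector to be dropped. Uniqueness of coefficients then makes the chosen coordinates
  linear.\<close>

lemma finite_algebra_dual_basis:
  fixes M :: "('c, 'a, 'y) module_scheme"
  assumes k: "field k" and fin: "finite_algebra k M"
  obtains E :: "'a set" and e \<phi> where "dual_basis k M E e \<phi>"
proof -
  interpret k: field k by fact
  have alg: "algebra k M" using fin by (simp add: finite_algebra_def)
  interpret algebra k M by fact
  define lc where "lc E c = (\<Oplus>\<^bsub>M\<^esub>e\<in>E. c e \<odot>\<^bsub>M\<^esub> e)" for E c
  define spans where "spans E \<longleftrightarrow> finite E \<and> E \<subseteq> carrier M \<and>
      (\<forall>m \<in> carrier M. \<exists>c \<in> E \<rightarrow> carrier k. m = lc E c)" for E
  have "\<exists>E. spans E" using fin by (simp add: finite_algebra_def spans_def lc_def)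
  then obtain E where E: "spans E" and min: "\<And>E'. spans E' \<Longrightarrow> card E \<le> card E'"
    using ex_has_least_nat[of spans _ card] by metis
  have finE: "finite E" and EM: "E \<subseteq> carrier M" using E by (auto simp: spans_def)
  have t: "c e \<odot>\<^bsub>M\<^esub> e \<in> carrier M" if "c \<in> E \<rightarrow> carrier k" "e \<in> E" for c e
    using that EM by auto
  have lc_closed: "lc E c \<in> carrier M" if "c \<in> E \<rightarrow> carrier k" for c
    unfolding lc_def using t[OF that] by (auto intro: M.finsum_closed)
  have lc_add: "lc E (\<lambda>e. c e \<oplus>\<^bsub>k\<^esub> d e) = lc E c \<oplus>\<^bsub>M\<^esub> lc E d"
    if "c \<in> E \<rightarrow> carrier k" "d \<in> E \<rightarrow> carrier k" for c d
  proof -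
    have "lc E (\<lambda>e. c e \<oplus>\<^bsub>k\<^esub> d e) = (\<Oplus>\<^bsub>M\<^esub>e\<in>E. c e \<odot>\<^bsub>M\<^esub> e \<oplus>\<^bsub>M\<^esub> d e \<odot>\<^bsub>M\<^esub> e)"
      unfolding lc_def
      by (rule M.finsum_cong') (use t that EM in \<open>auto simp: Pi_iff subset_iff smult_l_distr\<close>)
    also have "\<dots> = lc E c \<oplus>\<^bsub>M\<^esub> lc E d"
      unfolding lc_def by (rule M.finsum_addf) (use t that in auto)
    finally show ?thesis .
  qed
  have lc_smult: "lc E (\<lambda>e. r \<otimes>\<^bsub>k\<^esub> c e) = r \<odot>\<^bsub>M\<^esub> lc E c"
    if "c \<in> E \<rightarrow> carrier k" "r \<in> carrier k" for c r
  proof -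
    have "additive_map M M (\<lambda>x. r \<odot>\<^bsub>M\<^esub> x)"
      by (rule additive_mapI) (use that in \<open>auto simp: smult_r_distr\<close>)
    then have "r \<odot>\<^bsub>M\<^esub> lc E c = (\<Oplus>\<^bsub>M\<^esub>e\<in>E. r \<odot>\<^bsub>M\<^esub> (c e \<odot>\<^bsub>M\<^esub> e))"
      unfolding lc_def
      by (rule additive_map_finsum[OF M.abelian_group_axioms M.abelian_group_axioms]) (use t that in auto)
    also have "\<dots> = lc E (\<lambda>e. r \<otimes>\<^bsub>k\<^esub> c e)"
      unfolding lc_def
      by (rule M.finsum_cong') (use t that EM in \<open>auto simp: Pi_iff subset_iff smult_assoc1\<close>)
    finally show ?thesis by simp
  qed
  have indep: "d e0 = \<zero>\<^bsub>k\<^esub>" if d: "d \<in> E \<rightarrow> carrier k" and d0: "lc E d = \<zero>\<^bsub>M\<^esub>" and e0: "e0 \<in> E" for d e0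
  proof (rule ccontr)
    assume nz: "d e0 \<noteq> \<zero>\<^bsub>k\<^esub>"
    have de0: "d e0 \<in> carrier k" using d e0 by auto
    then have u: "d e0 \<in> Units k" using nz k.field_Units by simp
    have "spans (E - {e0})"
      unfolding spans_def
    proof (intro conjI ballI)
      fix m assume "m \<in> carrier M"
      then obtain c where c: "c \<in> E \<rightarrow> carrier k" "m = lc E c" using E by (auto simp: spans_def)
      \<comment> \<open>The multiple of the relation \<open>d\<close> whose addition cancels the
        coefficient at \<open>e0\<close>; adding it leaves the value of the combination
        unchanged.\<close>
      define r where "r = \<ominus>\<^bsub>k\<^esub> (c e0 \<otimes>\<^bsub>k\<^esub> inv\<^bsub>k\<^esub> (d e0))"
      define c' where "c' e = c e \<oplus>\<^bsub>k\<^esub> r \<otimes>\<^bsub>k\<^esub> d e" for e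
      have ce0: "c e0 \<in> carrier k" using c e0 by auto
      have r: "r \<in> carrier k" unfolding r_def using u ce0 by simp
      have rd: "(\<lambda>e. r \<otimes>\<^bsub>k\<^esub> d e) \<in> E \<rightarrow> carrier k" using d r by auto
      have c': "c' \<in> E \<rightarrow> carrier k" using c(1) rd by (auto simp: c'_def Pi_iff)
      have "lc E c' = lc E c"
        unfolding c'_def using lc_add[OF c(1) rd] lc_smult[OF d r] d0 r lc_closed[OF c(1)] by simp
      moreover have "c' e0 = \<zero>\<^bsub>k\<^esub>"
        unfolding c'_def r_def using u ce0 de0 by (simp add: k.l_minus k.m_assoc k.r_neg)
      then have "lc (E - {e0}) c' = lc E c'"
        unfolding lc_def using EM e0 finE c' t[OF c']
        by (intro M.finsum_mono_neutral) auto
      ultimately show "\<exists>c\<in>E - {e0} \<rightarrow> carrier k. m = lc (E - {e0}) c"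
        using c c' by (intro bexI[of _ c']) auto
    qed (use finE EM in auto)
    then show False using min[of "E - {e0}"] e0 finE card_Diff1_less[OF finE e0] by simp
  qed
  have uniq: "c e = d e" if c: "c \<in> E \<rightarrow> carrier k" and d: "d \<in> E \<rightarrow> carrier k" and "lc E c = lc E d" and e: "e \<in> E" for c d e
  proof -
    have md: "(\<lambda>e. \<ominus>\<^bsub>k\<^esub> \<one>\<^bsub>k\<^esub> \<otimes>\<^bsub>k\<^esub> d e) \<in> E \<rightarrow> carrier k" using d by auto
    have "lc E (\<lambda>e. c e \<oplus>\<^bsub>k\<^esub> (\<ominus>\<^bsub>k\<^esub> \<one>\<^bsub>k\<^esub> \<otimes>\<^bsub>k\<^esub> d e)) = lc E d \<oplus>\<^bsub>M\<^esub> (\<ominus>\<^bsub>k\<^esub> \<one>\<^bsub>k\<^esub>) \<odot>\<^bsub>M\<^esub> lc E d"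
      using lc_add[OF c md] lc_smult[OF d, of "\<ominus>\<^bsub>k\<^esub> \<one>\<^bsub>k\<^esub>"] that(3) by simp
    also have "\<dots> = \<zero>\<^bsub>M\<^esub>" using lc_closed[OF d] by (simp add: smult_l_minus M.r_neg)
    finally have "c e \<oplus>\<^bsub>k\<^esub> (\<ominus>\<^bsub>k\<^esub> \<one>\<^bsub>k\<^esub> \<otimes>\<^bsub>k\<^esub> d e) = \<zero>\<^bsub>k\<^esub>"
      using c md e by (intro indep) auto
    moreover have "c e \<in> carrier k" "d e \<in> carrier k" using c d e by auto
    ultimately have "c e \<ominus>\<^bsub>k\<^esub> d e = \<zero>\<^bsub>k\<^esub>" by (simp add: k.l_minus k.minus_eq)
    then show ?thesis using \<open>c e \<in> _\<close> \<open>d e \<in> _\<close> by simp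
  qed
  \<comment> \<open>The whole coefficient function is chosen once for each \<open>m\<close> and then
    evaluated at \<open>e\<close>, so that the coordinates of \<open>m\<close> belong to a single
    representation.\<close>
  define \<phi> where "\<phi> e m = (SOME c. c \<in> E \<rightarrow> carrier k \<and> m = lc E c) e" for e m
  have \<phi>: "(\<lambda>e. \<phi> e m) \<in> E \<rightarrow> carrier k" "m = lc E (\<lambda>e. \<phi> e m)" if "m \<in> carrier M" for m
  proof -
    have "\<exists>c. c \<in> E \<rightarrow> carrier k \<and> m = lc E c" using E that unfolding spans_def by blast
    from someI_ex[OF this] show "(\<lambda>e. \<phi> e m) \<in> E \<rightarrow> carrier k" "m = lc E (\<lambda>e. \<phi> e m)"
      by (simp_all add: \<phi>_def)
  qed
  have "dual_basis k M E (\<lambda>e. e) \<phi>"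
    unfolding dual_basis_def linear_map_def
  proof (intro conjI ballI additive_mapI)
    fix e m assume "e \<in> E" "m \<in> carrier M"
    then show "\<phi> e m \<in> carrier (self_alg k)" using \<phi>(1) by auto
    fix m' assume "m' \<in> carrier M"
    then have "lc E (\<lambda>e. \<phi> e (m \<oplus>\<^bsub>M\<^esub> m')) = lc E (\<lambda>e. \<phi> e m \<oplus>\<^bsub>k\<^esub> \<phi> e m')"
      using \<open>m \<in> carrier M\<close> by (simp add: \<phi>(2)[symmetric] lc_add \<phi>(1))
    moreover have "(\<lambda>e. \<phi> e m \<oplus>\<^bsub>k\<^esub> \<phi> e m') \<in> E \<rightarrow> carrier k"
      using \<phi>(1)[OF \<open>m \<in> carrier M\<close>] \<phi>(1)[OF \<open>m' \<in> carrier M\<close>] by (auto simp: Pi_iff)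
    ultimately have "(\<lambda>e. \<phi> e (m \<oplus>\<^bsub>M\<^esub> m')) e = (\<lambda>e. \<phi> e m \<oplus>\<^bsub>k\<^esub> \<phi> e m') e"
      by (intro uniq[OF \<phi>(1)] \<open>e \<in> E\<close> M.a_closed \<open>m \<in> carrier M\<close> \<open>m' \<in> carrier M\<close>)
    then show "\<phi> e (m \<oplus>\<^bsub>M\<^esub> m') = \<phi> e m \<oplus>\<^bsub>self_alg k\<^esub> \<phi> e m'" by simp
  next
    fix e r m assume *: "e \<in> E" "r \<in> carrier k" "m \<in> carrier M"
    then have "lc E (\<lambda>e. \<phi> e (r \<odot>\<^bsub>M\<^esub> m)) = lc E (\<lambda>e. r \<otimes>\<^bsub>k\<^esub> \<phi> e m)"
      by (simp add: \<phi>(2)[symmetric] lc_smult \<phi>(1))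
    moreover have "(\<lambda>e. r \<otimes>\<^bsub>k\<^esub> \<phi> e m) \<in> E \<rightarrow> carrier k"
      using \<phi>(1)[OF *(3)] *(2) by (auto simp: Pi_iff)
    ultimately have "(\<lambda>e. \<phi> e (r \<odot>\<^bsub>M\<^esub> m)) e = (\<lambda>e. r \<otimes>\<^bsub>k\<^esub> \<phi> e m) e"
      by (intro uniq[OF \<phi>(1)] smult_closed *)
    then show "\<phi> e (r \<odot>\<^bsub>M\<^esub> m) = r \<odot>\<^bsub>self_alg k\<^esub> \<phi> e m" by simp
  next
    fix m assume "m \<in> carrier M"
    then show "m = (\<Oplus>\<^bsub>M\<^esub>i\<in>E. \<phi> i m \<odot>\<^bsub>M\<^esub> i)" using \<phi>(2) unfolding lc_def by blast
  qed (use finE EM in auto)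
  then show ?thesis using that by blast
qed

text \<open>The coordinate map \<phi>_i \<otimes> id from M \<otimes> N to R \<otimes> N = N. It is
  not multiplicative, which is why lifts of balanced pairs are needed.\<close>

definition tcoord where
  "tcoord R M N \<phi> i = tensor_lift R M N N (\<lambda>m. \<phi> i m \<odot>\<^bsub>N\<^esub> \<one>\<^bsub>N\<^esub>) (\<lambda>n. n)"

context algebra_pair
begin

context
  fixes E :: "'i set" and e \<phi>
  assumes db: "dual_basis R M E e \<phi>"
begin

private lemma tcoord_balanced:
  assumes "i \<in> E"
  shows "balanced R M N N (\<lambda>m. \<phi> i m \<odot>\<^bsub>N\<^esub> \<one>\<^bsub>N\<^esub>) (\<lambda>n. n)"
proof -
  note D = dual_basisD[OF db] and A = additive_mapD[OF dual_basisD(3)[OF db assms]]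
  have "additive_map M N (\<lambda>m. \<phi> i m \<odot>\<^bsub>N\<^esub> \<one>\<^bsub>N\<^esub>)"
    by (rule additive_mapI) (use A in \<open>auto simp: N.smult_l_distr\<close>)
  moreover have "(r \<otimes>\<^bsub>R\<^esub> \<phi> i m) \<odot>\<^bsub>N\<^esub> \<one>\<^bsub>N\<^esub> \<otimes>\<^bsub>N\<^esub> n = \<phi> i m \<odot>\<^bsub>N\<^esub> \<one>\<^bsub>N\<^esub> \<otimes>\<^bsub>N\<^esub> (r \<odot>\<^bsub>N\<^esub> n)"
    if "r \<in> carrier R" "m \<in> carrier M" "n \<in> carrier N" for r m n
    using that A(1) M.R.m_comm[of r "\<phi> i m"] by (simp add: N.smult_assoc2 N.smult_assoc1)
  ultimately show ?thesis using D(5)[OF assms] additive_map_id by (simp add: balanced_def)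
qed

lemma tcoord_additive: "i \<in> E \<Longrightarrow> additive_map T N (tcoord R M N \<phi> i)"
  unfolding tcoord_def by (rule lift_additive[OF N.M_cring tcoord_balanced])

lemma tcoord_tens: "i \<in> E \<Longrightarrow> m \<in> carrier M \<Longrightarrow> n \<in> carrier N \<Longrightarrow>
    tcoord R M N \<phi> i (tens R M N m n) = \<phi> i m \<odot>\<^bsub>N\<^esub> n"
  unfolding tcoord_def using dual_basisD(4)[OF db]
  by (simp add: lift_tens[OF N.M_cring tcoord_balanced] N.smult_assoc2)

lemma tcoord_mult_inr:
  assumes i: "i \<in> E" and t: "t \<in> carrier T" and n: "n \<in> carrier N"
  shows "tcoord R M N \<phi> i (t_inr R M N n \<otimes>\<^bsub>T\<^esub> t) = n \<otimes>\<^bsub>N\<^esub> tcoord R M N \<phi> i t"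
proof -
  interpret T: cring T by (rule T_cring)
  show ?thesis
  proof (rule additive_ext[OF _ _ t])
    show "additive_map T N (\<lambda>t. tcoord R M N \<phi> i (t_inr R M N n \<otimes>\<^bsub>T\<^esub> t))"
      by (rule additive_mapI) (use n additive_mapD[OF tcoord_additive[OF i]] in \<open>simp_all add: T.r_distr\<close>)
    show "additive_map T N (\<lambda>t. n \<otimes>\<^bsub>N\<^esub> tcoord R M N \<phi> i t)"
      by (rule additive_mapI) (use n additive_mapD[OF tcoord_additive[OF i]] in \<open>simp_all add: N.r_distr\<close>)
  qed (use i n dual_basisD(4)[OF db i] in \<open>simp add: tens_mult tcoord_tens N.smult_mult_r\<close>)
qed

lemma tcoord_expand:
  assumes t: "t \<in> carrier T"
  shows "(\<Oplus>\<^bsub>T\<^esub>i\<in>E. tens R M N (e i) (tcoord R M N \<phi> i t)) = t"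
proof -
  interpret T: cring T by (rule T_cring)
  note D = dual_basisD[OF db]
  note A = additive_mapD[OF tcoord_additive]
  show ?thesis
  proof (rule additive_ext[OF _ additive_map_id t])
    show "additive_map T T (\<lambda>t. \<Oplus>\<^bsub>T\<^esub>i\<in>E. tens R M N (e i) (tcoord R M N \<phi> i t))"
    proof (rule additive_mapI)
      fix x y assume xy: "x \<in> carrier T" "y \<in> carrier T"
      show "(\<Oplus>\<^bsub>T\<^esub>i\<in>E. tens R M N (e i) (tcoord R M N \<phi> i x)) \<in> carrier T"
        by (rule T.finsum_closed) (use A D xy in auto)
      have "(\<Oplus>\<^bsub>T\<^esub>i\<in>E. tens R M N (e i) (tcoord R M N \<phi> i (x \<oplus>\<^bsub>T\<^esub> y))) =
        (\<Oplus>\<^bsub>T\<^esub>i\<in>E. tens R M N (e i) (tcoord R M N \<phi> i x) \<oplus>\<^bsub>T\<^esub> tens R M N (e i) (tcoord R M N \<phi> i y))"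
        by (rule T.finsum_cong') (use A D xy in \<open>auto simp: tens_add_r\<close>)
      also have "\<dots> = (\<Oplus>\<^bsub>T\<^esub>i\<in>E. tens R M N (e i) (tcoord R M N \<phi> i x)) \<oplus>\<^bsub>T\<^esub>
          (\<Oplus>\<^bsub>T\<^esub>i\<in>E. tens R M N (e i) (tcoord R M N \<phi> i y))"
        by (rule T.finsum_addf) (use A D xy in auto)
      finally show "(\<Oplus>\<^bsub>T\<^esub>i\<in>E. tens R M N (e i) (tcoord R M N \<phi> i (x \<oplus>\<^bsub>T\<^esub> y))) = \<dots>" .
    qed
    fix m n assume mn: "m \<in> carrier M" "n \<in> carrier N"
    have add: "additive_map M T (\<lambda>m. tens R M N m n)"
      by (rule additive_mapI) (use mn in \<open>auto simp: tens_add_l\<close>)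
    have "tens R M N m n = tens R M N (\<Oplus>\<^bsub>M\<^esub>i\<in>E. \<phi> i m \<odot>\<^bsub>M\<^esub> e i) n"
      using D(6)[OF mn(1)] by simp
    also have "\<dots> = (\<Oplus>\<^bsub>T\<^esub>i\<in>E. tens R M N (\<phi> i m \<odot>\<^bsub>M\<^esub> e i) n)"
      by (rule additive_map_finsum[OF M.abelian_group_axioms T.abelian_group_axioms add]) (use D mn in auto)
    also have "\<dots> = (\<Oplus>\<^bsub>T\<^esub>i\<in>E. tens R M N (e i) (tcoord R M N \<phi> i (tens R M N m n)))"
      by (rule T.finsum_cong') (use D(2,4) mn module.smult_closed[OF algebra.module[OF T_algebra]] in \<open>auto simp: tcoord_tens tens_smult_l tens_smult_r\<close>)
    finally show "(\<Oplus>\<^bsub>T\<^esub>i\<in>E. tens R M N (e i) (tcoord R M N \<phi> i (tens R M N m n))) = tens R M N m n" ..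
  qed
qed

lemma tcoord_eqI:
  assumes "t \<in> carrier T" "t' \<in> carrier T" "\<And>i. i \<in> E \<Longrightarrow> tcoord R M N \<phi> i t = tcoord R M N \<phi> i t'"
  shows "t = t'"
proof -
  interpret T: cring T by (rule T_cring)
  have "(\<Oplus>\<^bsub>T\<^esub>i\<in>E. tens R M N (e i) (tcoord R M N \<phi> i t)) = (\<Oplus>\<^bsub>T\<^esub>i\<in>E. tens R M N (e i) (tcoord R M N \<phi> i t'))"
    by (rule T.finsum_cong')
      (use assms dual_basisD(2)[OF db] additive_mapD(1)[OF tcoord_additive] in auto)
  then show ?thesis unfolding tcoord_expand[OF assms(1)] tcoord_expand[OF assms(2)] .
qed

end

end

section \<open>Rank factorization\<close>

text \<open>Gaussian elimination for the matrix with finitely many rows \<open>E j\<close> and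
  columns indexed by a possibly infinite \<open>S\<close>. The columns \<open>y i\<close> are pivots
  and the \<open>u i\<close> are combinations of rows that form an identity matrix there, so each
  row is determined by its values at the pivots. The set \<open>U\<close> carries along where the
  combinations come from; only values on \<open>S\<close> count, whence
  \<open>Ucong\<close>.\<close>

lemma rank_factorization:
  fixes F :: "('f, 'x) ring_scheme" and S :: "'s set" and U :: "('s \<Rightarrow> 'f) set"
  assumes F: "field F" and J: "finite J"
    and UF: "\<And>u s. u \<in> U \<Longrightarrow> s \<in> S \<Longrightarrow> u s \<in> carrier F"
    and Ucong: "\<And>u v. u \<in> U \<Longrightarrow> (\<And>s. s \<in> S \<Longrightarrow> v s = u s) \<Longrightarrow> v \<in> U"
    and Uscale: "\<And>u c. u \<in> U \<Longrightarrow> c \<in> carrier F \<Longrightarrow> (\<lambda>s. c \<otimes>\<^bsub>F\<^esub> u s) \<in> U"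
    and Udiff: "\<And>u v c. u \<in> U \<Longrightarrow> v \<in> U \<Longrightarrow> c \<in> carrier F \<Longrightarrow> (\<lambda>s. u s \<ominus>\<^bsub>F\<^esub> c \<otimes>\<^bsub>F\<^esub> v s) \<in> U"
    and E: "\<And>j. j \<in> J \<Longrightarrow> E j \<in> U"
  shows "\<exists>(n::nat) y u. (\<forall>i<n. y i \<in> S \<and> u i \<in> U) \<and>
    (\<forall>i<n. \<forall>l<n. u i (y l) = (if i = l then \<one>\<^bsub>F\<^esub> else \<zero>\<^bsub>F\<^esub>)) \<and>
    (\<forall>j \<in> J. \<forall>s \<in> S. E j s = (\<Oplus>\<^bsub>F\<^esub>i\<in>{..<n}. u i s \<otimes>\<^bsub>F\<^esub> E j (y i)))"
  using J E
proof (induction J rule: finite_induct)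
  case empty
  then show ?case by (intro exI[of _ "0::nat"]) simp
next
  case (insert j0 J)
  interpret F: field F by fact
  have IH: "\<exists>(n::nat) y u. (\<forall>i<n. y i \<in> S \<and> u i \<in> U) \<and>
    (\<forall>i<n. \<forall>l<n. u i (y l) = (if i = l then \<one>\<^bsub>F\<^esub> else \<zero>\<^bsub>F\<^esub>)) \<and>
    (\<forall>j \<in> J. \<forall>s \<in> S. E j s = (\<Oplus>\<^bsub>F\<^esub>i\<in>{..<n}. u i s \<otimes>\<^bsub>F\<^esub> E j (y i)))"
    by (rule insert.IH) (rule insert.prems, simp)
  then obtain n :: nat and y u where yS: "\<And>i. i < n \<Longrightarrow> y i \<in> S" and uU: "\<And>i. i < n \<Longrightarrow> u i \<in> U"
    and dual: "\<And>i l. i < n \<Longrightarrow> l < n \<Longrightarrow> u i (y l) = (if i = l then \<one>\<^bsub>F\<^esub> else \<zero>\<^bsub>F\<^esub>)"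
    and ex: "\<And>j s. j \<in> J \<Longrightarrow> s \<in> S \<Longrightarrow> E j s = (\<Oplus>\<^bsub>F\<^esub>i\<in>{..<n}. u i s \<otimes>\<^bsub>F\<^esub> E j (y i))"
    by blast
  have E: "E j \<in> U" if "j \<in> insert j0 J" for j using insert.prems that by blast
  have EF: "E j s \<in> carrier F" if "j \<in> insert j0 J" "s \<in> S" for j s using UF[OF E] that by blast
  have uF: "u i s \<in> carrier F" if "i < n" "s \<in> S" for i s using UF[OF uU] that by blast
  define a where "a m j s = (\<Oplus>\<^bsub>F\<^esub>i\<in>{..<m::nat}. u i s \<otimes>\<^bsub>F\<^esub> E j (y i))" for m j s
  have aF: "a m j s \<in> carrier F" if "m \<le> n" "j \<in> insert j0 J" "s \<in> S" for m j s
    unfolding a_def using that by (auto intro!: F.finsum_closed simp: uF EF yS)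
  \<comment> \<open>The part of the new row that the old pivots do not explain.\<close>
  define r where "r s = E j0 s \<ominus>\<^bsub>F\<^esub> a n j0 s" for s
  have rF: "r s \<in> carrier F" if "s \<in> S" for s unfolding r_def using that EF aF by simp
  \<comment> \<open>One summand is removed at a time because \<open>Udiff\<close> subtracts a
    multiple of a single member. \<open>Ucong\<close> is used since the functions agree on
    \<open>S\<close> only.\<close>
  have "(\<lambda>s. E j0 s \<ominus>\<^bsub>F\<^esub> a m j0 s) \<in> U" if "m \<le> n" for m
    using that
  proof (induction m)
    case 0
    show ?case by (rule Ucong[OF E[of j0]]) (simp_all add: a_def EF F.minus_eq)
  next
    case (Suc m)
    have "(\<lambda>s. (E j0 s \<ominus>\<^bsub>F\<^esub> a m j0 s) \<ominus>\<^bsub>F\<^esub> E j0 (y m) \<otimes>\<^bsub>F\<^esub> u m s) \<in> U"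
      using Suc by (intro Udiff uU EF yS) auto
    then show ?case
    proof (rule Ucong)
      fix s assume s: "s \<in> S"
      have "a (Suc m) j0 s = u m s \<otimes>\<^bsub>F\<^esub> E j0 (y m) \<oplus>\<^bsub>F\<^esub> a m j0 s"
        unfolding a_def lessThan_Suc using s Suc.prems
        by (subst F.finsum_insert) (auto simp: uF EF yS)
      moreover have "u m s \<in> carrier F" "E j0 (y m) \<in> carrier F" "a m j0 s \<in> carrier F" "E j0 s \<in> carrier F"
        using s Suc.prems by (auto simp: uF EF yS aF)
      ultimately show "E j0 s \<ominus>\<^bsub>F\<^esub> a (Suc m) j0 s = (E j0 s \<ominus>\<^bsub>F\<^esub> a m j0 s) \<ominus>\<^bsub>F\<^esub> E j0 (y m) \<otimes>\<^bsub>F\<^esub> u m s"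
        by (simp, algebra)
    qed
  qed
  then have rU: "r \<in> U" unfolding r_def[abs_def] by simp
  show ?case
  proof (cases "\<forall>s\<in>S. r s = \<zero>\<^bsub>F\<^esub>")
    case True
    then have eq: "E j0 s = a n j0 s" if "s \<in> S" for s
      using that EF[of j0 s] aF[of n j0 s] F.r_right_minus_eq[of "E j0 s" "a n j0 s"]
      unfolding r_def by blast
    show ?thesis
      using yS uU dual ex eq[unfolded a_def] by (intro exI[of _ n] exI[of _ y] exI[of _ u]) blast
  next
    case False
    then obtain s0 where s0: "s0 \<in> S" "r s0 \<noteq> \<zero>\<^bsub>F\<^esub>" by blast
    define d where "d = inv\<^bsub>F\<^esub> (r s0)"
    have un: "r s0 \<in> Units F" using s0 rF F.field_Units by simp
    then have d: "d \<in> carrier F" "d \<otimes>\<^bsub>F\<^esub> r s0 = \<one>\<^bsub>F\<^esub>" unfolding d_def by simp_all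
    define w where "w s = d \<otimes>\<^bsub>F\<^esub> r s" for s
    have wU: "w \<in> U" unfolding w_def[abs_def] by (rule Uscale[OF rU d(1)])
    have wF: "w s \<in> carrier F" if "s \<in> S" for s using UF[OF wU that] .
    have w0: "w s0 = \<one>\<^bsub>F\<^esub>" by (simp add: w_def d)
    have wr: "w s \<otimes>\<^bsub>F\<^esub> r s0 = r s" if "s \<in> S" for s
    proof -
      have "w s \<otimes>\<^bsub>F\<^esub> r s0 = (d \<otimes>\<^bsub>F\<^esub> r s0) \<otimes>\<^bsub>F\<^esub> r s"
        unfolding w_def using d(1) rF[OF that] rF[OF s0(1)] by (simp only: F.m_ac F.m_closed)
      then show ?thesis using d rF[OF that] by simp
    qed
    have wy: "w (y l) = \<zero>\<^bsub>F\<^esub>" if "l < n" for l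
    proof -
      have "a n j0 (y l) = u l (y l) \<otimes>\<^bsub>F\<^esub> E j0 (y l)"
        unfolding a_def by (rule F.finsum_single) (use that in \<open>auto simp: dual EF yS\<close>)
      then have "r (y l) = \<zero>\<^bsub>F\<^esub>" using that by (simp add: r_def dual EF yS)
      then show ?thesis by (simp add: w_def d)
    qed
    \<comment> \<open>The normalised residual \<open>w\<close> is one at the new pivot
      \<open>s0\<close> and vanishes at the old ones. Subtracting \<open>u i s0\<close> times
      \<open>w\<close> thus makes \<open>u i\<close> vanish at \<open>s0\<close> without disturbing
      the old pivots.\<close>
    define u' where "u' i = (if i = n then w else (\<lambda>s. u i s \<ominus>\<^bsub>F\<^esub> u i s0 \<otimes>\<^bsub>F\<^esub> w s))" for i
    define y' where "y' = y(n := s0)"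
    have y'S: "y' i \<in> S" if "i < Suc n" for i using that yS s0 by (auto simp: y'_def less_Suc_eq)
    have u'U: "u' i \<in> U" if "i < Suc n" for i
      using that wU uU uF s0 by (auto simp: u'_def less_Suc_eq intro!: Udiff)
    have "u' i (y' l) = (if i = l then \<one>\<^bsub>F\<^esub> else \<zero>\<^bsub>F\<^esub>)" if "i < Suc n" "l < Suc n" for i l
      using that w0 uF[OF _ s0(1)] by (auto simp: u'_def y'_def less_Suc_eq wy dual F.minus_eq F.r_neg)
    moreover have "E j s = (\<Oplus>\<^bsub>F\<^esub>i\<in>{..<Suc n}. u' i s \<otimes>\<^bsub>F\<^esub> E j (y' i))"
      if j: "j \<in> insert j0 J" and s: "s \<in> S" for j s
    proof -
      note cl = uF[OF _ s] uF[OF _ s0(1)] wF[OF s] EF[OF j] yS aF[OF le_refl j s] aF[OF le_refl j s0(1)] s s0(1)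
      have "(\<Oplus>\<^bsub>F\<^esub>i\<in>{..<Suc n}. u' i s \<otimes>\<^bsub>F\<^esub> E j (y' i)) =
        w s \<otimes>\<^bsub>F\<^esub> E j s0 \<oplus>\<^bsub>F\<^esub> (\<Oplus>\<^bsub>F\<^esub>i\<in>{..<n}. u' i s \<otimes>\<^bsub>F\<^esub> E j (y' i))"
        unfolding lessThan_Suc by (subst F.finsum_insert) (auto simp: u'_def y'_def cl)
      also have "(\<Oplus>\<^bsub>F\<^esub>i\<in>{..<n}. u' i s \<otimes>\<^bsub>F\<^esub> E j (y' i)) =
        (\<Oplus>\<^bsub>F\<^esub>i\<in>{..<n}. u i s \<otimes>\<^bsub>F\<^esub> E j (y i) \<oplus>\<^bsub>F\<^esub> (\<ominus>\<^bsub>F\<^esub> w s) \<otimes>\<^bsub>F\<^esub> (u i s0 \<otimes>\<^bsub>F\<^esub> E j (y i)))"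
      proof (rule F.finsum_cong')
        fix i assume "i \<in> {..<n}"
        then have "u i s \<in> carrier F" "u i s0 \<in> carrier F" "w s \<in> carrier F" "E j (y i) \<in> carrier F" "i \<noteq> n" "i < n"
          using cl by auto
        then show "u' i s \<otimes>\<^bsub>F\<^esub> E j (y' i) =
            u i s \<otimes>\<^bsub>F\<^esub> E j (y i) \<oplus>\<^bsub>F\<^esub> (\<ominus>\<^bsub>F\<^esub> w s) \<otimes>\<^bsub>F\<^esub> (u i s0 \<otimes>\<^bsub>F\<^esub> E j (y i))"
          by (simp add: u'_def y'_def) algebra
      qed (auto simp: cl)
      also have "\<dots> = a n j s \<oplus>\<^bsub>F\<^esub> (\<Oplus>\<^bsub>F\<^esub>i\<in>{..<n}. (\<ominus>\<^bsub>F\<^esub> w s) \<otimes>\<^bsub>F\<^esub> (u i s0 \<otimes>\<^bsub>F\<^esub> E j (y i)))"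
        unfolding a_def by (rule F.finsum_addf) (auto simp: cl)
      also have "(\<Oplus>\<^bsub>F\<^esub>i\<in>{..<n}. (\<ominus>\<^bsub>F\<^esub> w s) \<otimes>\<^bsub>F\<^esub> (u i s0 \<otimes>\<^bsub>F\<^esub> E j (y i))) = (\<ominus>\<^bsub>F\<^esub> w s) \<otimes>\<^bsub>F\<^esub> a n j s0"
        unfolding a_def by (rule F.finsum_rdistr[symmetric]) (auto simp: cl)
      finally have eq: "(\<Oplus>\<^bsub>F\<^esub>i\<in>{..<Suc n}. u' i s \<otimes>\<^bsub>F\<^esub> E j (y' i)) =
        w s \<otimes>\<^bsub>F\<^esub> E j s0 \<oplus>\<^bsub>F\<^esub> (a n j s \<oplus>\<^bsub>F\<^esub> (\<ominus>\<^bsub>F\<^esub> w s) \<otimes>\<^bsub>F\<^esub> a n j s0)" .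
      \<comment> \<open>In this form the correction is visible: the bracket is zero for an old row
        and equals \<open>r s0\<close> for the new row, where \<open>w s\<close> times
        \<open>r s0\<close> restores the residual \<open>r s\<close>.\<close>
      have eq': "\<dots> = a n j s \<oplus>\<^bsub>F\<^esub> w s \<otimes>\<^bsub>F\<^esub> (E j s0 \<ominus>\<^bsub>F\<^esub> a n j s0)"
        using cl(3) cl(4)[OF s0(1)] cl(6,7) by algebra
      show ?thesis
      proof (cases "j = j0")
        case True
        have "E j s = a n j s \<oplus>\<^bsub>F\<^esub> r s"
          unfolding r_def True using aF[OF le_refl _ s, of j0] EF[OF _ s, of j0] by simp algebra
        then show ?thesis using wr[OF s] eq eq' by (simp add: r_def True)
      next
        case False
        then have "j \<in> J" using j by simp
        then have "E j s = a n j s" "E j s0 = a n j s0" using ex s s0 by (auto simp: a_def)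
        then show ?thesis unfolding eq eq' using cl by (simp add: F.minus_eq F.r_neg)
      qed
    qed
    ultimately show ?thesis using y'S u'U by (intro exI[of _ "Suc n"] exI[of _ y'] exI[of _ u']) auto
  qed
qed

section \<open>Coactions on a field\<close>

lemma module_extend_simps [simp]:
  "carrier (module.extend M r) = carrier M" "monoid.mult (module.extend M r) = monoid.mult M"
  "one (module.extend M r) = one M" "zero (module.extend M r) = zero M"
  "add (module.extend M r) = add M" "smult (module.extend M r) = smult M"
  by (simp_all add: module.defs)

lemma ring_hom_cring_of: "cring R \<Longrightarrow> cring S \<Longrightarrow> h \<in> ring_hom R S \<Longrightarrow> ring_hom_cring R S h"
  by (simp add: ring_hom_cring_def ring_hom_cring_axioms_def)

lemma (in ring) equalizer_subring:
  assumes "ring S" "f \<in> ring_hom R S" "g \<in> ring_hom R S"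
  shows "subring {x \<in> carrier R. f x = g x} R"
proof -
  interpret S: ring S by fact
  interpret f: ring_hom_ring R S f by (intro ring_hom_ringI2 ring_axioms assms)
  interpret g: ring_hom_ring R S g by (intro ring_hom_ringI2 ring_axioms assms)
  show ?thesis by (rule subringI) auto
qed

locale field_coaction =
  fixes k :: "('c, 'x) ring_scheme" and A :: "('c, 'a) hopf" and K :: "('c, 'm) module" and \<rho>
  assumes field_k: "field k" and fgs: "finite_group_scheme k A" and field_K: "field K"
    and K_algebra: "algebra k K" and coact: "coaction k A K \<rho>"
begin

lemma hopf: "hopf_algebra k A" and fin: "finite_algebra k A"
  using fgs by (simp_all add: finite_group_scheme_def)

sublocale K: field K by (rule field_K)

sublocale algebra_coaction k A K \<rho>
  by (intro algebra_coaction.intro hopf K_algebra coact)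

text \<open>\<open>TT\<close> is the coordinate ring of G_K as a \<open>k\<close>-algebra, and
  \<open>C\<close> is the same ring as a Hopf algebra over \<open>K\<close> acting through the
  second factor. The maps \<open>j\<close> and \<iota> are the inclusions of O(G) and of the base
  field.\<close>

abbreviation "TT \<equiv> tensor k A K"
abbreviation "C \<equiv> base_change k A K"
abbreviation "j \<equiv> t_inl k A K"
abbreviation "\<iota> \<equiv> t_inr k A K"

sublocale T: cring TT by (rule AM.T_cring)

lemma C_simps [simp]: "carrier C = carrier TT" "monoid.mult C = monoid.mult TT" "one C = one TT"
  "zero C = zero TT" "add C = add TT" "x \<odot>\<^bsub>C\<^esub> t = \<iota> x \<otimes>\<^bsub>TT\<^esub> t"
  by (simp_all add: base_change_def Let_def)

lemma C_algebra: "algebra K C"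
  by (rule algebra_cong[OF alg_via_algebra[OF K.is_cring T.is_cring AM.inr_hom]])
    (simp_all add: base_change_def Let_def)

lemma C_cring: "cring C"
  using algebra.M_cring[OF C_algebra] .

lemma ring_hom_C [simp]: "ring_hom C Q = ring_hom TT Q" "ring_hom Q C = ring_hom Q TT"
  by (simp_all add: ring_hom_def)

lemma additive_map_C [simp]: "additive_map C Q = additive_map TT Q" "additive_map Q' C = additive_map Q' TT"
  by (simp_all add: additive_map_def fun_eq_iff)

lemmas j_hom = AM.inl_hom and \<iota>_hom = AM.inr_hom
lemmas \<rho>_ring_hom = alg_homD(1)[OF \<rho>_hom]

lemma j_closed [simp]: "a \<in> carrier A \<Longrightarrow> j a \<in> carrier TT"
  and \<iota>_closed [simp]: "x \<in> carrier K \<Longrightarrow> \<iota> x \<in> carrier TT"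
  by simp_all

lemma \<rho>_closed [simp]: "x \<in> carrier K \<Longrightarrow> \<rho> x \<in> carrier TT"
  by (rule ring_hom_closed[OF \<rho>_ring_hom])

lemma j_smult_one: "r \<in> carrier k \<Longrightarrow> j (r \<odot>\<^bsub>A\<^esub> \<one>\<^bsub>A\<^esub>) = \<iota> (r \<odot>\<^bsub>K\<^esub> \<one>\<^bsub>K\<^esub>)"
  using hom_overD(2)[OF AM.inl_hom_over] hom_overD(2)[OF AM.inr_hom_over] by simp

lemma \<rho>_smult_one: "r \<in> carrier k \<Longrightarrow> \<rho> (r \<odot>\<^bsub>K\<^esub> \<one>\<^bsub>K\<^esub>) = \<iota> (r \<odot>\<^bsub>K\<^esub> \<one>\<^bsub>K\<^esub>)"
  using hom_overD(2)[OF alg_hom_hom_over[OF K_algebra \<rho>_hom]] hom_overD(2)[OF AM.inr_hom_over] by simp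

lemma one_k_closed [simp]: "r \<in> carrier k \<Longrightarrow> r \<odot>\<^bsub>K\<^esub> \<one>\<^bsub>K\<^esub> \<in> carrier K"
  by simp

text \<open>The structure map over \<open>K\<close> restricted to \<open>k\<close>. It lets points
  of G_K be regarded as points of G.\<close>

abbreviation "rst s \<equiv> (\<lambda>r. s (r \<odot>\<^bsub>K\<^esub> \<one>\<^bsub>K\<^esub>))"

lemma hom_over_C: "f \<in> hom_over K s C Q \<longleftrightarrow> f \<in> ring_hom TT Q \<and> (\<forall>x \<in> carrier K. f (\<iota> x) = s x)"
  by (auto simp: hom_over_def)

lemma point_of_hom:
  assumes "f \<in> hom_over K s C Q"
  shows "(\<lambda>a. f (j a)) \<in> hom_over k (rst s) A Q"
  using assms unfolding hom_over_C
  by (intro hom_overI) (auto intro: ring_hom_comp[OF j_hom] simp: j_smult_one)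

lemma base_point: "s \<in> ring_hom K Q \<Longrightarrow> s \<in> hom_over k (rst s) K Q"
  by (simp add: hom_over_def)

lemma lift_C:
  assumes "cring Q" "g \<in> hom_over k (rst s) A Q" "s \<in> ring_hom K Q"
  shows "tensor_lift k A K Q g s \<in> hom_over K s C Q"
    "a \<in> carrier A \<Longrightarrow> tensor_lift k A K Q g s (j a) = g a"
    "x \<in> carrier K \<Longrightarrow> tensor_lift k A K Q g s (\<iota> x) = s x"
  using AM.lift_hom_over[OF assms(1,2) base_point[OF assms(3)]] unfolding hom_over_C
  by (auto dest: hom_overD)

text \<open>A homomorphism \<open>f\<close> on A \<otimes> K is the pair consisting of the group
  point f o j and the point f o \<iota> of Spec K; composing it with \<rho> lets the former act on
  the latter.\<close>

lemma hom_\<rho>: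
  assumes Q: "cring Q" and f: "f \<in> ring_hom TT Q" and y: "y \<in> carrier K"
    and "\<And>a. a \<in> carrier A \<Longrightarrow> g a = f (j a)" "\<And>x. x \<in> carrier K \<Longrightarrow> s x = f (\<iota> x)"
  shows "act k A K \<rho> Q g s y = f (\<rho> y)"
  unfolding act_def by (rule AM.lift_unique[OF Q f assms(4,5)]) (use y in simp_all)

text \<open>\<open>K\<close>-linear forms on the coordinate ring of G_K, for the
  \<open>K\<close>-structure through \<iota>.\<close>

definition klin where
  "klin \<Lambda> \<longleftrightarrow> additive_map TT K \<Lambda> \<and>
    (\<forall>x \<in> carrier K. \<forall>t \<in> carrier TT. \<Lambda> (\<iota> x \<otimes>\<^bsub>TT\<^esub> t) = x \<otimes>\<^bsub>K\<^esub> \<Lambda> t)"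

lemma klinD:
  assumes "klin \<Lambda>"
  shows "additive_map TT K \<Lambda>" "t \<in> carrier TT \<Longrightarrow> \<Lambda> t \<in> carrier K"
    "t \<in> carrier TT \<Longrightarrow> u \<in> carrier TT \<Longrightarrow> \<Lambda> (t \<oplus>\<^bsub>TT\<^esub> u) = \<Lambda> t \<oplus>\<^bsub>K\<^esub> \<Lambda> u"
    "x \<in> carrier K \<Longrightarrow> t \<in> carrier TT \<Longrightarrow> \<Lambda> (\<iota> x \<otimes>\<^bsub>TT\<^esub> t) = x \<otimes>\<^bsub>K\<^esub> \<Lambda> t"
  using assms by (auto simp: klin_def additive_map_def)

lemma klin_scale: "klin \<Lambda> \<Longrightarrow> c \<in> carrier K \<Longrightarrow> klin (\<lambda>t. c \<otimes>\<^bsub>K\<^esub> \<Lambda> t)"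
  unfolding klin_def additive_map_def by (auto simp: K.r_distr K.m_lcomm Pi_iff)

lemma klin_diff:
  assumes "klin \<Lambda>" "klin \<Lambda>'" "c \<in> carrier K"
  shows "klin (\<lambda>t. \<Lambda> t \<ominus>\<^bsub>K\<^esub> c \<otimes>\<^bsub>K\<^esub> \<Lambda>' t)"
  unfolding klin_def
proof (intro conjI ballI additive_mapI)
  note D = klinD[OF assms(1)] and D' = klinD[OF assms(2)]
  fix t assume t: "t \<in> carrier TT"
  show "\<Lambda> t \<ominus>\<^bsub>K\<^esub> c \<otimes>\<^bsub>K\<^esub> \<Lambda>' t \<in> carrier K" using t D(2) D'(2) assms(3) by simp
  fix u assume u: "u \<in> carrier TT"
  note cl = D(2)[OF t] D'(2)[OF t] D(2)[OF u] D'(2)[OF u] assms(3)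
  show "\<Lambda> (t \<oplus>\<^bsub>TT\<^esub> u) \<ominus>\<^bsub>K\<^esub> c \<otimes>\<^bsub>K\<^esub> \<Lambda>' (t \<oplus>\<^bsub>TT\<^esub> u) = \<Lambda> t \<ominus>\<^bsub>K\<^esub> c \<otimes>\<^bsub>K\<^esub> \<Lambda>' t \<oplus>\<^bsub>K\<^esub> (\<Lambda> u \<ominus>\<^bsub>K\<^esub> c \<otimes>\<^bsub>K\<^esub> \<Lambda>' u)"
    unfolding D(3)[OF t u] D'(3)[OF t u] using cl by algebra
next
  note D = klinD[OF assms(1)] and D' = klinD[OF assms(2)]
  fix x t assume x: "x \<in> carrier K" and t: "t \<in> carrier TT"
  note cl = D(2)[OF t] D'(2)[OF t] x assms(3)
  show "\<Lambda> (\<iota> x \<otimes>\<^bsub>TT\<^esub> t) \<ominus>\<^bsub>K\<^esub> c \<otimes>\<^bsub>K\<^esub> \<Lambda>' (\<iota> x \<otimes>\<^bsub>TT\<^esub> t) = x \<otimes>\<^bsub>K\<^esub> (\<Lambda> t \<ominus>\<^bsub>K\<^esub> c \<otimes>\<^bsub>K\<^esub> \<Lambda>' t)"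
    unfolding D(4)[OF x t] D'(4)[OF x t] using cl by algebra
qed

abbreviation "L \<equiv> invariants k A K \<rho>"

lemma L_def: "L = {x \<in> carrier K. \<rho> x = \<iota> x}"
  by (simp add: invariants_def)

lemma L_iff: "x \<in> L \<longleftrightarrow> x \<in> carrier K \<and> \<rho> x = \<iota> x"
  by (simp add: L_def)

lemma klin_finsum:
  assumes "klin \<Lambda>" "\<And>i. i \<in> I \<Longrightarrow> c i \<in> carrier K" "\<And>i. i \<in> I \<Longrightarrow> t i \<in> carrier TT"
  shows "\<Lambda> (\<Oplus>\<^bsub>TT\<^esub>i\<in>I. \<iota> (c i) \<otimes>\<^bsub>TT\<^esub> t i) = (\<Oplus>\<^bsub>K\<^esub>i\<in>I. c i \<otimes>\<^bsub>K\<^esub> \<Lambda> (t i))"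
proof -
  have "\<Lambda> (\<Oplus>\<^bsub>TT\<^esub>i\<in>I. \<iota> (c i) \<otimes>\<^bsub>TT\<^esub> t i) = (\<Oplus>\<^bsub>K\<^esub>i\<in>I. \<Lambda> (\<iota> (c i) \<otimes>\<^bsub>TT\<^esub> t i))"
    by (rule additive_map_finsum[OF T.abelian_group_axioms K.abelian_group_axioms klinD(1)[OF assms(1)]])
      (use assms in auto)
  also have "\<dots> = (\<Oplus>\<^bsub>K\<^esub>i\<in>I. c i \<otimes>\<^bsub>K\<^esub> \<Lambda> (t i))"
    by (rule K.finsum_cong') (use assms klinD[OF assms(1)] in auto)
  finally show ?thesis .
qed

text \<open>Rank factorization is applied to the matrix of coordinates of \<open>\<rho> s\<close>:
  there is one row for each element of a finite \<open>k\<close>-basis of O(G) and one column for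
  each \<open>s\<close>. The pivot columns give vectors \<open>\<rho> (y i)\<close> that span
  \<rho>(K) over \<open>K\<close>, with biorthogonal forms.\<close>

lemma galois_expansion:
  "\<exists>(n::nat) y \<Lambda>. (\<forall>i<n. y i \<in> carrier K \<and> klin (\<Lambda> i)) \<and>
    (\<forall>i<n. \<forall>l<n. \<Lambda> i (\<rho> (y l)) = (if i = l then \<one>\<^bsub>K\<^esub> else \<zero>\<^bsub>K\<^esub>)) \<and>
    (\<forall>s \<in> carrier K. \<rho> s = (\<Oplus>\<^bsub>TT\<^esub>i\<in>{..<n}. \<iota> (\<Lambda> i (\<rho> s)) \<otimes>\<^bsub>TT\<^esub> \<rho> (y i)))"
proof -
  obtain E :: "'a set" and e \<phi> where db: "dual_basis k A E e \<phi>"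
    using finite_algebra_dual_basis[OF field_k fin] by blast
  let ?q = "tcoord k A K \<phi>"
  have q: "klin (?q i)" if "i \<in> E" for i
    unfolding klin_def using AM.tcoord_additive[OF db that] AM.tcoord_mult_inr[OF db that] by blast
  \<comment> \<open>Restricting to functions of this shape makes the factorization return linear
    forms on all of O(G_K), not merely functions on \<open>K\<close>.\<close>
  define U where "U = {u. \<exists>\<Lambda>. klin \<Lambda> \<and> (\<forall>s \<in> carrier K. u s = \<Lambda> (\<rho> s))}"
  have "\<exists>(n::nat) y u. (\<forall>i<n. y i \<in> carrier K \<and> u i \<in> U) \<and>
    (\<forall>i<n. \<forall>l<n. u i (y l) = (if i = l then \<one>\<^bsub>K\<^esub> else \<zero>\<^bsub>K\<^esub>)) \<and>
    (\<forall>j \<in> E. \<forall>s \<in> carrier K. ?q j (\<rho> s) = (\<Oplus>\<^bsub>K\<^esub>i\<in>{..<n}. u i s \<otimes>\<^bsub>K\<^esub> ?q j (\<rho> (y i))))"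
  proof (rule rank_factorization[OF field_K dual_basisD(1)[OF db]])
    fix u s assume "u \<in> U" "s \<in> carrier K"
    then show "u s \<in> carrier K" using klinD(2) by (auto simp: U_def)
  next
    fix u v assume "u \<in> U" "\<And>s. s \<in> carrier K \<Longrightarrow> v s = u s"
    then show "v \<in> U" by (auto simp: U_def)
  next
    fix u c assume u: "u \<in> U" and c: "c \<in> carrier K"
    then obtain \<Lambda> where "klin \<Lambda>" "\<forall>s \<in> carrier K. u s = \<Lambda> (\<rho> s)" by (auto simp: U_def)
    then show "(\<lambda>s. c \<otimes>\<^bsub>K\<^esub> u s) \<in> U" using klin_scale[OF _ c] unfolding U_def by (intro CollectI exI[of _ "\<lambda>t. c \<otimes>\<^bsub>K\<^esub> \<Lambda> t"]) auto
  next
    fix u v c assume u: "u \<in> U" and v: "v \<in> U" and c: "c \<in> carrier K"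
    then obtain \<Lambda> \<Lambda>' where "klin \<Lambda>" "\<forall>s \<in> carrier K. u s = \<Lambda> (\<rho> s)" "klin \<Lambda>'" "\<forall>s \<in> carrier K. v s = \<Lambda>' (\<rho> s)" by (auto simp: U_def)
    then show "(\<lambda>s. u s \<ominus>\<^bsub>K\<^esub> c \<otimes>\<^bsub>K\<^esub> v s) \<in> U"
      using klin_diff[OF _ _ c] unfolding U_def by (intro CollectI exI[of _ "\<lambda>t. \<Lambda> t \<ominus>\<^bsub>K\<^esub> c \<otimes>\<^bsub>K\<^esub> \<Lambda>' t"]) auto
  next
    fix i assume "i \<in> E"
    then show "(\<lambda>s. ?q i (\<rho> s)) \<in> U" using q unfolding U_def by blast
  qed
  then obtain n :: nat and y u where yu: "\<forall>i<n. y i \<in> carrier K \<and> u i \<in> U"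
    and uy0: "\<forall>i<n. \<forall>l<n. u i (y l) = (if i = l then \<one>\<^bsub>K\<^esub> else \<zero>\<^bsub>K\<^esub>)"
    and qe0: "\<forall>j \<in> E. \<forall>s \<in> carrier K. ?q j (\<rho> s) = (\<Oplus>\<^bsub>K\<^esub>i\<in>{..<n}. u i s \<otimes>\<^bsub>K\<^esub> ?q j (\<rho> (y i)))"
    by (elim exE conjE)
  have y: "y i \<in> carrier K" and u: "u i \<in> U" if "i < n" for i using yu that by blast+
  note uy = uy0[rule_format] and qe = qe0[rule_format]
  have "\<forall>i. \<exists>\<Lambda>. i < n \<longrightarrow> klin \<Lambda> \<and> (\<forall>s \<in> carrier K. u i s = \<Lambda> (\<rho> s))" using u unfolding U_def by blast
  then obtain \<Lambda> where \<Lambda>: "\<And>i. i < n \<Longrightarrow> klin (\<Lambda> i)" "\<And>i s. i < n \<Longrightarrow> s \<in> carrier K \<Longrightarrow> u i s = \<Lambda> i (\<rho> s)"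
    by metis
  have \<Lambda>c: "\<Lambda> i (\<rho> s) \<in> carrier K" if "i < n" "s \<in> carrier K" for i s
    using klinD(2)[OF \<Lambda>(1)[OF that(1)]] that by simp
  have "\<rho> s = (\<Oplus>\<^bsub>TT\<^esub>i\<in>{..<n}. \<iota> (\<Lambda> i (\<rho> s)) \<otimes>\<^bsub>TT\<^esub> \<rho> (y i))" (is "_ = ?R") if s: "s \<in> carrier K" for s
  \<comment> \<open>The factorization is an identity of coordinates; elements of A \<otimes> K with
    the same coordinates are equal.\<close>
  proof (rule AM.tcoord_eqI[OF db])
    show "\<rho> s \<in> carrier TT" using s by simp
    show "?R \<in> carrier TT" using \<Lambda>c s y by (auto intro!: T.finsum_closed)
    fix i assume i: "i \<in> E"
    have "?q i ?R = (\<Oplus>\<^bsub>K\<^esub>l\<in>{..<n}. \<Lambda> l (\<rho> s) \<otimes>\<^bsub>K\<^esub> ?q i (\<rho> (y l)))"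
      by (rule klin_finsum[OF q[OF i]]) (use \<Lambda>c s y in auto)
    also have "\<dots> = (\<Oplus>\<^bsub>K\<^esub>l\<in>{..<n}. u l s \<otimes>\<^bsub>K\<^esub> ?q i (\<rho> (y l)))"
      by (rule K.finsum_cong') (use \<Lambda>c s y \<Lambda>(2) klinD(2)[OF q[OF i]] in auto)
    finally show "?q i (\<rho> s) = ?q i ?R" using qe[OF i s] by simp
  qed
  then show ?thesis
    using y \<Lambda> uy by (intro exI[of _ n] exI[of _ y] exI[of _ \<Lambda>]) auto
qed

text \<open>At the points \<open>g\<^sub>1\<close>, \<open>g\<^sub>2\<close> with values in \<open>A \<otimes> (A \<otimes> K)\<close>, \<open>g\<^sub>1 \<cdot> x = (g\<^sub>1 g\<^sub>2\<^sup>-\<^sup>1) \<cdot> (g\<^sub>2 \<cdot> x)\<close>.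
  Evaluating the expansion of \<open>\<rho> s\<close> in the right-hand form moves the coefficients to \<open>g\<^sub>2\<close> and leaves
  the \<open>\<rho> (y i)\<close> at \<open>g\<^sub>1\<close>; comparing \<open>\<Lambda> l\<close> of both sides in the variable \<open>g\<^sub>1\<close> gives the invariance.\<close>

lemma coefficients_invariant:
  assumes y: "\<And>i. i < n \<Longrightarrow> y i \<in> carrier K" and \<Lambda>: "\<And>i. i < n \<Longrightarrow> klin (\<Lambda> i)"
    and dual: "\<And>i l. i < (n::nat) \<Longrightarrow> l < n \<Longrightarrow> \<Lambda> i (\<rho> (y l)) = (if i = l then \<one>\<^bsub>K\<^esub> else \<zero>\<^bsub>K\<^esub>)"
    and ex: "\<And>s. s \<in> carrier K \<Longrightarrow> \<rho> s = (\<Oplus>\<^bsub>TT\<^esub>i\<in>{..<n}. \<iota> (\<Lambda> i (\<rho> s)) \<otimes>\<^bsub>TT\<^esub> \<rho> (y i))"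
    and l: "l < n" and s: "s \<in> carrier K"
  shows "\<Lambda> l (\<rho> s) \<in> L"
proof -
  interpret W: algebra_pair k A TT by (intro algebra_pair.intro A_algebra AM.T_algebra)
  let ?W = "tensor k A TT"
  let ?s = "\<lambda>r. r \<odot>\<^bsub>?W\<^esub> \<one>\<^bsub>?W\<^esub>"
  interpret WR: cring ?W by (rule W.T_cring)
  \<comment> \<open>In A \<otimes> (A \<otimes> K) the outer factor is the universal point g2, the
    inner copy of A is g1, and K gives the base point x0.\<close>
  define in1 where "in1 = t_inr k A TT"
  define g2 where "g2 = t_inl k A TT"
  define g1 where "g1 = (\<lambda>a. in1 (j a))"
  define x0 where "x0 = (\<lambda>x. in1 (\<iota> x))"
  have in1: "in1 \<in> ring_hom TT ?W" unfolding in1_def by (rule W.inr_hom)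
  have g2: "g2 \<in> hom_over k ?s A ?W" unfolding g2_def by (rule W.inl_hom_over)
  have g1: "g1 \<in> hom_over k ?s A ?W" unfolding g1_def in1_def
    by (rule hom_overI[OF ring_hom_comp[OF AM.inl_hom W.inr_hom]])
      (simp add: hom_overD(2)[OF AM.inl_hom_over] hom_overD(2)[OF W.inr_hom_over])
  have x0: "x0 \<in> hom_over k ?s K ?W" unfolding x0_def in1_def
    by (rule hom_overI[OF ring_hom_comp[OF AM.inr_hom W.inr_hom]])
      (simp add: hom_overD(2)[OF AM.inr_hom_over] hom_overD(2)[OF W.inr_hom_over])
  note g2' = pinv_hom_over[OF hopf g2]
  let ?gg = "act k A A (comult A) ?W g1 (pinv A g2)"
  let ?x1 = "act k A K \<rho> ?W g2 x0"
  have gg: "?gg \<in> hom_over k ?s A ?W"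
    by (rule act_hom_over[OF A_algebra A_algebra comult_hom W.T_cring g1 g2'])
  have x1: "?x1 \<in> hom_over k ?s K ?W"
    by (rule act_hom_over[OF A_algebra K_algebra \<rho>_hom W.T_cring g2 x0])
  \<comment> \<open>The pair (g2, x0), so that \<eta> o \<rho> is the translated point g2 .
    x0.\<close>
  define \<eta> where "\<eta> = tensor_lift k A K ?W g2 x0"
  note \<eta> = AM.lift_hom_over[OF W.T_cring g2 x0, folded \<eta>_def]
  note \<eta>h = hom_overD(1)[OF \<eta>(1)]
  have x1\<eta>: "?x1 c = \<eta> (\<rho> c)" for c by (simp add: act_def \<eta>_def)
  \<comment> \<open>The pair (g1 g2^-1, g2 . x0). Composed with \<rho> it gives g1 . x0 again, while
    on the coefficients \<iota>(c) it takes the value of g2 . x0.\<close>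
  define F where "F = tensor_lift k A K ?W ?gg ?x1"
  note F = AM.lift_hom_over[OF W.T_cring gg x1, folded F_def]
  note Fh = hom_overD(1)[OF F(1)]
  have F\<rho>: "F (\<rho> c) = in1 (\<rho> c)" if c: "c \<in> carrier K" for c
  proof -
    have "F (\<rho> c) = act k A K \<rho> ?W ?gg ?x1 c" by (simp add: F_def act_def)
    also have "\<dots> = act k A K \<rho> ?W g1 (act k A K \<rho> ?W (pinv A g2) ?x1) c"
      by (rule act_act[OF W.T_cring g1 g2' x1 c])
    also have "\<dots> = act k A K \<rho> ?W g1 x0 c"
      by (rule act_cong[OF A_algebra K_algebra \<rho>_hom W.T_cring g1 x0 _ _ c])
        (simp_all add: act_inverse(1)[OF W.T_cring g2 x0])
    also have "\<dots> = in1 (\<rho> c)"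
      by (rule hom_\<rho>[OF W.T_cring in1 c]) (simp_all add: g1_def x0_def)
    finally show ?thesis .
  qed
  \<comment> \<open>The form \<Lambda>_l applied to the inner factor A \<otimes> K, that is id
    \<otimes> \<Lambda>_l from A \<otimes> (A \<otimes> K) to A \<otimes> K. It is balanced over
    \<open>k\<close> but not multiplicative.\<close>
  define M where "M = tensor_lift k A TT TT j (\<lambda>t. \<iota> (\<Lambda> l t))"
  note \<Lambda>l = klinD[OF \<Lambda>[OF l]]
  have bal: "balanced k A TT TT j (\<lambda>t. \<iota> (\<Lambda> l t))"
    unfolding balanced_def
  proof (intro conjI ballI)
    show "additive_map A TT j" by (rule ring_hom_additive[OF j_hom])
    show "additive_map TT TT (\<lambda>t. \<iota> (\<Lambda> l t))"
      by (rule additive_map_comp[OF \<Lambda>l(1) ring_hom_additive[OF \<iota>_hom]])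
    fix r a t assume r: "r \<in> carrier k" and a: "a \<in> carrier A" and t: "t \<in> carrier TT"
    let ?r = "r \<odot>\<^bsub>K\<^esub> \<one>\<^bsub>K\<^esub>"
    have *: "r \<odot>\<^bsub>TT\<^esub> u = \<iota> ?r \<otimes>\<^bsub>TT\<^esub> u" if "u \<in> carrier TT" for u
      using alg_one_smult[OF AM.T_algebra r that] hom_overD(2)[OF AM.inr_hom_over r] by simp
    have "j (r \<odot>\<^bsub>A\<^esub> a) = \<iota> ?r \<otimes>\<^bsub>TT\<^esub> j a"
      using r a *[of "j a"] by (simp add: AM.tens_smult_l)
    moreover have "\<iota> (\<Lambda> l (r \<odot>\<^bsub>TT\<^esub> t)) = \<iota> ?r \<otimes>\<^bsub>TT\<^esub> \<iota> (\<Lambda> l t)"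
      using r t \<Lambda>l(2)[OF t] by (simp add: * \<Lambda>l(4) ring_hom_mult[OF \<iota>_hom])
    ultimately show "j (r \<odot>\<^bsub>A\<^esub> a) \<otimes>\<^bsub>TT\<^esub> \<iota> (\<Lambda> l t) = j a \<otimes>\<^bsub>TT\<^esub> \<iota> (\<Lambda> l (r \<odot>\<^bsub>TT\<^esub> t))"
      using r a \<Lambda>l(2)[OF t] by (simp add: T.m_ac)
  qed
  note Madd = W.lift_additive[OF T.is_cring bal, folded M_def]
  note MD = additive_mapD[OF Madd]
  have Mt: "M (tens k A TT a t) = j a \<otimes>\<^bsub>TT\<^esub> \<iota> (\<Lambda> l t)" if "a \<in> carrier A" "t \<in> carrier TT" for a t
    unfolding M_def by (rule W.lift_tens[OF T.is_cring bal that])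
  \<comment> \<open>\<open>M\<close> is linear over the functions of (g2, x0): these can be pulled
    out, and \<Lambda>_l meets only the factor depending on g1. This is where
    \<open>K\<close>-linearity of \<Lambda>_l is used, because K is shared by both
    variables.\<close>
  have M\<eta>: "M (\<eta> t \<otimes>\<^bsub>?W\<^esub> in1 c) = t \<otimes>\<^bsub>TT\<^esub> \<iota> (\<Lambda> l c)" if t: "t \<in> carrier TT" and c: "c \<in> carrier TT" for t c
  proof (rule AM.additive_ext[OF _ _ t])
    have ic: "in1 c \<in> carrier ?W" using c ring_hom_closed[OF in1] by simp
    show "additive_map TT TT (\<lambda>t. M (\<eta> t \<otimes>\<^bsub>?W\<^esub> in1 c))"
      by (rule additive_mapI)
        (simp_all add: MD ic ring_hom_closed[OF \<eta>h] ring_hom_add[OF \<eta>h] WR.l_distr)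
    show "additive_map TT TT (\<lambda>t. t \<otimes>\<^bsub>TT\<^esub> \<iota> (\<Lambda> l c))"
      by (rule additive_mapI) (simp_all add: \<Lambda>l(2)[OF c] T.l_distr)
    fix a x assume a: "a \<in> carrier A" and x: "x \<in> carrier K"
    have "\<eta> (tens k A K a x) = g2 a \<otimes>\<^bsub>?W\<^esub> x0 x"
      using AM.tens_inl_inr[OF a x] ring_hom_mult[OF \<eta>h, of "j a" "\<iota> x"] a x \<eta>(2,3) by simp
    also have "\<dots> = tens k A TT a (\<iota> x)"
      using a x by (simp add: g2_def x0_def in1_def W.tens_mult)
    finally have "\<eta> (tens k A K a x) \<otimes>\<^bsub>?W\<^esub> in1 c = tens k A TT a (\<iota> x \<otimes>\<^bsub>TT\<^esub> c)"
      using a x c by (simp add: in1_def W.tens_mult)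
    then have "M (\<eta> (tens k A K a x) \<otimes>\<^bsub>?W\<^esub> in1 c) = j a \<otimes>\<^bsub>TT\<^esub> \<iota> (x \<otimes>\<^bsub>K\<^esub> \<Lambda> l c)"
      using a x c by (simp add: Mt \<Lambda>l(4))
    also have "\<dots> = (j a \<otimes>\<^bsub>TT\<^esub> \<iota> x) \<otimes>\<^bsub>TT\<^esub> \<iota> (\<Lambda> l c)"
      using a x \<Lambda>l(2)[OF c] by (simp add: ring_hom_mult[OF \<iota>_hom] T.m_assoc)
    also have "j a \<otimes>\<^bsub>TT\<^esub> \<iota> x = tens k A K a x" using AM.tens_inl_inr[OF a x] by simp
    finally show "M (\<eta> (tens k A K a x) \<otimes>\<^bsub>?W\<^esub> in1 c) = tens k A K a x \<otimes>\<^bsub>TT\<^esub> \<iota> (\<Lambda> l c)" .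
  qed
  have Min1: "M (in1 c) = \<iota> (\<Lambda> l c)" if "c \<in> carrier TT" for c
    using M\<eta>[OF T.one_closed that] \<Lambda>l(2)[OF that] ring_hom_one[OF \<eta>h] ring_hom_closed[OF in1 that] by simp
  have uc: "\<Lambda> i (\<rho> s) \<in> carrier K" if "i < n" for i using klinD(2)[OF \<Lambda>[OF that]] s by simp
  have "in1 (\<rho> s) = F (\<Oplus>\<^bsub>TT\<^esub>i\<in>{..<n}. \<iota> (\<Lambda> i (\<rho> s)) \<otimes>\<^bsub>TT\<^esub> \<rho> (y i))"
    using F\<rho>[OF s] ex[OF s] by simp
  also have "\<dots> = (\<Oplus>\<^bsub>?W\<^esub>i\<in>{..<n}. F (\<iota> (\<Lambda> i (\<rho> s)) \<otimes>\<^bsub>TT\<^esub> \<rho> (y i)))"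
    by (rule additive_map_finsum[OF T.abelian_group_axioms WR.abelian_group_axioms ring_hom_additive[OF Fh]])
      (use uc y in auto)
  finally have "M (in1 (\<rho> s)) = M (\<Oplus>\<^bsub>?W\<^esub>i\<in>{..<n}. F (\<iota> (\<Lambda> i (\<rho> s)) \<otimes>\<^bsub>TT\<^esub> \<rho> (y i)))" by simp
  also have "\<dots> = (\<Oplus>\<^bsub>TT\<^esub>i\<in>{..<n}. M (F (\<iota> (\<Lambda> i (\<rho> s)) \<otimes>\<^bsub>TT\<^esub> \<rho> (y i))))"
    by (rule additive_map_finsum[OF WR.abelian_group_axioms T.abelian_group_axioms Madd])
      (use uc y ring_hom_closed[OF Fh] in auto)
  also have "\<dots> = (\<Oplus>\<^bsub>TT\<^esub>i\<in>{..<n}. \<rho> (\<Lambda> i (\<rho> s)) \<otimes>\<^bsub>TT\<^esub> \<iota> (\<Lambda> l (\<rho> (y i))))"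
  proof (rule T.finsum_cong')
    fix i assume "i \<in> {..<n}"
    then have i: "i < n" by simp
    have "F (\<iota> (\<Lambda> i (\<rho> s)) \<otimes>\<^bsub>TT\<^esub> \<rho> (y i)) = \<eta> (\<rho> (\<Lambda> i (\<rho> s))) \<otimes>\<^bsub>?W\<^esub> in1 (\<rho> (y i))"
      using uc[OF i] y[OF i] by (simp add: ring_hom_mult[OF Fh] F(3) x1\<eta> F\<rho>)
    then show "M (F (\<iota> (\<Lambda> i (\<rho> s)) \<otimes>\<^bsub>TT\<^esub> \<rho> (y i))) = \<rho> (\<Lambda> i (\<rho> s)) \<otimes>\<^bsub>TT\<^esub> \<iota> (\<Lambda> l (\<rho> (y i)))"
      using M\<eta> uc[OF i] y[OF i] by simp
  qed (use uc y \<Lambda>l(2) in auto)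
  also have "\<dots> = \<rho> (\<Lambda> l (\<rho> s)) \<otimes>\<^bsub>TT\<^esub> \<iota> (\<Lambda> l (\<rho> (y l)))"
    by (rule T.finsum_single)
      (use l uc y \<Lambda>l(2) dual ring_hom_zero'[OF K.abelian_group_axioms T.abelian_group_axioms \<iota>_hom] in auto)
  also have "\<dots> = \<rho> (\<Lambda> l (\<rho> s))"
    using uc[OF l] dual[OF l l] ring_hom_one[OF \<iota>_hom] by simp
  finally show ?thesis
    using Min1[of "\<rho> s"] s uc[OF l] by (simp add: L_iff)
qed

text \<open>A basis \<open>y\<close> of \<open>K\<close> over \<open>L\<close> whose coordinate
  functions are \<Lambda>_i o \<rho>: biorthogonality gives independence, the last clause spanning.
  In particular \<open>K\<close> has degree \<open>n\<close> over \<open>L\<close>.\<close>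

definition galois_family where
  "galois_family n y \<Lambda> \<longleftrightarrow> (\<forall>i<n. y i \<in> carrier K \<and> klin (\<Lambda> i)) \<and>
    (\<forall>i<n. \<forall>l<n. \<Lambda> i (\<rho> (y l)) = (if i = l then \<one>\<^bsub>K\<^esub> else \<zero>\<^bsub>K\<^esub>)) \<and>
    (\<forall>i<n. \<forall>s \<in> carrier K. \<Lambda> i (\<rho> s) \<in> L) \<and>
    (\<forall>s \<in> carrier K. s = (\<Oplus>\<^bsub>K\<^esub>i\<in>{..<n::nat}. \<Lambda> i (\<rho> s) \<otimes>\<^bsub>K\<^esub> y i))"

lemma galois_familyD:
  assumes "galois_family n y \<Lambda>"
  shows "i < n \<Longrightarrow> y i \<in> carrier K" "i < n \<Longrightarrow> klin (\<Lambda> i)"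
    "i < n \<Longrightarrow> l < n \<Longrightarrow> \<Lambda> i (\<rho> (y l)) = (if i = l then \<one>\<^bsub>K\<^esub> else \<zero>\<^bsub>K\<^esub>)"
    "i < n \<Longrightarrow> s \<in> carrier K \<Longrightarrow> \<Lambda> i (\<rho> s) \<in> L"
    "s \<in> carrier K \<Longrightarrow> s = (\<Oplus>\<^bsub>K\<^esub>i\<in>{..<n}. \<Lambda> i (\<rho> s) \<otimes>\<^bsub>K\<^esub> y i)"
  using assms unfolding galois_family_def by blast+

text \<open>Evaluating the expansion of \<open>\<rho> s\<close> at the neutral element turns
  \<rho>(s) into s and \<iota>(c) into c, so it becomes an expansion of \<open>s\<close> itself; its
  coefficients are invariant by \<open>coefficients_invariant\<close>.\<close>

lemma galois_basis: "\<exists>n y \<Lambda>. galois_family n y \<Lambda>"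
proof -
  obtain n :: nat and y \<Lambda> where y\<Lambda>: "\<forall>i<n. y i \<in> carrier K \<and> klin (\<Lambda> i)"
    and dual0: "\<forall>i<n. \<forall>l<n. \<Lambda> i (\<rho> (y l)) = (if i = l then \<one>\<^bsub>K\<^esub> else \<zero>\<^bsub>K\<^esub>)"
    and ex0: "\<forall>s \<in> carrier K. \<rho> s = (\<Oplus>\<^bsub>TT\<^esub>i\<in>{..<n}. \<iota> (\<Lambda> i (\<rho> s)) \<otimes>\<^bsub>TT\<^esub> \<rho> (y i))"
    using galois_expansion by (elim exE conjE)
  have y: "y i \<in> carrier K" and \<Lambda>: "klin (\<Lambda> i)" if "i < n" for i using y\<Lambda> that by blast+
  note dual = dual0[rule_format] and ex = ex0[rule_format]
  note inv = coefficients_invariant[OF y \<Lambda> dual ex]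
  let ?\<epsilon> = "tensor_lift k A K K (\<lambda>a. counit A a \<odot>\<^bsub>K\<^esub> \<one>\<^bsub>K\<^esub>) (\<lambda>x. x)"
  have cu: "(\<lambda>a. counit A a \<odot>\<^bsub>K\<^esub> \<one>\<^bsub>K\<^esub>) \<in> hom_over k (rst (\<lambda>x. x)) A K"
    using hom_over_comp[OF alg_hom_hom_over[OF A_algebra hopf_algebraD(3)[OF hopf]] _ A_algebra, of "\<lambda>r. r \<odot>\<^bsub>K\<^esub> \<one>\<^bsub>K\<^esub>" K]
      alg_one_smult_hom[OF K_algebra] by (simp add: hom_over_def)
  note \<epsilon> = lift_C[OF K.is_cring cu ring_hom_id]
  note \<epsilon>h = hom_overD(1)[OF \<epsilon>(1), simplified]
  have "s = (\<Oplus>\<^bsub>K\<^esub>i\<in>{..<n}. \<Lambda> i (\<rho> s) \<otimes>\<^bsub>K\<^esub> y i)" if s: "s \<in> carrier K" for s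
  proof -
    have uc: "\<Lambda> i (\<rho> s) \<in> carrier K" if "i < n" for i using klinD(2)[OF \<Lambda>[OF that]] s by simp
    have "s = ?\<epsilon> (\<Oplus>\<^bsub>TT\<^esub>i\<in>{..<n}. \<iota> (\<Lambda> i (\<rho> s)) \<otimes>\<^bsub>TT\<^esub> \<rho> (y i))"
      using coactionD(3)[OF coact s] ex[OF s] by simp
    also have "\<dots> = (\<Oplus>\<^bsub>K\<^esub>i\<in>{..<n}. ?\<epsilon> (\<iota> (\<Lambda> i (\<rho> s)) \<otimes>\<^bsub>TT\<^esub> \<rho> (y i)))"
      by (rule additive_map_finsum[OF T.abelian_group_axioms K.abelian_group_axioms ring_hom_additive[OF \<epsilon>h]])
        (use uc y in auto)
    also have "\<dots> = (\<Oplus>\<^bsub>K\<^esub>i\<in>{..<n}. \<Lambda> i (\<rho> s) \<otimes>\<^bsub>K\<^esub> y i)"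
      by (rule K.finsum_cong')
        (use uc y in \<open>auto simp: ring_hom_mult[OF \<epsilon>h] \<epsilon>(3) coactionD(3)[OF coact]\<close>)
    finally show ?thesis .
  qed
  then have "galois_family n y \<Lambda>"
    unfolding galois_family_def using y \<Lambda> dual inv by blast
  then show ?thesis by blast
qed

section \<open>The orbit map on \<open>K \<otimes>\<^sub>L K\<close>\<close>

text \<open>\<open>L'\<close> is the field of invariants as a ring and \<open>Z0\<close> the tensor
  square of \<open>K\<close> over it. \<open>Z\<close> is the same ring viewed over \<open>K\<close>
  through the left factor.\<close>

abbreviation "L' \<equiv> K\<lparr>carrier := L\<rparr>"
abbreviation "K' \<equiv> self_alg K"
abbreviation "Z0 \<equiv> tensor L' K' K'"
abbreviation "Z \<equiv> self_tensor K L"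

text \<open>\<open>L\<close> is the equalizer of the ring maps \<rho> and \<iota>. For a nonzero
  invariant l, both maps send the inverse of l to an inverse of the same element.\<close>

lemma L_subfield: "subfield L K"
proof (rule K.subfieldI')
  show "subring L K"
    unfolding L_def by (rule K.equalizer_subring[OF T.ring_axioms \<rho>_ring_hom \<iota>_hom])
  fix l assume l: "l \<in> L - {\<zero>\<^bsub>K\<^esub>}"
  then have lK: "l \<in> carrier K" and eq: "\<rho> l = \<iota> l" and u: "l \<in> Units K"
    by (auto simp: L_iff K.field_Units)
  have iK: "inv\<^bsub>K\<^esub> l \<in> carrier K" using u by simp
  have "\<rho> (inv\<^bsub>K\<^esub> l) = \<rho> (inv\<^bsub>K\<^esub> l) \<otimes>\<^bsub>TT\<^esub> (\<iota> l \<otimes>\<^bsub>TT\<^esub> \<iota> (inv\<^bsub>K\<^esub> l))"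
    using lK iK u by (simp add: ring_hom_mult[OF \<iota>_hom, symmetric] ring_hom_one[OF \<iota>_hom])
  also have "\<dots> = (\<rho> (inv\<^bsub>K\<^esub> l) \<otimes>\<^bsub>TT\<^esub> \<rho> l) \<otimes>\<^bsub>TT\<^esub> \<iota> (inv\<^bsub>K\<^esub> l)"
    using lK iK by (simp add: T.m_assoc eq)
  also have "\<dots> = \<iota> (inv\<^bsub>K\<^esub> l)"
    using lK iK u by (simp add: ring_hom_mult[OF \<rho>_ring_hom, symmetric] ring_hom_one[OF \<rho>_ring_hom])
  finally show "inv\<^bsub>K\<^esub> l \<in> L" using iK by (simp add: L_iff)
qed

lemma L'_field: "field L'"
  by (rule K.subfield_iff(2)[OF L_subfield])

sublocale L': field L' by (rule L'_field)

lemma L'_incl: "(\<lambda>x. x) \<in> ring_hom L' K"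
  by (rule ring_hom_memI) (auto simp: L_iff)

lemma L'_minus: "x \<in> L \<Longrightarrow> y \<in> L \<Longrightarrow> x \<ominus>\<^bsub>L'\<^esub> y = x \<ominus>\<^bsub>K\<^esub> y"
  using ring_hom_minus[OF L'.is_cring K.is_cring L'_incl] by simp

lemma L'_finsum: "(\<And>i. i \<in> I \<Longrightarrow> f i \<in> L) \<Longrightarrow> (\<Oplus>\<^bsub>L'\<^esub>i\<in>I. f i) = (\<Oplus>\<^bsub>K\<^esub>i\<in>I. f i)"
  using additive_map_finsum[OF L'.abelian_group_axioms K.abelian_group_axioms ring_hom_additive[OF L'_incl], of f I]
  by (simp add: Pi_iff)

lemma L_closed: "x \<in> L \<Longrightarrow> x \<in> carrier K"
  by (simp add: L_iff)

lemma K'_algebra: "algebra L' K'"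
  by (rule alg_via_algebra[OF L'.is_cring K.is_cring L'_incl])

sublocale LL: algebra_pair L' K' K'
  by (intro algebra_pair.intro K'_algebra)

sublocale Z0: cring Z0 by (rule LL.T_cring)

definition "zl = t_inl L' K' K'"
definition "zr = t_inr L' K' K'"

lemma zl_hom: "zl \<in> ring_hom K Z0" and zr_hom: "zr \<in> ring_hom K Z0"
  using LL.inl_hom LL.inr_hom by (simp_all add: zl_def zr_def)

lemma zlr_closed [simp]: "x \<in> carrier K \<Longrightarrow> zl x \<in> carrier Z0" "x \<in> carrier K \<Longrightarrow> zr x \<in> carrier Z0"
  using ring_hom_closed[OF zl_hom] ring_hom_closed[OF zr_hom] by simp_all

lemma Z_simps [simp]: "carrier Z = carrier Z0" "monoid.mult Z = monoid.mult Z0" "one Z = one Z0"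
  "zero Z = zero Z0" "add Z = add Z0" "x \<odot>\<^bsub>Z\<^esub> t = zl x \<otimes>\<^bsub>Z0\<^esub> t"
  by (simp_all add: self_tensor_def Let_def zl_def)

lemma ring_hom_Z [simp]: "ring_hom Z Q = ring_hom Z0 Q" "ring_hom Q Z = ring_hom Q Z0"
  by (simp_all add: ring_hom_def)

lemma Z_algebra: "algebra K Z"
  unfolding self_tensor_def Let_def by (rule alg_via_algebra[OF K.is_cring Z0.is_cring zl_hom[unfolded zl_def]])

lemma Z_cring: "cring Z"
  using algebra.M_cring[OF Z_algebra] .

definition "Psi = tensor_lift L' K' K' C \<iota> \<rho>"

text \<open>By the definition of invariants \<rho> and \<iota> agree on \<open>L\<close>; this is
  what makes the orbit comorphism well defined on the tensor product over \<open>L\<close>.\<close>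

lemma \<iota>_over: "\<iota> \<in> hom_over L' \<iota> K' C" and \<rho>_over: "\<rho> \<in> hom_over L' \<iota> K' C"
  using \<iota>_hom \<rho>_ring_hom by (auto simp: hom_over_def L_iff)

lemma Psi_ring_hom: "Psi \<in> ring_hom Z0 TT"
  and Psi_zl: "x \<in> carrier K \<Longrightarrow> Psi (zl x) = \<iota> x"
  and Psi_zr: "x \<in> carrier K \<Longrightarrow> Psi (zr x) = \<rho> x"
  using LL.lift_hom_over[OF C_cring \<iota>_over \<rho>_over] unfolding Psi_def zl_def zr_def by (auto simp: hom_over_def)

lemma tens_zlr: "x \<in> carrier K \<Longrightarrow> y \<in> carrier K \<Longrightarrow> tens L' K' K' x y = zl x \<otimes>\<^bsub>Z0\<^esub> zr y"
  using LL.tens_inl_inr[of x y] by (simp add: zl_def zr_def)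

lemma Psi_tens: "x \<in> carrier K \<Longrightarrow> y \<in> carrier K \<Longrightarrow> Psi (tens L' K' K' x y) = \<iota> x \<otimes>\<^bsub>TT\<^esub> \<rho> y"
  using tens_zlr[of x y] by (simp add: ring_hom_mult[OF Psi_ring_hom] Psi_zl Psi_zr)

lemma Psi_closed [simp]: "z \<in> carrier Z0 \<Longrightarrow> Psi z \<in> carrier TT"
  by (rule ring_hom_closed[OF Psi_ring_hom])

lemma hom_ext_Z:
  assumes "h \<in> ring_hom Z0 Q" "h' \<in> ring_hom Z0 Q" "z \<in> carrier Z0"
    "\<And>x. x \<in> carrier K \<Longrightarrow> h (zl x) = h' (zl x)" "\<And>x. x \<in> carrier K \<Longrightarrow> h (zr x) = h' (zr x)"
  shows "h z = h' z"
  using LL.hom_ext[OF assms(1-3)] assms(4,5) by (simp add: zl_def zr_def)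

text \<open>A left inverse is c |-> sum of \<Lambda>_i(c) \<otimes> y_i. On the image of x \<otimes>
  s the sum consists of x \<Lambda>_i(\<rho> s) \<otimes> y_i; the scalars \<Lambda>_i(\<rho> s) lie
  in \<open>L\<close>, cross the tensor sign and reassemble \<open>s\<close>.\<close>

lemma Psi_inj: "inj_on Psi (carrier Z0)"
proof -
  obtain n y \<Lambda> where gf: "galois_family n y \<Lambda>" using galois_basis by blast
  note y = galois_familyD(1)[OF gf] and \<Lambda> = galois_familyD(2)[OF gf] and dual = galois_familyD(3)[OF gf]
    and inL = galois_familyD(4)[OF gf] and ex = galois_familyD(5)[OF gf]
  define \<Phi> where "\<Phi> c = (\<Oplus>\<^bsub>Z0\<^esub>i\<in>{..<n}. tens L' K' K' (\<Lambda> i c) (y i))" for c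
  have tc: "tens L' K' K' (\<Lambda> i c) (y i) \<in> carrier Z0" if "i < n" "c \<in> carrier TT" for i c
    using that y klinD(2)[OF \<Lambda>] LL.tens_closed by simp
  have "additive_map TT Z0 \<Phi>"
  proof (rule additive_mapI)
    fix c d assume cd: "c \<in> carrier TT" "d \<in> carrier TT"
    show "\<Phi> c \<in> carrier Z0" unfolding \<Phi>_def using tc cd by (auto intro!: Z0.finsum_closed)
    have "\<Phi> (c \<oplus>\<^bsub>TT\<^esub> d) = (\<Oplus>\<^bsub>Z0\<^esub>i\<in>{..<n}. tens L' K' K' (\<Lambda> i c) (y i) \<oplus>\<^bsub>Z0\<^esub> tens L' K' K' (\<Lambda> i d) (y i))"
      unfolding \<Phi>_def
      by (rule Z0.finsum_cong')
        (use tc cd y klinD(2,3)[OF \<Lambda>] LL.tens_add_l in auto)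
    also have "\<dots> = \<Phi> c \<oplus>\<^bsub>Z0\<^esub> \<Phi> d"
      unfolding \<Phi>_def by (rule Z0.finsum_addf) (use tc cd in auto)
    finally show "\<Phi> (c \<oplus>\<^bsub>TT\<^esub> d) = \<Phi> c \<oplus>\<^bsub>Z0\<^esub> \<Phi> d" .
  qed
  then have add: "additive_map Z0 Z0 (\<lambda>z. \<Phi> (Psi z))"
    by (rule additive_map_comp[OF ring_hom_additive[OF Psi_ring_hom]])
  have "\<Phi> (Psi z) = z" if z: "z \<in> carrier Z0" for z
  proof (rule LL.additive_ext[OF add additive_map_id z])
    fix x s assume "x \<in> carrier K'" "s \<in> carrier K'"
    then have x: "x \<in> carrier K" and s: "s \<in> carrier K" by simp_all
    have addr: "additive_map K Z0 (\<lambda>s. tens L' K' K' x s)"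
      by (rule additive_mapI) (use x LL.tens_closed LL.tens_add_r in simp_all)
    have sc: "\<Lambda> i (\<rho> s) \<in> carrier K" if "i < n" for i using inL[OF that s] L_closed by blast
    have "\<Phi> (Psi (tens L' K' K' x s)) = (\<Oplus>\<^bsub>Z0\<^esub>i\<in>{..<n}. tens L' K' K' x (\<Lambda> i (\<rho> s) \<otimes>\<^bsub>K\<^esub> y i))"
      unfolding \<Phi>_def
    proof (rule Z0.finsum_cong')
      fix i assume "i \<in> {..<n}"
      then have i: "i < n" by simp
      have "\<Lambda> i (Psi (tens L' K' K' x s)) = \<Lambda> i (\<rho> s) \<otimes>\<^bsub>K\<^esub> x"
        using x s sc[OF i] klinD(4)[OF \<Lambda>[OF i] x, of "\<rho> s"] by (simp add: Psi_tens K.m_comm)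
      moreover have "tens L' K' K' (\<Lambda> i (\<rho> s) \<otimes>\<^bsub>K\<^esub> x) (y i) = tens L' K' K' x (\<Lambda> i (\<rho> s) \<otimes>\<^bsub>K\<^esub> y i)"
        using LL.tens_smult_l[of "\<Lambda> i (\<rho> s)" x "y i"] LL.tens_smult_r[of "\<Lambda> i (\<rho> s)" x "y i"] inL[OF i s] x y[OF i]
        by simp
      ultimately show "tens L' K' K' (\<Lambda> i (Psi (tens L' K' K' x s))) (y i) = tens L' K' K' x (\<Lambda> i (\<rho> s) \<otimes>\<^bsub>K\<^esub> y i)"
        by simp
    qed (use x y sc LL.tens_closed in auto)
    also have "\<dots> = tens L' K' K' x (\<Oplus>\<^bsub>K\<^esub>i\<in>{..<n}. \<Lambda> i (\<rho> s) \<otimes>\<^bsub>K\<^esub> y i)"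
      by (rule additive_map_finsum[OF K.abelian_group_axioms Z0.abelian_group_axioms addr, symmetric])
        (use sc y in auto)
    finally show "\<Phi> (Psi (tens L' K' K' x s)) = tens L' K' K' x s" using ex[OF s] by simp
  qed
  then show ?thesis by (rule inj_on_inverseI)
qed

text \<open>The functional \<open>tr\<close> below is a nonzero \<open>L\<close>-linear form on the field \<open>K\<close>, so it makes \<open>K \<otimes>\<^sub>L K\<close> a
  Frobenius algebra over \<open>K\<close>; extending it to a \<open>K\<close>-linear form on \<open>O(G\<^sub>K)\<close> and contracting with
  dual bases gives the retraction.\<close>

lemma retraction:
  obtains \<pi> where "additive_map TT TT \<pi>"
    "\<And>z t. z \<in> carrier Z0 \<Longrightarrow> t \<in> carrier TT \<Longrightarrow> \<pi> (Psi z \<otimes>\<^bsub>TT\<^esub> t) = Psi z \<otimes>\<^bsub>TT\<^esub> \<pi> t"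
    "\<pi> \<one>\<^bsub>TT\<^esub> = \<one>\<^bsub>TT\<^esub>" "\<And>t. t \<in> carrier TT \<Longrightarrow> \<pi> t \<in> Psi ` carrier Z0"
proof -
  obtain n y \<Lambda> where gf: "galois_family n y \<Lambda>" using galois_basis by blast
  note y = galois_familyD(1)[OF gf] and \<Lambda> = galois_familyD(2)[OF gf] and dual = galois_familyD(3)[OF gf]
    and inL = galois_familyD(4)[OF gf] and ex = galois_familyD(5)[OF gf]
  have n: "0 < n"
  proof (rule ccontr)
    assume "\<not> 0 < n"
    then show False using ex[OF K.one_closed] by simp
  qed
  \<comment> \<open>Any of the forms would do; the index 0 exists because one is a nonempty
    combination of the \<open>y i\<close>.\<close>
  define \<Lambda>0 where "\<Lambda>0 = \<Lambda> 0"
  note \<Lambda>0 = klinD[OF \<Lambda>[OF n], folded \<Lambda>0_def]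
  define tr where "tr s = \<Lambda>0 (\<rho> s)" for s
  have trL: "tr s \<in> L" if "s \<in> carrier K" for s unfolding tr_def \<Lambda>0_def using inL[OF n that] .
  have trK [simp]: "tr s \<in> carrier K" if "s \<in> carrier K" for s using L_closed[OF trL[OF that]] .
  have tradd: "additive_map K K tr" unfolding tr_def
    by (rule additive_map_comp[OF ring_hom_additive[OF \<rho>_ring_hom] \<Lambda>0(1)])
  have trlin: "tr (l \<otimes>\<^bsub>K\<^esub> s) = l \<otimes>\<^bsub>K\<^esub> tr s" if "l \<in> L" "s \<in> carrier K" for l s
    unfolding tr_def using that \<Lambda>0(4)[of l "\<rho> s"] by (simp add: ring_hom_mult[OF \<rho>_ring_hom] L_iff)
  have trsum: "tr (\<Oplus>\<^bsub>K\<^esub>i\<in>I. c i \<otimes>\<^bsub>K\<^esub> t i) = (\<Oplus>\<^bsub>K\<^esub>i\<in>I. c i \<otimes>\<^bsub>K\<^esub> tr (t i))"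
    if "\<And>i. i \<in> I \<Longrightarrow> c i \<in> L" "\<And>i. i \<in> I \<Longrightarrow> t i \<in> carrier K" for I :: "nat set" and c t
  proof -
    have "tr (\<Oplus>\<^bsub>K\<^esub>i\<in>I. c i \<otimes>\<^bsub>K\<^esub> t i) = (\<Oplus>\<^bsub>K\<^esub>i\<in>I. tr (c i \<otimes>\<^bsub>K\<^esub> t i))"
      by (rule additive_map_finsum[OF K.abelian_group_axioms K.abelian_group_axioms tradd]) (use that L_closed in auto)
    also have "\<dots> = (\<Oplus>\<^bsub>K\<^esub>i\<in>I. c i \<otimes>\<^bsub>K\<^esub> tr (t i))"
      by (rule K.finsum_cong') (use that L_closed trlin in auto)
    finally show ?thesis .
  qed
  have sum_mult: "x \<otimes>\<^bsub>K\<^esub> (\<Oplus>\<^bsub>K\<^esub>i\<in>I. c i \<otimes>\<^bsub>K\<^esub> t i) = (\<Oplus>\<^bsub>K\<^esub>i\<in>I. c i \<otimes>\<^bsub>K\<^esub> (x \<otimes>\<^bsub>K\<^esub> t i))"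
    if "x \<in> carrier K" "finite I" "\<And>i. i \<in> I \<Longrightarrow> c i \<in> carrier K" "\<And>i. i \<in> I \<Longrightarrow> t i \<in> carrier K" for x I and c t :: "nat \<Rightarrow> 'm"
  proof -
    have "x \<otimes>\<^bsub>K\<^esub> (\<Oplus>\<^bsub>K\<^esub>i\<in>I. c i \<otimes>\<^bsub>K\<^esub> t i) = (\<Oplus>\<^bsub>K\<^esub>i\<in>I. x \<otimes>\<^bsub>K\<^esub> (c i \<otimes>\<^bsub>K\<^esub> t i))"
      by (rule K.finsum_rdistr) (use that in auto)
    also have "\<dots> = (\<Oplus>\<^bsub>K\<^esub>i\<in>I. c i \<otimes>\<^bsub>K\<^esub> (x \<otimes>\<^bsub>K\<^esub> t i))"
      by (rule K.finsum_cong') (use that K.m_lcomm in auto)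
    finally show ?thesis .
  qed
  \<comment> \<open>A nonzero \<open>r\<close> is invertible, so y_0 is a multiple of
    \<open>r\<close>; but \<open>tr\<close> of y_0 is one.\<close>
  have nondeg0: "r = \<zero>\<^bsub>K\<^esub>" if r: "r \<in> carrier K" and z: "\<And>x. x \<in> carrier K \<Longrightarrow> tr (x \<otimes>\<^bsub>K\<^esub> r) = \<zero>\<^bsub>K\<^esub>" for r
  proof (rule ccontr)
    assume "r \<noteq> \<zero>\<^bsub>K\<^esub>"
    then have u: "r \<in> Units K" using r K.field_Units by simp
    have "tr ((y 0 \<otimes>\<^bsub>K\<^esub> inv\<^bsub>K\<^esub> r) \<otimes>\<^bsub>K\<^esub> r) = \<zero>\<^bsub>K\<^esub>" using z u y[OF n] by simp
    moreover have "(y 0 \<otimes>\<^bsub>K\<^esub> inv\<^bsub>K\<^esub> r) \<otimes>\<^bsub>K\<^esub> r = y 0" using u r y[OF n] by (simp add: K.m_assoc)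
    ultimately show False using dual[OF n n] by (simp add: tr_def \<Lambda>0_def)
  qed
  have nondeg: "r = r'" if r: "r \<in> carrier K" "r' \<in> carrier K" and z: "\<And>x. x \<in> carrier K \<Longrightarrow> tr (x \<otimes>\<^bsub>K\<^esub> r) = tr (x \<otimes>\<^bsub>K\<^esub> r')" for r r'
  proof -
    have "r \<ominus>\<^bsub>K\<^esub> r' = \<zero>\<^bsub>K\<^esub>"
    proof (rule nondeg0)
      fix x assume x: "x \<in> carrier K"
      have "x \<otimes>\<^bsub>K\<^esub> (r \<ominus>\<^bsub>K\<^esub> r') = x \<otimes>\<^bsub>K\<^esub> r \<ominus>\<^bsub>K\<^esub> x \<otimes>\<^bsub>K\<^esub> r'" using x r by algebra
      then have "tr (x \<otimes>\<^bsub>K\<^esub> (r \<ominus>\<^bsub>K\<^esub> r')) = tr (x \<otimes>\<^bsub>K\<^esub> r) \<ominus>\<^bsub>K\<^esub> tr (x \<otimes>\<^bsub>K\<^esub> r')"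
        using additive_map_minus[OF K.abelian_group_axioms K.abelian_group_axioms tradd] x r by simp
      then show "tr (x \<otimes>\<^bsub>K\<^esub> (r \<ominus>\<^bsub>K\<^esub> r')) = \<zero>\<^bsub>K\<^esub>" using z[OF x] x r by (simp add: K.minus_eq K.r_neg)
    qed (use r in simp)
    then show ?thesis using r K.r_right_minus_eq by blast
  qed
  \<comment> \<open>The rows are the functions tr(y_j s). Keeping to functions of the form tr(w s)
    makes the factorization over \<open>L\<close> return elements \<open>w i\<close> that are dual
    to the pivots \<open>v i\<close> for the form (x, y) |-> tr(x y).\<close>
  define U where "U = {u. \<exists>w \<in> carrier K. \<forall>s \<in> carrier K. u s = tr (w \<otimes>\<^bsub>K\<^esub> s)}"
  have "\<exists>(m::nat) v u. (\<forall>i<m. v i \<in> carrier K \<and> u i \<in> U) \<and>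
    (\<forall>i<m. \<forall>l<m. u i (v l) = (if i = l then \<one>\<^bsub>L'\<^esub> else \<zero>\<^bsub>L'\<^esub>)) \<and>
    (\<forall>j \<in> {..<n}. \<forall>s \<in> carrier K. tr (y j \<otimes>\<^bsub>K\<^esub> s) = (\<Oplus>\<^bsub>L'\<^esub>i\<in>{..<m}. u i s \<otimes>\<^bsub>L'\<^esub> tr (y j \<otimes>\<^bsub>K\<^esub> v i)))"
  proof (rule rank_factorization[OF L'_field])
    fix u s assume "u \<in> U" "s \<in> carrier K"
    then show "u s \<in> carrier L'" using trL by (auto simp: U_def)
  next
    fix u v assume "u \<in> U" "\<And>s. s \<in> carrier K \<Longrightarrow> v s = u s"
    then show "v \<in> U" by (auto simp: U_def)
  next
    fix u c assume u: "u \<in> U" and c: "c \<in> carrier L'"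
    then obtain w where w: "w \<in> carrier K" "\<forall>s \<in> carrier K. u s = tr (w \<otimes>\<^bsub>K\<^esub> s)" by (auto simp: U_def)
    have "c \<otimes>\<^bsub>K\<^esub> u s = tr ((c \<otimes>\<^bsub>K\<^esub> w) \<otimes>\<^bsub>K\<^esub> s)" if "s \<in> carrier K" for s
      using w c that L_closed[of c] trlin[of c "w \<otimes>\<^bsub>K\<^esub> s"] by (simp add: K.m_assoc)
    then show "(\<lambda>s. c \<otimes>\<^bsub>L'\<^esub> u s) \<in> U"
      unfolding U_def using w c L_closed[of c] by (intro CollectI bexI[of _ "c \<otimes>\<^bsub>K\<^esub> w"]) simp_all
  next
    fix u v c assume u: "u \<in> U" and v: "v \<in> U" and c: "c \<in> carrier L'"
    then obtain w w' where w: "w \<in> carrier K" "\<forall>s \<in> carrier K. u s = tr (w \<otimes>\<^bsub>K\<^esub> s)"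
      and w': "w' \<in> carrier K" "\<forall>s \<in> carrier K. v s = tr (w' \<otimes>\<^bsub>K\<^esub> s)" by (auto simp: U_def)
    have cK: "c \<in> carrier K" using c L_closed by simp
    have "u s \<ominus>\<^bsub>L'\<^esub> c \<otimes>\<^bsub>L'\<^esub> v s = tr ((w \<ominus>\<^bsub>K\<^esub> c \<otimes>\<^bsub>K\<^esub> w') \<otimes>\<^bsub>K\<^esub> s)" if s: "s \<in> carrier K" for s
    proof -
      have "c \<otimes>\<^bsub>K\<^esub> v s = tr (c \<otimes>\<^bsub>K\<^esub> (w' \<otimes>\<^bsub>K\<^esub> s))" using w' c s trlin by simp
      moreover have "c \<otimes>\<^bsub>K\<^esub> (w' \<otimes>\<^bsub>K\<^esub> s) \<in> carrier K" "w \<otimes>\<^bsub>K\<^esub> s \<in> carrier K" using cK w w' s by auto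
      ultimately have "u s \<ominus>\<^bsub>L'\<^esub> c \<otimes>\<^bsub>L'\<^esub> v s = tr (w \<otimes>\<^bsub>K\<^esub> s \<ominus>\<^bsub>K\<^esub> c \<otimes>\<^bsub>K\<^esub> (w' \<otimes>\<^bsub>K\<^esub> s))"
        using w(2) s trL L'_minus[of "tr (w \<otimes>\<^bsub>K\<^esub> s)" "tr (c \<otimes>\<^bsub>K\<^esub> (w' \<otimes>\<^bsub>K\<^esub> s))"]
          additive_map_minus[OF K.abelian_group_axioms K.abelian_group_axioms tradd, of "w \<otimes>\<^bsub>K\<^esub> s" "c \<otimes>\<^bsub>K\<^esub> (w' \<otimes>\<^bsub>K\<^esub> s)"]
        by simp
      also have "w \<otimes>\<^bsub>K\<^esub> s \<ominus>\<^bsub>K\<^esub> c \<otimes>\<^bsub>K\<^esub> (w' \<otimes>\<^bsub>K\<^esub> s) = (w \<ominus>\<^bsub>K\<^esub> c \<otimes>\<^bsub>K\<^esub> w') \<otimes>\<^bsub>K\<^esub> s"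
        using w(1) w'(1) cK s by algebra
      finally show ?thesis .
    qed
    then show "(\<lambda>s. u s \<ominus>\<^bsub>L'\<^esub> c \<otimes>\<^bsub>L'\<^esub> v s) \<in> U"
      unfolding U_def using w(1) w'(1) cK by (intro CollectI bexI[of _ "w \<ominus>\<^bsub>K\<^esub> c \<otimes>\<^bsub>K\<^esub> w'"]) simp_all
  next
    fix i assume "i \<in> {..<n}"
    then show "(\<lambda>s. tr (y i \<otimes>\<^bsub>K\<^esub> s)) \<in> U" unfolding U_def using y by blast
  qed simp
  then obtain m :: nat and v u where vu: "\<forall>i<m. v i \<in> carrier K \<and> u i \<in> U"
    and yu: "\<forall>j \<in> {..<n}. \<forall>s \<in> carrier K. tr (y j \<otimes>\<^bsub>K\<^esub> s) = (\<Oplus>\<^bsub>L'\<^esub>i\<in>{..<m}. u i s \<otimes>\<^bsub>L'\<^esub> tr (y j \<otimes>\<^bsub>K\<^esub> v i))"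
    by (elim exE conjE)
  have v [simp]: "v i \<in> carrier K" if "i < m" for i using vu that by blast
  have "\<forall>i. \<exists>w. i < m \<longrightarrow> w \<in> carrier K \<and> (\<forall>s \<in> carrier K. u i s = tr (w \<otimes>\<^bsub>K\<^esub> s))"
    using vu unfolding U_def by blast
  then obtain w where "\<forall>i. i < m \<longrightarrow> w i \<in> carrier K \<and> (\<forall>s \<in> carrier K. u i s = tr (w i \<otimes>\<^bsub>K\<^esub> s))"
    by (rule choice[THEN exE])
  then have w [simp]: "w i \<in> carrier K" and uw: "s \<in> carrier K \<Longrightarrow> u i s = tr (w i \<otimes>\<^bsub>K\<^esub> s)" if "i < m" for i s
    using that by blast+
  \<comment> \<open>By nondegeneracy it suffices to pair both sides with every \<open>x\<close>. For
    x = y_j this is the rank factorization, and the y_j span \<open>K\<close> over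
    \<open>L\<close>.\<close>
  have exv: "(\<Oplus>\<^bsub>K\<^esub>i\<in>{..<m}. tr (w i \<otimes>\<^bsub>K\<^esub> s) \<otimes>\<^bsub>K\<^esub> v i) = s" (is "?S = _") if s: "s \<in> carrier K" for s
  proof (rule nondeg)
    show SK: "?S \<in> carrier K" using s by (auto intro!: K.finsum_closed)
    have y1: "tr (y j \<otimes>\<^bsub>K\<^esub> ?S) = tr (y j \<otimes>\<^bsub>K\<^esub> s)" if j: "j < n" for j
    proof -
      have "y j \<otimes>\<^bsub>K\<^esub> ?S = (\<Oplus>\<^bsub>K\<^esub>i\<in>{..<m}. tr (w i \<otimes>\<^bsub>K\<^esub> s) \<otimes>\<^bsub>K\<^esub> (y j \<otimes>\<^bsub>K\<^esub> v i))"
        by (rule sum_mult) (use s y j in auto)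
      then have "tr (y j \<otimes>\<^bsub>K\<^esub> ?S) = (\<Oplus>\<^bsub>K\<^esub>i\<in>{..<m}. tr (w i \<otimes>\<^bsub>K\<^esub> s) \<otimes>\<^bsub>K\<^esub> tr (y j \<otimes>\<^bsub>K\<^esub> v i))"
        using trsum[of "{..<m}" "\<lambda>i. tr (w i \<otimes>\<^bsub>K\<^esub> s)" "\<lambda>i. y j \<otimes>\<^bsub>K\<^esub> v i"] trL s y[OF j] by simp
      also have "\<dots> = (\<Oplus>\<^bsub>K\<^esub>i\<in>{..<m}. u i s \<otimes>\<^bsub>K\<^esub> tr (y j \<otimes>\<^bsub>K\<^esub> v i))"
        by (rule K.finsum_cong') (use s y[OF j] uw in auto)
      also have "\<dots> = (\<Oplus>\<^bsub>L'\<^esub>i\<in>{..<m}. u i s \<otimes>\<^bsub>L'\<^esub> tr (y j \<otimes>\<^bsub>K\<^esub> v i))"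
        using L'_finsum[of "{..<m}" "\<lambda>i. u i s \<otimes>\<^bsub>L'\<^esub> tr (y j \<otimes>\<^bsub>K\<^esub> v i)"] L'.m_closed uw trL s y[OF j] by simp
      also have "\<dots> = tr (y j \<otimes>\<^bsub>K\<^esub> s)" using yu j s by simp
      finally show ?thesis .
    qed
    fix x assume x: "x \<in> carrier K"
    have "tr (x \<otimes>\<^bsub>K\<^esub> t) = (\<Oplus>\<^bsub>K\<^esub>i\<in>{..<n}. \<Lambda> i (\<rho> x) \<otimes>\<^bsub>K\<^esub> tr (y i \<otimes>\<^bsub>K\<^esub> t))" if t: "t \<in> carrier K" for t
    proof -
      have xc: "\<Lambda> i (\<rho> x) \<in> carrier K" if "i < n" for i using inL[OF that x] L_closed by blast
      have "x \<otimes>\<^bsub>K\<^esub> t = t \<otimes>\<^bsub>K\<^esub> (\<Oplus>\<^bsub>K\<^esub>i\<in>{..<n}. \<Lambda> i (\<rho> x) \<otimes>\<^bsub>K\<^esub> y i)" using x t K.m_comm ex[OF x] by simp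
      also have "\<dots> = (\<Oplus>\<^bsub>K\<^esub>i\<in>{..<n}. \<Lambda> i (\<rho> x) \<otimes>\<^bsub>K\<^esub> (t \<otimes>\<^bsub>K\<^esub> y i))"
        by (rule sum_mult) (use t xc y in auto)
      finally have "tr (x \<otimes>\<^bsub>K\<^esub> t) = (\<Oplus>\<^bsub>K\<^esub>i\<in>{..<n}. \<Lambda> i (\<rho> x) \<otimes>\<^bsub>K\<^esub> tr (t \<otimes>\<^bsub>K\<^esub> y i))"
        using trsum[of "{..<n}" "\<lambda>i. \<Lambda> i (\<rho> x)" "\<lambda>i. t \<otimes>\<^bsub>K\<^esub> y i"] inL x t y by simp
      also have "\<dots> = (\<Oplus>\<^bsub>K\<^esub>i\<in>{..<n}. \<Lambda> i (\<rho> x) \<otimes>\<^bsub>K\<^esub> tr (y i \<otimes>\<^bsub>K\<^esub> t))"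
        by (rule K.finsum_cong') (use t xc y K.m_comm in auto)
      finally show ?thesis .
    qed
    note eq = this
    have "(\<Oplus>\<^bsub>K\<^esub>i\<in>{..<n}. \<Lambda> i (\<rho> x) \<otimes>\<^bsub>K\<^esub> tr (y i \<otimes>\<^bsub>K\<^esub> ?S)) = (\<Oplus>\<^bsub>K\<^esub>i\<in>{..<n}. \<Lambda> i (\<rho> x) \<otimes>\<^bsub>K\<^esub> tr (y i \<otimes>\<^bsub>K\<^esub> s))"
      by (rule K.finsum_cong') (use y1 y s inL[OF _ x] L_closed in auto)
    then show "tr (x \<otimes>\<^bsub>K\<^esub> ?S) = tr (x \<otimes>\<^bsub>K\<^esub> s)" using eq[OF SK] eq[OF s] by simp
  qed (rule s)
  \<comment> \<open>The companion expansion with \<open>v\<close> and \<open>w\<close> exchanged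
    follows from the first because the form is symmetric.\<close>
  have exw: "(\<Oplus>\<^bsub>K\<^esub>i\<in>{..<m}. tr (s \<otimes>\<^bsub>K\<^esub> v i) \<otimes>\<^bsub>K\<^esub> w i) = s" (is "?S = _") if s: "s \<in> carrier K" for s
  proof (rule nondeg)
    show SK: "?S \<in> carrier K" using s by (auto intro!: K.finsum_closed)
    fix x assume x: "x \<in> carrier K"
    have "x \<otimes>\<^bsub>K\<^esub> ?S = (\<Oplus>\<^bsub>K\<^esub>i\<in>{..<m}. tr (s \<otimes>\<^bsub>K\<^esub> v i) \<otimes>\<^bsub>K\<^esub> (x \<otimes>\<^bsub>K\<^esub> w i))"
      by (rule sum_mult) (use x s in auto)
    then have "tr (x \<otimes>\<^bsub>K\<^esub> ?S) = (\<Oplus>\<^bsub>K\<^esub>i\<in>{..<m}. tr (s \<otimes>\<^bsub>K\<^esub> v i) \<otimes>\<^bsub>K\<^esub> tr (x \<otimes>\<^bsub>K\<^esub> w i))"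
      using trsum[of "{..<m}" "\<lambda>i. tr (s \<otimes>\<^bsub>K\<^esub> v i)" "\<lambda>i. x \<otimes>\<^bsub>K\<^esub> w i"] trL s x by simp
    also have "\<dots> = (\<Oplus>\<^bsub>K\<^esub>i\<in>{..<m}. tr (w i \<otimes>\<^bsub>K\<^esub> x) \<otimes>\<^bsub>K\<^esub> tr (s \<otimes>\<^bsub>K\<^esub> v i))"
      by (rule K.finsum_cong') (use x s K.m_comm in auto)
    also have "\<dots> = tr (\<Oplus>\<^bsub>K\<^esub>i\<in>{..<m}. tr (w i \<otimes>\<^bsub>K\<^esub> x) \<otimes>\<^bsub>K\<^esub> (s \<otimes>\<^bsub>K\<^esub> v i))"
      using trsum[of "{..<m}" "\<lambda>i. tr (w i \<otimes>\<^bsub>K\<^esub> x)" "\<lambda>i. s \<otimes>\<^bsub>K\<^esub> v i"] trL s x by simp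
    also have "(\<Oplus>\<^bsub>K\<^esub>i\<in>{..<m}. tr (w i \<otimes>\<^bsub>K\<^esub> x) \<otimes>\<^bsub>K\<^esub> (s \<otimes>\<^bsub>K\<^esub> v i)) = s \<otimes>\<^bsub>K\<^esub> (\<Oplus>\<^bsub>K\<^esub>i\<in>{..<m}. tr (w i \<otimes>\<^bsub>K\<^esub> x) \<otimes>\<^bsub>K\<^esub> v i)"
      by (rule sum_mult[symmetric]) (use x s in auto)
    finally show "tr (x \<otimes>\<^bsub>K\<^esub> ?S) = tr (x \<otimes>\<^bsub>K\<^esub> s)" using exv[OF x] x s K.m_comm by simp
  qed (rule s)
  have \<rho>sum: "\<rho> (\<Oplus>\<^bsub>K\<^esub>i\<in>{..<m}. c i \<otimes>\<^bsub>K\<^esub> t i) = (\<Oplus>\<^bsub>TT\<^esub>i\<in>{..<m}. \<iota> (c i) \<otimes>\<^bsub>TT\<^esub> \<rho> (t i))"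
    if "\<And>i. i < m \<Longrightarrow> c i \<in> L" "\<And>i. i < m \<Longrightarrow> t i \<in> carrier K" for c t
  proof -
    have "\<rho> (\<Oplus>\<^bsub>K\<^esub>i\<in>{..<m}. c i \<otimes>\<^bsub>K\<^esub> t i) = (\<Oplus>\<^bsub>TT\<^esub>i\<in>{..<m}. \<rho> (c i \<otimes>\<^bsub>K\<^esub> t i))"
      by (rule additive_map_finsum[OF K.abelian_group_axioms T.abelian_group_axioms ring_hom_additive[OF \<rho>_ring_hom]])
        (use that L_closed in auto)
    also have "\<dots> = (\<Oplus>\<^bsub>TT\<^esub>i\<in>{..<m}. \<iota> (c i) \<otimes>\<^bsub>TT\<^esub> \<rho> (t i))"
      by (rule T.finsum_cong') (use that L_iff in \<open>auto simp: ring_hom_mult[OF \<rho>_ring_hom]\<close>)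
    finally show ?thesis .
  qed
  \<comment> \<open>Contraction with the Casimir element of the form, the sum of w_i \<otimes> v_i,
    after multiplying the argument by \<rho>(w_i).\<close>
  define \<pi> where "\<pi> c = (\<Oplus>\<^bsub>TT\<^esub>i\<in>{..<m}. \<iota> (\<Lambda>0 (c \<otimes>\<^bsub>TT\<^esub> \<rho> (w i))) \<otimes>\<^bsub>TT\<^esub> \<rho> (v i))" for c
  have \<pi>t: "\<iota> (\<Lambda>0 (c \<otimes>\<^bsub>TT\<^esub> \<rho> (w i))) \<otimes>\<^bsub>TT\<^esub> \<rho> (v i) \<in> carrier TT" if "c \<in> carrier TT" "i < m" for c i
    using that \<Lambda>0(2) by simp
  have \<pi>c [simp]: "\<pi> c \<in> carrier TT" if "c \<in> carrier TT" for c
    unfolding \<pi>_def using \<pi>t[OF that] by (auto intro!: T.finsum_closed)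
  have \<pi>add: "additive_map TT TT \<pi>"
  proof (rule additive_mapI)
    fix c d assume c: "c \<in> carrier TT" and d: "d \<in> carrier TT"
    have "\<pi> (c \<oplus>\<^bsub>TT\<^esub> d) = (\<Oplus>\<^bsub>TT\<^esub>i\<in>{..<m}. \<iota> (\<Lambda>0 (c \<otimes>\<^bsub>TT\<^esub> \<rho> (w i))) \<otimes>\<^bsub>TT\<^esub> \<rho> (v i) \<oplus>\<^bsub>TT\<^esub> \<iota> (\<Lambda>0 (d \<otimes>\<^bsub>TT\<^esub> \<rho> (w i))) \<otimes>\<^bsub>TT\<^esub> \<rho> (v i))"
      unfolding \<pi>_def
      by (rule T.finsum_cong')
        (use c d \<Lambda>0(2,3) in \<open>auto simp: T.l_distr ring_hom_add[OF \<iota>_hom]\<close>)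
    also have "\<dots> = \<pi> c \<oplus>\<^bsub>TT\<^esub> \<pi> d" unfolding \<pi>_def by (rule T.finsum_addf) (use \<pi>t c d in auto)
    finally show "\<pi> (c \<oplus>\<^bsub>TT\<^esub> d) = \<pi> c \<oplus>\<^bsub>TT\<^esub> \<pi> d" .
  qed simp
  have \<pi>\<iota>: "\<pi> (\<iota> x \<otimes>\<^bsub>TT\<^esub> c) = \<iota> x \<otimes>\<^bsub>TT\<^esub> \<pi> c" if x: "x \<in> carrier K" and c: "c \<in> carrier TT" for x c
  proof -
    have "\<iota> x \<otimes>\<^bsub>TT\<^esub> \<pi> c = (\<Oplus>\<^bsub>TT\<^esub>i\<in>{..<m}. \<iota> x \<otimes>\<^bsub>TT\<^esub> (\<iota> (\<Lambda>0 (c \<otimes>\<^bsub>TT\<^esub> \<rho> (w i))) \<otimes>\<^bsub>TT\<^esub> \<rho> (v i)))"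
      unfolding \<pi>_def by (rule T.finsum_rdistr) (use x c \<pi>t in auto)
    also have "\<dots> = \<pi> (\<iota> x \<otimes>\<^bsub>TT\<^esub> c)"
      unfolding \<pi>_def
      by (rule T.finsum_cong')
        (use x c \<Lambda>0(2,4) in \<open>auto simp: T.m_assoc ring_hom_mult[OF \<iota>_hom]\<close>)
    finally show ?thesis by simp
  qed
  have \<pi>\<rho>: "\<pi> (\<rho> s \<otimes>\<^bsub>TT\<^esub> c) = \<rho> s \<otimes>\<^bsub>TT\<^esub> \<pi> c" if s: "s \<in> carrier K" and c: "c \<in> carrier TT" for s c
  proof -
    \<comment> \<open>One matrix describes multiplication by \<open>s\<close> in both families: w_i
      s is the sum over l of b_il w_l, and s v_l is the sum over i of b_il v_i. Its entries lie in
      \<open>L\<close>, so \<rho> acts on them as \<iota>, and moving the matrix from one family to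
      the other pulls \<open>\<rho> s\<close> out of \<pi>.\<close>
    let ?b = "\<lambda>i l. tr (w i \<otimes>\<^bsub>K\<^esub> s \<otimes>\<^bsub>K\<^esub> v l)"
    let ?d = "\<lambda>i. \<Lambda>0 (c \<otimes>\<^bsub>TT\<^esub> \<rho> (w i))"
    have b: "?b i l \<in> L" "?b i l \<in> carrier K" if "i < m" "l < m" for i l
      using that s trL by simp_all
    have d: "?d i \<in> carrier K" if "i < m" for i using that \<Lambda>0(2) c by simp
    have l: "\<Lambda>0 ((\<rho> s \<otimes>\<^bsub>TT\<^esub> c) \<otimes>\<^bsub>TT\<^esub> \<rho> (w i)) = (\<Oplus>\<^bsub>K\<^esub>l\<in>{..<m}. ?b i l \<otimes>\<^bsub>K\<^esub> ?d l)" if i: "i < m" for i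
    proof -
      have "(\<rho> s \<otimes>\<^bsub>TT\<^esub> c) \<otimes>\<^bsub>TT\<^esub> \<rho> (w i) = c \<otimes>\<^bsub>TT\<^esub> \<rho> (w i \<otimes>\<^bsub>K\<^esub> s)"
        using s c i by (simp add: ring_hom_mult[OF \<rho>_ring_hom] T.m_ac)
      also have "\<rho> (w i \<otimes>\<^bsub>K\<^esub> s) = \<rho> (\<Oplus>\<^bsub>K\<^esub>l\<in>{..<m}. ?b i l \<otimes>\<^bsub>K\<^esub> w l)"
        using exw[of "w i \<otimes>\<^bsub>K\<^esub> s"] i s by simp
      also have "\<dots> = (\<Oplus>\<^bsub>TT\<^esub>l\<in>{..<m}. \<iota> (?b i l) \<otimes>\<^bsub>TT\<^esub> \<rho> (w l))"
        by (rule \<rho>sum) (use b i in auto)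
      also have "c \<otimes>\<^bsub>TT\<^esub> \<dots> = (\<Oplus>\<^bsub>TT\<^esub>l\<in>{..<m}. c \<otimes>\<^bsub>TT\<^esub> (\<iota> (?b i l) \<otimes>\<^bsub>TT\<^esub> \<rho> (w l)))"
        by (rule T.finsum_rdistr) (use b i c in auto)
      also have "\<dots> = (\<Oplus>\<^bsub>TT\<^esub>l\<in>{..<m}. \<iota> (?b i l) \<otimes>\<^bsub>TT\<^esub> (c \<otimes>\<^bsub>TT\<^esub> \<rho> (w l)))"
        by (rule T.finsum_cong') (use b i c T.m_lcomm in auto)
      finally show ?thesis
        using klin_finsum[OF \<Lambda>[OF n], folded \<Lambda>0_def, of "{..<m}" "?b i" "\<lambda>l. c \<otimes>\<^bsub>TT\<^esub> \<rho> (w l)"] b i c by simp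
    qed
    have "\<pi> (\<rho> s \<otimes>\<^bsub>TT\<^esub> c) = (\<Oplus>\<^bsub>TT\<^esub>i\<in>{..<m}. \<Oplus>\<^bsub>TT\<^esub>l\<in>{..<m}. \<iota> (?b i l) \<otimes>\<^bsub>TT\<^esub> \<iota> (?d l) \<otimes>\<^bsub>TT\<^esub> \<rho> (v i))"
      unfolding \<pi>_def
    proof (rule T.finsum_cong')
      fix i assume "i \<in> {..<m}"
      then have i: "i < m" by simp
      have "\<iota> (\<Lambda>0 (\<rho> s \<otimes>\<^bsub>TT\<^esub> c \<otimes>\<^bsub>TT\<^esub> \<rho> (w i))) = (\<Oplus>\<^bsub>TT\<^esub>l\<in>{..<m}. \<iota> (?b i l \<otimes>\<^bsub>K\<^esub> ?d l))"
        unfolding l[OF i]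
        by (rule additive_map_finsum[OF K.abelian_group_axioms T.abelian_group_axioms ring_hom_additive[OF \<iota>_hom]])
          (use b d i in auto)
      then have "\<iota> (\<Lambda>0 (\<rho> s \<otimes>\<^bsub>TT\<^esub> c \<otimes>\<^bsub>TT\<^esub> \<rho> (w i))) \<otimes>\<^bsub>TT\<^esub> \<rho> (v i) = (\<Oplus>\<^bsub>TT\<^esub>l\<in>{..<m}. \<iota> (?b i l \<otimes>\<^bsub>K\<^esub> ?d l) \<otimes>\<^bsub>TT\<^esub> \<rho> (v i))"
        using T.finsum_ldistr[of "{..<m}" "\<rho> (v i)" "\<lambda>l. \<iota> (?b i l \<otimes>\<^bsub>K\<^esub> ?d l)"] b d i by simp
      also have "\<dots> = (\<Oplus>\<^bsub>TT\<^esub>l\<in>{..<m}. \<iota> (?b i l) \<otimes>\<^bsub>TT\<^esub> \<iota> (?d l) \<otimes>\<^bsub>TT\<^esub> \<rho> (v i))"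
        by (rule T.finsum_cong') (use b d i in \<open>auto simp: ring_hom_mult[OF \<iota>_hom]\<close>)
      finally show "\<iota> (\<Lambda>0 (\<rho> s \<otimes>\<^bsub>TT\<^esub> c \<otimes>\<^bsub>TT\<^esub> \<rho> (w i))) \<otimes>\<^bsub>TT\<^esub> \<rho> (v i) = \<dots>" .
    qed (use b d in \<open>auto intro!: T.finsum_closed\<close>)
    also have "\<dots> = (\<Oplus>\<^bsub>TT\<^esub>l\<in>{..<m}. \<Oplus>\<^bsub>TT\<^esub>i\<in>{..<m}. \<iota> (?b i l) \<otimes>\<^bsub>TT\<^esub> \<iota> (?d l) \<otimes>\<^bsub>TT\<^esub> \<rho> (v i))"
      by (rule T.finsum_swap) (use b d in auto)
    also have "\<dots> = (\<Oplus>\<^bsub>TT\<^esub>l\<in>{..<m}. \<rho> s \<otimes>\<^bsub>TT\<^esub> (\<iota> (?d l) \<otimes>\<^bsub>TT\<^esub> \<rho> (v l)))"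
    proof (rule T.finsum_cong')
      fix l assume "l \<in> {..<m}"
      then have l: "l < m" by simp
      have "(\<Oplus>\<^bsub>TT\<^esub>i\<in>{..<m}. \<iota> (?b i l) \<otimes>\<^bsub>TT\<^esub> \<iota> (?d l) \<otimes>\<^bsub>TT\<^esub> \<rho> (v i)) =
          (\<Oplus>\<^bsub>TT\<^esub>i\<in>{..<m}. \<iota> (?d l) \<otimes>\<^bsub>TT\<^esub> (\<iota> (?b i l) \<otimes>\<^bsub>TT\<^esub> \<rho> (v i)))"
        by (rule T.finsum_cong') (use b d l in \<open>auto simp: T.m_ac\<close>)
      also have "\<dots> = \<iota> (?d l) \<otimes>\<^bsub>TT\<^esub> (\<Oplus>\<^bsub>TT\<^esub>i\<in>{..<m}. \<iota> (?b i l) \<otimes>\<^bsub>TT\<^esub> \<rho> (v i))"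
        by (rule T.finsum_rdistr[symmetric]) (use b d l in auto)
      also have "(\<Oplus>\<^bsub>TT\<^esub>i\<in>{..<m}. \<iota> (?b i l) \<otimes>\<^bsub>TT\<^esub> \<rho> (v i)) = \<rho> (\<Oplus>\<^bsub>K\<^esub>i\<in>{..<m}. ?b i l \<otimes>\<^bsub>K\<^esub> v i)"
        by (rule \<rho>sum[symmetric]) (use b l in auto)
      also have "(\<Oplus>\<^bsub>K\<^esub>i\<in>{..<m}. ?b i l \<otimes>\<^bsub>K\<^esub> v i) = (\<Oplus>\<^bsub>K\<^esub>i\<in>{..<m}. tr (w i \<otimes>\<^bsub>K\<^esub> (s \<otimes>\<^bsub>K\<^esub> v l)) \<otimes>\<^bsub>K\<^esub> v i)"
        by (rule K.finsum_cong') (use s l in \<open>auto simp: K.m_assoc\<close>)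
      also have "\<dots> = s \<otimes>\<^bsub>K\<^esub> v l" using exv[of "s \<otimes>\<^bsub>K\<^esub> v l"] s l by simp
      finally show "(\<Oplus>\<^bsub>TT\<^esub>i\<in>{..<m}. \<iota> (?b i l) \<otimes>\<^bsub>TT\<^esub> \<iota> (?d l) \<otimes>\<^bsub>TT\<^esub> \<rho> (v i)) = \<rho> s \<otimes>\<^bsub>TT\<^esub> (\<iota> (?d l) \<otimes>\<^bsub>TT\<^esub> \<rho> (v l))"
        using s l d by (simp add: ring_hom_mult[OF \<rho>_ring_hom] T.m_ac)
    qed (use s d in auto)
    also have "\<dots> = \<rho> s \<otimes>\<^bsub>TT\<^esub> \<pi> c"
      unfolding \<pi>_def by (rule T.finsum_rdistr[symmetric]) (use s \<pi>t c in auto)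
    finally show ?thesis .
  qed
  show ?thesis
  proof (rule that[OF \<pi>add])
    fix z t assume z: "z \<in> carrier Z0" and t: "t \<in> carrier TT"
    note \<pi>D = additive_mapD[OF \<pi>add]
    show "\<pi> (Psi z \<otimes>\<^bsub>TT\<^esub> t) = Psi z \<otimes>\<^bsub>TT\<^esub> \<pi> t"
    proof (rule LL.additive_ext[OF _ _ z])
      show "additive_map Z0 TT (\<lambda>z. \<pi> (Psi z \<otimes>\<^bsub>TT\<^esub> t))"
        by (rule additive_mapI) (use t \<pi>D in \<open>simp_all add: ring_hom_add[OF Psi_ring_hom] T.l_distr\<close>)
      show "additive_map Z0 TT (\<lambda>z. Psi z \<otimes>\<^bsub>TT\<^esub> \<pi> t)"
        by (rule additive_mapI) (use t in \<open>simp_all add: ring_hom_add[OF Psi_ring_hom] T.l_distr\<close>)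
    qed (use t in \<open>simp add: Psi_tens T.m_assoc \<pi>\<iota> \<pi>\<rho>\<close>)
  next
    have "\<pi> \<one>\<^bsub>TT\<^esub> = (\<Oplus>\<^bsub>TT\<^esub>i\<in>{..<m}. \<iota> (tr (w i \<otimes>\<^bsub>K\<^esub> \<one>\<^bsub>K\<^esub>)) \<otimes>\<^bsub>TT\<^esub> \<rho> (v i))"
      unfolding \<pi>_def by (rule T.finsum_cong') (auto simp: tr_def \<Lambda>0(2))
    also have "\<dots> = \<rho> (\<Oplus>\<^bsub>K\<^esub>i\<in>{..<m}. tr (w i \<otimes>\<^bsub>K\<^esub> \<one>\<^bsub>K\<^esub>) \<otimes>\<^bsub>K\<^esub> v i)"
      by (rule \<rho>sum[symmetric]) (use trL in auto)
    also have "\<dots> = \<one>\<^bsub>TT\<^esub>" using exv[OF K.one_closed] ring_hom_one[OF \<rho>_ring_hom] by simp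
    finally show "\<pi> \<one>\<^bsub>TT\<^esub> = \<one>\<^bsub>TT\<^esub>" .
  next
    fix t assume t: "t \<in> carrier TT"
    \<comment> \<open>The formula for \<pi> read in K \<otimes> K before applying
      \<open>Psi\<close>.\<close>
    let ?z = "\<Oplus>\<^bsub>Z0\<^esub>i\<in>{..<m}. tens L' K' K' (\<Lambda>0 (t \<otimes>\<^bsub>TT\<^esub> \<rho> (w i))) (v i)"
    have dc: "\<Lambda>0 (t \<otimes>\<^bsub>TT\<^esub> \<rho> (w i)) \<in> carrier K" if "i < m" for i using \<Lambda>0(2) t that by simp
    have tc: "tens L' K' K' (\<Lambda>0 (t \<otimes>\<^bsub>TT\<^esub> \<rho> (w i))) (v i) \<in> carrier Z0" if "i < m" for i
      using LL.tens_closed dc that by simp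
    have "Psi ?z = (\<Oplus>\<^bsub>TT\<^esub>i\<in>{..<m}. Psi (tens L' K' K' (\<Lambda>0 (t \<otimes>\<^bsub>TT\<^esub> \<rho> (w i))) (v i)))"
      by (rule additive_map_finsum[OF Z0.abelian_group_axioms T.abelian_group_axioms ring_hom_additive[OF Psi_ring_hom]])
        (use tc in auto)
    also have "\<dots> = \<pi> t"
      unfolding \<pi>_def by (rule T.finsum_cong') (use dc in \<open>auto simp: Psi_tens\<close>)
    finally show "\<pi> t \<in> Psi ` carrier Z0"
      using tc by (intro image_eqI[of _ _ ?z]) (auto intro!: Z0.finsum_closed)
  qed
qed

section \<open>Tensor products of \<open>C\<close> and \<open>Z\<close> over
  \<open>K\<close>\<close>

declare C_simps(3) [simp del] Z_simps(3) [simp del]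

lemma smult_one_C: "x \<in> carrier K \<Longrightarrow> x \<odot>\<^bsub>C\<^esub> \<one>\<^bsub>C\<^esub> = \<iota> x"
  by (simp add: C_simps(3))

lemma smult_one_Z: "x \<in> carrier K \<Longrightarrow> x \<odot>\<^bsub>Z\<^esub> \<one>\<^bsub>Z\<^esub> = zl x"
  by (simp add: Z_simps(3))

abbreviation "T2 \<equiv> tensor K C C"

sublocale CC: algebra_pair K C C
  by (intro algebra_pair.intro C_algebra)

sublocale CZ: algebra_pair K C Z
  by (intro algebra_pair.intro C_algebra Z_algebra)

abbreviation "TZ \<equiv> tensor K C Z"
abbreviation "unit_map S \<equiv> (\<lambda>x. x \<odot>\<^bsub>S\<^esub> \<one>\<^bsub>S\<^esub>)"

lemma unit_map_hom: "algebra K S \<Longrightarrow> unit_map S \<in> ring_hom K S"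
  by (rule alg_one_smult_hom)

subsection \<open>Comultiplication\<close>

text \<open>The comultiplication of G_K is the product of the two tautological points of G with
  values in C \<otimes> C. \<open>tensor_cong\<close> absorbs the difference between
  \<open>C\<close> and the bare algebra named in \<open>base_change\<close>.\<close>

lemma comult_C: "comult C = tensor_lift k A K T2
    (act k A A (comult A) T2 (\<lambda>b. t_inl K C C (j b)) (\<lambda>b. t_inr K C C (j b))) (unit_map T2)"
proof -
  note eq = tensor_cong[of "alg_via \<iota> TT" C "alg_via \<iota> TT" C]
  have s: "smult (alg_via \<iota> TT) = smult C" by (intro ext) simp
  have t: "tensor K (alg_via \<iota> TT) (alg_via \<iota> TT) = T2"
    "tens K (alg_via \<iota> TT) (alg_via \<iota> TT) = tens K C C"
    by (rule eq; simp add: s C_simps(3))+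
  have o: "\<one>\<^bsub>alg_via \<iota> TT\<^esub> = \<one>\<^bsub>C\<^esub>" by (simp add: C_simps(3))
  have "comult C = tensor_lift k A K (tensor K (alg_via \<iota> TT) (alg_via \<iota> TT))
      (\<lambda>a. tensor_lift k A A (tensor K (alg_via \<iota> TT) (alg_via \<iota> TT))
        (\<lambda>b. t_inl K (alg_via \<iota> TT) (alg_via \<iota> TT) (j b)) (\<lambda>b. t_inr K (alg_via \<iota> TT) (alg_via \<iota> TT) (j b)) (comult A a))
      (unit_map (tensor K (alg_via \<iota> TT) (alg_via \<iota> TT)))"
    by (simp only: base_change_def Let_def module.defs hopf.simps)
  then show ?thesis unfolding t o by (simp only: act_def[abs_def])
qed

lemma g1: "(\<lambda>b. t_inl K C C (j b)) \<in> hom_over k (rst (unit_map T2)) A T2"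
  and g2: "(\<lambda>b. t_inr K C C (j b)) \<in> hom_over k (rst (unit_map T2)) A T2"
  by (rule point_of_hom[OF CC.inl_hom_over]) (rule point_of_hom[OF CC.inr_hom_over])

lemma comult_C_over: "comult C \<in> hom_over K (unit_map T2) C T2"
  and comult_C_j: "a \<in> carrier A \<Longrightarrow> comult C (j a) =
    act k A A (comult A) T2 (\<lambda>b. t_inl K C C (j b)) (\<lambda>b. t_inr K C C (j b)) a"
  and comult_C_\<iota>: "x \<in> carrier K \<Longrightarrow> comult C (\<iota> x) = x \<odot>\<^bsub>T2\<^esub> \<one>\<^bsub>T2\<^esub>"
  using lift_C[OF CC.T_cring act_hom_over[OF A_algebra A_algebra comult_hom CC.T_cring g1 g2]
      unit_map_hom[OF CC.T_algebra], folded comult_C] by blast+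

text \<open>The comultiplication of \<open>\<rho> y\<close> is the value of \<open>y\<close> at the point \<open>g\<^sub>1 \<cdot> (g\<^sub>2 \<cdot> x)\<close>.\<close>

lemma comult_C_\<rho>:
  assumes y: "y \<in> carrier K"
  shows "comult C (\<rho> y) =
    act k A K \<rho> T2 (\<lambda>b. t_inl K C C (j b)) (\<lambda>x. t_inr K C C (\<rho> x)) y"
proof -
  note s2 = base_point[OF unit_map_hom[OF CC.T_algebra]]
  have in2: "t_inr K C C \<in> ring_hom TT T2" using CC.inr_hom by simp
  have i: "t_inr K C C (\<iota> x) = x \<odot>\<^bsub>T2\<^esub> \<one>\<^bsub>T2\<^esub>" if "x \<in> carrier K" for x
    using hom_overD(2)[OF CC.inr_hom_over that] smult_one_C[OF that] by simp
  have "comult C (\<rho> y) = act k A K \<rho> T2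
      (act k A A (comult A) T2 (\<lambda>b. t_inl K C C (j b)) (\<lambda>b. t_inr K C C (j b))) (unit_map T2) y"
    by (rule hom_\<rho>[OF CC.T_cring _ y, symmetric])
      (use hom_overD(1)[OF comult_C_over] comult_C_j comult_C_\<iota> in auto)
  also have "\<dots> = act k A K \<rho> T2 (\<lambda>b. t_inl K C C (j b))
      (act k A K \<rho> T2 (\<lambda>b. t_inr K C C (j b)) (unit_map T2)) y"
    by (rule act_act[OF CC.T_cring g1 g2 s2 y])
  also have "\<dots> = act k A K \<rho> T2 (\<lambda>b. t_inl K C C (j b)) (\<lambda>x. t_inr K C C (\<rho> x)) y"
    by (rule act_cong[OF A_algebra K_algebra \<rho>_hom CC.T_cring g1
          act_hom_over[OF A_algebra K_algebra \<rho>_hom CC.T_cring g2 s2] refl _ y, symmetric])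
      (rule hom_\<rho>[OF CC.T_cring in2, symmetric], auto simp: i)
  finally show ?thesis .
qed

subsection \<open>The action on \<open>K \<otimes>\<^sub>L K\<close>\<close>

abbreviation "\<rho>Z \<equiv> self_tensor_coaction k A K \<rho> L"

lemma zl_eq_zr: "l \<in> L \<Longrightarrow> zl l = zr l"
  using hom_overD(2)[OF LL.inl_hom_over, of l] hom_overD(2)[OF LL.inr_hom_over, of l]
  by (simp add: zl_def zr_def L_iff)

lemma smult_one_k_L: "r \<in> carrier k \<Longrightarrow> r \<odot>\<^bsub>K\<^esub> \<one>\<^bsub>K\<^esub> \<in> L"
  by (simp add: L_iff \<rho>_smult_one)

lemma inr_zl: "x \<in> carrier K \<Longrightarrow> t_inr K C Z (zl x) = x \<odot>\<^bsub>TZ\<^esub> \<one>\<^bsub>TZ\<^esub>"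
  using hom_overD(2)[OF CZ.inr_hom_over] smult_one_Z by simp

lemma pZ1: "(\<lambda>b. t_inl K C Z (j b)) \<in> hom_over k (rst (unit_map TZ)) A TZ"
  by (rule point_of_hom[OF CZ.inl_hom_over])

lemma pZ2: "(\<lambda>c. t_inr K C Z (zr c)) \<in> hom_over k (rst (unit_map TZ)) K TZ"
proof (rule hom_overI)
  show "(\<lambda>c. t_inr K C Z (zr c)) \<in> ring_hom K TZ"
    using ring_hom_comp[OF zr_hom, of "t_inr K C Z"] CZ.inr_hom by simp
  fix r assume "r \<in> carrier k"
  then show "t_inr K C Z (zr (r \<odot>\<^bsub>K\<^esub> \<one>\<^bsub>K\<^esub>)) = (r \<odot>\<^bsub>K\<^esub> \<one>\<^bsub>K\<^esub>) \<odot>\<^bsub>TZ\<^esub> \<one>\<^bsub>TZ\<^esub>"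
    using zl_eq_zr[OF smult_one_k_L] inr_zl[OF one_k_closed] by simp
qed

text \<open>On the second factor the coaction is g . y, with g the tautological point of G_K and y
  the second projection; the first factor is left alone.\<close>

lemma \<rho>Z_eq: "\<rho>Z = tensor_lift L' K' K' TZ (unit_map TZ)
    (act k A K \<rho> TZ (\<lambda>b. t_inl K C Z (j b)) (\<lambda>c. t_inr K C Z (zr c)))"
  by (simp only: self_tensor_coaction_def Let_def act_def[abs_def] zr_def)

lemma \<rho>Z_facts:
  shows \<rho>Z_hom: "\<rho>Z \<in> ring_hom Z0 TZ"
    and \<rho>Z_zl: "x \<in> carrier K \<Longrightarrow> \<rho>Z (zl x) = x \<odot>\<^bsub>TZ\<^esub> \<one>\<^bsub>TZ\<^esub>"
    and \<rho>Z_zr: "y \<in> carrier K \<Longrightarrow> \<rho>Z (zr y) =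
      act k A K \<rho> TZ (\<lambda>b. t_inl K C Z (j b)) (\<lambda>c. t_inr K C Z (zr c)) y"
proof -
  note f2 = act_hom_over[OF A_algebra K_algebra \<rho>_hom CZ.T_cring pZ1 pZ2]
  let ?f2 = "act k A K \<rho> TZ (\<lambda>b. t_inl K C Z (j b)) (\<lambda>c. t_inr K C Z (zr c))"
  have a: "unit_map TZ \<in> hom_over L' (unit_map TZ) K' TZ"
    using unit_map_hom[OF CZ.T_algebra] by (auto simp: hom_over_def L_iff)
  \<comment> \<open>For invariant \<open>l\<close> the group point drops out because
    \<open>\<rho> l = \<iota> l\<close>. Hence the two maps agree on \<open>L\<close> and factor
    through the tensor product over \<open>L\<close>.\<close>
  have l: "?f2 l = l \<odot>\<^bsub>TZ\<^esub> \<one>\<^bsub>TZ\<^esub>" if "l \<in> L" for l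
  proof -
    have "?f2 l = tensor_lift k A K TZ (\<lambda>b. t_inl K C Z (j b)) (\<lambda>c. t_inr K C Z (zr c)) (\<iota> l)"
      using that by (simp add: act_def L_iff)
    also have "\<dots> = t_inr K C Z (zr l)"
      by (rule AM.lift_hom_over(3)[OF CZ.T_cring pZ1 pZ2 L_closed[OF that]])
    finally show ?thesis using inr_zl[OF L_closed[OF that]] zl_eq_zr[OF that] by simp
  qed
  have b: "?f2 \<in> hom_over L' (unit_map TZ) K' TZ"
    using hom_overD(1)[OF f2] l by (auto simp: hom_over_def L_iff)
  note r = LL.lift_hom_over[OF CZ.T_cring a b, folded \<rho>Z_eq]
  show "\<rho>Z \<in> ring_hom Z0 TZ" using hom_overD(1)[OF r(1)] .
  show "x \<in> carrier K \<Longrightarrow> \<rho>Z (zl x) = x \<odot>\<^bsub>TZ\<^esub> \<one>\<^bsub>TZ\<^esub>" "y \<in> carrier K \<Longrightarrow> \<rho>Z (zr y) = ?f2 y"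
    using r(2)[of x] r(3)[of y] by (simp_all add: zl_def zr_def)
qed

lemma hom_\<rho>Z_zr:
  assumes S: "cring S" and h: "h \<in> ring_hom TZ S" and y: "y \<in> carrier K"
  shows "h (\<rho>Z (zr y)) = act k A K \<rho> S (\<lambda>a. h (t_inl K C Z (j a))) (\<lambda>c. h (t_inr K C Z (zr c))) y"
  unfolding \<rho>Z_zr[OF y]
  by (rule act_natural[OF A_algebra K_algebra \<rho>_hom CZ.T_cring S pZ1 pZ2 h y])

abbreviation "zd \<equiv> diag_point K L"

lemma zd_facts:
  shows zd_hom: "zd \<in> ring_hom Z0 K" and zd_zl: "x \<in> carrier K \<Longrightarrow> zd (zl x) = x"
    and zd_zr: "x \<in> carrier K \<Longrightarrow> zd (zr x) = x"
proof -
  have i: "(\<lambda>x. x) \<in> hom_over L' (\<lambda>x. x) K' K" by (auto simp: hom_over_def L_iff ring_hom_id)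
  note r = LL.lift_hom_over[OF K.is_cring i i, folded diag_point_def]
  show "zd \<in> ring_hom Z0 K" using hom_overD(1)[OF r(1)] .
  show "x \<in> carrier K \<Longrightarrow> zd (zl x) = x" "x \<in> carrier K \<Longrightarrow> zd (zr x) = x"
    using r(2,3)[of x] by (simp_all add: zl_def zr_def)
qed

text \<open>At the diagonal point both copies of \<open>K\<close> take the same values, so g . z
  restricts to \<iota> on the first factor and to \<rho> on the second. This identifies the abstract
  orbit map with \<open>Psi\<close>.\<close>

lemma orbit_comorphism_eq:
  assumes m: "m \<in> carrier Z0"
  shows "orbit_comorphism K C Z \<rho>Z zd m = Psi m"
proof -
  have i: "(\<lambda>x. x) \<in> hom_over K \<iota> C C" by (simp add: hom_over_C ring_hom_id)
  have zd_closed: "zd x \<in> carrier K" if "x \<in> carrier Z0" for x using ring_hom_closed[OF zd_hom that] .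
  have w: "(\<lambda>x. zd x \<odot>\<^bsub>C\<^esub> \<one>\<^bsub>C\<^esub>) \<in> hom_over K \<iota> Z C"
  proof (rule hom_overI)
    have "(\<lambda>x. zd x \<odot>\<^bsub>C\<^esub> \<one>\<^bsub>C\<^esub>) \<in> ring_hom Z0 C"
      by (rule ring_hom_comp[OF zd_hom unit_map_hom[OF C_algebra]])
    then show "(\<lambda>x. zd x \<odot>\<^bsub>C\<^esub> \<one>\<^bsub>C\<^esub>) \<in> ring_hom Z C" by simp
    fix x assume "x \<in> carrier K"
    then show "zd (x \<odot>\<^bsub>Z\<^esub> \<one>\<^bsub>Z\<^esub>) \<odot>\<^bsub>C\<^esub> \<one>\<^bsub>C\<^esub> = \<iota> x"
      by (simp only: smult_one_Z zd_zl smult_one_C)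
  qed
  let ?l = "tensor_lift K C Z C (\<lambda>x. x) (\<lambda>x. zd x \<odot>\<^bsub>C\<^esub> \<one>\<^bsub>C\<^esub>)"
  note l = CZ.lift_hom_over[OF C_cring i w]
  have lh: "?l \<in> ring_hom TZ TT" using hom_overD(1)[OF l(1)] by simp
  have l2: "?l (t_inl K C Z c) = c" if "c \<in> carrier TT" for c using l(2) that by simp
  have l3: "?l (t_inr K C Z (zr y)) = \<iota> y" if "y \<in> carrier K" for y
    using l(3)[of "zr y"] that zd_zr[OF that] smult_one_C[OF that] by simp
  have "?l (\<rho>Z m) = Psi m"
  proof (rule hom_ext_Z[OF ring_hom_comp[OF \<rho>Z_hom lh] Psi_ring_hom m])
    fix x assume x: "x \<in> carrier K"
    show "?l (\<rho>Z (zl x)) = Psi (zl x)"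
      using hom_overD(2)[OF l(1) x] x by (simp add: \<rho>Z_zl Psi_zl)
    have "?l (\<rho>Z (zr x)) = act k A K \<rho> TT (\<lambda>a. ?l (t_inl K C Z (j a))) (\<lambda>c. ?l (t_inr K C Z (zr c))) x"
      by (rule hom_\<rho>Z_zr[OF T.is_cring lh x])
    also have "\<dots> = \<rho> x"
      by (rule hom_\<rho>[OF T.is_cring ring_hom_id x]) (simp_all only: l2 l3 j_closed)
    finally show "?l (\<rho>Z (zr x)) = Psi (zr x)" using x by (simp add: Psi_zr)
  qed
  then show ?thesis by (simp only: orbit_comorphism_def)
qed

subsection \<open>The stabilizer\<close>

abbreviation "J \<equiv> stabilizer_ideal K C Z \<rho>Z zd"

lemma J_gens: "{orbit_comorphism K C Z \<rho>Z zd m \<ominus>\<^bsub>C\<^esub> (zd m \<odot>\<^bsub>C\<^esub> \<one>\<^bsub>C\<^esub>) | m. m \<in> carrier Z}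
    = {Psi m \<ominus>\<^bsub>C\<^esub> \<iota> (zd m) | m. m \<in> carrier Z0}"
proof -
  have "orbit_comorphism K C Z \<rho>Z zd m \<ominus>\<^bsub>C\<^esub> (zd m \<odot>\<^bsub>C\<^esub> \<one>\<^bsub>C\<^esub>) = Psi m \<ominus>\<^bsub>C\<^esub> \<iota> (zd m)" if "m \<in> carrier Z0" for m
    using orbit_comorphism_eq[OF that] smult_one_C[OF ring_hom_closed[OF zd_hom that]] by simp
  then show ?thesis by force
qed

lemma J_eq: "J = Idl\<^bsub>C\<^esub> {Psi m \<ominus>\<^bsub>C\<^esub> \<iota> (zd m) | m. m \<in> carrier Z0}"
  by (simp only: stabilizer_ideal_def J_gens)

lemma gens_closed: "{Psi m \<ominus>\<^bsub>C\<^esub> \<iota> (zd m) | m. m \<in> carrier Z0} \<subseteq> carrier C"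
  using abelian_group.minus_closed[OF cring_ab[OF C_cring]] ring_hom_closed[OF zd_hom] by auto

lemma J_ideal: "ideal J C"
  unfolding J_eq by (rule ring.genideal_ideal[OF cring.axioms(1)[OF C_cring] gens_closed])

sublocale CJ: algebra_ideal K C J
  by (intro algebra_ideal.intro C_algebra J_ideal)

text \<open>The generator of the ideal belonging to 1 \<otimes> y: points of H fix the tautological
  point of Spec K.\<close>

lemma \<rho>_minus_\<iota>_J:
  assumes y: "y \<in> carrier K"
  shows "\<rho> y \<ominus>\<^bsub>C\<^esub> \<iota> y \<in> J"
proof -
  have "Psi (zr y) \<ominus>\<^bsub>C\<^esub> \<iota> (zd (zr y)) \<in> J"
    unfolding J_eq
    by (rule subsetD[OF ring.genideal_self[OF cring.axioms(1)[OF C_cring] gens_closed]])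
      (use y in \<open>intro CollectI exI[of _ "zr y"] conjI refl zlr_closed\<close>)
  then show ?thesis using y by (simp add: Psi_zr zd_zr)
qed

text \<open>The universal property of the stabilizer: a point of G_K that fixes the tautological
  point of Spec K factors through H. Agreement of \<rho> and \<iota> on \<open>K\<close> suffices
  because the two factors generate K \<otimes> K.\<close>

lemma J_vanish:
  assumes S: "cring S" and h: "h \<in> ring_hom TT S" and eq: "\<And>y. y \<in> carrier K \<Longrightarrow> h (\<rho> y) = h (\<iota> y)"
    and x: "x \<in> J"
  shows "h x = \<zero>\<^bsub>S\<^esub>"
proof -
  interpret S: cring S by fact
  have h': "h \<in> ring_hom C S" using h by simp
  have "h (Psi m) = h (\<iota> (zd m))" if m: "m \<in> carrier Z0" for m
    by (rule hom_ext_Z[OF ring_hom_comp[OF Psi_ring_hom h] ring_hom_comp[OF ring_hom_comp[OF zd_hom \<iota>_hom] h] m])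
      (simp_all add: Psi_zl Psi_zr zd_zl zd_zr eq)
  then have h0: "h (Psi m \<ominus>\<^bsub>C\<^esub> \<iota> (zd m)) = \<zero>\<^bsub>S\<^esub>" if m: "m \<in> carrier Z0" for m
    using ring_hom_minus[OF C_cring S h'] m ring_hom_closed[OF zd_hom m] ring_hom_closed[OF h]
    by (simp add: S.minus_eq S.r_neg)
  have "{Psi m \<ominus>\<^bsub>C\<^esub> \<iota> (zd m) | m. m \<in> carrier Z0} \<subseteq> a_kernel C S h"
  proof
    fix u assume u: "u \<in> {Psi m \<ominus>\<^bsub>C\<^esub> \<iota> (zd m) | m. m \<in> carrier Z0}"
    then obtain m where m: "m \<in> carrier Z0" "u = Psi m \<ominus>\<^bsub>C\<^esub> \<iota> (zd m)" by blast
    show "u \<in> a_kernel C S h"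
      unfolding a_kernel_def' using subsetD[OF gens_closed u] h0[OF m(1)] m(2) by simp
  qed
  moreover have "ideal (a_kernel C S h) C"
    by (rule ring_hom_ring.kernel_is_ideal[OF ring_hom_ringI2[OF cring.axioms(1)[OF C_cring] cring.axioms(1)[OF S] h']])
  ultimately have "J \<subseteq> a_kernel C S h"
    unfolding J_eq by (intro ring.genideal_minimal[OF cring.axioms(1)[OF C_cring]])
  then have "x \<in> a_kernel C S h" using x by blast
  then show ?thesis by (simp add: a_kernel_def')
qed

subsection \<open>The coset algebra\<close>

abbreviation "Q \<equiv> quot_alg C J"
abbreviation "pr \<equiv> (\<lambda>x. J +>\<^bsub>C\<^esub> x)"
abbreviation "TQ \<equiv> tensor K C Q"
abbreviation "N \<equiv> coset_alg K C J"

text \<open>The comorphism of the multiplication G_K x H -> G_K. A function is right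
  \<open>H\<close>-invariant when this agrees with its pullback along the first projection.\<close>

definition "shear = (\<lambda>a. tensor_map K C C C Q (\<lambda>x. x) pr (comult C a))"

lemma N_simps [simp]:
  "carrier N = {a \<in> carrier TT. shear a = t_inl K C Q a}"
  "monoid.mult N = monoid.mult TT" "one N = one C" "zero N = zero TT" "add N = add TT" "x \<odot>\<^bsub>N\<^esub> t = \<iota> x \<otimes>\<^bsub>TT\<^esub> t"
  by (simp_all add: coset_alg_def shear_def module.defs)

lemma pr_hom: "pr \<in> ring_hom TT Q"
  using CJ.class_hom by simp

lemma pr_\<rho>: "y \<in> carrier K \<Longrightarrow> pr (\<rho> y) = pr (\<iota> y)"
  using CJ.class_eq_iff[of "\<rho> y" "\<iota> y"] \<rho>_minus_\<iota>_J by simp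

lemma id_alg_hom: "(\<lambda>x. x) \<in> alg_hom K S S"
  by (simp add: alg_hom_def ring_hom_id)

lemma CQ_pair: "algebra_pair K C Q"
  by (intro algebra_pair.intro C_algebra CJ.Q_algebra)

lemma inlQ_over: "t_inl K C Q \<in> hom_over K (unit_map TQ) C TQ"
  by (rule algebra_pair.inl_hom_over[OF CQ_pair])

lemma inrQ_pr_over: "(\<lambda>x. t_inr K C Q (pr x)) \<in> hom_over K (unit_map TQ) C TQ"
proof (rule hom_overI)
  show "(\<lambda>x. t_inr K C Q (pr x)) \<in> ring_hom C TQ"
    using ring_hom_comp[OF pr_hom algebra_pair.inr_hom[OF CQ_pair]] by simp
  fix x assume x: "x \<in> carrier K"
  have "pr (x \<odot>\<^bsub>C\<^esub> \<one>\<^bsub>C\<^esub>) = x \<odot>\<^bsub>Q\<^esub> \<one>\<^bsub>Q\<^esub>"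
    using hom_overD(2)[OF alg_hom_hom_over[OF C_algebra CJ.class_alg_hom] x] .
  then show "t_inr K C Q (pr (x \<odot>\<^bsub>C\<^esub> \<one>\<^bsub>C\<^esub>)) = x \<odot>\<^bsub>TQ\<^esub> \<one>\<^bsub>TQ\<^esub>"
    using hom_overD(2)[OF algebra_pair.inr_hom_over[OF CQ_pair] x] by (simp only:)
qed

lemma inrQ_pr_\<iota>: "x \<in> carrier K \<Longrightarrow> t_inr K C Q (pr (\<iota> x)) = x \<odot>\<^bsub>TQ\<^esub> \<one>\<^bsub>TQ\<^esub>"
  using hom_overD(2)[OF inrQ_pr_over] smult_one_C by (simp only:)

lemma inlQ_\<iota>: "x \<in> carrier K \<Longrightarrow> t_inl K C Q (\<iota> x) = x \<odot>\<^bsub>TQ\<^esub> \<one>\<^bsub>TQ\<^esub>"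
  using hom_overD(2)[OF inlQ_over] smult_one_C by (simp only:)

lemma TQ_cring: "cring TQ"
  by (rule algebra_pair.T_cring[OF CQ_pair])

lemma TQ_algebra: "algebra K TQ"
  by (rule algebra_pair.T_algebra[OF CQ_pair])

abbreviation "hQ1 \<equiv> (\<lambda>b. t_inl K C Q (j b))"
abbreviation "hQ2 \<equiv> (\<lambda>b. t_inr K C Q (pr (j b)))"

lemma hQ1: "hQ1 \<in> hom_over k (rst (unit_map TQ)) A TQ"
  and hQ2: "hQ2 \<in> hom_over k (rst (unit_map TQ)) A TQ"
  by (rule point_of_hom[OF inlQ_over]) (rule point_of_hom[OF inrQ_pr_over])

lemma shear_hom: "shear \<in> ring_hom TT TQ"
  and shear_j: "a \<in> carrier A \<Longrightarrow> shear (j a) = act k A A (comult A) TQ hQ1 hQ2 a"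
  and shear_\<iota>: "x \<in> carrier K \<Longrightarrow> shear (\<iota> x) = x \<odot>\<^bsub>TQ\<^esub> \<one>\<^bsub>TQ\<^esub>"
proof -
  let ?m = "tensor_map K C C C Q (\<lambda>x. x) pr"
  note m = CC.tensor_map_alg_hom[OF C_algebra CJ.Q_algebra id_alg_hom CJ.class_alg_hom]
  have mh: "?m \<in> ring_hom T2 TQ" using alg_homD(1)[OF m(1)] .
  have c: "comult C \<in> ring_hom TT T2" using hom_overD(1)[OF comult_C_over] by simp
  show "shear \<in> ring_hom TT TQ"
    unfolding shear_def by (rule ring_hom_comp[OF c mh])
  show "shear (j a) = act k A A (comult A) TQ hQ1 hQ2 a" if a: "a \<in> carrier A"
  proof -
    have "shear (j a) = ?m (act k A A (comult A) T2 (\<lambda>b. t_inl K C C (j b)) (\<lambda>b. t_inr K C C (j b)) a)"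
      unfolding shear_def using comult_C_j[OF a] by (simp only:)
    also have "\<dots> = act k A A (comult A) TQ (\<lambda>b. ?m (t_inl K C C (j b))) (\<lambda>b. ?m (t_inr K C C (j b))) a"
      by (rule act_natural[OF A_algebra A_algebra comult_hom CC.T_cring TQ_cring g1 g2 mh a])
    also have "\<dots> = act k A A (comult A) TQ hQ1 hQ2 a"
      by (rule act_cong[OF A_algebra A_algebra comult_hom TQ_cring hQ1 hQ2 _ _ a])
        (rule m(2) m(3); simp)+
    finally show ?thesis .
  qed
  show "shear (\<iota> x) = x \<odot>\<^bsub>TQ\<^esub> \<one>\<^bsub>TQ\<^esub>" if x: "x \<in> carrier K"
    unfolding shear_def comult_C_\<iota>[OF x]
    by (rule hom_overD(2)[OF alg_hom_hom_over[OF CC.T_algebra m(1)] x])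
qed

text \<open>Functions of the orbit point g . x are right invariant, as (g h) . x = g . (h . x) and h
  fixes x modulo \<open>J\<close>.\<close>

lemma shear_Psi:
  assumes z: "z \<in> carrier Z0"
  shows "shear (Psi z) = t_inl K C Q (Psi z)"
proof -
  have il: "t_inl K C Q \<in> ring_hom TT TQ" using algebra_pair.inl_hom[OF CQ_pair] by simp
  have ir: "(\<lambda>x. t_inr K C Q (pr x)) \<in> ring_hom TT TQ" using hom_overD(1)[OF inrQ_pr_over] by simp
  have s: "unit_map TQ \<in> hom_over k (rst (unit_map TQ)) K TQ"
    by (rule base_point[OF unit_map_hom[OF TQ_algebra]])
  show ?thesis
  proof (rule hom_ext_Z[OF ring_hom_comp[OF Psi_ring_hom shear_hom] ring_hom_comp[OF Psi_ring_hom il] z])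
    fix x assume x: "x \<in> carrier K"
    show "shear (Psi (zl x)) = t_inl K C Q (Psi (zl x))"
      using x by (simp only: Psi_zl shear_\<iota> inlQ_\<iota>)
    have "shear (\<rho> x) = act k A K \<rho> TQ (act k A A (comult A) TQ hQ1 hQ2) (unit_map TQ) x"
      by (rule hom_\<rho>[OF TQ_cring shear_hom x, symmetric]) (simp_all only: shear_j shear_\<iota>)
    also have "\<dots> = act k A K \<rho> TQ hQ1 (act k A K \<rho> TQ hQ2 (unit_map TQ)) x"
      by (rule act_act[OF TQ_cring hQ1 hQ2 s x])
    also have "\<dots> = act k A K \<rho> TQ hQ1 (unit_map TQ) x"
    proof (rule act_cong[OF A_algebra K_algebra \<rho>_hom TQ_cring hQ1 s refl _ x])
      fix y assume y: "y \<in> carrier K"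
      have "act k A K \<rho> TQ hQ2 (unit_map TQ) y = t_inr K C Q (pr (\<rho> y))"
        by (rule hom_\<rho>[OF TQ_cring ir y]) (simp_all only: inrQ_pr_\<iota>)
      then show "act k A K \<rho> TQ hQ2 (unit_map TQ) y = y \<odot>\<^bsub>TQ\<^esub> \<one>\<^bsub>TQ\<^esub>"
        using y by (simp only: pr_\<rho> inrQ_pr_\<iota>)
    qed
    also have "\<dots> = t_inl K C Q (\<rho> x)"
      by (rule hom_\<rho>[OF TQ_cring il x]) (simp_all only: inlQ_\<iota>)
    finally show "shear (Psi (zr x)) = t_inl K C Q (Psi (zr x))" using x by (simp only: Psi_zr)
  qed
qed

text \<open>In \<open>E = C \<otimes> C\<close> over \<open>K \<otimes>\<^sub>L K\<close> an \<open>H\<close>-invariant function takes the same value at both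
  tautological points \<open>g\<^sub>1\<close>, \<open>g\<^sub>2\<close>, because \<open>g\<^sub>1\<^sup>-\<^sup>1 g\<^sub>2\<close> lies in \<open>H\<close>; the retraction onto the image of
  \<open>K \<otimes>\<^sub>L K\<close> then shows that the function lies in this image.\<close>

lemma invariant_in_range:
  assumes f: "f \<in> carrier TT" and inv: "shear f = t_inl K C Q f"
  shows "f \<in> Psi ` carrier Z0"
proof -
  \<comment> \<open>O(G_K) as an algebra over K \<otimes> K along the orbit comorphism, so that the
    tensor square below is the ring of pairs of group points with the same orbit point.\<close>
  define CP where "CP = alg_via Psi C"
  have CP: "carrier CP = carrier TT" "monoid.mult CP = monoid.mult TT" "one CP = one C" "add CP = add TT"
    "z \<odot>\<^bsub>CP\<^esub> c = Psi z \<otimes>\<^bsub>TT\<^esub> c" for z c by (simp_all add: CP_def)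
  have "algebra Z CP" unfolding CP_def
    by (rule alg_via_algebra[OF Z_cring C_cring]) (simp add: Psi_ring_hom)
  then interpret E: algebra_pair Z CP CP by (intro algebra_pair.intro)
  define E where "E = tensor Z CP CP"
  define El where "El = t_inl Z CP CP"
  define Er where "Er = t_inr Z CP CP"
  have rhCP: "ring_hom CP S = ring_hom TT S" for S by (simp add: ring_hom_def CP C_simps(3))
  have E_cring: "cring E" unfolding E_def by (rule E.T_cring)
  have Elh: "El \<in> ring_hom TT E" and Erh: "Er \<in> ring_hom TT E"
    using E.inl_hom E.inr_hom unfolding rhCP El_def Er_def E_def by auto
  have Psi1: "Psi z \<otimes>\<^bsub>TT\<^esub> \<one>\<^bsub>C\<^esub> = Psi z" if "z \<in> carrier Z0" for z
    using that by (simp add: C_simps(3))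
  \<comment> \<open>The two points of the pair have the same image in the orbit: this is exactly
    what tensoring over K \<otimes> K imposes.\<close>
  have ElEr: "El (Psi z) = Er (Psi z)" if "z \<in> carrier Z0" for z
    using hom_overD(2)[OF E.inl_hom_over, of z] hom_overD(2)[OF E.inr_hom_over, of z] that
    unfolding El_def Er_def CP Psi1[OF that] by simp
  define s where "s x = El (\<iota> x)" for x
  have s: "s \<in> ring_hom K E" unfolding s_def by (rule ring_hom_comp[OF \<iota>_hom Elh])
  have Er\<iota>: "Er (\<iota> x) = s x" if "x \<in> carrier K" for x
    using ElEr[of "zl x"] that by (simp add: Psi_zl s_def)
  have Er\<rho>: "Er (\<rho> x) = El (\<rho> x)" if "x \<in> carrier K" for x
    using ElEr[of "zr x"] that by (simp add: Psi_zr)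
  have Elo: "El \<in> hom_over K s C E" and Ero: "Er \<in> hom_over K s C E"
    using Elh Erh Er\<iota> by (auto simp: hom_over_C s_def)
  define p1 where "p1 = (\<lambda>a. El (j a))"
  define p2 where "p2 = (\<lambda>a. Er (j a))"
  have p1: "p1 \<in> hom_over k (rst s) A E" and p2: "p2 \<in> hom_over k (rst s) A E"
    unfolding p1_def p2_def by (rule point_of_hom[OF Elo], rule point_of_hom[OF Ero])
  note p1' = pinv_hom_over[OF hopf p1]
  note s' = base_point[OF s]
  interpret HA: algebra_coaction k A A "comult A"
    by (intro algebra_coaction.intro hopf A_algebra hopf_coaction)
  \<comment> \<open>The quotient p1^-1 p2 of the two tautological points.\<close>
  define h where "h = act k A A (comult A) E (pinv A p1) p2"
  have h: "h \<in> hom_over k (rst s) A E"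
    unfolding h_def by (rule act_hom_over[OF A_algebra A_algebra comult_hom E_cring p1' p2])
  define \<theta> where "\<theta> = tensor_lift k A K E h s"
  note \<theta> = lift_C[OF E_cring h s, folded \<theta>_def]
  have \<theta>h: "\<theta> \<in> ring_hom TT E" using hom_overD(1)[OF \<theta>(1)] by simp
  \<comment> \<open>p2 and p1 move the base point to the same place, so p1^-1 p2 fixes it.\<close>
  have \<theta>\<rho>: "\<theta> (\<rho> y) = \<theta> (\<iota> y)" if y: "y \<in> carrier K" for y
  proof -
    have "\<theta> (\<rho> y) = act k A K \<rho> E h s y"
      by (simp only: \<theta>_def act_def)
    also have "\<dots> = act k A K \<rho> E (pinv A p1) (act k A K \<rho> E p2 s) y"
      unfolding h_def by (rule act_act[OF E_cring p1' p2 s' y])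
    also have "\<dots> = act k A K \<rho> E (pinv A p1) (act k A K \<rho> E p1 s) y"
    proof (rule act_cong[OF A_algebra K_algebra \<rho>_hom E_cring p1'
          act_hom_over[OF A_algebra K_algebra \<rho>_hom E_cring p1 s'] refl _ y])
      fix x assume x: "x \<in> carrier K"
      have "act k A K \<rho> E p2 s x = Er (\<rho> x)"
        by (rule hom_\<rho>[OF E_cring Erh x]) (simp_all only: p2_def Er\<iota>)
      moreover have "act k A K \<rho> E p1 s x = El (\<rho> x)"
        by (rule hom_\<rho>[OF E_cring Elh x]) (simp_all only: p1_def s_def)
      ultimately show "act k A K \<rho> E p2 s x = act k A K \<rho> E p1 s x" using Er\<rho>[OF x] by simp
    qed
    also have "\<dots> = s y" by (rule act_inverse(1)[OF E_cring p1 s' y])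
    finally show ?thesis using \<theta>(3)[OF y] by simp
  qed
  have \<theta>h': "\<theta> \<in> ring_hom C E" using \<theta>h by simp
  \<comment> \<open>Since \<open>h\<close> fixes the base point, its comorphism kills
    \<open>J\<close>: it is a point of H.\<close>
  obtain \<theta>' where \<theta>'h: "\<theta>' \<in> ring_hom Q E" and \<theta>'0: "\<And>x. x \<in> carrier C \<Longrightarrow> \<theta>' (J +>\<^bsub>C\<^esub> x) = \<theta> x"
    using CJ.quot_lift[OF \<theta>h' E_cring J_vanish[OF E_cring \<theta>h \<theta>\<rho>]] by blast
  have \<theta>': "\<theta>' (pr x) = \<theta> x" if "x \<in> carrier TT" for x using \<theta>'0 that by simp
  have \<theta>'o: "\<theta>' \<in> hom_over K s Q E"
  proof (rule hom_overI[OF \<theta>'h])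
    fix x assume x: "x \<in> carrier K"
    have "x \<odot>\<^bsub>Q\<^esub> \<one>\<^bsub>Q\<^esub> = pr (\<iota> x)"
      using hom_overD(2)[OF alg_hom_hom_over[OF C_algebra CJ.class_alg_hom] x] smult_one_C[OF x] by (simp only:)
    then show "\<theta>' (x \<odot>\<^bsub>Q\<^esub> \<one>\<^bsub>Q\<^esub>) = s x" using \<theta>'[of "\<iota> x"] \<theta>(3)[OF x] x by (simp only: \<iota>_closed)
  qed
  \<comment> \<open>The point (p1, h) of G_K x H with values in \<open>E\<close>.\<close>
  define \<kappa> where "\<kappa> = tensor_lift K C Q E El \<theta>'"
  note \<kappa> = algebra_pair.lift_hom_over[OF CQ_pair E_cring Elo \<theta>'o, folded \<kappa>_def]
  have \<kappa>h: "\<kappa> \<in> ring_hom TQ E" using hom_overD(1)[OF \<kappa>(1)] .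
  \<comment> \<open>This says p1 (p1^-1 p2) = p2 in terms of comorphisms.\<close>
  have "Er c = \<kappa> (shear c)" if c: "c \<in> carrier TT" for c
  proof (rule AM.hom_ext[OF Erh ring_hom_comp[OF shear_hom \<kappa>h] c])
    fix a assume a: "a \<in> carrier A"
    have "\<kappa> (shear (j a)) = \<kappa> (act k A A (comult A) TQ hQ1 hQ2 a)"
      using shear_j[OF a] by (simp only:)
    also have "\<dots> = act k A A (comult A) E (\<lambda>b. \<kappa> (hQ1 b)) (\<lambda>b. \<kappa> (hQ2 b)) a"
      by (rule act_natural[OF A_algebra A_algebra comult_hom TQ_cring E_cring hQ1 hQ2 \<kappa>h a])
    also have "\<dots> = act k A A (comult A) E p1 h a"
    proof (rule act_cong[OF A_algebra A_algebra comult_hom E_cring p1 h _ _ a])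
      fix b assume b: "b \<in> carrier A"
      show "\<kappa> (hQ1 b) = p1 b" using \<kappa>(2)[of "j b"] b by (simp only: C_simps(1) j_closed p1_def)
      have "pr (j b) \<in> carrier Q" using ring_hom_closed[OF pr_hom] b by simp
      then show "\<kappa> (hQ2 b) = h b"
        using \<kappa>(3)[of "pr (j b)"] \<theta>'[of "j b"] \<theta>(2)[OF b] b by (simp only: j_closed)
    qed
    also have "\<dots> = p2 a" unfolding h_def by (rule HA.act_inverse(2)[OF E_cring p1 p2 a])
    finally show "Er (j a) = \<kappa> (shear (j a))" by (simp only: p2_def)
  next
    fix x assume x: "x \<in> carrier K"
    have "\<kappa> (shear (\<iota> x)) = s x"
      using hom_overD(2)[OF \<kappa>(1) x] shear_\<iota>[OF x] by (simp only:)
    then show "Er (\<iota> x) = \<kappa> (shear (\<iota> x))" using Er\<iota>[OF x] by (simp only:)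
  qed
  then have EE: "Er f = El f" using f inv \<kappa>(2)[of f] by (simp only: C_simps(1))
  obtain \<pi> where \<pi>add: "additive_map TT TT \<pi>"
    and \<pi>mult: "\<And>z t. z \<in> carrier Z0 \<Longrightarrow> t \<in> carrier TT \<Longrightarrow> \<pi> (Psi z \<otimes>\<^bsub>TT\<^esub> t) = Psi z \<otimes>\<^bsub>TT\<^esub> \<pi> t"
    and \<pi>1: "\<pi> \<one>\<^bsub>TT\<^esub> = \<one>\<^bsub>TT\<^esub>" and \<pi>r: "\<And>t. t \<in> carrier TT \<Longrightarrow> \<pi> t \<in> Psi ` carrier Z0"
    by (rule retraction) blast
  have bal: "balanced Z CP CP C \<pi> (\<lambda>x. x)"
    unfolding balanced_def
  proof (intro conjI ballI)
    show "additive_map CP C \<pi>" "additive_map CP C (\<lambda>x. x)"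
      using \<pi>add by (simp_all add: additive_map_def CP)
    fix z c d assume "z \<in> carrier Z" "c \<in> carrier CP" "d \<in> carrier CP"
    then have zcd: "z \<in> carrier Z0" "c \<in> carrier TT" "d \<in> carrier TT" by (simp_all add: CP)
    have "\<pi> (z \<odot>\<^bsub>CP\<^esub> c) \<otimes>\<^bsub>C\<^esub> d = (Psi z \<otimes>\<^bsub>TT\<^esub> \<pi> c) \<otimes>\<^bsub>TT\<^esub> d"
      using zcd by (simp add: CP \<pi>mult)
    also have "\<dots> = \<pi> c \<otimes>\<^bsub>C\<^esub> (z \<odot>\<^bsub>CP\<^esub> d)"
      using zcd additive_mapD(1)[OF \<pi>add zcd(2)] by (simp add: CP T.m_ac)
    finally show "\<pi> (z \<odot>\<^bsub>CP\<^esub> c) \<otimes>\<^bsub>C\<^esub> d = \<pi> c \<otimes>\<^bsub>C\<^esub> (z \<odot>\<^bsub>CP\<^esub> d)" .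
  qed
  \<comment> \<open>The contraction c \<otimes> d |-> \<pi>(c) d, well defined because \<pi> is
    linear over K \<otimes> K. It sends f \<otimes> 1 to \<pi>(f) and, as \<pi> fixes one, 1
    \<otimes> f to f.\<close>
  let ?R = "tensor_lift Z CP CP C \<pi> (\<lambda>x. x)"
  have R: "?R (tens Z CP CP c d) = \<pi> c \<otimes>\<^bsub>TT\<^esub> d" if "c \<in> carrier TT" "d \<in> carrier TT" for c d
    using E.lift_tens[OF C_cring bal, of c d] that by (simp add: CP)
  have "?R (El f) = \<pi> f" unfolding El_def using R[OF f, of "\<one>\<^bsub>TT\<^esub>"] additive_mapD(1)[OF \<pi>add f]
    by (simp add: CP C_simps(3))
  moreover have "?R (Er f) = f" unfolding Er_def using R[OF _ f, of "\<one>\<^bsub>TT\<^esub>"] f \<pi>1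
    by (simp add: CP C_simps(3))
  ultimately have "f = \<pi> f" using EE by simp
  then show ?thesis using \<pi>r[OF f] by simp
qed

section \<open>The coset algebra as an isomorphic copy of K \<otimes> K\<close>

lemma N_carrier: "carrier N = Psi ` carrier Z0"
  using invariant_in_range shear_Psi by auto

declare N_simps(1) [simp del]

lemma N_sub: "x \<in> carrier N \<Longrightarrow> x \<in> carrier TT"
  by (simp add: N_simps(1))

lemma N_algebra: "algebra K N"
proof -
  have sub: "subring (carrier N) TT"
  proof -
    have il: "t_inl K C Q \<in> ring_hom TT TQ" using algebra_pair.inl_hom[OF CQ_pair] by simp
    show ?thesis unfolding N_simps(1)
      by (rule T.equalizer_subring[OF cring.axioms(1)[OF TQ_cring] shear_hom il])
  qed
  note subE = subringE[OF sub]
  have "cring (TT\<lparr>carrier := carrier N\<rparr>)"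
    using T.subring_is_ring[OF sub] by (intro cring.intro comm_monoid.intro comm_monoid_axioms.intro)
      (auto simp: ring_def T.m_comm N_sub)
  then have "cring N"
    by (rule cring_cong) (simp_all add: C_simps(3))
  moreover have "\<iota> x \<otimes>\<^bsub>TT\<^esub> c \<in> carrier N" if "x \<in> carrier K" "c \<in> carrier N" for x c
  proof (rule subE(6)[OF _ that(2)])
    show "\<iota> x \<in> carrier N" unfolding N_carrier using Psi_zl[OF that(1)] that(1) by (intro image_eqI[of _ _ "zl x"]) simp_all
  qed
  ultimately show ?thesis
    by (intro algebraI K.is_cring)
      (simp_all add: N_sub T.l_distr T.r_distr T.m_assoc ring_hom_add[OF \<iota>_hom] ring_hom_mult[OF \<iota>_hom] ring_hom_one[OF \<iota>_hom])
qed

lemma Psi_alg_hom: "Psi \<in> alg_hom K Z N"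
proof -
  have "Psi \<in> ring_hom Z N"
    using Psi_ring_hom by (auto simp: ring_hom_def N_carrier C_simps(3) Z_simps(3))
  then show ?thesis
    by (simp add: alg_hom_def ring_hom_mult[OF Psi_ring_hom] Psi_zl)
qed

definition "Phi = the_inv_into (carrier Z0) Psi"

lemma Phi_Psi: "z \<in> carrier Z0 \<Longrightarrow> Phi (Psi z) = z"
  unfolding Phi_def by (rule the_inv_into_f_f[OF Psi_inj])

lemma Phi_closed: "n \<in> carrier N \<Longrightarrow> Phi n \<in> carrier Z0"
  and Psi_Phi: "n \<in> carrier N \<Longrightarrow> Psi (Phi n) = n"
  using Phi_Psi by (auto simp: N_carrier)

lemma Phi_alg_hom: "Phi \<in> alg_hom K N Z"
proof -
  note P = alg_homD[OF Psi_alg_hom]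
  have "Phi \<in> ring_hom N Z"
  proof (rule ring_hom_memI)
    show "Phi \<one>\<^bsub>N\<^esub> = \<one>\<^bsub>Z\<^esub>"
      using Phi_Psi[of "\<one>\<^bsub>Z0\<^esub>"] ring_hom_one[OF Psi_ring_hom] by (simp add: Z_simps(3) C_simps(3))
    fix x y assume "x \<in> carrier N" "y \<in> carrier N"
    then obtain z w where zw: "z \<in> carrier Z0" "w \<in> carrier Z0" "x = Psi z" "y = Psi w"
      by (auto simp: N_carrier)
    show "Phi (x \<otimes>\<^bsub>N\<^esub> y) = Phi x \<otimes>\<^bsub>Z\<^esub> Phi y"
      using zw Phi_Psi[of "z \<otimes>\<^bsub>Z0\<^esub> w"] by (simp add: Phi_Psi ring_hom_mult[OF Psi_ring_hom])
    show "Phi (x \<oplus>\<^bsub>N\<^esub> y) = Phi x \<oplus>\<^bsub>Z\<^esub> Phi y"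
      using zw Phi_Psi[of "z \<oplus>\<^bsub>Z0\<^esub> w"] by (simp add: Phi_Psi ring_hom_add[OF Psi_ring_hom])
  qed (simp add: Phi_closed)
  moreover have "Phi (x \<odot>\<^bsub>N\<^esub> c) = x \<odot>\<^bsub>Z\<^esub> Phi c" if "x \<in> carrier K" "c \<in> carrier N" for x c
  proof -
    have "c \<in> Psi ` carrier Z0" using that(2) by (simp only: N_carrier)
    then obtain z where z: "z \<in> carrier Z0" "c = Psi z" by blast
    then show ?thesis
      using that Phi_Psi[of "zl x \<otimes>\<^bsub>Z0\<^esub> z"] by (simp add: Phi_Psi ring_hom_mult[OF Psi_ring_hom] Psi_zl)
  qed
  ultimately show ?thesis by (simp add: alg_hom_def)
qed

subsection \<open>The action on the coset space\<close>

abbreviation "TN \<equiv> tensor K C N"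
abbreviation "\<tau> \<equiv> coset_coaction K C J"

lemma CN_pair: "algebra_pair K C N"
  by (intro algebra_pair.intro C_algebra N_algebra)

lemma incl_alg_hom: "(\<lambda>x. x) \<in> alg_hom K N C"
  by (auto simp: alg_hom_def ring_hom_def N_sub)

abbreviation "incl_map \<equiv> tensor_map K C N C C (\<lambda>x. x) (\<lambda>x. x)"

lemmas incl_map = algebra_pair.tensor_map_alg_hom[OF CN_pair C_algebra C_algebra id_alg_hom incl_alg_hom]

text \<open>A dual basis of O(G) over \<open>k\<close> gives one of \<open>C\<close> over
  \<open>K\<close>, and inclusion in the second factor does not change coordinates. The injectivity
  makes the definite description in \<open>coset_coaction\<close> unique.\<close>

lemma incl_map_inj: "inj_on incl_map (carrier TN)"
proof -
  interpret CN: algebra_pair K C N by (rule CN_pair)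
  obtain E :: "'a set" and e \<phi> where db: "dual_basis k A E e \<phi>"
    using finite_algebra_dual_basis[OF field_k fin] by blast
  let ?q = "tcoord k A K \<phi>"
  note D = dual_basisD[OF db]
  have qc: "?q i t \<in> carrier K" if "i \<in> E" "t \<in> carrier TT" for i t
    using additive_mapD(1)[OF AM.tcoord_additive[OF db that(1)] that(2)] .
  have db': "dual_basis K C E (\<lambda>i. j (e i)) ?q"
    unfolding dual_basis_def linear_map_def
  proof (intro conjI ballI)
    show "finite E" "(\<lambda>i. j (e i)) \<in> E \<rightarrow> carrier C" using D by auto
    fix i assume i: "i \<in> E"
    show "additive_map C (self_alg K) (?q i)"
      using AM.tcoord_additive[OF db i] by (simp add: additive_map_def)
    fix r t assume "r \<in> carrier K" "t \<in> carrier C"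
    then show "?q i (r \<odot>\<^bsub>C\<^esub> t) = r \<odot>\<^bsub>self_alg K\<^esub> ?q i t"
      using AM.tcoord_mult_inr[OF db i] by simp
  next
    fix t assume "t \<in> carrier C"
    then have t: "t \<in> carrier TT" by simp
    have "t = (\<Oplus>\<^bsub>TT\<^esub>i\<in>E. tens k A K (e i) (?q i t))" using AM.tcoord_expand[OF db t] by (rule sym)
    also have "\<dots> = (\<Oplus>\<^bsub>TT\<^esub>i\<in>E. ?q i t \<odot>\<^bsub>C\<^esub> j (e i))"
      by (rule T.finsum_cong') (use D qc t in \<open>auto simp: AM.tens_mult\<close>)
    also have "\<dots> = (\<Oplus>\<^bsub>C\<^esub>i\<in>E. ?q i t \<odot>\<^bsub>C\<^esub> j (e i))"
      by (rule additive_map_finsum[OF T.abelian_group_axioms cring_ab[OF C_cring]])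
        (use D qc t in \<open>auto simp: additive_map_id\<close>)
    finally show "t = (\<Oplus>\<^bsub>C\<^esub>i\<in>E. ?q i t \<odot>\<^bsub>C\<^esub> j (e i))" .
  qed
  have eq: "tcoord K C C ?q i (incl_map t) = tcoord K C N ?q i t" if i: "i \<in> E" and t: "t \<in> carrier TN" for i t
  proof (rule CN.additive_ext[OF _ _ t])
    show "additive_map TN C (\<lambda>t. tcoord K C C ?q i (incl_map t))"
      by (rule additive_map_comp[OF ring_hom_additive[OF alg_homD(1)[OF incl_map(1)]] CC.tcoord_additive[OF db' i]])
    show "additive_map TN C (tcoord K C N ?q i)"
      by (rule additive_map_comp[OF CN.tcoord_additive[OF db' i] ring_hom_additive[OF alg_homD(1)[OF incl_alg_hom]]])
    fix c d assume cd: "c \<in> carrier C" "d \<in> carrier N"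
    then have "d \<in> carrier C" using N_sub by simp
    then show "tcoord K C C ?q i (incl_map (tens K C N c d)) = tcoord K C N ?q i (tens K C N c d)"
      using cd by (simp only: incl_map(4) CC.tcoord_tens[OF db' i] CN.tcoord_tens[OF db' i] C_simps N_simps)
  qed
  show ?thesis
  proof (rule inj_onI)
    fix t t' assume "t \<in> carrier TN" "t' \<in> carrier TN" "incl_map t = incl_map t'"
    then show "t = t'" using CN.tcoord_eqI[OF db'] eq by metis
  qed
qed

abbreviation "Psi_map \<equiv> tensor_map K C Z C N (\<lambda>x. x) Psi"

lemmas Psi_map = CZ.tensor_map_alg_hom[OF C_algebra N_algebra id_alg_hom Psi_alg_hom]

text \<open>Equivariance of the orbit map. On the second copy of \<open>K\<close> both sides are the
  comorphism of g1 . (g2 . x), by \<open>comult_C_\<rho>\<close>; on the first copy both are the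
  structure map.\<close>

lemma incl_Psi_\<rho>Z:
  assumes z: "z \<in> carrier Z0"
  shows "incl_map (Psi_map (\<rho>Z z)) = comult C (Psi z)"
proof -
  let ?n = "\<lambda>t. incl_map (Psi_map t)"
  have nh: "?n \<in> ring_hom TZ T2"
    by (rule ring_hom_comp[OF alg_homD(1)[OF Psi_map(1)] alg_homD(1)[OF incl_map(1)]])
  have c: "comult C \<in> ring_hom TT T2" using hom_overD(1)[OF comult_C_over] by simp
  have n1: "?n (t_inl K C Z x) = t_inl K C C x" if "x \<in> carrier C" for x
    using Psi_map(2)[OF that] incl_map(2)[OF that] by (simp only:)
  have n2: "?n (t_inr K C Z w) = t_inr K C C (Psi w)" if w: "w \<in> carrier Z0" for w
  proof -
    have "Psi w \<in> carrier N" using w by (simp add: N_carrier)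
    then show ?thesis using Psi_map(3)[of w] incl_map(3)[of "Psi w"] w by (simp only: Z_simps(1))
  qed
  show ?thesis
  proof (rule hom_ext_Z[OF ring_hom_comp[OF \<rho>Z_hom nh] ring_hom_comp[OF Psi_ring_hom c] z])
    fix x assume x: "x \<in> carrier K"
    have "?n (x \<odot>\<^bsub>TZ\<^esub> \<one>\<^bsub>TZ\<^esub>) = x \<odot>\<^bsub>T2\<^esub> \<one>\<^bsub>T2\<^esub>"
      using hom_overD(2)[OF alg_hom_hom_over[OF CZ.T_algebra Psi_map(1)] x]
        hom_overD(2)[OF alg_hom_hom_over[OF algebra_pair.T_algebra[OF CN_pair] incl_map(1)] x] by (simp only:)
    then show "?n (\<rho>Z (zl x)) = comult C (Psi (zl x))"
      using x by (simp only: \<rho>Z_zl Psi_zl comult_C_\<iota>)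
    have in2: "(\<lambda>y. t_inr K C C (\<rho> y)) \<in> hom_over k (rst (unit_map T2)) K T2"
    proof (rule hom_overI)
      show "(\<lambda>y. t_inr K C C (\<rho> y)) \<in> ring_hom K T2"
        using ring_hom_comp[OF \<rho>_ring_hom, of "t_inr K C C"] CC.inr_hom by simp
      fix r assume r: "r \<in> carrier k"
      show "t_inr K C C (\<rho> (r \<odot>\<^bsub>K\<^esub> \<one>\<^bsub>K\<^esub>)) = (r \<odot>\<^bsub>K\<^esub> \<one>\<^bsub>K\<^esub>) \<odot>\<^bsub>T2\<^esub> \<one>\<^bsub>T2\<^esub>"
        using hom_overD(2)[OF CC.inr_hom_over one_k_closed[OF r]] smult_one_C[OF one_k_closed[OF r]] \<rho>_smult_one[OF r]
        by (simp only:)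
    qed
    have "?n (\<rho>Z (zr x)) = act k A K \<rho> T2 (\<lambda>a. ?n (t_inl K C Z (j a))) (\<lambda>y. ?n (t_inr K C Z (zr y))) x"
      by (rule hom_\<rho>Z_zr[OF CC.T_cring nh x])
    also have "\<dots> = act k A K \<rho> T2 (\<lambda>b. t_inl K C C (j b)) (\<lambda>y. t_inr K C C (\<rho> y)) x"
      by (rule act_cong[OF A_algebra K_algebra \<rho>_hom CC.T_cring g1 in2 _ _ x])
        (simp_all only: n1 n2 C_simps(1) j_closed zlr_closed Psi_zr)
    finally show "?n (\<rho>Z (zr x)) = comult C (Psi (zr x))"
      using x comult_C_\<rho>[OF x] by (simp only: Psi_zr)
  qed
qed

text \<open>The action on the coset space is the one on K \<otimes> K transported along
  \<open>Psi\<close>: its image in C \<otimes> C is the comultiplication, and such a preimage is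
  unique.\<close>

lemma \<tau>_eq:
  assumes n: "n \<in> carrier N"
  shows "\<tau> n = Psi_map (\<rho>Z (Phi n))"
proof -
  note P = Phi_closed[OF n]
  have c: "Psi_map (\<rho>Z (Phi n)) \<in> carrier TN"
    using ring_hom_closed[OF alg_homD(1)[OF Psi_map(1)] ring_hom_closed[OF \<rho>Z_hom P]] .
  have e: "incl_map (Psi_map (\<rho>Z (Phi n))) = comult C n"
    using incl_Psi_\<rho>Z[OF P] Psi_Phi[OF n] by (simp only:)
  show ?thesis
    unfolding coset_coaction_def Let_def
    by (rule the_equality) (use c e incl_map_inj in \<open>auto dest: inj_onD\<close>)
qed

abbreviation "Phi_map \<equiv> tensor_map K C N C Z (\<lambda>x. x) Phi"

lemmas Phi_map = algebra_pair.tensor_map_alg_hom[OF CN_pair C_algebra Z_algebra id_alg_hom Phi_alg_hom]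

lemma \<tau>_hom: "\<tau> \<in> ring_hom N TN"
proof (rule ring_hom_cong)
  show "(\<lambda>n. Psi_map (\<rho>Z (Phi n))) \<in> ring_hom N TN"
    using ring_hom_comp[OF ring_hom_comp[OF alg_homD(1)[OF Phi_alg_hom], of \<rho>Z TZ] alg_homD(1)[OF Psi_map(1)]] \<rho>Z_hom
    by simp
  show "ring N" using algebra.M_cring[OF N_algebra] by (rule cring.axioms(1))
qed (rule \<tau>_eq)

lemma Phi_map_\<tau>:
  assumes n: "n \<in> carrier N"
  shows "Phi_map (\<tau> n) = \<rho>Z (Phi n)"
proof -
  have t: "\<rho>Z (Phi n) \<in> carrier TZ" by (rule ring_hom_closed[OF \<rho>Z_hom Phi_closed[OF n]])
  have "Phi_map (Psi_map t) = t" if t: "t \<in> carrier TZ" for t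
  proof (rule CZ.hom_ext[OF ring_hom_comp[OF alg_homD(1)[OF Psi_map(1)] alg_homD(1)[OF Phi_map(1)]] ring_hom_id t])
    fix c assume "c \<in> carrier C"
    then show "Phi_map (Psi_map (t_inl K C Z c)) = t_inl K C Z c" by (simp only: Psi_map(2) Phi_map(2))
  next
    fix z assume "z \<in> carrier Z"
    then have z: "z \<in> carrier Z" "z \<in> carrier Z0" by simp_all
    then have "Psi z \<in> carrier N" by (simp add: N_carrier)
    then show "Phi_map (Psi_map (t_inr K C Z z)) = t_inr K C Z z"
      using z by (simp only: Psi_map(3) Phi_map(3) Phi_Psi)
  qed
  then show ?thesis unfolding \<tau>_eq[OF n] using t .
qed

end

section \<open>Germs\<close>

text \<open>Only the restriction axioms, which is all that comparing germs needs. Thus Spec can be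
  treated without gluing or ring axioms for its sections.\<close>

definition presheaf :: "('p, 'r, 'c) rspace \<Rightarrow> bool" where
  "presheaf X \<longleftrightarrow>
    (\<forall>U \<in> opens X. \<forall>s \<in> carrier (sec X U). res X U U s = s) \<and>
    (\<forall>U \<in> opens X. \<forall>V \<in> opens X. V \<subseteq> U \<longrightarrow> (\<forall>s \<in> carrier (sec X U). res X U V s \<in> carrier (sec X V))) \<and>
    (\<forall>U \<in> opens X. \<forall>V \<in> opens X. \<forall>W \<in> opens X. W \<subseteq> V \<and> V \<subseteq> U \<longrightarrow>
       (\<forall>s \<in> carrier (sec X U). res X V W (res X U V s) = res X U W s))"

lemma presheafD:
  assumes "presheaf X"
  shows "U \<in> opens X \<Longrightarrow> s \<in> carrier (sec X U) \<Longrightarrow> res X U U s = s"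
    "U \<in> opens X \<Longrightarrow> V \<in> opens X \<Longrightarrow> V \<subseteq> U \<Longrightarrow> s \<in> carrier (sec X U) \<Longrightarrow> res X U V s \<in> carrier (sec X V)"
    "U \<in> opens X \<Longrightarrow> V \<in> opens X \<Longrightarrow> W \<in> opens X \<Longrightarrow> W \<subseteq> V \<Longrightarrow> V \<subseteq> U \<Longrightarrow> s \<in> carrier (sec X U) \<Longrightarrow>
      res X V W (res X U V s) = res X U W s"
proof -
  note p = assms[unfolded presheaf_def]
  show "U \<in> opens X \<Longrightarrow> s \<in> carrier (sec X U) \<Longrightarrow> res X U U s = s"
    by (rule p[THEN conjunct1, rule_format])
  show "U \<in> opens X \<Longrightarrow> V \<in> opens X \<Longrightarrow> V \<subseteq> U \<Longrightarrow> s \<in> carrier (sec X U) \<Longrightarrow> res X U V s \<in> carrier (sec X V)"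
    by (rule p[THEN conjunct2, THEN conjunct1, rule_format])
  show "U \<in> opens X \<Longrightarrow> V \<in> opens X \<Longrightarrow> W \<in> opens X \<Longrightarrow> W \<subseteq> V \<Longrightarrow> V \<subseteq> U \<Longrightarrow> s \<in> carrier (sec X U) \<Longrightarrow>
      res X V W (res X U V s) = res X U W s"
    by (rule p[THEN conjunct2, THEN conjunct2, rule_format]) auto
qed

lemma opens_Int: "U \<in> opens X \<Longrightarrow> V \<in> opens X \<Longrightarrow> U \<inter> V \<in> opens X"
  by auto

lemma opens_sub: "U \<in> opens X \<Longrightarrow> U \<subseteq> points X"
  by (auto dest: openin_subset)

lemma germ_self:
  assumes "U \<in> opens X" "x \<in> U" "s \<in> carrier (sec X U)"
  shows "(U, s) \<in> germ X x U s"
  unfolding germ_def using assms by blast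

lemma germ_memD:
  assumes "(V, t) \<in> germ X x U s"
  shows "V \<in> opens X" "x \<in> V" "t \<in> carrier (sec X V)"
    "\<exists>W \<in> opens X. x \<in> W \<and> W \<subseteq> U \<inter> V \<and> res X U W s = res X V W t"
  using assms unfolding germ_def by blast+

lemma germ_eqI:
  assumes X: "presheaf X" and U: "U \<in> opens X" "s \<in> carrier (sec X U)"
    and V: "V \<in> opens X" "t \<in> carrier (sec X V)"
    and W: "W \<in> opens X" "x \<in> W" "W \<subseteq> U \<inter> V" "res X U W s = res X V W t"
  shows "germ X x U s = germ X x V t"
proof -
  note D = presheafD[OF X]
  have "germ X x U s \<subseteq> germ X x V t"
    if U: "U \<in> opens X" "s \<in> carrier (sec X U)" and V: "V \<in> opens X" "t \<in> carrier (sec X V)"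
      and W: "W \<subseteq> U \<inter> V" "res X U W s = res X V W t" for U V s t
  proof
    fix p assume "p \<in> germ X x U s"
    then obtain V' t' where p: "p = (V', t')" "(V', t') \<in> germ X x U s" by (cases p) auto
    note m = germ_memD[OF p(2)]
    from m(4) obtain W' where W': "W' \<in> opens X" "x \<in> W'" "W' \<subseteq> U \<inter> V'" "res X U W' s = res X V' W' t'" by blast
    let ?W = "W \<inter> W'"
    have o: "?W \<in> opens X" using opens_Int[OF \<open>W \<in> opens X\<close> W'(1)] .
    have "res X V ?W t = res X W ?W (res X V W t)" using D(3)[OF V(1) \<open>W \<in> opens X\<close> o _ _ V(2)] W by auto
    also have "\<dots> = res X U ?W s" unfolding W(2)[symmetric] using D(3)[OF U(1) \<open>W \<in> opens X\<close> o _ _ U(2)] W by auto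
    also have "\<dots> = res X W' ?W (res X U W' s)" using D(3)[OF U(1) W'(1) o _ _ U(2)] W' by auto
    also have "\<dots> = res X V' ?W t'" unfolding W'(4) using D(3)[OF m(1) W'(1) o _ _ m(3)] W' by auto
    finally have "res X V ?W t = res X V' ?W t'" .
    moreover have "?W \<subseteq> V \<inter> V'" using W W' by auto
    ultimately show "p \<in> germ X x V t"
      unfolding p(1) germ_def using m o \<open>x \<in> W\<close> W'(2) by blast
  qed
  from this[OF U V W(3,4)] this[OF V U _ W(4)[symmetric]] W(3) show ?thesis by blast
qed

lemma germ_eqD:
  assumes "U \<in> opens X" "x \<in> U" "s \<in> carrier (sec X U)" "germ X x V t = germ X x U s"
  shows "\<exists>W \<in> opens X. x \<in> W \<and> W \<subseteq> V \<inter> U \<and> res X V W t = res X U W s"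
  using germ_memD(4)[of U s X x V t] germ_self[OF assms(1-3)] assms(4) by blast

text \<open>The stalk operations are unions over all pairs of representatives. Any two pairs agree
  on a common smaller neighbourhood, so the union has one member; \<open>f\<close> stands for
  addition as well as multiplication.\<close>

lemma germ_binop:
  assumes X: "presheaf X"
    and cl: "\<And>U s t. U \<in> opens X \<Longrightarrow> s \<in> carrier (sec X U) \<Longrightarrow> t \<in> carrier (sec X U) \<Longrightarrow> f U s t \<in> carrier (sec X U)"
    and rs: "\<And>U V s t. U \<in> opens X \<Longrightarrow> V \<in> opens X \<Longrightarrow> V \<subseteq> U \<Longrightarrow> s \<in> carrier (sec X U) \<Longrightarrow> t \<in> carrier (sec X U) \<Longrightarrow>
      res X U V (f U s t) = f V (res X U V s) (res X U V t)"
    and U: "U \<in> opens X" "x \<in> U" "s \<in> carrier (sec X U)"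
    and V: "V \<in> opens X" "x \<in> V" "t \<in> carrier (sec X V)"
  shows "(\<Union>(U, s) \<in> germ X x U s. \<Union>(V, t) \<in> germ X x V t. germ X x (U \<inter> V) (f (U \<inter> V) (res X U (U \<inter> V) s) (res X V (U \<inter> V) t)))
    = germ X x (U \<inter> V) (f (U \<inter> V) (res X U (U \<inter> V) s) (res X V (U \<inter> V) t))"
proof -
  note D = presheafD[OF X]
  have eq: "germ X x (U' \<inter> V') (f (U' \<inter> V') (res X U' (U' \<inter> V') s') (res X V' (U' \<inter> V') t'))
      = germ X x (U \<inter> V) (f (U \<inter> V) (res X U (U \<inter> V) s) (res X V (U \<inter> V) t))"
    if s': "(U', s') \<in> germ X x U s" and t': "(V', t') \<in> germ X x V t" for U' V' s' t'
  proof -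
    note ms = germ_memD[OF s'] and mt = germ_memD[OF t']
    from ms(4) obtain W1 where W1: "W1 \<in> opens X" "x \<in> W1" "W1 \<subseteq> U \<inter> U'" "res X U W1 s = res X U' W1 s'" by blast
    from mt(4) obtain W2 where W2: "W2 \<in> opens X" "x \<in> W2" "W2 \<subseteq> V \<inter> V'" "res X V W2 t = res X V' W2 t'" by blast
    let ?W = "W1 \<inter> W2"
    have W: "?W \<in> opens X" "x \<in> ?W" using W1 W2 by auto
    have r: "res X (A \<inter> B) ?W (f (A \<inter> B) (res X A (A \<inter> B) a) (res X B (A \<inter> B) b)) = f ?W (res X A ?W a) (res X B ?W b)"
      if "A \<in> opens X" "B \<in> opens X" "a \<in> carrier (sec X A)" "b \<in> carrier (sec X B)" "?W \<subseteq> A \<inter> B" for A B a b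
    proof -
      have o: "A \<inter> B \<in> opens X" using that opens_Int by blast
      have c: "res X A (A \<inter> B) a \<in> carrier (sec X (A \<inter> B))" "res X B (A \<inter> B) b \<in> carrier (sec X (A \<inter> B))"
        using D(2)[OF that(1) o _ that(3)] D(2)[OF that(2) o _ that(4)] by auto
      show ?thesis
        using rs[OF o W(1) that(5) c] D(3)[OF that(1) o W(1) that(5) _ that(3)] D(3)[OF that(2) o W(1) that(5) _ that(4)]
        by simp
    qed
    have e1: "res X A ?W a = res X B ?W b"
      if "A \<in> opens X" "B \<in> opens X" "a \<in> carrier (sec X A)" "b \<in> carrier (sec X B)" "W0 \<in> opens X"
        "W0 \<subseteq> A \<inter> B" "?W \<subseteq> W0" "res X A W0 a = res X B W0 b" for A B a b W0
      using D(3)[OF that(1,5) W(1) that(7) _ that(3)] D(3)[OF that(2,5) W(1) that(7) _ that(4)] that(6,8) by auto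
    have ss: "res X U ?W s = res X U' ?W s'"
      by (rule e1[OF U(1) ms(1) U(3) ms(3) W1(1,3) _ W1(4)]) auto
    have tt: "res X V ?W t = res X V' ?W t'"
      by (rule e1[OF V(1) mt(1) V(3) mt(3) W2(1,3) _ W2(4)]) auto
    have o: "U \<inter> V \<in> opens X" "U' \<inter> V' \<in> opens X" using U V ms mt opens_Int by blast+
    have sub: "?W \<subseteq> U \<inter> V" "?W \<subseteq> U' \<inter> V'" "?W \<subseteq> (U' \<inter> V') \<inter> (U \<inter> V)" using W1 W2 by auto
    have fc: "f (A \<inter> B) (res X A (A \<inter> B) a) (res X B (A \<inter> B) b) \<in> carrier (sec X (A \<inter> B))"
      if "A \<in> opens X" "B \<in> opens X" "a \<in> carrier (sec X A)" "b \<in> carrier (sec X B)" "A \<inter> B \<in> opens X" for A B a b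
      using D(2)[OF that(1,5) _ that(3)] D(2)[OF that(2,5) _ that(4)] by (intro cl that(5)) auto
    show ?thesis
      by (rule germ_eqI[OF X o(2) fc[OF ms(1) mt(1) ms(3) mt(3) o(2)] o(1) fc[OF U(1) V(1) U(3) V(3) o(1)] W sub(3)])
        (simp only: r[OF ms(1) mt(1) ms(3) mt(3) sub(2)] r[OF U(1) V(1) U(3) V(3) sub(1)] ss tt)
  qed
  note ss = germ_self[OF U] and tt = germ_self[OF V]
  have "(\<Union>(V', t') \<in> germ X x V t. germ X x (U' \<inter> V') (f (U' \<inter> V') (res X U' (U' \<inter> V') s') (res X V' (U' \<inter> V') t')))
      = germ X x (U \<inter> V) (f (U \<inter> V) (res X U (U \<inter> V) s) (res X V (U \<inter> V) t))"
    if "(U', s') \<in> germ X x U s" for U' s'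
    using eq[OF that] tt by auto
  then show ?thesis using ss by auto
qed

lemma stalk_simps:
  "carrier (stalk X x) = {germ X x U s | U s. U \<in> opens X \<and> x \<in> U \<and> s \<in> carrier (sec X U)}"
  "\<one>\<^bsub>stalk X x\<^esub> = germ X x (points X) \<one>\<^bsub>sec X (points X)\<^esub>"
  "\<zero>\<^bsub>stalk X x\<^esub> = germ X x (points X) \<zero>\<^bsub>sec X (points X)\<^esub>"
  "\<alpha> \<otimes>\<^bsub>stalk X x\<^esub> \<beta> = (\<Union>(U, s)\<in>\<alpha>. \<Union>(V, t)\<in>\<beta>. germ X x (U \<inter> V)
        (res X U (U \<inter> V) s \<otimes>\<^bsub>sec X (U \<inter> V)\<^esub> res X V (U \<inter> V) t))"
  "\<alpha> \<oplus>\<^bsub>stalk X x\<^esub> \<beta> = (\<Union>(U, s)\<in>\<alpha>. \<Union>(V, t)\<in>\<beta>. germ X x (U \<inter> V)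
        (res X U (U \<inter> V) s \<oplus>\<^bsub>sec X (U \<inter> V)\<^esub> res X V (U \<inter> V) t))"
  "c \<odot>\<^bsub>stalk X x\<^esub> \<alpha> = (\<Union>(U, s)\<in>\<alpha>. germ X x U (c \<odot>\<^bsub>sec X U\<^esub> s))"
  by (simp_all add: stalk_def)

section \<open>Localization at a prime\<close>

locale cring_module = cring R for R :: "('c, 'a, 'y) module_scheme" (structure)
begin

lemma prime_mult:
  assumes "primeideal P R" "a \<in> carrier R - P" "b \<in> carrier R - P"
  shows "a \<otimes> b \<in> carrier R - P"
  using assms primeideal.I_prime[OF assms(1), of a b] by auto

lemma prime_one:
  assumes "primeideal P R"
  shows "\<one> \<in> carrier R - P"
  using assms primeideal.I_notcarr[OF assms] ideal.one_imp_carrier[OF primeideal.axioms(1)[OF assms]] by auto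

lemma frac_memI:
  assumes "primeideal P R" "a \<in> carrier R" "s \<in> carrier R - P"
  shows "(a, s) \<in> fraction R P a s"
  using assms prime_one[OF assms(1)] unfolding fraction_def by auto

lemma frac_memD:
  assumes "(b, t) \<in> fraction R P a s"
  shows "b \<in> carrier R" "t \<in> carrier R - P" "\<exists>u \<in> carrier R - P. u \<otimes> (a \<otimes> t) = u \<otimes> (b \<otimes> s)"
  using assms unfolding fraction_def by auto

text \<open>Transitivity of equality of fractions: besides the two witnesses the middle denominator
  enters the new witness, since it cannot be cancelled in a ring with zero divisors.\<close>

lemma frac_eqI:
  assumes P: "primeideal P R" and c: "a \<in> carrier R" "s \<in> carrier R - P" "b \<in> carrier R" "t \<in> carrier R - P"
    and u: "u \<in> carrier R - P" "u \<otimes> (a \<otimes> t) = u \<otimes> (b \<otimes> s)"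
  shows "fraction R P a s = fraction R P b t"
proof -
  have sub: "fraction R P a s \<subseteq> fraction R P b t"
    if c: "a \<in> carrier R" "s \<in> carrier R - P" "b \<in> carrier R" "t \<in> carrier R - P"
      and u: "u \<in> carrier R - P" "u \<otimes> (a \<otimes> t) = u \<otimes> (b \<otimes> s)" for a b s t u
  proof
    fix p assume "p \<in> fraction R P a s"
    then obtain d w where p: "p = (d, w)" "(d, w) \<in> fraction R P a s" by (cases p) auto
    note m = frac_memD[OF p(2)]
    from m(3) obtain v where v: "v \<in> carrier R - P" "v \<otimes> (a \<otimes> w) = v \<otimes> (d \<otimes> s)" by blast
    let ?u = "u \<otimes> v \<otimes> s"
    have uP: "?u \<in> carrier R - P" using prime_mult[OF P] u v c by blast
    have cc: "u \<in> carrier R" "v \<in> carrier R" "s \<in> carrier R" "t \<in> carrier R" "w \<in> carrier R" using u v c m by auto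
    have "?u \<otimes> (b \<otimes> w) = (u \<otimes> (b \<otimes> s)) \<otimes> (v \<otimes> w)" using cc c(3) by algebra
    also have "\<dots> = (v \<otimes> (a \<otimes> w)) \<otimes> (u \<otimes> t)" unfolding u(2)[symmetric] using cc c(1) by algebra
    also have "\<dots> = ?u \<otimes> (d \<otimes> t)" unfolding v(2) using cc m(1) by algebra
    finally show "p \<in> fraction R P b t" unfolding p(1) fraction_def using m(1,2) uP by blast
  qed
  show ?thesis using sub[OF c u] sub[OF c(3,4,1,2) u(1) u(2)[symmetric]] by blast
qed

lemma frac_eqD:
  assumes "primeideal P R" "a \<in> carrier R" "s \<in> carrier R - P" "b \<in> carrier R" "t \<in> carrier R - P"
    "fraction R P a s = fraction R P b t"
  shows "\<exists>u \<in> carrier R - P. u \<otimes> (a \<otimes> t) = u \<otimes> (b \<otimes> s)"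
  using frac_memD(3)[of b t P a s] frac_memI[OF assms(1,4,5)] assms(6) by blast

lemma frac_scale:
  assumes "primeideal P R" "a \<in> carrier R" "s \<in> carrier R - P" "t \<in> carrier R - P"
  shows "fraction R P (a \<otimes> t) (s \<otimes> t) = fraction R P a s"
proof (rule frac_eqI[OF assms(1) _ prime_mult[OF assms(1,3,4)] assms(2,3) prime_one[OF assms(1)]])
  have c: "s \<in> carrier R" "t \<in> carrier R" using assms by auto
  show "a \<otimes> t \<in> carrier R" using assms c by simp
  show "\<one> \<otimes> (a \<otimes> t \<otimes> s) = \<one> \<otimes> (a \<otimes> (s \<otimes> t))" using assms(2) c by algebra
qed

text \<open>The product of the two witnesses shows that all choices of representatives give the same
  fraction, which collapses the union in the definition; the next two lemmas follow the same
  pattern.\<close>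

lemma frac_mult:
  assumes P: "primeideal P R" and "a \<in> carrier R" "s \<in> carrier R - P" "b \<in> carrier R" "t \<in> carrier R - P"
  shows "fraction R P a s \<otimes>\<^bsub>localize R P\<^esub> fraction R P b t = fraction R P (a \<otimes> b) (s \<otimes> t)"
proof -
  have eq: "fraction R P (a' \<otimes> b') (s' \<otimes> t') = fraction R P (a \<otimes> b) (s \<otimes> t)"
    if 1: "(a', s') \<in> fraction R P a s" and 2: "(b', t') \<in> fraction R P b t" for a' b' s' t'
  proof -
    note m1 = frac_memD[OF 1] and m2 = frac_memD[OF 2]
    from m1(3) obtain u where u: "u \<in> carrier R - P" "u \<otimes> (a \<otimes> s') = u \<otimes> (a' \<otimes> s)" by blast
    from m2(3) obtain v where v: "v \<in> carrier R - P" "v \<otimes> (b \<otimes> t') = v \<otimes> (b' \<otimes> t)" by blast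
    have cc: "u \<in> carrier R" "v \<in> carrier R" "s \<in> carrier R" "s' \<in> carrier R" "t \<in> carrier R" "t' \<in> carrier R"
      using u v m1 m2 assms by auto
    have "(u \<otimes> v) \<otimes> ((a' \<otimes> b') \<otimes> (s \<otimes> t)) = (u \<otimes> (a' \<otimes> s)) \<otimes> (v \<otimes> (b' \<otimes> t))"
      using cc m1(1) m2(1) by algebra
    also have "\<dots> = (u \<otimes> v) \<otimes> ((a \<otimes> b) \<otimes> (s' \<otimes> t'))"
      unfolding u(2)[symmetric] v(2)[symmetric] using cc assms(2,4) by algebra
    finally show ?thesis
      using assms m1 m2 prime_mult[OF P] u v by (intro frac_eqI[OF P, of _ _ _ _ "u \<otimes> v"]) auto
  qed
  have "fraction R P a s \<otimes>\<^bsub>localize R P\<^esub> fraction R P b t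
      = (\<Union>(a', s')\<in>fraction R P a s. \<Union>(b', t')\<in>fraction R P b t. fraction R P (a' \<otimes> b') (s' \<otimes> t'))"
    by (simp add: localize_def)
  also have "\<dots> = fraction R P (a \<otimes> b) (s \<otimes> t)"
    using eq frac_memI[OF P assms(2,3)] frac_memI[OF P assms(4,5)] by blast
  finally show ?thesis .
qed

lemma frac_add:
  assumes P: "primeideal P R" and "a \<in> carrier R" "s \<in> carrier R - P" "b \<in> carrier R" "t \<in> carrier R - P"
  shows "fraction R P a s \<oplus>\<^bsub>localize R P\<^esub> fraction R P b t = fraction R P ((a \<otimes> t) \<oplus> (b \<otimes> s)) (s \<otimes> t)"
proof -
  have eq: "fraction R P ((a' \<otimes> t') \<oplus> (b' \<otimes> s')) (s' \<otimes> t') = fraction R P ((a \<otimes> t) \<oplus> (b \<otimes> s)) (s \<otimes> t)"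
    if 1: "(a', s') \<in> fraction R P a s" and 2: "(b', t') \<in> fraction R P b t" for a' b' s' t'
  proof -
    note m1 = frac_memD[OF 1] and m2 = frac_memD[OF 2]
    from m1(3) obtain u where u: "u \<in> carrier R - P" "u \<otimes> (a \<otimes> s') = u \<otimes> (a' \<otimes> s)" by blast
    from m2(3) obtain v where v: "v \<in> carrier R - P" "v \<otimes> (b \<otimes> t') = v \<otimes> (b' \<otimes> t)" by blast
    have cc: "u \<in> carrier R" "v \<in> carrier R" "s \<in> carrier R" "s' \<in> carrier R" "t \<in> carrier R" "t' \<in> carrier R"
      using u v m1 m2 assms by auto
    have "(u \<otimes> v) \<otimes> (((a' \<otimes> t') \<oplus> (b' \<otimes> s')) \<otimes> (s \<otimes> t)) =
        (u \<otimes> (a' \<otimes> s)) \<otimes> (v \<otimes> t \<otimes> t') \<oplus> (v \<otimes> (b' \<otimes> t)) \<otimes> (u \<otimes> s \<otimes> s')"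
      using cc m1(1) m2(1) by algebra
    also have "\<dots> = (u \<otimes> v) \<otimes> (((a \<otimes> t) \<oplus> (b \<otimes> s)) \<otimes> (s' \<otimes> t'))"
      unfolding u(2)[symmetric] v(2)[symmetric] using cc assms(2,4) by algebra
    finally show ?thesis
      using assms m1 m2 cc prime_mult[OF P] u v by (intro frac_eqI[OF P, of _ _ _ _ "u \<otimes> v"]) auto
  qed
  have "fraction R P a s \<oplus>\<^bsub>localize R P\<^esub> fraction R P b t
      = (\<Union>(a', s')\<in>fraction R P a s. \<Union>(b', t')\<in>fraction R P b t. fraction R P ((a' \<otimes> t') \<oplus> (b' \<otimes> s')) (s' \<otimes> t'))"
    by (simp add: localize_def)
  also have "\<dots> = fraction R P ((a \<otimes> t) \<oplus> (b \<otimes> s)) (s \<otimes> t)"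
    using eq frac_memI[OF P assms(2,3)] frac_memI[OF P assms(4,5)] by blast
  finally show ?thesis .
qed

lemma frac_smult:
  assumes R: "algebra k R" and P: "primeideal P R" and c: "c \<in> carrier k" and "a \<in> carrier R" "s \<in> carrier R - P"
  shows "c \<odot>\<^bsub>localize R P\<^esub> fraction R P a s = fraction R P (c \<odot> a) s"
proof -
  interpret A: algebra k R by fact
  have eq: "fraction R P (c \<odot> a') s' = fraction R P (c \<odot> a) s" if 1: "(a', s') \<in> fraction R P a s" for a' s'
  proof -
    note m = frac_memD[OF 1]
    from m(3) obtain u where u: "u \<in> carrier R - P" "u \<otimes> (a \<otimes> s') = u \<otimes> (a' \<otimes> s)" by blast
    have "u \<otimes> ((c \<odot> x) \<otimes> y) = c \<odot> (u \<otimes> (x \<otimes> y))" if "x \<in> carrier R" "y \<in> carrier R" for x y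
      using that u c by (simp add: A.smult_assoc2 A.smult_mult_r)
    then show ?thesis
      using assms m u c by (intro frac_eqI[OF P, of _ _ _ _ u]) auto
  qed
  have "c \<odot>\<^bsub>localize R P\<^esub> fraction R P a s = (\<Union>(a', s')\<in>fraction R P a s. fraction R P (c \<odot> a') s')"
    by (simp add: localize_def)
  also have "\<dots> = fraction R P (c \<odot> a) s" using eq frac_memI[OF P assms(4,5)] by blast
  finally show ?thesis .
qed

lemma localize_one: "\<one>\<^bsub>localize R P\<^esub> = fraction R P \<one> \<one>"
  by (simp add: localize_def)

section \<open>Spectra\<close>

definition basic :: "'a \<Rightarrow> 'a set set" where
  "basic f = {P. primeideal P R \<and> f \<notin> P}"

lemma basic_mult: "f \<in> carrier R \<Longrightarrow> g \<in> carrier R \<Longrightarrow> basic (f \<otimes> g) = basic f \<inter> basic g"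
  unfolding basic_def using prime_mult by (auto simp: ideal.I_l_closed ideal.I_r_closed primeideal.axioms(1))

lemma Spec_tp: "tp (Spec R) = topology_generated_by {basic f | f. f \<in> carrier R}"
proof -
  have "fst ` {({P. primeideal P R \<and> f \<notin> P}, \<lambda>P. fraction R P a f) | a f. a \<in> carrier R \<and> f \<in> carrier R}
      = {basic f | f. f \<in> carrier R}"
    (is "fst ` ?B = _")
  proof (intro equalityI subsetI)
    fix X assume "X \<in> {basic f | f. f \<in> carrier R}"
    then obtain f where "f \<in> carrier R" "X = basic f" by blast
    then show "X \<in> fst ` ?B"
      by (intro image_eqI[of _ _ "(basic f, \<lambda>P. fraction R P f f)"]) (auto simp: basic_def)
  qed (auto simp: basic_def)
  then show ?thesis by (simp add: Spec_def germ_space_def)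
qed

lemma Spec_points: "points (Spec R) = {P. primeideal P R}"
proof -
  have "\<one> \<in> carrier R \<and> P \<in> basic \<one>" if "primeideal P R" for P
    using prime_one[OF that] that by (simp add: basic_def)
  then show ?thesis unfolding Spec_tp topology_generated_by_topspace by (auto simp: basic_def)
qed

lemma basic_open: "f \<in> carrier R \<Longrightarrow> basic f \<in> opens (Spec R)"
  unfolding Spec_tp by (auto intro: topology_generated_by_Basis)

text \<open>The basic open sets generate the topology and are closed under finite intersections, so
  they form a base.\<close>

lemma Spec_base:
  assumes "U \<in> opens (Spec R)" "P \<in> U"
  shows "\<exists>f \<in> carrier R. P \<in> basic f \<and> basic f \<subseteq> U"
proof -
  have "generate_topology_on {basic f | f. f \<in> carrier R} U"
    using assms(1) unfolding Spec_tp by (simp add: openin_topology_generated_by_iff)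
  then show ?thesis using assms(2)
  proof (induction arbitrary: P)
    case (Int a b)
    then obtain f g where "f \<in> carrier R" "P \<in> basic f" "basic f \<subseteq> a" "g \<in> carrier R" "P \<in> basic g" "basic g \<subseteq> b"
      by blast
    then show ?case using basic_mult by (intro bexI[of _ "f \<otimes> g"]) auto
  next
    case (UN K)
    then show ?case by blast
  qed auto
qed

lemma Spec_sec_carrier:
  "carrier (sec (Spec R) U) = {s \<in> extensional U. \<forall>P \<in> U. \<exists>a \<in> carrier R. \<exists>f \<in> carrier R.
      P \<in> basic f \<and> basic f \<subseteq> U \<and> (\<forall>w \<in> basic f. s w = fraction R w a f)}"
proof -
  have *: "(\<exists>(D, \<sigma>) \<in> {(F f, G a f) | a f. a \<in> S \<and> f \<in> S}. \<Phi> D \<sigma>) \<longleftrightarrow> (\<exists>a \<in> S. \<exists>f \<in> S. \<Phi> (F f) (G a f))"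
    for F :: "'a \<Rightarrow> 'a set set" and G :: "'a \<Rightarrow> 'a \<Rightarrow> 'a set \<Rightarrow> ('a \<times> 'a) set" and S \<Phi>
    by blast
  show ?thesis
    unfolding Spec_def germ_space_def rspace.simps partial_object.simps * basic_def ..
qed

lemma Spec_ops:
  "s \<otimes>\<^bsub>sec (Spec R) U\<^esub> t = (\<lambda>z\<in>U. s z \<otimes>\<^bsub>localize R z\<^esub> t z)"
  "s \<oplus>\<^bsub>sec (Spec R) U\<^esub> t = (\<lambda>z\<in>U. s z \<oplus>\<^bsub>localize R z\<^esub> t z)"
  "c \<odot>\<^bsub>sec (Spec R) U\<^esub> s = (\<lambda>z\<in>U. c \<odot>\<^bsub>localize R z\<^esub> s z)"
  "\<one>\<^bsub>sec (Spec R) U\<^esub> = (\<lambda>z\<in>U. \<one>\<^bsub>localize R z\<^esub>)"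
  "\<zero>\<^bsub>sec (Spec R) U\<^esub> = (\<lambda>z\<in>U. \<zero>\<^bsub>localize R z\<^esub>)"
  "res (Spec R) U V s = restrict s V"
  by (simp_all add: Spec_def germ_space_def)

lemma Spec_secD:
  assumes "s \<in> carrier (sec (Spec R) U)" "P \<in> U"
  obtains a f where "a \<in> carrier R" "f \<in> carrier R" "P \<in> basic f" "basic f \<subseteq> U"
    "\<And>w. w \<in> basic f \<Longrightarrow> s w = fraction R w a f"
proof -
  from assms(1) have "\<forall>P \<in> U. \<exists>a \<in> carrier R. \<exists>f \<in> carrier R.
      P \<in> basic f \<and> basic f \<subseteq> U \<and> (\<forall>w \<in> basic f. s w = fraction R w a f)"
    unfolding Spec_sec_carrier mem_Collect_eq by (rule conjunct2)
  from bspec[OF this assms(2)] obtain a f where "a \<in> carrier R" "f \<in> carrier R" "P \<in> basic f" "basic f \<subseteq> U"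
    and "\<forall>w \<in> basic f. s w = fraction R w a f" by (elim bexE conjE)
  then show ?thesis by (intro that[of a f]) simp_all
qed

lemma Spec_secI:
  assumes "s \<in> extensional U"
    "\<And>P. P \<in> U \<Longrightarrow> \<exists>a \<in> carrier R. \<exists>f \<in> carrier R. P \<in> basic f \<and> basic f \<subseteq> U \<and> (\<forall>w \<in> basic f. s w = fraction R w a f)"
  shows "s \<in> carrier (sec (Spec R) U)"
  unfolding Spec_sec_carrier by (intro CollectI conjI ballI assms)

lemma frac_section:
  assumes "a \<in> carrier R" "f \<in> carrier R"
  shows "(\<lambda>z\<in>basic f. fraction R z a f) \<in> carrier (sec (Spec R) (basic f))"
proof (rule Spec_secI)
  fix P assume "P \<in> basic f"
  then show "\<exists>b \<in> carrier R. \<exists>g \<in> carrier R. P \<in> basic g \<and> basic g \<subseteq> basic f \<and>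
      (\<forall>w \<in> basic g. (\<lambda>z\<in>basic f. fraction R z a f) w = fraction R w b g)"
    by (intro bexI[OF _ assms(1)] bexI[OF _ assms(2)]) simp
qed simp

lemma Spec_sec_val:
  assumes "s \<in> carrier (sec (Spec R) U)" "P \<in> U"
  obtains a f where "a \<in> carrier R" "f \<in> carrier R - P" "s P = fraction R P a f" "primeideal P R"
proof -
  obtain a f where "a \<in> carrier R" "f \<in> carrier R" "P \<in> basic f" "s P = fraction R P a f"
    by (rule Spec_secD[OF assms]) (rule that)
  then show ?thesis by (intro that[of a f]) (simp_all add: basic_def)
qed

lemma Spec_sec_ext: "s \<in> carrier (sec (Spec R) U) \<Longrightarrow> s \<in> extensional U"
  by (simp add: Spec_sec_carrier)

lemma basic_prime: "P \<in> basic f \<Longrightarrow> primeideal P R"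
  and basic_notin: "f \<in> carrier R \<Longrightarrow> P \<in> basic f \<Longrightarrow> f \<in> carrier R - P"
  by (auto simp: basic_def)

lemma Spec_mult_closed:
  assumes s: "s \<in> carrier (sec (Spec R) U)" and t: "t \<in> carrier (sec (Spec R) U)"
  shows "s \<otimes>\<^bsub>sec (Spec R) U\<^esub> t \<in> carrier (sec (Spec R) U)"
proof (rule Spec_secI)
  show "s \<otimes>\<^bsub>sec (Spec R) U\<^esub> t \<in> extensional U" by (simp add: Spec_ops)
  fix P assume P: "P \<in> U"
  obtain a f where a: "a \<in> carrier R" "f \<in> carrier R" "P \<in> basic f" "basic f \<subseteq> U"
    "\<And>w. w \<in> basic f \<Longrightarrow> s w = fraction R w a f" by (rule Spec_secD[OF s P]) (rule that)
  obtain b g where b: "b \<in> carrier R" "g \<in> carrier R" "P \<in> basic g" "basic g \<subseteq> U"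
    "\<And>w. w \<in> basic g \<Longrightarrow> t w = fraction R w b g" by (rule Spec_secD[OF t P]) (rule that)
  have "(s \<otimes>\<^bsub>sec (Spec R) U\<^esub> t) w = fraction R w (a \<otimes> b) (f \<otimes> g)" if "w \<in> basic (f \<otimes> g)" for w
  proof -
    have w: "w \<in> basic f" "w \<in> basic g" using that basic_mult a b by auto
    then show ?thesis
      using a b frac_mult[OF basic_prime[OF w(1)] a(1) basic_notin[OF a(2) w(1)] b(1) basic_notin[OF b(2) w(2)]]
      by (auto simp: Spec_ops)
  qed
  then show "\<exists>a \<in> carrier R. \<exists>f \<in> carrier R. P \<in> basic f \<and> basic f \<subseteq> U \<and>
      (\<forall>w \<in> basic f. (s \<otimes>\<^bsub>sec (Spec R) U\<^esub> t) w = fraction R w a f)"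
    using a b basic_mult[OF a(2) b(2)] by (intro bexI[of _ "a \<otimes> b"] bexI[of _ "f \<otimes> g"]) auto
qed

lemma Spec_restrict:
  assumes s: "s \<in> carrier (sec (Spec R) U)" and V: "V \<in> opens (Spec R)" "V \<subseteq> U"
  shows "restrict s V \<in> carrier (sec (Spec R) V)"
proof (rule Spec_secI)
  show "restrict s V \<in> extensional V" by simp
  fix P assume P: "P \<in> V"
  have "P \<in> U" using P V by blast
  then obtain a f where a: "a \<in> carrier R" "f \<in> carrier R" "P \<in> basic f"
    "\<And>w. w \<in> basic f \<Longrightarrow> s w = fraction R w a f" by (rule Spec_secD[OF s]) (rule that)
  obtain g where g: "g \<in> carrier R" "P \<in> basic g" "basic g \<subseteq> V" using Spec_base[OF V(1) P] by blast
  have "restrict s V w = fraction R w (a \<otimes> g) (f \<otimes> g)" if "w \<in> basic (f \<otimes> g)" for w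
  proof -
    have w: "w \<in> basic f" "w \<in> basic g" using that basic_mult a g by auto
    then show ?thesis
      using a g frac_scale[OF basic_prime[OF w(1)] a(1) basic_notin[OF a(2) w(1)] basic_notin[OF g(1) w(2)]]
      by auto
  qed
  then show "\<exists>a \<in> carrier R. \<exists>f \<in> carrier R. P \<in> basic f \<and> basic f \<subseteq> V \<and> (\<forall>w \<in> basic f. restrict s V w = fraction R w a f)"
    using a g basic_mult[OF a(2) g(1)] by (intro bexI[of _ "a \<otimes> g"] bexI[of _ "f \<otimes> g"]) auto
qed

lemma Spec_presheaf: "presheaf (Spec R)"
  unfolding presheaf_def Spec_ops
proof (intro conjI ballI impI)
  fix U s assume "s \<in> carrier (sec (Spec R) U)"
  then show "restrict s U = s" by (intro extensional_restrict Spec_sec_ext)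
next
  fix U V s assume "V \<in> opens (Spec R)" "V \<subseteq> U" "s \<in> carrier (sec (Spec R) U)"
  then show "restrict s V \<in> carrier (sec (Spec R) V)" by (intro Spec_restrict)
qed (auto simp: Int_absorb1 Int_absorb2)

lemma Spec_stalk_mult:
  assumes "U \<in> opens (Spec R)" "P \<in> U" "s \<in> carrier (sec (Spec R) U)"
    "V \<in> opens (Spec R)" "P \<in> V" "t \<in> carrier (sec (Spec R) V)"
  shows "germ (Spec R) P U s \<otimes>\<^bsub>stalk (Spec R) P\<^esub> germ (Spec R) P V t =
    germ (Spec R) P (U \<inter> V) (restrict s (U \<inter> V) \<otimes>\<^bsub>sec (Spec R) (U \<inter> V)\<^esub> restrict t (U \<inter> V))"
proof -
  have "restrict (s \<otimes>\<^bsub>sec (Spec R) U\<^esub> t) V = restrict s V \<otimes>\<^bsub>sec (Spec R) V\<^esub> restrict t V"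
    if "V \<subseteq> U" for U V s t using that by (auto simp: Spec_ops fun_eq_iff)
  then show ?thesis
    unfolding stalk_simps
    using germ_binop[OF Spec_presheaf, of "\<lambda>U s t. s \<otimes>\<^bsub>sec (Spec R) U\<^esub> t", OF Spec_mult_closed _ assms]
    by (simp add: Spec_ops(6))
qed

text \<open>If \<open>t\<close> is b/g near P with b outside P, then g/b inverts it on the smaller
  basic open set where b is invertible as well.\<close>

lemma Spec_germ_unitI:
  assumes V: "V \<in> opens (Spec R)" and P: "P \<in> V" and t: "t \<in> carrier (sec (Spec R) V)"
    and a: "a \<in> carrier R - P" "f \<in> carrier R - P" "t P = fraction R P a f"
  shows "germ (Spec R) P V t \<in> Units (stalk (Spec R) P)"
proof -
  obtain b g where b: "b \<in> carrier R" "g \<in> carrier R" "P \<in> basic g" "basic g \<subseteq> V"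
    "\<And>w. w \<in> basic g \<Longrightarrow> t w = fraction R w b g" by (rule Spec_secD[OF t P]) (rule that)
  have pr: "primeideal P R" using basic_prime b by blast
  have gP: "g \<in> carrier R - P" using b basic_notin by blast
  have "fraction R P a f = fraction R P b g" using a b by simp
  then obtain u where u: "u \<in> carrier R - P" "u \<otimes> (a \<otimes> g) = u \<otimes> (b \<otimes> f)"
    using frac_eqD[OF pr _ a(2) b(1) gP] a by blast
  have "u \<otimes> (a \<otimes> g) \<in> carrier R - P" using prime_mult[OF pr] u a gP by blast
  then have "b \<notin> P"
    using u a b ideal.I_l_closed[OF primeideal.axioms(1)[OF pr]] ideal.I_r_closed[OF primeideal.axioms(1)[OF pr]] by auto
  let ?h = "g \<otimes> b"
  let ?W = "basic ?h"
  have hR: "?h \<in> carrier R" using b by simp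
  have PW: "P \<in> ?W" unfolding basic_mult[OF b(2,1)] using \<open>b \<notin> P\<close> b(3) pr by (simp add: basic_def)
  have W: "?W \<in> opens (Spec R)" by (rule basic_open[OF hR])
  have WV: "?W \<subseteq> V" using b basic_mult[OF b(2,1)] by auto
  \<comment> \<open>The inverse g/b is written as g^2/(gb), because sections over a basic open set
    must have its defining element as denominator.\<close>
  define w where "w = (\<lambda>z\<in>?W. fraction R z (g \<otimes> g) ?h)"
  have wc: "w \<in> carrier (sec (Spec R) ?W)"
    unfolding w_def by (rule frac_section) (use b hR in auto)
  have tw: "t z \<otimes>\<^bsub>localize R z\<^esub> w z = \<one>\<^bsub>localize R z\<^esub>" "w z \<otimes>\<^bsub>localize R z\<^esub> t z = \<one>\<^bsub>localize R z\<^esub>" if z: "z \<in> ?W" for z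
  proof -
    have pz: "primeideal z R" by (rule basic_prime[OF z])
    have zz: "z \<in> basic g" using z basic_mult[OF b(2,1)] by auto
    have gz: "g \<in> carrier R - z" by (rule basic_notin[OF b(2) zz])
    have hz: "?h \<in> carrier R - z" by (rule basic_notin[OF hR z])
    have t: "t z = fraction R z b g" using b(5)[OF zz] .
    have w: "w z = fraction R z (g \<otimes> g) ?h" using z by (simp add: w_def)
    have bg: "b \<in> carrier R" "g \<in> carrier R" using b by auto
    have e: "\<one> \<otimes> ((b \<otimes> (g \<otimes> g)) \<otimes> \<one>) = \<one> \<otimes> (\<one> \<otimes> (g \<otimes> (g \<otimes> b)))" using bg by algebra
    have e': "\<one> \<otimes> (((g \<otimes> g) \<otimes> b) \<otimes> \<one>) = \<one> \<otimes> (\<one> \<otimes> ((g \<otimes> b) \<otimes> g))" using bg by algebra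
    show "t z \<otimes>\<^bsub>localize R z\<^esub> w z = \<one>\<^bsub>localize R z\<^esub>"
      unfolding t w localize_one
      using frac_mult[OF pz bg(1) gz _ hz, of "g \<otimes> g"] bg
        frac_eqI[OF pz _ prime_mult[OF pz gz hz] _ prime_one[OF pz] prime_one[OF pz] e] by simp
    show "w z \<otimes>\<^bsub>localize R z\<^esub> t z = \<one>\<^bsub>localize R z\<^esub>"
      unfolding t w localize_one
      using frac_mult[OF pz _ hz bg(1) gz, of "g \<otimes> g"] bg
        frac_eqI[OF pz _ prime_mult[OF pz hz gz] _ prime_one[OF pz] prime_one[OF pz] e'] by simp
  qed
  have one_sec: "\<one>\<^bsub>sec (Spec R) (points (Spec R))\<^esub> \<in> carrier (sec (Spec R) (points (Spec R)))"
  proof (rule Spec_secI)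
    fix Q assume Q: "Q \<in> points (Spec R)"
    have *: "points (Spec R) = basic \<one>" using prime_one by (auto simp: Spec_points basic_def)
    show "\<exists>a \<in> carrier R. \<exists>f \<in> carrier R. Q \<in> basic f \<and> basic f \<subseteq> points (Spec R) \<and>
      (\<forall>w \<in> basic f. \<one>\<^bsub>sec (Spec R) (points (Spec R))\<^esub> w = fraction R w a f)"
      by (intro bexI[of _ \<one>]) (use Q * in \<open>auto simp: Spec_ops localize_one\<close>)
  qed (simp add: Spec_ops)
  have po: "points (Spec R) \<in> opens (Spec R)" by auto
  have Wp: "?W \<subseteq> points (Spec R)" by (rule opens_sub[OF W])
  have rt: "restrict t (V \<inter> ?W) \<in> carrier (sec (Spec R) (V \<inter> ?W))" "restrict t (?W \<inter> V) \<in> carrier (sec (Spec R) (?W \<inter> V))"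
    by (rule Spec_restrict[OF t]; use V W in auto)+
  have rw: "restrict w (V \<inter> ?W) \<in> carrier (sec (Spec R) (V \<inter> ?W))" "restrict w (?W \<inter> V) \<in> carrier (sec (Spec R) (?W \<inter> V))"
    by (rule Spec_restrict[OF wc]; use V W in auto)+
  have "germ (Spec R) P V t \<otimes>\<^bsub>stalk (Spec R) P\<^esub> germ (Spec R) P ?W w = \<one>\<^bsub>stalk (Spec R) P\<^esub>"
    unfolding Spec_stalk_mult[OF V P t W PW wc] stalk_simps(2)
    by (rule germ_eqI[OF Spec_presheaf opens_Int[OF V W] Spec_mult_closed[OF rt(1) rw(1)] po one_sec W PW])
      (use WV Wp in \<open>auto simp: Spec_ops tw fun_eq_iff restrict_def\<close>)
  moreover have "germ (Spec R) P ?W w \<otimes>\<^bsub>stalk (Spec R) P\<^esub> germ (Spec R) P V t = \<one>\<^bsub>stalk (Spec R) P\<^esub>"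
    unfolding Spec_stalk_mult[OF W PW wc V P t] stalk_simps(2)
    by (rule germ_eqI[OF Spec_presheaf opens_Int[OF W V] Spec_mult_closed[OF rw(2) rt(2)] po one_sec W PW])
      (use WV Wp in \<open>auto simp: Spec_ops tw fun_eq_iff restrict_def\<close>)
  moreover have "germ (Spec R) P V t \<in> carrier (stalk (Spec R) P)" "germ (Spec R) P ?W w \<in> carrier (stalk (Spec R) P)"
    unfolding stalk_simps using V P t W PW wc by blast+
  ultimately show ?thesis unfolding Units_def by blast
qed

text \<open>An inverse b/g of a/f gives u f g = u a b with u outside P. The left side avoids the
  prime P, whereas the right side lies in it as soon as \<open>a\<close> does.\<close>

lemma Spec_germ_unitD:
  assumes V: "V \<in> opens (Spec R)" and P: "P \<in> V" and t: "t \<in> carrier (sec (Spec R) V)"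
    and a: "a \<in> carrier R" "f \<in> carrier R - P" "t P = fraction R P a f"
    and u: "germ (Spec R) P V t \<in> Units (stalk (Spec R) P)"
  shows "a \<notin> P"
proof
  assume aP: "a \<in> P"
  from u obtain \<beta> where \<beta>: "\<beta> \<in> carrier (stalk (Spec R) P)" "germ (Spec R) P V t \<otimes>\<^bsub>stalk (Spec R) P\<^esub> \<beta> = \<one>\<^bsub>stalk (Spec R) P\<^esub>"
    unfolding Units_def by blast
  then obtain U w where w: "U \<in> opens (Spec R)" "P \<in> U" "w \<in> carrier (sec (Spec R) U)" "\<beta> = germ (Spec R) P U w"
    unfolding stalk_simps by blast
  obtain b g where b: "b \<in> carrier R" "g \<in> carrier R - P" "w P = fraction R P b g" "primeideal P R"
    by (rule Spec_sec_val[OF w(3,2)]) (rule that)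
  have rt: "restrict t (V \<inter> U) \<in> carrier (sec (Spec R) (V \<inter> U))" "restrict w (V \<inter> U) \<in> carrier (sec (Spec R) (V \<inter> U))"
    by (rule Spec_restrict[OF t] Spec_restrict[OF w(3)]; use V w in auto)+
  have "germ (Spec R) P (points (Spec R)) \<one>\<^bsub>sec (Spec R) (points (Spec R))\<^esub> =
      germ (Spec R) P (V \<inter> U) (restrict t (V \<inter> U) \<otimes>\<^bsub>sec (Spec R) (V \<inter> U)\<^esub> restrict w (V \<inter> U))"
    using \<beta>(2) Spec_stalk_mult[OF V P t w(1-3)] unfolding w(4) stalk_simps(2) by simp
  from germ_eqD[OF opens_Int[OF V w(1)] _ Spec_mult_closed[OF rt] this] P w(2)
  obtain W where W: "P \<in> W" "W \<subseteq> points (Spec R) \<inter> (V \<inter> U)"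
    "restrict \<one>\<^bsub>sec (Spec R) (points (Spec R))\<^esub> W =
      restrict (restrict t (V \<inter> U) \<otimes>\<^bsub>sec (Spec R) (V \<inter> U)\<^esub> restrict w (V \<inter> U)) W" unfolding Spec_ops(6) by blast
  have "fraction R P \<one> \<one> = t P \<otimes>\<^bsub>localize R P\<^esub> w P"
    using fun_cong[OF W(3), of P] W(1) subsetD[OF W(2,1)] by (simp add: Spec_ops localize_one)
  also have "\<dots> = fraction R P (a \<otimes> b) (f \<otimes> g)"
    unfolding a(3) b(3) by (rule frac_mult[OF b(4) a(1,2) b(1,2)])
  finally obtain u where u: "u \<in> carrier R - P" "u \<otimes> (\<one> \<otimes> (f \<otimes> g)) = u \<otimes> ((a \<otimes> b) \<otimes> \<one>)"
    using frac_eqD[OF b(4) one_closed prime_one[OF b(4)] _ prime_mult[OF b(4) a(2) b(2)], of "a \<otimes> b"] a(1) b(1) by auto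
  have I: "ideal P R" using primeideal.axioms(1)[OF b(4)] .
  have "u \<otimes> (f \<otimes> g) \<in> carrier R - P" using prime_mult[OF b(4)] u a b by blast
  moreover have "u \<otimes> ((a \<otimes> b) \<otimes> \<one>) \<in> P"
    using aP u a b ideal.I_l_closed[OF I] ideal.I_r_closed[OF I] by simp
  ultimately show False using u a b by simp
qed

end

section \<open>Morphisms of spectra\<close>

locale spec_map = R: cring_module R + S: cring_module S
  for R :: "('c, 'a, 'y) module_scheme" and S :: "('c, 'b, 'z) module_scheme" +
  fixes h
  assumes h: "h \<in> ring_hom R S"
begin

abbreviation "cp Q \<equiv> {a \<in> carrier R. h a \<in> Q}"

lemma h_closed: "a \<in> carrier R \<Longrightarrow> h a \<in> carrier S"
  by (rule ring_hom_closed[OF h])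

lemma cp_prime:
  assumes "primeideal Q S"
  shows "primeideal (cp Q) R"
proof -
  interpret hh: ring_hom_cring R S h
    by (rule ring_hom_cring_of) (use h R.is_cring S.is_cring in auto)
  interpret Q: primeideal Q S by fact
  have add: "h a \<in> Q \<Longrightarrow> h b \<in> Q \<Longrightarrow> h (a \<oplus>\<^bsub>R\<^esub> b) \<in> Q" if "a \<in> carrier R" "b \<in> carrier R" for a b
    using that Q.a_closed by simp
  have "ideal (cp Q) R"
  proof (rule idealI)
    show "ring R" by (rule R.ring_axioms)
    show "subgroup (cp Q) (add_monoid R)"
    proof (rule R.add.subgroupI)
      show "cp Q \<noteq> {}" using Q.zero_closed by (intro ex_in_conv[THEN iffD1] exI[of _ "\<zero>\<^bsub>R\<^esub>"]) simp
      show "\<ominus>\<^bsub>R\<^esub> a \<in> cp Q" if "a \<in> cp Q" for a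
        using that Q.a_inv_closed by simp
    qed (use add in auto)
  qed (use Q.I_l_closed Q.I_r_closed h_closed in auto)
  then show ?thesis
  proof (rule primeidealI)
    show "cring R" by (rule R.is_cring)
    have "h \<one>\<^bsub>R\<^esub> \<notin> Q" using S.prime_one[OF assms] by simp
    then show "carrier R \<noteq> cp Q" using R.one_closed by blast
    show "a \<in> cp Q \<or> b \<in> cp Q" if "a \<in> carrier R" "b \<in> carrier R" "a \<otimes>\<^bsub>R\<^esub> b \<in> cp Q" for a b
      using that Q.I_prime[of "h a" "h b"] h_closed by simp
  qed
qed

lemma cp_notin: "f \<in> carrier R - cp Q \<Longrightarrow> h f \<in> carrier S - Q"
  using h_closed by auto

lemma frac_image:
  assumes Q: "primeideal Q S" and a: "a \<in> carrier R" "f \<in> carrier R - cp Q"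
  shows "(\<Union>(a, b) \<in> fraction R (cp Q) a f. fraction S Q (h a) (h b)) = fraction S Q (h a) (h f)"
proof -
  have "fraction S Q (h b) (h g) = fraction S Q (h a) (h f)" if m: "(b, g) \<in> fraction R (cp Q) a f" for b g
  proof -
    note m' = R.frac_memD[OF m]
    from m'(3) obtain u where u: "u \<in> carrier R - cp Q" "u \<otimes>\<^bsub>R\<^esub> (a \<otimes>\<^bsub>R\<^esub> g) = u \<otimes>\<^bsub>R\<^esub> (b \<otimes>\<^bsub>R\<^esub> f)" by blast
    have c: "u \<in> carrier R" "g \<in> carrier R" "b \<in> carrier R" "f \<in> carrier R" using u m' a by auto
    have "h u \<otimes>\<^bsub>S\<^esub> (h b \<otimes>\<^bsub>S\<^esub> h f) = h (u \<otimes>\<^bsub>R\<^esub> (b \<otimes>\<^bsub>R\<^esub> f))"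
      using c by (simp add: ring_hom_mult[OF h])
    also have "\<dots> = h u \<otimes>\<^bsub>S\<^esub> (h a \<otimes>\<^bsub>S\<^esub> h g)"
      unfolding u(2)[symmetric] using c a(1) by (simp add: ring_hom_mult[OF h])
    finally have "h u \<otimes>\<^bsub>S\<^esub> (h b \<otimes>\<^bsub>S\<^esub> h f) = h u \<otimes>\<^bsub>S\<^esub> (h a \<otimes>\<^bsub>S\<^esub> h g)" .
    then show ?thesis
      using S.frac_eqI[OF Q h_closed[OF m'(1)] cp_notin[OF m'(2)] h_closed[OF a(1)] cp_notin[OF a(2)] cp_notin[OF u(1)]]
      by simp
  qed
  then show ?thesis using R.frac_memI[OF cp_prime[OF Q] a] by blast
qed

abbreviation "X \<equiv> Spec S"
abbreviation "Y \<equiv> Spec R"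
abbreviation "\<phi> \<equiv> Spec_map R S h"

lemma pt_eq: "pt \<phi> Q = cp Q"
  by (simp add: Spec_map_def Let_def)

lemma pull_eq: "pull \<phi> U s = (\<lambda>Q \<in> {Q. primeideal Q S \<and> cp Q \<in> U}. \<Union>(a, b) \<in> s (cp Q). fraction S Q (h a) (h b))"
  by (simp add: Spec_map_def Let_def)

lemma pre_eq: "pre X \<phi> V = {Q. primeideal Q S \<and> cp Q \<in> V}"
  by (simp add: pre_def S.Spec_points pt_eq)

lemma pull_val:
  assumes "primeideal Q S" "cp Q \<in> V" "s (cp Q) = fraction R (cp Q) a f" "a \<in> carrier R" "f \<in> carrier R - cp Q"
  shows "pull \<phi> V s Q = fraction S Q (h a) (h f)"
  using assms frac_image[OF assms(1,4,5)] by (simp add: pull_eq)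

lemma basic_pre: "f \<in> carrier R \<Longrightarrow> pre X \<phi> (R.basic f) = S.basic (h f)"
  using cp_prime by (auto simp: pre_eq R.basic_def S.basic_def)

lemma continuous: "continuous_map (tp X) (tp Y) (pt \<phi>)"
  unfolding R.Spec_tp continuous_on_generated_topo_iff
proof (intro conjI allI impI)
  fix U assume "U \<in> {R.basic f |f. f \<in> carrier R}"
  then obtain f where f: "f \<in> carrier R" "U = R.basic f" by blast
  have "pt \<phi> -` U \<inter> points X = S.basic (h f)"
    using basic_pre[OF f(1)] by (auto simp: pre_def f(2))
  then show "openin (tp X) (pt \<phi> -` U \<inter> points X)" using S.basic_open[OF h_closed[OF f(1)]] by simp
next
  have "cp Q \<in> R.basic \<one>\<^bsub>R\<^esub>" if "primeideal Q S" for Q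
    using cp_prime[OF that] R.prime_one[OF cp_prime[OF that]] by (simp add: R.basic_def)
  then show "pt \<phi> ` points X \<subseteq> \<Union> {R.basic f |f. f \<in> carrier R}"
    unfolding S.Spec_points pt_eq using R.one_closed by blast
qed

lemma pre_open: "V \<in> opens Y \<Longrightarrow> pre X \<phi> V \<in> opens X"
  using continuous unfolding continuous_map_def pre_def by auto

lemma pull_closed:
  assumes V: "V \<in> opens Y" and t: "t \<in> carrier (sec Y V)"
  shows "pull \<phi> V t \<in> carrier (sec X (pre X \<phi> V))"
proof (rule S.Spec_secI)
  show "pull \<phi> V t \<in> extensional (pre X \<phi> V)" by (simp add: pull_eq pre_eq)
  fix Q assume Q: "Q \<in> pre X \<phi> V"
  then have Qp: "primeideal Q S" "cp Q \<in> V" by (auto simp: pre_eq)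
  obtain a f where a: "a \<in> carrier R" "f \<in> carrier R" "cp Q \<in> R.basic f" "R.basic f \<subseteq> V"
    "\<And>w. w \<in> R.basic f \<Longrightarrow> t w = fraction R w a f" by (rule R.Spec_secD[OF t Qp(2)]) (rule that)
  have sub: "S.basic (h f) \<subseteq> pre X \<phi> V" unfolding basic_pre[OF a(2), symmetric] using a(4) by (auto simp: pre_def)
  have Qf: "Q \<in> S.basic (h f)" unfolding basic_pre[OF a(2), symmetric] using a(3) Qp by (simp add: pre_eq)
  have "pull \<phi> V t w = fraction S w (h a) (h f)" if w: "w \<in> S.basic (h f)" for w
  proof -
    have w': "primeideal w S" "cp w \<in> R.basic f" using w unfolding basic_pre[OF a(2), symmetric] by (auto simp: pre_eq)
    then show ?thesis
      using pull_val[where s = t and V = V and a = a and f = f, OF w'(1) _ a(5)[OF w'(2)] a(1) R.basic_notin[OF a(2) w'(2)]] a(4) by blast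
  qed
  then show "\<exists>a \<in> carrier S. \<exists>f \<in> carrier S. Q \<in> S.basic f \<and> S.basic f \<subseteq> pre X \<phi> V \<and>
      (\<forall>w \<in> S.basic f. pull \<phi> V t w = fraction S w a f)"
    using sub Qf by (intro bexI[OF _ h_closed[OF a(1)]] bexI[OF _ h_closed[OF a(2)]] conjI) auto
qed

lemma pull_alg_hom:
  assumes kR: "algebra k R" and kS: "algebra k S" and hk: "h \<in> alg_hom k R S" and V: "V \<in> opens Y"
  shows "pull \<phi> V \<in> alg_hom k (sec Y V) (sec X (pre X \<phi> V))"
proof -
  note hD = ring_hom_mult[OF h] ring_hom_add[OF h] ring_hom_one[OF h]
  interpret kR: algebra k R by fact
  have ext: "f = g" if "f \<in> extensional (pre X \<phi> V)" "g \<in> extensional (pre X \<phi> V)"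
    "\<And>Q. primeideal Q S \<Longrightarrow> cp Q \<in> V \<Longrightarrow> f Q = g Q" for f g :: "'b set \<Rightarrow> ('b \<times> 'b) set"
    by (rule extensionalityI[OF that(1,2)]) (use that(3) in \<open>auto simp: pre_eq\<close>)
  have pe: "pull \<phi> V s \<in> extensional (pre X \<phi> V)" for s by (simp add: pull_eq pre_eq)
  have "pull \<phi> V \<in> ring_hom (sec Y V) (sec X (pre X \<phi> V))"
  proof (rule ring_hom_memI)
    show "pull \<phi> V t \<in> carrier (sec X (pre X \<phi> V))" if "t \<in> carrier (sec Y V)" for t
      by (rule pull_closed[OF V that])
    fix s t assume s: "s \<in> carrier (sec Y V)" and t: "t \<in> carrier (sec Y V)"
    show "pull \<phi> V (s \<otimes>\<^bsub>sec Y V\<^esub> t) = pull \<phi> V s \<otimes>\<^bsub>sec X (pre X \<phi> V)\<^esub> pull \<phi> V t"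
    proof (rule ext[OF pe])
      fix Q assume Q: "primeideal Q S" "cp Q \<in> V"
      obtain a f where a: "a \<in> carrier R" "f \<in> carrier R - cp Q" "s (cp Q) = fraction R (cp Q) a f"
        by (rule R.Spec_sec_val[OF s Q(2)]) (rule that)
      obtain b g where b: "b \<in> carrier R" "g \<in> carrier R - cp Q" "t (cp Q) = fraction R (cp Q) b g"
        by (rule R.Spec_sec_val[OF t Q(2)]) (rule that)
      note pQ = cp_prime[OF Q(1)]
      have ab: "a \<otimes>\<^bsub>R\<^esub> b \<in> carrier R" using a b by simp
      have fg: "f \<otimes>\<^bsub>R\<^esub> g \<in> carrier R - cp Q" by (rule R.prime_mult[OF pQ a(2) b(2)])
      have "(s \<otimes>\<^bsub>sec Y V\<^esub> t) (cp Q) = fraction R (cp Q) (a \<otimes>\<^bsub>R\<^esub> b) (f \<otimes>\<^bsub>R\<^esub> g)"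
        using Q(2) R.frac_mult[OF pQ a(1,2) b(1,2)] a(3) b(3) by (simp add: R.Spec_ops)
      then have "pull \<phi> V (s \<otimes>\<^bsub>sec Y V\<^esub> t) Q = fraction S Q (h (a \<otimes>\<^bsub>R\<^esub> b)) (h (f \<otimes>\<^bsub>R\<^esub> g))"
        by (rule pull_val[where s = "s \<otimes>\<^bsub>sec Y V\<^esub> t" and V = V and a = "a \<otimes>\<^bsub>R\<^esub> b" and f = "f \<otimes>\<^bsub>R\<^esub> g", OF Q _ ab fg])
      also have "\<dots> = fraction S Q (h a) (h f) \<otimes>\<^bsub>localize S Q\<^esub> fraction S Q (h b) (h g)"
        using S.frac_mult[OF Q(1) h_closed[OF a(1)] cp_notin[OF a(2)] h_closed[OF b(1)] cp_notin[OF b(2)]] a b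
        by (simp add: hD)
      also have "\<dots> = (pull \<phi> V s \<otimes>\<^bsub>sec X (pre X \<phi> V)\<^esub> pull \<phi> V t) Q"
        using Q pull_val[where s = s and V = V and a = a and f = f, OF Q a(3,1,2)] pull_val[where s = t and V = V and a = b and f = g, OF Q b(3,1,2)] by (simp add: S.Spec_ops pre_eq)
      finally show "pull \<phi> V (s \<otimes>\<^bsub>sec Y V\<^esub> t) Q = (pull \<phi> V s \<otimes>\<^bsub>sec X (pre X \<phi> V)\<^esub> pull \<phi> V t) Q" .
    qed (simp add: S.Spec_ops)
    show "pull \<phi> V (s \<oplus>\<^bsub>sec Y V\<^esub> t) = pull \<phi> V s \<oplus>\<^bsub>sec X (pre X \<phi> V)\<^esub> pull \<phi> V t"
    proof (rule ext[OF pe])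
      fix Q assume Q: "primeideal Q S" "cp Q \<in> V"
      obtain a f where a: "a \<in> carrier R" "f \<in> carrier R - cp Q" "s (cp Q) = fraction R (cp Q) a f"
        by (rule R.Spec_sec_val[OF s Q(2)]) (rule that)
      obtain b g where b: "b \<in> carrier R" "g \<in> carrier R - cp Q" "t (cp Q) = fraction R (cp Q) b g"
        by (rule R.Spec_sec_val[OF t Q(2)]) (rule that)
      note pQ = cp_prime[OF Q(1)]
      let ?c = "(a \<otimes>\<^bsub>R\<^esub> g) \<oplus>\<^bsub>R\<^esub> (b \<otimes>\<^bsub>R\<^esub> f)"
      have ab: "?c \<in> carrier R" using a b by simp
      have fg: "f \<otimes>\<^bsub>R\<^esub> g \<in> carrier R - cp Q" by (rule R.prime_mult[OF pQ a(2) b(2)])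
      have "(s \<oplus>\<^bsub>sec Y V\<^esub> t) (cp Q) = fraction R (cp Q) ?c (f \<otimes>\<^bsub>R\<^esub> g)"
        using Q(2) R.frac_add[OF pQ a(1,2) b(1,2)] a(3) b(3) by (simp add: R.Spec_ops)
      then have "pull \<phi> V (s \<oplus>\<^bsub>sec Y V\<^esub> t) Q = fraction S Q (h ?c) (h (f \<otimes>\<^bsub>R\<^esub> g))"
        by (rule pull_val[where s = "s \<oplus>\<^bsub>sec Y V\<^esub> t" and V = V and a = ?c and f = "f \<otimes>\<^bsub>R\<^esub> g", OF Q _ ab fg])
      also have "\<dots> = fraction S Q (h a) (h f) \<oplus>\<^bsub>localize S Q\<^esub> fraction S Q (h b) (h g)"
        using S.frac_add[OF Q(1) h_closed[OF a(1)] cp_notin[OF a(2)] h_closed[OF b(1)] cp_notin[OF b(2)]] a b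
        by (simp add: hD)
      also have "\<dots> = (pull \<phi> V s \<oplus>\<^bsub>sec X (pre X \<phi> V)\<^esub> pull \<phi> V t) Q"
        using Q pull_val[where s = s and V = V and a = a and f = f, OF Q a(3,1,2)] pull_val[where s = t and V = V and a = b and f = g, OF Q b(3,1,2)] by (simp add: S.Spec_ops pre_eq)
      finally show "pull \<phi> V (s \<oplus>\<^bsub>sec Y V\<^esub> t) Q = (pull \<phi> V s \<oplus>\<^bsub>sec X (pre X \<phi> V)\<^esub> pull \<phi> V t) Q" .
    qed (simp add: S.Spec_ops)
  next
    show "pull \<phi> V \<one>\<^bsub>sec Y V\<^esub> = \<one>\<^bsub>sec X (pre X \<phi> V)\<^esub>"
    proof (rule ext[OF pe])
      fix Q assume Q: "primeideal Q S" "cp Q \<in> V"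
      have "\<one>\<^bsub>sec Y V\<^esub> (cp Q) = fraction R (cp Q) \<one>\<^bsub>R\<^esub> \<one>\<^bsub>R\<^esub>"
        using Q by (simp add: R.Spec_ops R.localize_one)
      then show "pull \<phi> V \<one>\<^bsub>sec Y V\<^esub> Q = \<one>\<^bsub>sec X (pre X \<phi> V)\<^esub> Q"
        using pull_val[where s = "\<one>\<^bsub>sec Y V\<^esub>" and V = V, OF Q _ R.one_closed R.prime_one[OF cp_prime[OF Q(1)]]] Q
        by (simp add: hD S.Spec_ops S.localize_one pre_eq)
    qed (simp add: S.Spec_ops)
  qed
  moreover have "pull \<phi> V (c \<odot>\<^bsub>sec Y V\<^esub> s) = c \<odot>\<^bsub>sec X (pre X \<phi> V)\<^esub> pull \<phi> V s"
    if c: "c \<in> carrier k" and s: "s \<in> carrier (sec Y V)" for c s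
  proof (rule ext[OF pe])
    fix Q assume Q: "primeideal Q S" "cp Q \<in> V"
    obtain a f where a: "a \<in> carrier R" "f \<in> carrier R - cp Q" "s (cp Q) = fraction R (cp Q) a f"
      by (rule R.Spec_sec_val[OF s Q(2)]) (rule that)
    have ca: "c \<odot>\<^bsub>R\<^esub> a \<in> carrier R" using a c by simp
    have "(c \<odot>\<^bsub>sec Y V\<^esub> s) (cp Q) = fraction R (cp Q) (c \<odot>\<^bsub>R\<^esub> a) f"
      using Q(2) R.frac_smult[OF kR cp_prime[OF Q(1)] c a(1,2)] a(3) by (simp add: R.Spec_ops)
    then have "pull \<phi> V (c \<odot>\<^bsub>sec Y V\<^esub> s) Q = fraction S Q (h (c \<odot>\<^bsub>R\<^esub> a)) (h f)"
      by (rule pull_val[where s = "c \<odot>\<^bsub>sec Y V\<^esub> s" and V = V and a = "c \<odot>\<^bsub>R\<^esub> a" and f = f, OF Q _ ca a(2)])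
    also have "\<dots> = c \<odot>\<^bsub>localize S Q\<^esub> fraction S Q (h a) (h f)"
      using S.frac_smult[OF kS Q(1) c h_closed[OF a(1)] cp_notin[OF a(2)]] alg_homD(2)[OF hk c a(1)] by simp
    also have "\<dots> = (c \<odot>\<^bsub>sec X (pre X \<phi> V)\<^esub> pull \<phi> V s) Q"
      using Q pull_val[where s = s and V = V and a = a and f = f, OF Q a(3,1,2)] by (simp add: S.Spec_ops pre_eq)
    finally show "pull \<phi> V (c \<odot>\<^bsub>sec Y V\<^esub> s) Q = (c \<odot>\<^bsub>sec X (pre X \<phi> V)\<^esub> pull \<phi> V s) Q" .
  qed (simp add: S.Spec_ops)
  ultimately show ?thesis by (simp add: alg_hom_def)
qed

lemma mor:
  assumes kR: "algebra k R" and kS: "algebra k S" and hk: "h \<in> alg_hom k R S"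
  shows "mor k X Y \<phi>"
  unfolding mor_def
proof (intro conjI ballI impI continuous pull_alg_hom[OF kR kS hk])
  fix V W t assume V: "V \<in> opens Y" and W: "W \<in> opens Y" "W \<subseteq> V" and t: "t \<in> carrier (sec Y V)"
  have "pull \<phi> W (restrict t W) = restrict (pull \<phi> V t) (pre X \<phi> W)"
    unfolding pull_eq pre_eq using W(2) by (intro ext) (auto simp: restrict_def)
  then show "pull \<phi> W (res Y V W t) = res X (pre X \<phi> V) (pre X \<phi> W) (pull \<phi> V t)"
    by (simp only: R.Spec_ops S.Spec_ops)
next
  fix Q V t assume Q: "Q \<in> points X" and V: "V \<in> opens Y" and t: "t \<in> carrier (sec Y V)"
    and u: "pt \<phi> Q \<in> V \<and> germ X Q (pre X \<phi> V) (pull \<phi> V t) \<in> Units (stalk X Q)"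
  have Q': "primeideal Q S" "cp Q \<in> V" using Q u by (auto simp: S.Spec_points pt_eq)
  obtain a f where a: "a \<in> carrier R" "f \<in> carrier R - cp Q" "t (cp Q) = fraction R (cp Q) a f"
    by (rule R.Spec_sec_val[OF t Q'(2)]) (rule that)
  \<comment> \<open>Locality of the morphism: a fraction is a unit at a prime exactly when its
    numerator avoids it, and membership in Q and in its preimage correspond under
    \<open>h\<close>.\<close>
  have "h a \<notin> Q"
    by (rule S.Spec_germ_unitD[OF pre_open[OF V] _ pull_closed[OF V t] h_closed[OF a(1)] cp_notin[OF a(2)]
          pull_val[where s = t and V = V and a = a and f = f, OF Q' a(3,1,2)] conjunct2[OF u]]) (use Q' in \<open>simp add: pre_eq\<close>)
  then have "a \<in> carrier R - cp Q" using a by simp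
  then show "germ Y (pt \<phi> Q) V t \<in> Units (stalk Y (pt \<phi> Q))"
    unfolding pt_eq by (rule R.Spec_germ_unitI[OF V Q'(2) t _ a(2,3)])
qed

end

section \<open>Functoriality of Spec and equivariant isomorphisms\<close>

lemma mor_eq_sym: "mor_eq X Y f g \<Longrightarrow> mor_eq X Y g f"
  by (simp add: mor_eq_def)

lemma mor_eq_trans: "mor_eq X Y f g \<Longrightarrow> mor_eq X Y g l \<Longrightarrow> mor_eq X Y f l"
  by (simp add: mor_eq_def)

text \<open>The composite is allowed to be any \<open>l\<close> agreeing with it on the carrier, so
  that identities of algebra maps that hold on carriers only translate into equalities of
  morphisms.\<close>

lemma Spec_map_comp:
  assumes "cring A" "cring B" "cring C" and f: "f \<in> ring_hom A B" and g: "g \<in> ring_hom B C"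
    and l: "\<And>a. a \<in> carrier A \<Longrightarrow> l a = g (f a)"
  shows "mor_eq (Spec C) (Spec A) (mcomp (Spec B) (Spec_map A B f) (Spec_map B C g)) (Spec_map A C l)"
proof -
  interpret F: spec_map A B f
    by (intro spec_map.intro spec_map_axioms.intro cring_module.intro assms)
  interpret G: spec_map B C g
    by (intro spec_map.intro spec_map_axioms.intro cring_module.intro assms)
  have lh: "l \<in> ring_hom A C"
    by (rule ring_hom_cong[OF ring_hom_comp[OF f g] l]) (use assms cring.axioms(1) in auto)
  interpret H: spec_map A C l
    by (intro spec_map.intro spec_map_axioms.intro cring_module.intro assms lh)
  have cp: "F.cp (G.cp Q) = H.cp Q" for Q using l ring_hom_closed[OF f] by auto
  show ?thesis
    unfolding mor_eq_def
  proof (intro conjI ballI)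
    fix Q
    show "pt (mcomp (Spec B) (Spec_map A B f) (Spec_map B C g)) Q = pt (Spec_map A C l) Q"
      by (simp only: mcomp_def morph.simps F.pt_eq G.pt_eq H.pt_eq cp)
  next
    fix V t assume V: "V \<in> opens (Spec A)" and t: "t \<in> carrier (sec (Spec A) V)"
    have pre': "Q \<in> pre (Spec B) (Spec_map A B f) V \<longleftrightarrow> primeideal Q B \<and> F.cp Q \<in> V" for Q
      by (simp only: F.pre_eq mem_Collect_eq)
    have dom: "{Q. primeideal Q C \<and> G.cp Q \<in> pre (Spec B) (Spec_map A B f) V} = {Q. primeideal Q C \<and> H.cp Q \<in> V}"
      unfolding pre' cp using G.cp_prime by blast
    have val: "pull (Spec_map B C g) (pre (Spec B) (Spec_map A B f) V) (pull (Spec_map A B f) V t) Q = pull (Spec_map A C l) V t Q"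
      if Q: "primeideal Q C" "H.cp Q \<in> V" for Q
    proof -
      obtain a d where a: "a \<in> carrier A" "d \<in> carrier A - H.cp Q" "t (H.cp Q) = fraction A (H.cp Q) a d"
        by (rule F.R.Spec_sec_val[OF t Q(2)]) (rule that)
      note pg = G.cp_prime[OF Q(1)]
      have F: "pull (Spec_map A B f) V t (G.cp Q) = fraction B (G.cp Q) (f a) (f d)"
        by (rule F.pull_val[where s = t and V = V and a = a and f = d, OF pg, unfolded cp]) (rule Q a)+
      have "G.cp Q \<in> pre (Spec B) (Spec_map A B f) V" unfolding pre' cp using pg Q by blast
      then have "pull (Spec_map B C g) (pre (Spec B) (Spec_map A B f) V) (pull (Spec_map A B f) V t) Q
          = fraction C Q (g (f a)) (g (f d))"
        by (rule G.pull_val[where s = "pull (Spec_map A B f) V t" and V = "pre (Spec B) (Spec_map A B f) V" and a = "f a" and f = "f d", OF Q(1) _ F F.h_closed[OF a(1)] F.cp_notin[where Q = "G.cp Q", unfolded cp, OF a(2)]])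
      also have "\<dots> = pull (Spec_map A C l) V t Q"
        using H.pull_val[where s = t and V = V and a = a and f = d, OF Q a(3,1,2)] a l by simp
      finally show ?thesis .
    qed
    show "pull (mcomp (Spec B) (Spec_map A B f) (Spec_map B C g)) V t = pull (Spec_map A C l) V t"
      unfolding mcomp_def morph.simps
    proof (rule extensionalityI)
      show "pull (Spec_map B C g) (pre (Spec B) (Spec_map A B f) V) (pull (Spec_map A B f) V t) \<in> extensional {Q. primeideal Q C \<and> H.cp Q \<in> V}"
        unfolding G.pull_eq dom by simp
      show "pull (Spec_map A C l) V t \<in> extensional {Q. primeideal Q C \<and> H.cp Q \<in> V}"
        unfolding H.pull_eq by simp
    qed (use val in blast)
  qed
qed

lemma Spec_map_id:
  assumes "cring A" and l: "\<And>a. a \<in> carrier A \<Longrightarrow> l a = a"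
  shows "mor_eq (Spec A) (Spec A) (Spec_map A A l) idm"
proof -
  have lh: "l \<in> ring_hom A A"
    by (rule ring_hom_cong[OF ring_hom_id l]) (use assms cring.axioms(1) in auto)
  interpret L: spec_map A A l
    by (intro spec_map.intro spec_map_axioms.intro cring_module.intro assms lh)
  have cp: "L.cp Q = Q" if "primeideal Q A" for Q
    using l ideal.Icarr[OF primeideal.axioms(1)[OF that]] by auto
  show ?thesis
    unfolding mor_eq_def
  proof (intro conjI ballI)
    fix Q assume "Q \<in> points (Spec A)"
    then show "pt (Spec_map A A l) Q = pt idm Q"
      unfolding L.pt_eq by (simp only: L.R.Spec_points mem_Collect_eq cp idm_def morph.simps)
  next
    fix V t assume V: "V \<in> opens (Spec A)" and t: "t \<in> carrier (sec (Spec A) V)"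
    have VP: "primeideal Q A" if "Q \<in> V" for Q
      using opens_sub[OF V] that unfolding L.R.Spec_points by blast
    have dom: "{Q. primeideal Q A \<and> L.cp Q \<in> V} = V" using cp VP by force
    have "pull (Spec_map A A l) V t = t"
    proof (rule extensionalityI[of _ V])
      show "pull (Spec_map A A l) V t \<in> extensional V" unfolding L.pull_eq dom by simp
      show "t \<in> extensional V" by (rule L.R.Spec_sec_ext[OF t])
      fix Q assume Q: "Q \<in> V"
      obtain a d where a: "a \<in> carrier A" "d \<in> carrier A - Q" "t Q = fraction A Q a d"
        by (rule L.R.Spec_sec_val[OF t Q]) (rule that)
      have "pull (Spec_map A A l) V t Q = fraction A Q (l a) (l d)"
        by (rule L.pull_val[where V = V and s = t and a = a and f = d, OF VP[OF Q], unfolded cp[OF VP[OF Q]]])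
          (rule Q a)+
      then show "pull (Spec_map A A l) V t Q = t Q" using a l by simp
    qed
    then show "pull (Spec_map A A l) V t = pull idm V t" by (simp add: idm_def)
  qed
qed

lemma Spec_map_mor:
  assumes "algebra k R" "algebra k S" "h \<in> alg_hom k R S"
  shows "mor k (Spec S) (Spec R) (Spec_map R S h)"
proof -
  interpret spec_map R S h
    by (intro spec_map.intro spec_map_axioms.intro cring_module.intro)
      (use algebra.M_cring[OF assms(1)] algebra.M_cring[OF assms(2)] alg_homD(1)[OF assms(3)] in auto)
  show ?thesis by (rule mor[OF assms])
qed

text \<open>Functoriality of Spec turns each square of \<open>equivariant_iso\<close> into an
  identity of comorphisms. The witness for id x \<phi> is Spec of id \<otimes> \<Phi>, and the last
  identity is the hypothesis \<open>eq\<close>.\<close>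

lemma equivariant_isoI:
  assumes A: "algebra F A" and M: "algebra F M" and N: "algebra F N"
    and \<Phi>: "\<Phi> \<in> alg_hom F N M" and \<Psi>: "\<Psi> \<in> alg_hom F M N"
    and \<Phi>\<Psi>: "\<And>m. m \<in> carrier M \<Longrightarrow> \<Phi> (\<Psi> m) = m" and \<Psi>\<Phi>: "\<And>n. n \<in> carrier N \<Longrightarrow> \<Psi> (\<Phi> n) = n"
    and \<rho>: "\<rho> \<in> ring_hom M (tensor F A M)" and \<tau>: "\<tau> \<in> ring_hom N (tensor F A N)"
    and eq: "\<And>n. n \<in> carrier N \<Longrightarrow> tensor_map F A N A M (\<lambda>x. x) \<Phi> (\<tau> n) = \<rho> (\<Phi> n)"
  shows "equivariant_iso F A M \<rho> N \<tau> (Spec_map N M \<Phi>)"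
proof -
  interpret AM: algebra_pair F A M by (intro algebra_pair.intro A M)
  interpret AN: algebra_pair F A N by (intro algebra_pair.intro A N)
  have idA: "(\<lambda>x. x) \<in> alg_hom F A A" by (simp add: alg_hom_def ring_hom_id)
  note \<theta> = AN.tensor_map_alg_hom[OF A M idA \<Phi>]
  let ?\<theta> = "tensor_map F A N A M (\<lambda>x. x) \<Phi>"
  note cr = AM.M.M_cring AM.N.M_cring AN.N.M_cring AM.T_cring AN.T_cring
  note \<Phi>h = alg_homD(1)[OF \<Phi>] and \<Psi>h = alg_homD(1)[OF \<Psi>] and \<theta>h = alg_homD(1)[OF \<theta>(1)]
  let ?\<phi> = "Spec_map N M \<Phi>" and ?\<phi>' = "Spec_map M N \<Psi>" and ?\<psi> = "Spec_map AN.T AM.T ?\<theta>"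
  have iso: "miso F (Spec M) (Spec N) ?\<phi>"
    unfolding miso_def
  proof (intro conjI exI[of _ ?\<phi>'])
    show "mor F (Spec M) (Spec N) ?\<phi>" by (rule Spec_map_mor[OF N M \<Phi>])
    show "mor F (Spec N) (Spec M) ?\<phi>'" by (rule Spec_map_mor[OF M N \<Psi>])
    show "mor_eq (Spec M) (Spec M) (mcomp (Spec N) ?\<phi>' ?\<phi>) idm"
      by (rule mor_eq_trans[OF Spec_map_comp[OF cr(2,3,2) \<Psi>h \<Phi>h refl] Spec_map_id[OF cr(2) \<Phi>\<Psi>]])
    show "mor_eq (Spec N) (Spec N) (mcomp (Spec M) ?\<phi> ?\<phi>') idm"
      by (rule mor_eq_trans[OF Spec_map_comp[OF cr(3,2,3) \<Phi>h \<Psi>h refl] Spec_map_id[OF cr(3) \<Psi>\<Phi>]])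
  qed
  have m: "mor F (Spec AM.T) (Spec AN.T) ?\<psi>"
    by (rule Spec_map_mor[OF AN.T_algebra AM.T_algebra \<theta>(1)])
  have e1: "mor_eq (Spec AM.T) (Spec A) (mcomp (Spec AN.T) (Spec_map A AN.T (t_inl F A N)) ?\<psi>) (Spec_map A AM.T (t_inl F A M))"
    by (rule Spec_map_comp[OF cr(1,5,4) AN.inl_hom \<theta>h]) (simp only: \<theta>(2))
  have e2: "mor_eq (Spec AM.T) (Spec N) (mcomp (Spec AN.T) (Spec_map N AN.T (t_inr F A N)) ?\<psi>)
      (mcomp (Spec M) ?\<phi> (Spec_map M AM.T (t_inr F A M)))"
    by (rule mor_eq_trans[OF Spec_map_comp[OF cr(3,5,4) AN.inr_hom \<theta>h refl]
          mor_eq_sym[OF Spec_map_comp[OF cr(3,2,4) \<Phi>h AM.inr_hom]]]) (simp only: \<theta>(3))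
  have e3: "mor_eq (Spec AM.T) (Spec N) (mcomp (Spec M) ?\<phi> (Spec_map M AM.T \<rho>)) (mcomp (Spec AN.T) (Spec_map N AN.T \<tau>) ?\<psi>)"
    by (rule mor_eq_trans[OF Spec_map_comp[OF cr(3,2,4) \<Phi>h \<rho> refl]
          mor_eq_sym[OF Spec_map_comp[OF cr(3,5,4) \<tau> \<theta>h]]]) (simp only: eq)
  show ?thesis
    unfolding equivariant_iso_def Let_def using iso m e1 e2 e3 by blast
qed

section \<open>The stalk at the generic point\<close>

lemma (in cring_module) frac_inverse:
  assumes pz: "primeideal z R" and b: "b \<in> carrier R - z" and g: "g \<in> carrier R - z"
  shows "fraction R z b g \<otimes>\<^bsub>localize R z\<^esub> fraction R z (g \<otimes> g) (g \<otimes> b) = \<one>\<^bsub>localize R z\<^esub>"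
proof -
  have hz: "g \<otimes> b \<in> carrier R - z" by (rule prime_mult[OF pz g b])
  have bg: "b \<in> carrier R" "g \<in> carrier R" using b g by auto
  have e: "\<one> \<otimes> ((b \<otimes> (g \<otimes> g)) \<otimes> \<one>) = \<one> \<otimes> (\<one> \<otimes> (g \<otimes> (g \<otimes> b)))" using bg by algebra
  show ?thesis
    unfolding localize_one
    using frac_mult[OF pz bg(1) g _ hz, of "g \<otimes> g"] bg
      frac_eqI[OF pz _ prime_mult[OF pz g hz] _ prime_one[OF pz] prime_one[OF pz] e] by simp
qed

locale alg_space =
  fixes k :: "('c, 'x) ring_scheme" and X :: "('p, 'r, 'c) rspace"
  assumes sheaf: "alg_sheaf k X"
begin

lemmas sheafD = sheaf[unfolded alg_sheaf_def]

lemma sec_algebra: "U \<in> opens X \<Longrightarrow> algebra k (sec X U)"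
  by (rule bspec[OF sheafD[THEN conjunct1], THEN conjunct1])

lemma res_hom:
  assumes "U \<in> opens X" "V \<in> opens X" "V \<subseteq> U"
  shows "res X U V \<in> alg_hom k (sec X U) (sec X V)"
  by (rule sheafD[THEN conjunct2, THEN conjunct1, rule_format]) (rule assms)+

lemma X_presheaf: "presheaf X"
  unfolding presheaf_def
proof (intro conjI)
  show "\<forall>U\<in>opens X. \<forall>s\<in>carrier (sec X U). res X U U s = s"
    using bspec[OF sheafD[THEN conjunct1], THEN conjunct2] by blast
  show "\<forall>U\<in>opens X. \<forall>V\<in>opens X. V \<subseteq> U \<longrightarrow> (\<forall>s\<in>carrier (sec X U). res X U V s \<in> carrier (sec X V))"
    using ring_hom_closed[OF alg_homD(1)[OF res_hom]] by blast
  show "\<forall>U\<in>opens X. \<forall>V\<in>opens X. \<forall>W\<in>opens X. W \<subseteq> V \<and> V \<subseteq> U \<longrightarrow>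
      (\<forall>s\<in>carrier (sec X U). res X V W (res X U V s) = res X U W s)"
    by (rule sheafD[THEN conjunct2, THEN conjunct2, THEN conjunct1])
qed

lemma sec_cring: "U \<in> opens X \<Longrightarrow> cring (sec X U)"
  by (rule algebra.M_cring[OF sec_algebra])

lemma germ_res:
  assumes "U \<in> opens X" "V \<in> opens X" "V \<subseteq> U" "x \<in> V" "s \<in> carrier (sec X U)"
  shows "germ X x V (res X U V s) = germ X x U s"
proof -
  note D = presheafD[OF X_presheaf]
  show ?thesis
    by (rule germ_eqI[OF X_presheaf assms(2) D(2)[OF assms(1,2,3,5)] assms(1,5,2,4)])
      (use assms(3) D(1)[OF assms(2) D(2)[OF assms(1,2,3,5)]] in auto)
qed

context
  fixes x :: 'p
  assumes x: "x \<in> points X"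
begin

lemma germ_closed: "U \<in> opens X \<Longrightarrow> x \<in> U \<Longrightarrow> s \<in> carrier (sec X U) \<Longrightarrow> germ X x U s \<in> carrier (stalk X x)"
  unfolding stalk_simps by blast

lemma germ_mult:
  assumes U: "U \<in> opens X" "x \<in> U" and s: "s \<in> carrier (sec X U)" and t: "t \<in> carrier (sec X U)"
  shows "germ X x U s \<otimes>\<^bsub>stalk X x\<^esub> germ X x U t = germ X x U (s \<otimes>\<^bsub>sec X U\<^esub> t)"
  unfolding stalk_simps
  using germ_binop[OF X_presheaf, of "\<lambda>U s t. s \<otimes>\<^bsub>sec X U\<^esub> t" U x s U t] U s t
    ring_hom_mult[OF alg_homD(1)[OF res_hom]] monoid.m_closed[OF ring.is_monoid[OF cring.axioms(1)[OF sec_cring]]]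
  by (simp add: presheafD(1)[OF X_presheaf])

lemma germ_add:
  assumes U: "U \<in> opens X" "x \<in> U" and s: "s \<in> carrier (sec X U)" and t: "t \<in> carrier (sec X U)"
  shows "germ X x U s \<oplus>\<^bsub>stalk X x\<^esub> germ X x U t = germ X x U (s \<oplus>\<^bsub>sec X U\<^esub> t)"
  unfolding stalk_simps
  using germ_binop[OF X_presheaf, of "\<lambda>U s t. s \<oplus>\<^bsub>sec X U\<^esub> t" U x s U t] U s t
    ring_hom_add[OF alg_homD(1)[OF res_hom]] abelian_monoid.a_closed[OF abelian_group.axioms(1)[OF cring_ab[OF sec_cring]]]
  by (simp add: presheafD(1)[OF X_presheaf])

lemma germ_smult:
  assumes U: "U \<in> opens X" "x \<in> U" and s: "s \<in> carrier (sec X U)" and c: "c \<in> carrier k"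
  shows "c \<odot>\<^bsub>stalk X x\<^esub> germ X x U s = germ X x U (c \<odot>\<^bsub>sec X U\<^esub> s)"
proof -
  have "germ X x V (c \<odot>\<^bsub>sec X V\<^esub> t) = germ X x U (c \<odot>\<^bsub>sec X U\<^esub> s)" if m: "(V, t) \<in> germ X x U s" for V t
  proof -
    note m' = germ_memD[OF m]
    from m'(4) obtain W where W: "W \<in> opens X" "x \<in> W" "W \<subseteq> U \<inter> V" "res X U W s = res X V W t" by blast
    have cl: "c \<odot>\<^bsub>sec X V\<^esub> t \<in> carrier (sec X V)" "c \<odot>\<^bsub>sec X U\<^esub> s \<in> carrier (sec X U)"
      using module.smult_closed[OF algebra.module[OF sec_algebra]] m' U s c by auto
    show ?thesis
      by (rule germ_eqI[OF X_presheaf m'(1) cl(1) U(1) cl(2) W(1,2)])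
        (use W alg_homD(2)[OF res_hom[OF m'(1) W(1)] c m'(3)] alg_homD(2)[OF res_hom[OF U(1) W(1)] c s] in auto)
  qed
  then show ?thesis unfolding stalk_simps using germ_self[OF U s] by blast
qed

lemma germ_one: "U \<in> opens X \<Longrightarrow> x \<in> U \<Longrightarrow> \<one>\<^bsub>stalk X x\<^esub> = germ X x U \<one>\<^bsub>sec X U\<^esub>"
  unfolding stalk_simps
  using germ_res[of "points X" U x "\<one>\<^bsub>sec X (points X)\<^esub>"] opens_sub[of U X]
    ring_hom_one[OF alg_homD(1)[OF res_hom[of "points X" U]]]
    monoid.one_closed[OF ring.is_monoid[OF cring.axioms(1)[OF sec_cring[of "points X"]]]]
  by simp

lemma germ_zero: "U \<in> opens X \<Longrightarrow> x \<in> U \<Longrightarrow> \<zero>\<^bsub>stalk X x\<^esub> = germ X x U \<zero>\<^bsub>sec X U\<^esub>"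
  unfolding stalk_simps
  using germ_res[of "points X" U x "\<zero>\<^bsub>sec X (points X)\<^esub>"] opens_sub[of U X]
    ring_hom_zero'[OF cring_ab[OF sec_cring] cring_ab[OF sec_cring] alg_homD(1)[OF res_hom[of "points X" U]]]
    abelian_monoid.zero_closed[OF abelian_group.axioms(1)[OF cring_ab[OF sec_cring[of "points X"]]]]
  by simp

lemma stalk_cases:
  assumes "\<alpha> \<in> carrier (stalk X x)"
  obtains U s where "U \<in> opens X" "x \<in> U" "s \<in> carrier (sec X U)" "\<alpha> = germ X x U s"
  using assms unfolding stalk_simps by blast

text \<open>Finitely many germs have representatives over one common neighbourhood; three suffice
  because no ring axiom involves more elements.\<close>

lemma stalk_cases3:
  assumes "\<alpha> \<in> carrier (stalk X x)" "\<beta> \<in> carrier (stalk X x)" "\<gamma> \<in> carrier (stalk X x)"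
  obtains U s t r where "U \<in> opens X" "x \<in> U" "s \<in> carrier (sec X U)" "t \<in> carrier (sec X U)" "r \<in> carrier (sec X U)"
    "\<alpha> = germ X x U s" "\<beta> = germ X x U t" "\<gamma> = germ X x U r"
proof -
  obtain U s where U: "U \<in> opens X" "x \<in> U" "s \<in> carrier (sec X U)" "\<alpha> = germ X x U s"
    by (rule stalk_cases[OF assms(1)]) (rule that)
  obtain V t where V: "V \<in> opens X" "x \<in> V" "t \<in> carrier (sec X V)" "\<beta> = germ X x V t"
    by (rule stalk_cases[OF assms(2)]) (rule that)
  obtain W r where W: "W \<in> opens X" "x \<in> W" "r \<in> carrier (sec X W)" "\<gamma> = germ X x W r"
    by (rule stalk_cases[OF assms(3)]) (rule that)
  let ?O = "U \<inter> V \<inter> W"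
  have O: "?O \<in> opens X" "x \<in> ?O" using U V W opens_Int by blast+
  note D = presheafD(2)[OF X_presheaf]
  show ?thesis
  proof (rule that[OF O])
    show "res X U ?O s \<in> carrier (sec X ?O)" by (rule D[OF U(1) O(1) _ U(3)]) auto
    show "res X V ?O t \<in> carrier (sec X ?O)" by (rule D[OF V(1) O(1) _ V(3)]) auto
    show "res X W ?O r \<in> carrier (sec X ?O)" by (rule D[OF W(1) O(1) _ W(3)]) auto
    show "\<alpha> = germ X x ?O (res X U ?O s)" unfolding U(4) by (rule germ_res[symmetric, OF U(1) O(1) _ O(2) U(3)]) auto
    show "\<beta> = germ X x ?O (res X V ?O t)" unfolding V(4) by (rule germ_res[symmetric, OF V(1) O(1) _ O(2) V(3)]) auto
    show "\<gamma> = germ X x ?O (res X W ?O r)" unfolding W(4) by (rule germ_res[symmetric, OF W(1) O(1) _ O(2) W(3)]) auto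
  qed
qed

text \<open>Each axiom is inherited from the sections over a neighbourhood on which all germs
  involved are represented.\<close>

lemma stalk_algebra: "algebra k (stalk X x)"
proof -
  let ?S = "stalk X x"
  have main: "\<alpha> \<oplus>\<^bsub>?S\<^esub> \<beta> \<in> carrier ?S \<and> \<alpha> \<otimes>\<^bsub>?S\<^esub> \<beta> \<in> carrier ?S \<and>
      \<alpha> \<oplus>\<^bsub>?S\<^esub> \<beta> \<oplus>\<^bsub>?S\<^esub> \<gamma> = \<alpha> \<oplus>\<^bsub>?S\<^esub> (\<beta> \<oplus>\<^bsub>?S\<^esub> \<gamma>) \<and> \<alpha> \<oplus>\<^bsub>?S\<^esub> \<beta> = \<beta> \<oplus>\<^bsub>?S\<^esub> \<alpha> \<and> \<zero>\<^bsub>?S\<^esub> \<oplus>\<^bsub>?S\<^esub> \<alpha> = \<alpha> \<and>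
      (\<exists>\<delta>\<in>carrier ?S. \<delta> \<oplus>\<^bsub>?S\<^esub> \<alpha> = \<zero>\<^bsub>?S\<^esub>) \<and>
      \<alpha> \<otimes>\<^bsub>?S\<^esub> \<beta> \<otimes>\<^bsub>?S\<^esub> \<gamma> = \<alpha> \<otimes>\<^bsub>?S\<^esub> (\<beta> \<otimes>\<^bsub>?S\<^esub> \<gamma>) \<and> \<alpha> \<otimes>\<^bsub>?S\<^esub> \<beta> = \<beta> \<otimes>\<^bsub>?S\<^esub> \<alpha> \<and> \<one>\<^bsub>?S\<^esub> \<otimes>\<^bsub>?S\<^esub> \<alpha> = \<alpha> \<and>
      (\<alpha> \<oplus>\<^bsub>?S\<^esub> \<beta>) \<otimes>\<^bsub>?S\<^esub> \<gamma> = \<alpha> \<otimes>\<^bsub>?S\<^esub> \<gamma> \<oplus>\<^bsub>?S\<^esub> \<beta> \<otimes>\<^bsub>?S\<^esub> \<gamma>"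
    if "\<alpha> \<in> carrier ?S" "\<beta> \<in> carrier ?S" "\<gamma> \<in> carrier ?S" for \<alpha> \<beta> \<gamma>
  proof -
    note abc = that
    obtain U s t r where U: "U \<in> opens X" "x \<in> U" and str: "s \<in> carrier (sec X U)" "t \<in> carrier (sec X U)" "r \<in> carrier (sec X U)"
      and e: "\<alpha> = germ X x U s" "\<beta> = germ X x U t" "\<gamma> = germ X x U r"
      by (rule stalk_cases3[OF abc]) (rule that)
    interpret A: cring "sec X U" by (rule sec_cring[OF U(1)])
    have "germ X x U (\<ominus>\<^bsub>sec X U\<^esub> s) \<oplus>\<^bsub>?S\<^esub> germ X x U s = \<zero>\<^bsub>?S\<^esub>"
      using str(1) by (simp add: germ_add[OF U] germ_zero[OF U] A.l_neg)
    moreover have "germ X x U (\<ominus>\<^bsub>sec X U\<^esub> s) \<in> carrier ?S" using germ_closed[OF U] str by simp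
    ultimately have ex: "\<exists>\<delta>\<in>carrier ?S. \<delta> \<oplus>\<^bsub>?S\<^esub> germ X x U s = \<zero>\<^bsub>?S\<^esub>" by blast
    show ?thesis
      unfolding e using ex str
      by (simp add: germ_mult[OF U] germ_add[OF U] germ_zero[OF U] germ_one[OF U] germ_closed[OF U]
          A.a_ac A.m_ac A.l_distr A.r_distr)
  qed
  interpret P: cring "sec X (points X)" by (rule sec_cring) simp
  have zc: "\<zero>\<^bsub>?S\<^esub> \<in> carrier ?S" and oc: "\<one>\<^bsub>?S\<^esub> \<in> carrier ?S"
    using germ_closed[of "points X"] x by (simp_all add: stalk_simps(2,3))
  have ab: "abelian_group ?S"
  proof (rule abelian_groupI)
    fix \<alpha> \<beta> \<gamma> assume a: "\<alpha> \<in> carrier ?S" "\<beta> \<in> carrier ?S" "\<gamma> \<in> carrier ?S"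
    show "\<alpha> \<oplus>\<^bsub>?S\<^esub> \<beta> \<oplus>\<^bsub>?S\<^esub> \<gamma> = \<alpha> \<oplus>\<^bsub>?S\<^esub> (\<beta> \<oplus>\<^bsub>?S\<^esub> \<gamma>)" using main[OF a] by blast
  next
    fix \<alpha> \<beta> assume a: "\<alpha> \<in> carrier ?S" "\<beta> \<in> carrier ?S"
    show "\<alpha> \<oplus>\<^bsub>?S\<^esub> \<beta> \<in> carrier ?S" "\<alpha> \<oplus>\<^bsub>?S\<^esub> \<beta> = \<beta> \<oplus>\<^bsub>?S\<^esub> \<alpha>" using main[OF a a(1)] by blast+
  next
    fix \<alpha> assume a: "\<alpha> \<in> carrier ?S"
    show "\<zero>\<^bsub>?S\<^esub> \<oplus>\<^bsub>?S\<^esub> \<alpha> = \<alpha>" "\<exists>\<delta>\<in>carrier ?S. \<delta> \<oplus>\<^bsub>?S\<^esub> \<alpha> = \<zero>\<^bsub>?S\<^esub>" using main[OF a a a] by blast+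
  qed (rule zc)
  have cm: "comm_monoid ?S"
  proof (rule comm_monoidI)
    fix \<alpha> \<beta> \<gamma> assume a: "\<alpha> \<in> carrier ?S" "\<beta> \<in> carrier ?S" "\<gamma> \<in> carrier ?S"
    show "\<alpha> \<otimes>\<^bsub>?S\<^esub> \<beta> \<otimes>\<^bsub>?S\<^esub> \<gamma> = \<alpha> \<otimes>\<^bsub>?S\<^esub> (\<beta> \<otimes>\<^bsub>?S\<^esub> \<gamma>)" using main[OF a] by blast
  next
    fix \<alpha> \<beta> assume a: "\<alpha> \<in> carrier ?S" "\<beta> \<in> carrier ?S"
    show "\<alpha> \<otimes>\<^bsub>?S\<^esub> \<beta> \<in> carrier ?S" "\<alpha> \<otimes>\<^bsub>?S\<^esub> \<beta> = \<beta> \<otimes>\<^bsub>?S\<^esub> \<alpha>" using main[OF a a(1)] by blast+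
  next
    fix \<alpha> assume a: "\<alpha> \<in> carrier ?S"
    show "\<one>\<^bsub>?S\<^esub> \<otimes>\<^bsub>?S\<^esub> \<alpha> = \<alpha>" using main[OF a a a] by blast
  qed (rule oc)
  have cr: "cring ?S"
    by (rule cringI[OF ab cm]) (use main in blast)
  show ?thesis
  proof (rule algebraI)
    show "cring k" using algebra.R_cring[OF sec_algebra[of "points X"]] by simp
    show "cring ?S" by (rule cr)
    have sm: "c \<odot>\<^bsub>?S\<^esub> \<alpha> \<in> carrier ?S \<and> (c \<oplus>\<^bsub>k\<^esub> d) \<odot>\<^bsub>?S\<^esub> \<alpha> = c \<odot>\<^bsub>?S\<^esub> \<alpha> \<oplus>\<^bsub>?S\<^esub> d \<odot>\<^bsub>?S\<^esub> \<alpha> \<and>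
      c \<odot>\<^bsub>?S\<^esub> (\<alpha> \<oplus>\<^bsub>?S\<^esub> \<beta>) = c \<odot>\<^bsub>?S\<^esub> \<alpha> \<oplus>\<^bsub>?S\<^esub> c \<odot>\<^bsub>?S\<^esub> \<beta> \<and> (c \<otimes>\<^bsub>k\<^esub> d) \<odot>\<^bsub>?S\<^esub> \<alpha> = c \<odot>\<^bsub>?S\<^esub> (d \<odot>\<^bsub>?S\<^esub> \<alpha>) \<and>
      \<one>\<^bsub>k\<^esub> \<odot>\<^bsub>?S\<^esub> \<alpha> = \<alpha> \<and> (c \<odot>\<^bsub>?S\<^esub> \<alpha>) \<otimes>\<^bsub>?S\<^esub> \<beta> = c \<odot>\<^bsub>?S\<^esub> (\<alpha> \<otimes>\<^bsub>?S\<^esub> \<beta>)"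
      if "c \<in> carrier k" "d \<in> carrier k" "\<alpha> \<in> carrier ?S" "\<beta> \<in> carrier ?S" for c d \<alpha> \<beta>
    proof -
      note abc = that
      obtain U s t r where U: "U \<in> opens X" "x \<in> U" and str: "s \<in> carrier (sec X U)" "t \<in> carrier (sec X U)" "r \<in> carrier (sec X U)"
        and e: "\<alpha> = germ X x U s" "\<beta> = germ X x U t" "\<beta> = germ X x U r"
        by (rule stalk_cases3[OF abc(3,4,4)]) (rule that)
      interpret A: algebra k "sec X U" by (rule sec_algebra[OF U(1)])
      show ?thesis
        unfolding e(1,2) using str(1,2) \<open>c \<in> carrier k\<close> \<open>d \<in> carrier k\<close>
        by (simp add: germ_mult[OF U] germ_add[OF U] germ_smult[OF U] germ_closed[OF U]
            A.smult_l_distr A.smult_r_distr A.smult_assoc1 A.smult_assoc2)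
    qed
    have one: "\<one>\<^bsub>k\<^esub> \<in> carrier k"
      using monoid.one_closed[OF ring.is_monoid[OF cring.axioms(1)[OF algebra.R_cring[OF sec_algebra[of "points X"]]]]] by simp
    show "\<one>\<^bsub>k\<^esub> \<odot>\<^bsub>?S\<^esub> \<alpha> = \<alpha>" if "\<alpha> \<in> carrier ?S" for \<alpha> using sm[OF one one that that] by blast
    show "c \<odot>\<^bsub>?S\<^esub> \<alpha> \<in> carrier ?S" if "c \<in> carrier k" "\<alpha> \<in> carrier ?S" for c \<alpha> using sm[OF that(1,1,2,2)] by blast
    show "(c \<oplus>\<^bsub>k\<^esub> d) \<odot>\<^bsub>?S\<^esub> \<alpha> = c \<odot>\<^bsub>?S\<^esub> \<alpha> \<oplus>\<^bsub>?S\<^esub> d \<odot>\<^bsub>?S\<^esub> \<alpha>"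
      if "c \<in> carrier k" "d \<in> carrier k" "\<alpha> \<in> carrier ?S" for c d \<alpha> using sm[OF that that(3)] by blast
    show "c \<odot>\<^bsub>?S\<^esub> (\<alpha> \<oplus>\<^bsub>?S\<^esub> \<beta>) = c \<odot>\<^bsub>?S\<^esub> \<alpha> \<oplus>\<^bsub>?S\<^esub> c \<odot>\<^bsub>?S\<^esub> \<beta>"
      if "c \<in> carrier k" "\<alpha> \<in> carrier ?S" "\<beta> \<in> carrier ?S" for c \<alpha> \<beta> using sm[OF that(1,1,2,3)] by blast
    show "(c \<otimes>\<^bsub>k\<^esub> d) \<odot>\<^bsub>?S\<^esub> \<alpha> = c \<odot>\<^bsub>?S\<^esub> (d \<odot>\<^bsub>?S\<^esub> \<alpha>)"
      if "c \<in> carrier k" "d \<in> carrier k" "\<alpha> \<in> carrier ?S" for c d \<alpha> using sm[OF that that(3)] by blast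
    show "(c \<odot>\<^bsub>?S\<^esub> \<alpha>) \<otimes>\<^bsub>?S\<^esub> \<beta> = c \<odot>\<^bsub>?S\<^esub> (\<alpha> \<otimes>\<^bsub>?S\<^esub> \<beta>)"
      if "c \<in> carrier k" "\<alpha> \<in> carrier ?S" "\<beta> \<in> carrier ?S" for c \<alpha> \<beta> using sm[OF that(1,1,2,3)] by blast
  qed
qed

end

end

section \<open>The generic point and the function field\<close>

lemma generic_point_open:
  assumes "generic_point X \<xi>" "V \<in> opens X" "V \<noteq> {}"
  shows "\<xi> \<in> V"
proof -
  obtain y where y: "y \<in> V" using assms(3) by blast
  then have "y \<in> tp X closure_of {\<xi>}"
    using assms(1) opens_sub[OF assms(2)] by (auto simp: generic_point_def)
  then show ?thesis using y assms(2) by (auto simp: in_closure_of)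
qed

lemma open_sub_simps [simp]:
  "tp (open_sub X U) = subtopology (tp X) U" "sec (open_sub X U) = sec X" "res (open_sub X U) = res X"
  by (simp_all add: open_sub_def)

text \<open>On an affine neighbourhood Spec R with R a domain, a germ is locally a fraction b/d. A
  vanishing numerator gives the zero germ, and otherwise the fraction is invertible where d b is.
  All these nonempty open sets contain the generic point, so it need not be matched with the zero
  ideal.\<close>

lemma stalk_generic_field:
  assumes X: "scheme k X" and int: "integral_scheme X" and gen: "generic_point X \<xi>"
  shows "field (stalk X \<xi>)"
proof -
  interpret alg_space k X using X by (simp add: alg_space_def scheme_def lr_space_def)
  have \<xi>: "\<xi> \<in> points X" using gen by (simp add: generic_point_def)
  note gmult = germ_mult[OF \<xi>] and gone = germ_one[OF \<xi>] and gzero = germ_zero[OF \<xi>] and gclosed = germ_closed[OF \<xi>]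
  note D = presheafD[OF X_presheaf]
  interpret K: algebra k "stalk X \<xi>" by (rule stalk_algebra[OF \<xi>])
  have dom: "domain (sec X U)" if "U \<in> opens X" "U \<noteq> {}" for U
    using int that by (simp add: integral_scheme_def)
  have one_zero: "\<one>\<^bsub>stalk X \<xi>\<^esub> \<noteq> \<zero>\<^bsub>stalk X \<xi>\<^esub>"
  proof
    assume eq: "\<one>\<^bsub>stalk X \<xi>\<^esub> = \<zero>\<^bsub>stalk X \<xi>\<^esub>"
    have P: "points X \<in> opens X" by simp
    interpret S: cring "sec X (points X)" by (rule sec_cring[OF P])
    from germ_eqD[OF P \<xi> S.zero_closed eq[unfolded stalk_simps]]
    obtain W where W: "W \<in> opens X" "\<xi> \<in> W" "W \<subseteq> points X \<inter> points X"
      "res X (points X) W \<one>\<^bsub>sec X (points X)\<^esub> = res X (points X) W \<zero>\<^bsub>sec X (points X)\<^esub>" by blast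
    have r: "res X (points X) W \<in> ring_hom (sec X (points X)) (sec X W)"
      by (rule alg_homD(1)[OF res_hom[OF P W(1)]]) (use W(3) in auto)
    interpret SW: domain "sec X W" by (rule dom) (use W in auto)
    show False
      using W(4) ring_hom_one[OF r] ring_hom_zero'[OF S.abelian_group_axioms SW.abelian_group_axioms r] by simp
  qed
  have unit: "\<alpha> \<in> Units (stalk X \<xi>)" if \<alpha>: "\<alpha> \<in> carrier (stalk X \<xi>)" and nz: "\<alpha> \<noteq> \<zero>\<^bsub>stalk X \<xi>\<^esub>" for \<alpha>
  proof -
    obtain V s where V: "V \<in> opens X" "\<xi> \<in> V" and s: "s \<in> carrier (sec X V)" and \<alpha>s: "\<alpha> = germ X \<xi> V s"
      by (rule stalk_cases[OF \<xi> \<alpha>]) (rule that)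
    obtain U where U: "\<xi> \<in> U" "affine_open k X U" using X \<xi> by (auto simp: scheme_def)
    then have Uo: "U \<in> opens X" by (simp add: affine_open_def)
    define R where "R = sec X U"
    interpret R: domain R unfolding R_def by (rule dom[OF Uo]) (use U in auto)
    interpret SR: cring_module R by (rule cring_module.intro[OF R.is_cring])
    let ?U = "open_sub X U" and ?Y = "Spec R"
    obtain f g where f: "mor k ?U ?Y f" and g: "mor k ?Y ?U g"
      and gf: "mor_eq ?U ?U (mcomp ?Y g f) idm" and fg: "mor_eq ?Y ?Y (mcomp ?U f g) idm"
      using U(2) unfolding affine_open_def miso_def R_def by blast
    have pU: "points ?U = U" using opens_sub[OF Uo] by auto
    have gf_pt: "pt g (pt f y) = y" if "y \<in> U" for y
      using gf that unfolding mor_eq_def pU by (simp add: mcomp_def idm_def)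
    have fg_pt: "pt f (pt g Q) = Q" if "Q \<in> points ?Y" for Q
      using fg that unfolding mor_eq_def by (simp add: mcomp_def idm_def)
    have fc: "continuous_map (tp ?U) (tp ?Y) (pt f)" and gc: "continuous_map (tp ?Y) (tp ?U) (pt g)"
      using f g by (auto simp: mor_def)
    have fP: "pt f y \<in> points ?Y" if "y \<in> U" for y
      using fc that pU unfolding continuous_map_def by auto
    have gU: "pt g Q \<in> U" if "Q \<in> points ?Y" for Q
      using gc that pU unfolding continuous_map_def by auto
    have sub_open: "S \<in> opens ?U \<longleftrightarrow> S \<in> opens X \<and> S \<subseteq> U" for S
      using Uo by (simp add: openin_open_subtopology)
    let ?V = "V \<inter> U"
    have V': "?V \<in> opens X" "?V \<in> opens ?U" "\<xi> \<in> ?V" using V U Uo sub_open opens_Int[OF V(1) Uo] by auto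
    define s' where "s' = res X V ?V s"
    have s': "s' \<in> carrier (sec X ?V)" unfolding s'_def by (rule D(2)[OF V(1) V'(1) _ s]) auto
    have \<alpha>s': "\<alpha> = germ X \<xi> ?V s'"
      unfolding \<alpha>s s'_def by (rule germ_res[symmetric, OF V(1) V'(1) _ V'(3) s]) auto
    let ?W = "pre ?Y g ?V"
    \<comment> \<open>The section carried over to Spec R along the inverse of the affine chart,
      where it can be written as a fraction.\<close>
    define t where "t = pull g ?V s'"
    have Wo: "?W \<in> opens ?Y" using gc V'(2) unfolding continuous_map_def pre_def by auto
    have t: "t \<in> carrier (sec ?Y ?W)"
      unfolding t_def
    proof (rule ring_hom_closed[OF alg_homD(1)])
      show "pull g ?V \<in> alg_hom k (sec ?U ?V) (sec ?Y ?W)" using g V'(2) unfolding mor_def by blast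
      show "s' \<in> carrier (sec ?U ?V)" using s' by simp
    qed
    have ft: "pull f ?W t = s'"
    proof -
      have "pull (mcomp ?Y g f) ?V s' = pull idm ?V s'"
        using gf V'(2) s' unfolding mor_eq_def by simp
      then show ?thesis by (simp add: mcomp_def idm_def t_def)
    qed
    have pre_f: "pre ?U f S = {y \<in> U. pt f y \<in> S}" for S
      unfolding pre_def pU ..
    have pre_g: "pre ?Y g S = {Q \<in> points ?Y. pt g Q \<in> S}" for S
      unfolding pre_def ..
    have preW: "pre ?U f ?W = ?V"
      unfolding pre_f pre_g using gf_pt fP by auto
    \<comment> \<open>The zero ideal lies in every basic open set of a nonzero element. Expanding
      \<open>t\<close> there makes nonvanishing of the denominator and of the numerator the only
      conditions to track.\<close>
    have zp: "primeideal {\<zero>\<^bsub>R\<^esub>} R" by (rule R.zeroprimeideal)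
    have zY: "{\<zero>\<^bsub>R\<^esub>} \<in> points ?Y" using zp by (simp add: SR.Spec_points)
    have "pt f \<xi> \<in> ?W" using fP[OF U(1)] gf_pt[OF U(1)] V'(3) by (simp add: pre_def)
    then obtain a where a: "a \<in> carrier R" "pt f \<xi> \<in> SR.basic a" "SR.basic a \<subseteq> ?W"
      using SR.Spec_base[OF Wo] by blast
    have "a \<noteq> \<zero>\<^bsub>R\<^esub>"
      using a(2) additive_subgroup.zero_closed[OF ideal.axioms(1)[OF primeideal.axioms(1)]] by (auto simp: SR.basic_def)
    then have "{\<zero>\<^bsub>R\<^esub>} \<in> ?W" using a(3) zp by (auto simp: SR.basic_def)
    then obtain b d where b: "b \<in> carrier R" "d \<in> carrier R" "{\<zero>\<^bsub>R\<^esub>} \<in> SR.basic d" "SR.basic d \<subseteq> ?W"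
      "\<And>w. w \<in> SR.basic d \<Longrightarrow> t w = fraction R w b d" by (rule SR.Spec_secD[OF t]) (rule that)
    have dn: "d \<noteq> \<zero>\<^bsub>R\<^esub>" using b(3) by (auto simp: SR.basic_def)
    \<comment> \<open>Shrinking to the basic open set of any nonzero \<open>e\<close> keeps the
      germ: its preimage in X is nonempty, as it contains the image of the zero ideal, and hence
      contains the generic point.\<close>
    have step: "pre ?U f (SR.basic e) \<in> opens X \<and> \<xi> \<in> pre ?U f (SR.basic e) \<and>
        pull f (SR.basic e) \<in> alg_hom k (sec ?Y (SR.basic e)) (sec X (pre ?U f (SR.basic e))) \<and>
        germ X \<xi> (pre ?U f (SR.basic e)) (pull f (SR.basic e) (restrict t (SR.basic e))) = \<alpha>"
      if e: "e \<in> carrier R" "e \<noteq> \<zero>\<^bsub>R\<^esub>" "SR.basic e \<subseteq> ?W" for e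
    proof -
      let ?O = "pre ?U f (SR.basic e)"
      have eo: "SR.basic e \<in> opens ?Y" by (rule SR.basic_open[OF e(1)])
      have "?O \<in> opens ?U" using fc eo unfolding continuous_map_def pre_def by auto
      then have O: "?O \<in> opens X" using sub_open by blast
      have "{\<zero>\<^bsub>R\<^esub>} \<in> SR.basic e" using zp e by (simp add: SR.basic_def)
      then have "pt g {\<zero>\<^bsub>R\<^esub>} \<in> ?O" unfolding pre_f using gU[OF zY] fg_pt[OF zY] by simp
      then have \<xi>O: "\<xi> \<in> ?O" using generic_point_open[OF gen O] by blast
      have "?O \<subseteq> pre ?U f ?W" unfolding pre_f using e(3) by blast
      then have OV: "?O \<subseteq> ?V" unfolding preW .
      have h: "pull f (SR.basic e) \<in> alg_hom k (sec ?Y (SR.basic e)) (sec X ?O)"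
        using f eo unfolding mor_def by simp
      have "pull f (SR.basic e) (res ?Y ?W (SR.basic e) t) = res ?U (pre ?U f ?W) ?O (pull f ?W t)"
        using f Wo eo e(3) t unfolding mor_def by blast
      then have "pull f (SR.basic e) (restrict t (SR.basic e)) = res X ?V ?O s'"
        by (simp add: SR.Spec_ops ft preW)
      then show ?thesis using O \<xi>O h germ_res[OF V'(1) O OV \<xi>O s'] \<alpha>s' by simp
    qed
    have bn: "b \<noteq> \<zero>\<^bsub>R\<^esub>"
    proof
      assume b0: "b = \<zero>\<^bsub>R\<^esub>"
      note st = step[OF b(2) dn b(4)]
      let ?O = "pre ?U f (SR.basic d)" and ?h = "pull f (SR.basic d)" and ?z = "restrict t (SR.basic d)"
      interpret SO: cring "sec X ?O" by (rule sec_cring) (use st in blast)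
      have z: "?z \<in> carrier (sec ?Y (SR.basic d))"
        by (rule SR.Spec_restrict[OF t SR.basic_open[OF b(2)] b(4)])
      \<comment> \<open>An element that equals its own double is zero. Transporting this equation
        uses additivity of \<open>?h\<close> and the ring structure on X only, not that of the
        sections of Spec.\<close>
      have "?z \<oplus>\<^bsub>sec ?Y (SR.basic d)\<^esub> ?z = ?z"
      proof (rule extensionalityI)
        fix w assume w: "w \<in> SR.basic d"
        note pw = SR.basic_prime[OF w] and dw = SR.basic_notin[OF b(2) w]
        have "fraction R w (\<zero>\<^bsub>R\<^esub> \<otimes>\<^bsub>R\<^esub> d \<oplus>\<^bsub>R\<^esub> \<zero>\<^bsub>R\<^esub> \<otimes>\<^bsub>R\<^esub> d) (d \<otimes>\<^bsub>R\<^esub> d) = fraction R w (\<zero>\<^bsub>R\<^esub> \<otimes>\<^bsub>R\<^esub> d) (d \<otimes>\<^bsub>R\<^esub> d)"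
          using b(2) by simp
        also have "\<dots> = fraction R w \<zero>\<^bsub>R\<^esub> d" by (rule SR.frac_scale[OF pw R.zero_closed dw dw])
        finally show "(?z \<oplus>\<^bsub>sec ?Y (SR.basic d)\<^esub> ?z) w = ?z w"
          using w b(5)[OF w] SR.frac_add[OF pw R.zero_closed dw R.zero_closed dw] by (simp add: SR.Spec_ops b0)
      qed (simp_all add: SR.Spec_ops)
      then have "?h ?z \<oplus>\<^bsub>sec X ?O\<^esub> ?h ?z = ?h ?z"
        using ring_hom_add[OF alg_homD(1) z z, of ?h k "sec X ?O"] st by simp
      moreover have "?h ?z \<in> carrier (sec X ?O)" using ring_hom_closed[OF alg_homD(1) z] st by blast
      ultimately have "?h ?z = \<zero>\<^bsub>sec X ?O\<^esub>" using SO.add.l_cancel_one by metis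
      then have "\<alpha> = \<zero>\<^bsub>stalk X \<xi>\<^esub>" using st gzero[of ?O] by simp
      then show False using nz by blast
    qed
    let ?e = "d \<otimes>\<^bsub>R\<^esub> b"
    have e: "?e \<in> carrier R" "?e \<noteq> \<zero>\<^bsub>R\<^esub>" using b(1,2) bn dn R.integral_iff by auto
    have eb: "SR.basic ?e = SR.basic d \<inter> SR.basic b" by (rule SR.basic_mult[OF b(2,1)])
    have eW: "SR.basic ?e \<subseteq> ?W" using eb b(4) by blast
    note st = step[OF e eW]
    let ?O = "pre ?U f (SR.basic ?e)" and ?h = "pull f (SR.basic ?e)" and ?z = "restrict t (SR.basic ?e)"
    \<comment> \<open>The inverse d/b of the fraction b/d, expanded to have the denominator d b
      required on this basic open set.\<close>
    let ?u = "\<lambda>z\<in>SR.basic ?e. fraction R z (d \<otimes>\<^bsub>R\<^esub> d) ?e"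
    have z: "?z \<in> carrier (sec ?Y (SR.basic ?e))"
      by (rule SR.Spec_restrict[OF t SR.basic_open[OF e(1)] eW])
    have u: "?u \<in> carrier (sec ?Y (SR.basic ?e))"
      by (rule SR.frac_section) (use b e in auto)
    have "?z \<otimes>\<^bsub>sec ?Y (SR.basic ?e)\<^esub> ?u = \<one>\<^bsub>sec ?Y (SR.basic ?e)\<^esub>"
    proof (rule extensionalityI)
      fix w assume w: "w \<in> SR.basic ?e"
      then have w': "w \<in> SR.basic d" "w \<in> SR.basic b" using eb by auto
      show "(?z \<otimes>\<^bsub>sec ?Y (SR.basic ?e)\<^esub> ?u) w = \<one>\<^bsub>sec ?Y (SR.basic ?e)\<^esub> w"
        using w b(5)[OF w'(1)] SR.frac_inverse[OF SR.basic_prime[OF w] SR.basic_notin[OF b(1) w'(2)] SR.basic_notin[OF b(2) w'(1)]]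
        by (simp add: SR.Spec_ops)
    qed (simp_all add: SR.Spec_ops)
    then have prod: "?h ?z \<otimes>\<^bsub>sec X ?O\<^esub> ?h ?u = \<one>\<^bsub>sec X ?O\<^esub>"
      using ring_hom_mult[OF alg_homD(1) z u, of ?h k "sec X ?O"] ring_hom_one[OF alg_homD(1), of ?h k "sec ?Y (SR.basic ?e)" "sec X ?O"] st
      by simp
    have c: "?h ?z \<in> carrier (sec X ?O)" "?h ?u \<in> carrier (sec X ?O)"
      using ring_hom_closed[OF alg_homD(1) z] ring_hom_closed[OF alg_homD(1) u] st by blast+
    have r: "\<alpha> \<otimes>\<^bsub>stalk X \<xi>\<^esub> germ X \<xi> ?O (?h ?u) = \<one>\<^bsub>stalk X \<xi>\<^esub>"
      using gmult[of ?O, OF _ _ c] prod gone[of ?O] st by simp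
    have uc: "germ X \<xi> ?O (?h ?u) \<in> carrier (stalk X \<xi>)" using gclosed[of ?O, OF _ _ c(2)] st by blast
    show ?thesis
      unfolding Units_def using \<alpha> uc r K.m_comm[OF uc \<alpha>] by (intro CollectI conjI bexI[of _ "germ X \<xi> ?O (?h ?u)"]) simp_all
  qed
  show ?thesis
  proof (rule cring.cring_fieldI[OF K.M_cring])
    show "Units (stalk X \<xi>) = carrier (stalk X \<xi>) - {\<zero>\<^bsub>stalk X \<xi>\<^esub>}"
    proof (intro equalityI subsetI)
      fix \<alpha> assume u: "\<alpha> \<in> Units (stalk X \<xi>)"
      obtain \<beta> where \<beta>: "\<beta> \<in> carrier (stalk X \<xi>)" "\<beta> \<otimes>\<^bsub>stalk X \<xi>\<^esub> \<alpha> = \<one>\<^bsub>stalk X \<xi>\<^esub>"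
        using K.Units_l_inv_ex[OF u] by metis
      have "\<alpha> \<noteq> \<zero>\<^bsub>stalk X \<xi>\<^esub>"
      proof
        assume "\<alpha> = \<zero>\<^bsub>stalk X \<xi>\<^esub>"
        then show False using \<beta> one_zero K.r_null[OF \<beta>(1)] by simp
      qed
      then show "\<alpha> \<in> carrier (stalk X \<xi>) - {\<zero>\<^bsub>stalk X \<xi>\<^esub>}" using K.Units_closed[OF u] by simp
    qed (use unit in auto)
  qed
qed

section \<open>The orbit map as an isomorphism\<close>

context field_coaction
begin

text \<open>By contravariance a morphism from Spec Z to the coset space is given by an algebra map
  from \<open>N\<close> to \<open>Z\<close>. This is \<open>Phi\<close>, so the isomorphism is the
  inverse of the map gH |-> g . z.\<close>

lemma orbit_equivariant_iso: "equivariant_iso K C Z \<rho>Z N \<tau> (Spec_map N Z Phi)"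
proof (rule equivariant_isoI[OF C_algebra Z_algebra N_algebra Phi_alg_hom Psi_alg_hom])
  show "\<rho>Z \<in> ring_hom Z TZ" using \<rho>Z_hom by simp
qed (simp_all add: Phi_Psi Psi_Phi \<tau>_hom Phi_map_\<tau>)

end

theorem corollary2p5:
  fixes k :: "'k ring"
    and G :: "('k, 'a) hopf"
    and X :: "('p, 'r, 'k) rspace"
    and \<xi> :: 'p
    and a \<rho> K L GK Z \<rho>Z z H
  defines "K \<equiv> stalk X \<xi>"
    and "L \<equiv> invariants k G K \<rho>"
    and "GK \<equiv> base_change k G K"
    and "Z \<equiv> self_tensor K L"
    and "\<rho>Z \<equiv> self_tensor_coaction k G K \<rho> L"
    and "z \<equiv> diag_point K L"
    and "H \<equiv> stabilizer_ideal K GK Z \<rho>Z z"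
  assumes "field k"
    and "finite_group_scheme k G"
    and "variety k X"
    and "group_action k G X a"
    and "generic_point X \<xi>"
    and "coaction k G K \<rho>"
    and "generic_mor_equivariant k G X a \<xi> \<rho>"
  shows "\<exists>\<phi>. equivariant_iso K GK Z \<rho>Z (coset_alg K GK H) (coset_coaction K GK H) \<phi>"
proof -
  note defs = H_def z_def \<rho>Z_def Z_def GK_def L_def
  have sch: "scheme k X" and int: "integral_scheme X"
    using \<open>variety k X\<close> unfolding variety_def geometrically_integral_def by blast+
  then interpret alg_space k X
    unfolding scheme_def lr_space_def by unfold_locales blast
  have \<xi>: "\<xi> \<in> points X" using \<open>generic_point X \<xi>\<close> unfolding generic_point_def by blast
  interpret field_coaction k G K \<rho>
  proof (rule field_coaction.intro)
    show "field K" unfolding K_def by (rule stalk_generic_field[OF sch int \<open>generic_point X \<xi>\<close>])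
    show "algebra k K" unfolding K_def by (rule stalk_algebra[OF \<xi>])
  qed fact+
  show ?thesis
    unfolding defs using orbit_equivariant_iso by (rule exI)
qed

end
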